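(* Let $S$ be a countable strongly $0$-$E$-unitary inverse semigroup with universal group $G=\mathscr U(S)$ and idempotent set $E=E(S)$. Then there is a partial action of $G$ on $\widehat E$ such that $\mathscr G(S)\cong G\ltimes\widehat E$ as topological groupoids; in particular, $\mathscr G(S)$ is Hausdorff. Consequently, $C^*(S)\cong C^*(E)\rtimes G\cong C_0(\widehat E)\rtimes G$ (full partial crossed products for this partial action, where $C^*(E)\cong C_0(\widehat E)$).
   Context: An inverse semigroup is a semigroup $S$ in which each $s$ has a unique $s^*$ with $s=ss^*s$ and $s^*=s^*ss^*$. $E(S)$ is its commutative subsemigroup of idempotents; the natural partial order is $s\le t$ iff $s=te$ for some $e\in E(S)$. Let $S$ have a zero. A partial homomorphism from $S$ to a group $G$ is a map $\varphi\colon S\setminus\{0\}\to G$ with $\varphi(st)=\varphi(s)\varphi(t)$ whenever $st\ne 0$; it is idempotent pure if $\varphi^{-1}(1)=E(S)\setminus\{0\}$. $S$ is strongly $0$-$E$-unitary if it admits an idempotent pure partial homomorphism to a group. The universal group $\mathscr U(S)$ is the group generated by the set $S$ subject to the relations $s\cdot t=st$ whenever $st\neq 0$ in $S$, with its canonical partial homomorphism $\iota\colon S\setminus\{0\}\to\mathscr U(S)$, through which every partial homomorphism from $S$ to a group factors uniquely. Conventions for inverse semigroups with zero: $C^*(S)$ is the contracted universal $C^*$-algebra, i.e. the quotient of the universal $C^*$-algebra of $S$ by the ideal $\mathbb C z$ spanned by the zero $z$ of $S$ (it is universal for $*$-representations sending $z$ to $0$); likewise for $C^*(E)$. $\widehat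 E$ is the space of non-zero homomorphisms $\varphi\colon E\to\{0,1\}$ with $\varphi(0)=0$, a subspace of $\{0,1\}^E$; $D(e)=\{\varphi\in\widehat E\mid\varphi(e)=1\}$. $S$ acts on $\widehat E$: for $\varphi\in D(s^*s)$, $s\varphi\in D(ss^* )$ is $(s\varphi)(e)=\varphi(s^*es)$. The universal groupoid $\mathscr G(S)$ is the set of classes $[s,\varphi]$ of pairs with $s\in S$, $\varphi\in D(s^*s)$, where $(s,\varphi)\sim(t,\psi)$ iff $\varphi=\psi$ and there is $u\le s,t$ with $\varphi\in D(u^*u)$; $d[s,\varphi]=\varphi$, $r[s,\varphi]=s\varphi$, $[s,t\psi][t,\psi]=[st,\psi]$, $[s,\varphi]^{-1}=[s^*,s\varphi]$; a basis of the topology is given by the sets $(s,U)=\{[s,\varphi]\mid\varphi\in U\}$, $U\subseteq D(s^*s)$ open. A partial action of a discrete group $G$ on a locally compact Hausdorff space $X$ is a map $\theta$ from $G$ to the homeomorphisms between open subsets of $X$ with $\theta(1)=1_X$, $\theta(g^{-1})=\theta(g)^{-1}$, and $\theta(g)\theta(h)$ a restriction of $\theta(gh)$; the domain of $\theta(g)$ is written $X_{g^{-1}}$ and $\theta(g)(x)$ is written $gx$. The partial transformation groupoid is $G\ltimes X=\{(g,x)\mid x\in X_{g^{-1}}\}\subseteq G\times X$ with the subspace topology, $d(g,x)=x$, $r(g,x)=gx$, $(g,hy)(h,y)=(gh,y)$, $(g,x)^{-1}=(g^{-1},gx)$. Full partial crossed product $C_0(X)\rtimes G$: let $\alpha_g\colon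 C_0(X_{g^{-1}})\to C_0(X_g)$, $\alpha_g(f)(x)=f(g^{-1}x)$. On finite sums $\sum_g a_g\delta_g$ with $a_g\in C_0(X_g)$ put $(a\delta_g)(b\delta_h)=\alpha_g(\alpha_{g^{-1}}(a)b)\delta_{gh}$ and $(a\delta_g)^*=\alpha_{g^{-1}}(a^* )\delta_{g^{-1}}$; $C_0(X)\rtimes G$ is the enveloping $C^*$-algebra of this $*$-algebra. *)

theory Defs
  imports "HOL-Analysis.Analysis" "HOL-Algebra.QuotRing" "HOL-Algebra.Module"
begin

section \<open>Inverse semigroups with zero\<close>

record 's semigroup0 = "'s partial_object" +
  smul :: "'s \<Rightarrow> 's \<Rightarrow> 's" (infixl \<open>\<cdot>\<index>\<close> 70)
  szero :: 's

locale inverse_semigroup0 =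
  fixes S :: "'s semigroup0" (structure)
  assumes closed: "\<lbrakk>s \<in> carrier S; t \<in> carrier S\<rbrakk> \<Longrightarrow> s \<cdot> t \<in> carrier S"
    and assoc: "\<lbrakk>s \<in> carrier S; t \<in> carrier S; u \<in> carrier S\<rbrakk> \<Longrightarrow> (s \<cdot> t) \<cdot> u = s \<cdot> (t \<cdot> u)"
    and zero_closed: "szero S \<in> carrier S"
    and zero_mult: "s \<in> carrier S \<Longrightarrow> szero S \<cdot> s = szero S"
    and mult_zero: "s \<in> carrier S \<Longrightarrow> s \<cdot> szero S = szero S"
    and inverse: "s \<in> carrier S \<Longrightarrow> \<exists>!t. t \<in> carrier S \<and> s = s \<cdot> t \<cdot> s \<and> t = t \<cdot> s \<cdot> t"

definition sinv :: "'s semigroup0 \<Rightarrow> 's \<Rightarrow> 's" where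
  "sinv S s = (THE t. t \<in> carrier S \<and> s = s \<cdot>\<^bsub>S\<^esub> t \<cdot>\<^bsub>S\<^esub> s \<and> t = t \<cdot>\<^bsub>S\<^esub> s \<cdot>\<^bsub>S\<^esub> t)"

definition idem :: "'s semigroup0 \<Rightarrow> 's set" where
  "idem S = {e \<in> carrier S. e \<cdot>\<^bsub>S\<^esub> e = e}"

definition idem_semigroup :: "'s semigroup0 \<Rightarrow> 's semigroup0" where
  "idem_semigroup S = S\<lparr>carrier := idem S\<rparr>"

definition nat_le :: "'s semigroup0 \<Rightarrow> 's \<Rightarrow> 's \<Rightarrow> bool" where
  "nat_le S s t \<longleftrightarrow> (\<exists>e\<in>idem S. s = t \<cdot>\<^bsub>S\<^esub> e)"

definition nonzero :: "'s semigroup0 \<Rightarrow> 's set" where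
  "nonzero S = carrier S - {szero S}"

definition partial_hom :: "'s semigroup0 \<Rightarrow> 'h monoid \<Rightarrow> ('s \<Rightarrow> 'h) \<Rightarrow> bool" where
  "partial_hom S H \<phi> \<longleftrightarrow> \<phi> \<in> nonzero S \<rightarrow> carrier H \<and>
     (\<forall>s\<in>nonzero S. \<forall>t\<in>nonzero S. s \<cdot>\<^bsub>S\<^esub> t \<noteq> szero S \<longrightarrow> \<phi> (s \<cdot>\<^bsub>S\<^esub> t) = \<phi> s \<otimes>\<^bsub>H\<^esub> \<phi> t)"

definition idempotent_pure :: "'s semigroup0 \<Rightarrow> 'h monoid \<Rightarrow> ('s \<Rightarrow> 'h) \<Rightarrow> bool" where
  "idempotent_pure S H \<phi> \<longleftrightarrow> {s \<in> nonzero S. \<phi> s = \<one>\<^bsub>H\<^esub>} = idem S - {szero S}"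

text \<open>The existential over groups ranges over groups with elements in a type \<open>'h\<close>. Leaving \<open>'h\<close>
  free in the hypothesis of a theorem therefore covers groups of every type.\<close>

definition strongly_0_E_unitary :: "'h itself \<Rightarrow> 's semigroup0 \<Rightarrow> bool" where
  "strongly_0_E_unitary TYPE('h) S \<longleftrightarrow>
     (\<exists>(H :: 'h monoid) \<phi>. group H \<and> partial_hom S H \<phi> \<and> idempotent_pure S H \<phi>)"


section \<open>The universal group\<close>

text \<open>Words in the letters \<open>(s, True)\<close>, standing for the generator \<open>s\<close>, and \<open>(s, False)\<close>, standing
  for its formal inverse. The generators are the nonzero elements of \<open>S\<close>: the element \<open>0\<close>
  occurs in no relation \<open>s \<cdot> t = st\<close> with \<open>st \<noteq> 0\<close>, and as a generator it would be free and destroy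
  the uniqueness in the universal property of \<open>S - {0} \<rightarrow> U(S)\<close>.\<close>

definition ug_words :: "'s semigroup0 \<Rightarrow> ('s \<times> bool) list set" where
  "ug_words S = lists (nonzero S \<times> UNIV)"

inductive ug_eq :: "'s semigroup0 \<Rightarrow> ('s \<times> bool) list \<Rightarrow> ('s \<times> bool) list \<Rightarrow> bool" for S where
  refl: "w \<in> ug_words S \<Longrightarrow> ug_eq S w w"
| sym: "ug_eq S v w \<Longrightarrow> ug_eq S w v"
| trans: "ug_eq S u v \<Longrightarrow> ug_eq S v w \<Longrightarrow> ug_eq S u w"
| append: "ug_eq S v v' \<Longrightarrow> ug_eq S w w' \<Longrightarrow> ug_eq S (v @ w) (v' @ w')"
| cancel: "s \<in> nonzero S \<Longrightarrow> ug_eq S [(s, b), (s, \<not> b)] []"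
| mult: "\<lbrakk>s \<in> nonzero S; t \<in> nonzero S; s \<cdot>\<^bsub>S\<^esub> t \<noteq> szero S\<rbrakk> \<Longrightarrow>
    ug_eq S [(s, True), (t, True)] [(s \<cdot>\<^bsub>S\<^esub> t, True)]"

definition ug_rel :: "'s semigroup0 \<Rightarrow> (('s \<times> bool) list \<times> ('s \<times> bool) list) set" where
  "ug_rel S = {(v, w). ug_eq S v w}"

definition universal_group :: "'s semigroup0 \<Rightarrow> ('s \<times> bool) list set monoid" where
  "universal_group S =
     \<lparr>carrier = ug_words S // ug_rel S,
      mult = (\<lambda>X Y. \<Union>v\<in>X. \<Union>w\<in>Y. ug_rel S `` {v @ w}),
      one = ug_rel S `` {[]}\<rparr>"


section \<open>The spectrum of the idempotents and the universal groupoid\<close>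

text \<open>Characters are functions on \<open>E(S)\<close>, extended by \<open>undefined\<close> outside of \<open>E(S)\<close>.\<close>

definition characters :: "'s semigroup0 \<Rightarrow> ('s \<Rightarrow> nat) set" where
  "characters S = {\<phi> \<in> idem S \<rightarrow>\<^sub>E {0, 1}.
     (\<forall>e\<in>idem S. \<forall>f\<in>idem S. \<phi> (e \<cdot>\<^bsub>S\<^esub> f) = \<phi> e * \<phi> f) \<and> \<phi> (szero S) = 0 \<and> (\<exists>e\<in>idem S. \<phi> e \<noteq> 0)}"

definition spectrum :: "'s semigroup0 \<Rightarrow> ('s \<Rightarrow> nat) topology" where
  "spectrum S = subtopology (product_topology (\<lambda>_. discrete_topology {0, 1}) (idem S)) (characters S)"

definition DD :: "'s semigroup0 \<Rightarrow> 's \<Rightarrow> ('s \<Rightarrow> nat) set" where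
  "DD S e = {\<phi> \<in> characters S. \<phi> e = 1}"

definition act :: "'s semigroup0 \<Rightarrow> 's \<Rightarrow> ('s \<Rightarrow> nat) \<Rightarrow> ('s \<Rightarrow> nat)" where
  "act S s \<phi> = (\<lambda>e\<in>idem S. \<phi> (sinv S s \<cdot>\<^bsub>S\<^esub> e \<cdot>\<^bsub>S\<^esub> s))"

definition germ_rel :: "'s semigroup0 \<Rightarrow> (('s \<times> ('s \<Rightarrow> nat)) \<times> ('s \<times> ('s \<Rightarrow> nat))) set" where
  "germ_rel S = {((s, \<phi>), (t, \<psi>)).
     s \<in> carrier S \<and> \<phi> \<in> DD S (sinv S s \<cdot>\<^bsub>S\<^esub> s) \<and>
     t \<in> carrier S \<and> \<psi> \<in> DD S (sinv S t \<cdot>\<^bsub>S\<^esub> t) \<and>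
     \<phi> = \<psi> \<and> (\<exists>u\<in>carrier S. nat_le S u s \<and> nat_le S u t \<and> \<phi> \<in> DD S (sinv S u \<cdot>\<^bsub>S\<^esub> u))}"

definition germ :: "'s semigroup0 \<Rightarrow> 's \<Rightarrow> ('s \<Rightarrow> nat) \<Rightarrow> ('s \<times> ('s \<Rightarrow> nat)) set" where
  "germ S s \<phi> = germ_rel S `` {(s, \<phi>)}"

definition slice :: "'s semigroup0 \<Rightarrow> 's \<Rightarrow> ('s \<Rightarrow> nat) set \<Rightarrow> ('s \<times> ('s \<Rightarrow> nat)) set set" where
  "slice S s U = {germ S s \<phi> |\<phi>. \<phi> \<in> U}"

text \<open>A topological groupoid is given by the spaces of arrows and of units together with its
  structure maps; \<open>gcomp \<G> g h\<close> is the product \<open>gh\<close> and is meaningful only if \<open>d(g) = r(h)\<close>.\<close>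

record ('g, 'x) topgroupoid =
  arrows :: "'g topology"
  units :: "'x topology"
  gdom :: "'g \<Rightarrow> 'x"
  grng :: "'g \<Rightarrow> 'x"
  gcomp :: "'g \<Rightarrow> 'g \<Rightarrow> 'g"
  ginv :: "'g \<Rightarrow> 'g"

definition topgroupoid_iso ::
    "('g, 'x) topgroupoid \<Rightarrow> ('h, 'y) topgroupoid \<Rightarrow> ('g \<Rightarrow> 'h) \<Rightarrow> ('x \<Rightarrow> 'y) \<Rightarrow> bool" where
  "topgroupoid_iso \<G> \<H> F f \<longleftrightarrow>
     homeomorphic_map (arrows \<G>) (arrows \<H>) F \<and> homeomorphic_map (units \<G>) (units \<H>) f \<and>
     (\<forall>g\<in>topspace (arrows \<G>).
        gdom \<H> (F g) = f (gdom \<G> g) \<and> grng \<H> (F g) = f (grng \<G> g) \<and> ginv \<H> (F g) = F (ginv \<G> g)) \<and>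
     (\<forall>g\<in>topspace (arrows \<G>). \<forall>h\<in>topspace (arrows \<G>). gdom \<G> g = grng \<G> h \<longrightarrow>
        F (gcomp \<G> g h) = gcomp \<H> (F g) (F h))"

definition topgroupoid_isomorphic :: "('g, 'x) topgroupoid \<Rightarrow> ('h, 'y) topgroupoid \<Rightarrow> bool" where
  "topgroupoid_isomorphic \<G> \<H> \<longleftrightarrow> (\<exists>F f. topgroupoid_iso \<G> \<H> F f)"

definition universal_groupoid ::
    "'s semigroup0 \<Rightarrow> (('s \<times> ('s \<Rightarrow> nat)) set, 's \<Rightarrow> nat) topgroupoid" where
  "universal_groupoid S =
     \<lparr>arrows = topology_generated_by
        {slice S s U |s U. s \<in> carrier S \<and> openin (spectrum S) U \<and> U \<subseteq> DD S (sinv S s \<cdot>\<^bsub>S\<^esub> s)},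
      units = spectrum S,
      gdom = (\<lambda>X. THE \<phi>. \<exists>s. (s, \<phi>) \<in> X),
      grng = (\<lambda>X. THE \<psi>. \<exists>s \<phi>. (s, \<phi>) \<in> X \<and> \<psi> = act S s \<phi>),
      gcomp = (\<lambda>X Y. \<Union>{germ S (s \<cdot>\<^bsub>S\<^esub> t) \<psi> |s t \<psi>. (s, act S t \<psi>) \<in> X \<and> (t, \<psi>) \<in> Y}),
      ginv = (\<lambda>X. \<Union>{germ S (sinv S s) (act S s \<phi>) |s \<phi>. (s, \<phi>) \<in> X})\<rparr>"


section \<open>Partial actions on spaces\<close>

text \<open>\<open>\<theta> g\<close> is a partial function, \<open>X\<^sub>g\<close> the domain of \<open>\<theta> (g\<inverse>)\<close>, and \<open>\<theta> g x = Some y\<close> means that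
  \<open>gx\<close> is defined and equal to \<open>y\<close>.\<close>

definition partial_homeo :: "'x topology \<Rightarrow> ('x \<rightharpoonup> 'x) \<Rightarrow> bool" where
  "partial_homeo X \<tau> \<longleftrightarrow> openin X (dom \<tau>) \<and> openin X (ran \<tau>) \<and>
     homeomorphic_map (subtopology X (dom \<tau>)) (subtopology X (ran \<tau>)) (\<lambda>x. the (\<tau> x))"

locale partial_action = group G for G :: "'g monoid" (structure) +
  fixes X :: "'x topology" and \<theta> :: "'g \<Rightarrow> 'x \<rightharpoonup> 'x"
  assumes locally_compact: "locally_compact_space X"
    and Hausdorff: "Hausdorff_space X"
    and partial_homeo: "g \<in> carrier G \<Longrightarrow> partial_homeo X (\<theta> g)"
    and act_one: "\<theta> \<one> = (\<lambda>x. if x \<in> topspace X then Some x else None)"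
    and act_inv: "g \<in> carrier G \<Longrightarrow> \<theta> (inv g) y = Some x \<longleftrightarrow> \<theta> g x = Some y"
    and act_mult: "\<lbrakk>g \<in> carrier G; h \<in> carrier G\<rbrakk> \<Longrightarrow> \<theta> g \<circ>\<^sub>m \<theta> h \<subseteq>\<^sub>m \<theta> (g \<otimes> h)"

definition transformation_groupoid ::
    "'g monoid \<Rightarrow> 'x topology \<Rightarrow> ('g \<Rightarrow> 'x \<rightharpoonup> 'x) \<Rightarrow> ('g \<times> 'x, 'x) topgroupoid" where
  "transformation_groupoid G X \<theta> =
     \<lparr>arrows = subtopology (prod_topology (discrete_topology (carrier G)) X)
        {(g, x). g \<in> carrier G \<and> x \<in> dom (\<theta> g)},
      units = X,
      gdom = snd,
      grng = (\<lambda>(g, x). the (\<theta> g x)),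
      gcomp = (\<lambda>(g, y) (h, x). (g \<otimes>\<^bsub>G\<^esub> h, x)),
      ginv = (\<lambda>(g, x). (inv\<^bsub>G\<^esub> g, the (\<theta> g x)))\<rparr>"


section \<open>$*$-algebras and enveloping \<open>C\<^sup>*\<close>-algebras\<close>

text \<open>Algebras are not assumed to be unital. The field \<open>one\<close> inherited from the ring records is
  never used and is left \<open>undefined\<close>.\<close>

record 'a star_algebra = "(complex, 'a) module" +
  adj :: "'a \<Rightarrow> 'a"

record 'a cstar_algebra = "'a star_algebra" +
  nrm :: "'a \<Rightarrow> real"

definition cstar_iso :: "'a cstar_algebra \<Rightarrow> 'b cstar_algebra \<Rightarrow> ('a \<Rightarrow> 'b) \<Rightarrow> bool" where
  "cstar_iso A B f \<longleftrightarrow> bij_betw f (carrier A) (carrier B) \<and>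
     (\<forall>x\<in>carrier A. \<forall>y\<in>carrier A. f (x \<oplus>\<^bsub>A\<^esub> y) = f x \<oplus>\<^bsub>B\<^esub> f y \<and> f (x \<otimes>\<^bsub>A\<^esub> y) = f x \<otimes>\<^bsub>B\<^esub> f y) \<and>
     (\<forall>c. \<forall>x\<in>carrier A. f (c \<odot>\<^bsub>A\<^esub> x) = c \<odot>\<^bsub>B\<^esub> f x) \<and>
     (\<forall>x\<in>carrier A. f (adj A x) = adj B (f x) \<and> nrm B (f x) = nrm A x)"

definition cstar_isomorphic :: "'a cstar_algebra \<Rightarrow> 'b cstar_algebra \<Rightarrow> bool" where
  "cstar_isomorphic A B \<longleftrightarrow> (\<exists>f. cstar_iso A B f)"

definition cstar_seminorm :: "('a, 'm) star_algebra_scheme \<Rightarrow> ('a \<Rightarrow> real) \<Rightarrow> bool" where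
  "cstar_seminorm A p \<longleftrightarrow>
     (\<forall>x\<in>carrier A. 0 \<le> p x) \<and>
     (\<forall>x\<in>carrier A. \<forall>y\<in>carrier A. p (x \<oplus>\<^bsub>A\<^esub> y) \<le> p x + p y \<and> p (x \<otimes>\<^bsub>A\<^esub> y) \<le> p x * p y) \<and>
     (\<forall>c. \<forall>x\<in>carrier A. p (c \<odot>\<^bsub>A\<^esub> x) = cmod c * p x) \<and>
     (\<forall>x\<in>carrier A. p (adj A x \<otimes>\<^bsub>A\<^esub> x) = (p x)\<^sup>2)"

text \<open>The enveloping \<open>C\<^sup>*\<close>-algebra is the Hausdorff completion of \<open>A\<close> in its largest \<open>C\<^sup>*\<close>-seminorm.
  The \<open>C\<^sup>*\<close>-seminorms on \<open>A\<close> are the seminorms \<open>x \<mapsto> \<parallel>\<pi>(x)\<parallel>\<close> for \<open>\<pi>\<close> a $*$-homomorphism to a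
  \<open>C\<^sup>*\<close>-algebra, so this is the algebra through which all these \<open>\<pi>\<close> factor. The supremum is a genuine
  one when the values of the \<open>C\<^sup>*\<close>-seminorms at each element are bounded, as they are for the
  semigroup and crossed product algebras below. Elements of the completion are
  classes of Cauchy sequences.\<close>

definition env_norm :: "('a, 'm) star_algebra_scheme \<Rightarrow> 'a \<Rightarrow> real" where
  "env_norm A x = Sup {p x |p. cstar_seminorm A p}"

definition env_Cauchy :: "('a, 'm) star_algebra_scheme \<Rightarrow> (nat \<Rightarrow> 'a) set" where
  "env_Cauchy A = {u. range u \<subseteq> carrier A \<and>
     (\<forall>\<epsilon>>0. \<exists>N. \<forall>m\<ge>N. \<forall>n\<ge>N. env_norm A (u m \<ominus>\<^bsub>A\<^esub> u n) < \<epsilon>)}"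

definition env_rel :: "('a, 'm) star_algebra_scheme \<Rightarrow> ((nat \<Rightarrow> 'a) \<times> (nat \<Rightarrow> 'a)) set" where
  "env_rel A = {(u, v). u \<in> env_Cauchy A \<and> v \<in> env_Cauchy A \<and>
     (\<lambda>n. env_norm A (u n \<ominus>\<^bsub>A\<^esub> v n)) \<longlonglongrightarrow> 0}"

definition env_class :: "('a, 'm) star_algebra_scheme \<Rightarrow> (nat \<Rightarrow> 'a) \<Rightarrow> (nat \<Rightarrow> 'a) set" where
  "env_class A u = env_rel A `` {u}"

definition env_embed :: "('a, 'm) star_algebra_scheme \<Rightarrow> 'a \<Rightarrow> (nat \<Rightarrow> 'a) set" where
  "env_embed A x = env_class A (\<lambda>_. x)"

definition envelope :: "('a, 'm) star_algebra_scheme \<Rightarrow> (nat \<Rightarrow> 'a) set cstar_algebra" where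
  "envelope A =
     \<lparr>carrier = env_Cauchy A // env_rel A,
      mult = (\<lambda>X Y. \<Union>u\<in>X. \<Union>v\<in>Y. env_class A (\<lambda>n. u n \<otimes>\<^bsub>A\<^esub> v n)),
      one = undefined,
      zero = env_embed A \<zero>\<^bsub>A\<^esub>,
      add = (\<lambda>X Y. \<Union>u\<in>X. \<Union>v\<in>Y. env_class A (\<lambda>n. u n \<oplus>\<^bsub>A\<^esub> v n)),
      smult = (\<lambda>c X. \<Union>u\<in>X. env_class A (\<lambda>n. c \<odot>\<^bsub>A\<^esub> u n)),
      adj = (\<lambda>X. \<Union>u\<in>X. env_class A (\<lambda>n. adj A (u n))),
      nrm = (\<lambda>X. THE r. \<exists>u\<in>X. (\<lambda>n. env_norm A (u n)) \<longlonglongrightarrow> r)\<rparr>"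

definition cstar_quotient :: "'a cstar_algebra \<Rightarrow> 'a set \<Rightarrow> 'a set cstar_algebra" where
  "cstar_quotient A J =
     \<lparr>carrier = a_rcosets\<^bsub>A\<^esub> J,
      mult = rcoset_mult A J,
      one = undefined,
      zero = J,
      add = set_add A,
      smult = (\<lambda>c X. \<Union>x\<in>X. J +>\<^bsub>A\<^esub> (c \<odot>\<^bsub>A\<^esub> x)),
      adj = (\<lambda>X. \<Union>x\<in>X. J +>\<^bsub>A\<^esub> adj A x),
      nrm = (\<lambda>X. Inf (nrm A ` X))\<rparr>"


section \<open>\<open>C\<^sup>*\<close>-algebras of inverse semigroups with zero\<close>

text \<open>The group-ring-like $*$-algebra of \<open>S\<close>. Here the zero of \<open>S\<close> is an ordinary basis element.\<close>

definition semigroup_algebra :: "'s semigroup0 \<Rightarrow> ('s \<Rightarrow> complex) star_algebra" where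
  "semigroup_algebra S =
     \<lparr>carrier = {a. finite {s. a s \<noteq> 0} \<and> {s. a s \<noteq> 0} \<subseteq> carrier S},
      mult = (\<lambda>a b u. \<Sum>(s, t)\<in>{(s, t). a s \<noteq> 0 \<and> b t \<noteq> 0 \<and> s \<cdot>\<^bsub>S\<^esub> t = u}. a s * b t),
      one = undefined,
      zero = (\<lambda>_. 0),
      add = (\<lambda>a b s. a s + b s),
      smult = (\<lambda>c a s. c * a s),
      adj = (\<lambda>a s. if s \<in> carrier S then cnj (a (sinv S s)) else 0)\<rparr>"

definition point_mass :: "'s \<Rightarrow> 's \<Rightarrow> complex" where
  "point_mass s = (\<lambda>t. if t = s then 1 else 0)"

text \<open>\<open>univ_cstar S\<close> is the universal \<open>C\<^sup>*\<close>-algebra of the semigroup \<open>S\<close>, its zero being treated as any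
  other element, and \<open>contracted_cstar S\<close> is the quotient by the line spanned by the zero.\<close>

definition univ_cstar :: "'s semigroup0 \<Rightarrow> (nat \<Rightarrow> 's \<Rightarrow> complex) set cstar_algebra" where
  "univ_cstar S = envelope (semigroup_algebra S)"

definition univ_cstar_gen :: "'s semigroup0 \<Rightarrow> 's \<Rightarrow> (nat \<Rightarrow> 's \<Rightarrow> complex) set" where
  "univ_cstar_gen S s = env_embed (semigroup_algebra S) (point_mass s)"

definition zero_ideal :: "'s semigroup0 \<Rightarrow> (nat \<Rightarrow> 's \<Rightarrow> complex) set set" where
  "zero_ideal S = {c \<odot>\<^bsub>univ_cstar S\<^esub> univ_cstar_gen S (szero S) |c. True}"

definition contracted_cstar :: "'s semigroup0 \<Rightarrow> (nat \<Rightarrow> 's \<Rightarrow> complex) set set cstar_algebra" where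
  "contracted_cstar S = cstar_quotient (univ_cstar S) (zero_ideal S)"

definition contracted_gen :: "'s semigroup0 \<Rightarrow> 's \<Rightarrow> (nat \<Rightarrow> 's \<Rightarrow> complex) set set" where
  "contracted_gen S s = zero_ideal S +>\<^bsub>univ_cstar S\<^esub> univ_cstar_gen S s"


section \<open>Partial crossed products\<close>

text \<open>Functions in \<open>C\<^sub>0(X)\<close> are extended by \<open>0\<close> outside of \<open>X\<close>. So for \<open>U\<close> open in \<open>X\<close> the inclusion
  of \<open>C\<^sub>0(U)\<close> in \<open>C\<^sub>0(X)\<close> is the inclusion of \<open>carrier (C0 (subtopology X U))\<close> in \<open>carrier (C0 X)\<close>.\<close>

definition C0 :: "'x topology \<Rightarrow> ('x \<Rightarrow> complex) cstar_algebra" where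
  "C0 X =
     \<lparr>carrier = {f. continuous_map X euclidean f \<and>
        (\<forall>\<epsilon>>0. compactin X {x \<in> topspace X. \<epsilon> \<le> cmod (f x)}) \<and> (\<forall>x. x \<notin> topspace X \<longrightarrow> f x = 0)},
      mult = (\<lambda>f g x. f x * g x),
      one = undefined,
      zero = (\<lambda>_. 0),
      add = (\<lambda>f g x. f x + g x),
      smult = (\<lambda>c f x. c * f x),
      adj = (\<lambda>f x. cnj (f x)),
      nrm = (\<lambda>f. Sup (insert 0 ((\<lambda>x. cmod (f x)) ` topspace X)))\<rparr>"

text \<open>The $*$-algebra of finite sums \<open>\<Sum>\<^sub>g a\<^sub>g\<delta>\<^sub>g\<close> with \<open>a\<^sub>g \<in> D\<^sub>g\<close>, for ideals \<open>D\<^sub>g\<close> of \<open>A\<close> and isomorphisms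
  \<open>\<alpha>\<^sub>g : D\<^sub>g\<^sub>\<inverse> \<rightarrow> D\<^sub>g\<close>. Such a sum is given by its coefficient function \<open>g \<mapsto> a\<^sub>g\<close>.\<close>

definition crossed_star_algebra :: "('a, 'm) star_algebra_scheme \<Rightarrow> 'g monoid \<Rightarrow>
    ('g \<Rightarrow> 'a set) \<Rightarrow> ('g \<Rightarrow> 'a \<Rightarrow> 'a) \<Rightarrow> ('g \<Rightarrow> 'a) star_algebra" where
  "crossed_star_algebra A G D \<alpha> =
     \<lparr>carrier = {a. (\<forall>g\<in>carrier G. a g \<in> D g) \<and> (\<forall>g. g \<notin> carrier G \<longrightarrow> a g = \<zero>\<^bsub>A\<^esub>) \<and>
        finite {g. a g \<noteq> \<zero>\<^bsub>A\<^esub>}},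
      mult = (\<lambda>a b k. finsum A (\<lambda>(g, h). \<alpha> g (\<alpha> (inv\<^bsub>G\<^esub> g) (a g) \<otimes>\<^bsub>A\<^esub> b h))
        {(g, h). a g \<noteq> \<zero>\<^bsub>A\<^esub> \<and> b h \<noteq> \<zero>\<^bsub>A\<^esub> \<and> g \<otimes>\<^bsub>G\<^esub> h = k}),
      one = undefined,
      zero = (\<lambda>_. \<zero>\<^bsub>A\<^esub>),
      add = (\<lambda>a b g. a g \<oplus>\<^bsub>A\<^esub> b g),
      smult = (\<lambda>c a g. c \<odot>\<^bsub>A\<^esub> a g),
      adj = (\<lambda>a g. if g \<in> carrier G then \<alpha> g (adj A (a (inv\<^bsub>G\<^esub> g))) else \<zero>\<^bsub>A\<^esub>)\<rparr>"

definition crossed_product :: "('a, 'm) star_algebra_scheme \<Rightarrow> 'g monoid \<Rightarrow>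
    ('g \<Rightarrow> 'a set) \<Rightarrow> ('g \<Rightarrow> 'a \<Rightarrow> 'a) \<Rightarrow> (nat \<Rightarrow> 'g \<Rightarrow> 'a) set cstar_algebra" where
  "crossed_product A G D \<alpha> = envelope (crossed_star_algebra A G D \<alpha>)"

definition C0_ideal :: "'g monoid \<Rightarrow> 'x topology \<Rightarrow> ('g \<Rightarrow> 'x \<rightharpoonup> 'x) \<Rightarrow> 'g \<Rightarrow> ('x \<Rightarrow> complex) set" where
  "C0_ideal G X \<theta> g = carrier (C0 (subtopology X (dom (\<theta> (inv\<^bsub>G\<^esub> g)))))"

definition C0_act :: "'g monoid \<Rightarrow> ('g \<Rightarrow> 'x \<rightharpoonup> 'x) \<Rightarrow> 'g \<Rightarrow> ('x \<Rightarrow> complex) \<Rightarrow> ('x \<Rightarrow> complex)" where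
  "C0_act G \<theta> g f = (\<lambda>x. case \<theta> (inv\<^bsub>G\<^esub> g) x of None \<Rightarrow> 0 | Some y \<Rightarrow> f y)"

definition C0_crossed_product :: "'g monoid \<Rightarrow> 'x topology \<Rightarrow> ('g \<Rightarrow> 'x \<rightharpoonup> 'x) \<Rightarrow>
    (nat \<Rightarrow> 'g \<Rightarrow> 'x \<Rightarrow> complex) set cstar_algebra" where
  "C0_crossed_product G X \<theta> = crossed_product (C0 X) G (C0_ideal G X \<theta>) (C0_act G \<theta>)"

text \<open>The crossed product \<open>A \<rtimes> G\<close> by the partial action obtained from that on \<open>C\<^sub>0(X)\<close> along an
  isomorphism \<open>\<gamma> : A \<rightarrow> C\<^sub>0(X)\<close>.\<close>

definition transported_crossed_product :: "'a cstar_algebra \<Rightarrow> ('a \<Rightarrow> 'x \<Rightarrow> complex) \<Rightarrow>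
    'g monoid \<Rightarrow> 'x topology \<Rightarrow> ('g \<Rightarrow> 'x \<rightharpoonup> 'x) \<Rightarrow> (nat \<Rightarrow> 'g \<Rightarrow> 'a) set cstar_algebra" where
  "transported_crossed_product A \<gamma> G X \<theta> =
     crossed_product A G (\<lambda>g. {a \<in> carrier A. \<gamma> a \<in> C0_ideal G X \<theta> g})
       (\<lambda>g a. inv_into (carrier A) \<gamma> (C0_act G \<theta> g (\<gamma> a)))"

end

theory Submission
  imports Defs
begin

text \<open>If \<open>\<iota>(s) = \<iota>(t)\<close> and a character lies in the domains of \<open>s\<close> and \<open>t\<close>, idempotent purity makes \<open>s\<close> and
  \<open>t\<close> agree below a common idempotent of value \<open>1\<close>. Hence the action of \<open>S\<close> on the spectrum
  depends on \<open>s\<close> only through \<open>\<iota>(s)\<close>, and \<open>[s, \<phi>] \<mapsto> (\<iota>(s), \<phi>)\<close> is an isomorphism of groupoids.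

  For the algebras, \<open>s \<mapsto> 1\<^bsub>D(ss*)\<^esub>\<delta>\<^bsub>\<iota>(s)\<^esub>\<close> is a $*$-homomorphism \<open>\<Phi>\<close> from the algebra of \<open>S\<close> to the algebraic
  crossed product, with image dense in the norm \<open>\<Sum>\<^sub>g \<parallel>a\<^sub>g\<parallel>\<close>. This norm dominates every \<open>C\<^sup>*\<close>-seminorm of the
  crossed product; pulled back along \<open>\<Phi>\<close> it also dominates every \<open>C\<^sup>*\<close>-seminorm vanishing at the zero of
  \<open>S\<close>, because by the \<open>C\<^sup>*\<close>-identity this only has to be checked on combinations of idempotents, which
  span finite-dimensional commutative algebras. So \<open>C\<^sup>*\<close>-seminorms can be restricted and extended along
  \<open>\<Phi>\<close>, the two largest ones correspond, and both completions are the same.\<close>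

section \<open>$*$-algebras with a \<open>C\<^sup>*\<close>-seminorm\<close>

text \<open>The algebraic crossed product has arbitrary functions in C0(X_g) as coefficients, so it
  is in general larger than the image of the semigroup algebra under \<Phi>, and a C*-seminorm of
  the latter has no values there a priori. It extends by limits once it is continuous in a norm for
  which the image is dense. This dictates the bound by \<open>l1_norm\<close>, and reduces
  everything to one question: how large can a C*-seminorm be on a single degree? There the element
  \<open>adj CS x \<otimes> x\<close> has degree 1, so idempotent purity puts its support into E(S).
  The zero of S is an ordinary basis vector of the algebra and needs separate care. Contraction is
  modelled by the projection \<kappa> along it, and the quotient norm, an infimum over a coset, is
  attained at the representative produced by \<kappa>. All isomorphisms rest on one principle: two
  algebras that complete the same seminormed algebra are isometrically isomorphic. The
  identification of C*(E) with C0 of the spectrum is the same comparison with the Gelfand transform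
  \<open>gelf\<close> in place of \<Phi>.\<close>

locale star_alg = abelian_group A for A :: "('a, 'm) star_algebra_scheme" (structure) +
  assumes m_closed: "\<lbrakk>x \<in> carrier A; y \<in> carrier A\<rbrakk> \<Longrightarrow> x \<otimes> y \<in> carrier A"
    and l_distr: "\<lbrakk>x \<in> carrier A; y \<in> carrier A; z \<in> carrier A\<rbrakk> \<Longrightarrow> (x \<oplus> y) \<otimes> z = x \<otimes> z \<oplus> y \<otimes> z"
    and r_distr: "\<lbrakk>x \<in> carrier A; y \<in> carrier A; z \<in> carrier A\<rbrakk> \<Longrightarrow> z \<otimes> (x \<oplus> y) = z \<otimes> x \<oplus> z \<otimes> y"
    and smult_closed: "x \<in> carrier A \<Longrightarrow> c \<odot> x \<in> carrier A"
    and smult_r_distr: "\<lbrakk>x \<in> carrier A; y \<in> carrier A\<rbrakk> \<Longrightarrow> c \<odot> (x \<oplus> y) = c \<odot> x \<oplus> c \<odot> y"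
    and smult_l_distr: "x \<in> carrier A \<Longrightarrow> (c + d) \<odot> x = c \<odot> x \<oplus> d \<odot> x"
    and smult_one: "x \<in> carrier A \<Longrightarrow> 1 \<odot> x = x"
    and adj_closed: "x \<in> carrier A \<Longrightarrow> adj A x \<in> carrier A"
    and adj_add: "\<lbrakk>x \<in> carrier A; y \<in> carrier A\<rbrakk> \<Longrightarrow> adj A (x \<oplus> y) = adj A x \<oplus> adj A y"
    and adj_adj: "x \<in> carrier A \<Longrightarrow> adj A (adj A x) = x"
begin

lemma diff_closed: "\<lbrakk>x \<in> carrier A; y \<in> carrier A\<rbrakk> \<Longrightarrow> x \<ominus> y \<in> carrier A"
  by (simp add: a_minus_def)

lemma eq_zeroI: "\<lbrakk>x \<in> carrier A; x = x \<oplus> x\<rbrakk> \<Longrightarrow> x = \<zero>"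
  using add.l_cancel_one' by metis

lemma l_null: "x \<in> carrier A \<Longrightarrow> \<zero> \<otimes> x = \<zero>"
  using l_distr[of \<zero> \<zero> x] m_closed eq_zeroI by (metis l_zero zero_closed)

lemma r_null: "x \<in> carrier A \<Longrightarrow> x \<otimes> \<zero> = \<zero>"
  using r_distr[of \<zero> \<zero> x] m_closed eq_zeroI by (metis l_zero zero_closed)

lemma smult_zero: "c \<odot> \<zero> = \<zero>"
  using smult_r_distr[of \<zero> \<zero>] smult_closed eq_zeroI by (metis l_zero zero_closed)

lemma zero_smult: "x \<in> carrier A \<Longrightarrow> 0 \<odot> x = \<zero>"
  using smult_l_distr[of x 0 0] smult_closed eq_zeroI by (metis add.left_neutral)

lemma adj_zero: "adj A \<zero> = \<zero>"
  using adj_add[of \<zero> \<zero>] adj_closed eq_zeroI by (metis l_zero zero_closed)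

lemma minus_smult: "x \<in> carrier A \<Longrightarrow> \<ominus> x = (- 1) \<odot> x"
  using smult_l_distr[of x "-1" 1] smult_closed[of x "-1"] smult_one[of x] zero_smult[of x]
  by (metis add.inv_equality add.left_inverse)

lemma l_minus: "\<lbrakk>x \<in> carrier A; y \<in> carrier A\<rbrakk> \<Longrightarrow> (\<ominus> x) \<otimes> y = \<ominus> (x \<otimes> y)"
  by (metis a_inv_closed add.inv_equality l_distr l_neg l_null m_closed)

lemma r_minus: "\<lbrakk>x \<in> carrier A; y \<in> carrier A\<rbrakk> \<Longrightarrow> x \<otimes> (\<ominus> y) = \<ominus> (x \<otimes> y)"
  by (metis a_inv_closed add.inv_equality r_distr l_neg r_null m_closed)

lemma smult_minus: "x \<in> carrier A \<Longrightarrow> c \<odot> (\<ominus> x) = \<ominus> (c \<odot> x)"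
  by (metis a_inv_closed add.inv_equality smult_r_distr l_neg smult_zero smult_closed)

lemma adj_minus: "x \<in> carrier A \<Longrightarrow> adj A (\<ominus> x) = \<ominus> (adj A x)"
  by (metis a_inv_closed add.inv_equality adj_add l_neg adj_zero adj_closed)

lemma diff_self: "x \<in> carrier A \<Longrightarrow> x \<ominus> x = \<zero>"
  by (simp add: a_minus_def r_neg)

lemma minus_diff: "\<lbrakk>x \<in> carrier A; y \<in> carrier A\<rbrakk> \<Longrightarrow> \<ominus> (x \<ominus> y) = y \<ominus> x"
  by (simp add: a_minus_def minus_add a_comm)

lemma diff_diff: "\<lbrakk>x \<in> carrier A; y \<in> carrier A; z \<in> carrier A\<rbrakk> \<Longrightarrow> (x \<ominus> y) \<oplus> (y \<ominus> z) = x \<ominus> z"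
  by (simp add: a_minus_def a_assoc r_neg1)

lemma diff_add: "\<lbrakk>x \<in> carrier A; y \<in> carrier A\<rbrakk> \<Longrightarrow> (x \<ominus> y) \<oplus> y = x"
  by (simp add: a_minus_def a_assoc l_neg)

lemma add_diff_add:
  "\<lbrakk>x \<in> carrier A; y \<in> carrier A; x' \<in> carrier A; y' \<in> carrier A\<rbrakk> \<Longrightarrow>
    (x \<oplus> y) \<ominus> (x' \<oplus> y') = (x \<ominus> x') \<oplus> (y \<ominus> y')"
  by (simp add: a_minus_def minus_add a_ac)

lemma mult_diff_mult:
  assumes "x \<in> carrier A" "y \<in> carrier A" "x' \<in> carrier A" "y' \<in> carrier A"
  shows "x \<otimes> y \<ominus> x' \<otimes> y' = x \<otimes> (y \<ominus> y') \<oplus> (x \<ominus> x') \<otimes> y'"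
proof -
  have "x \<otimes> (y \<ominus> y') = x \<otimes> y \<ominus> x \<otimes> y'" "(x \<ominus> x') \<otimes> y' = x \<otimes> y' \<ominus> x' \<otimes> y'"
    using assms by (simp_all add: a_minus_def r_distr l_distr l_minus r_minus)
  then show ?thesis using assms m_closed diff_diff by metis
qed

lemma smult_diff: "\<lbrakk>x \<in> carrier A; y \<in> carrier A\<rbrakk> \<Longrightarrow> c \<odot> (x \<ominus> y) = c \<odot> x \<ominus> c \<odot> y"
  by (simp add: a_minus_def smult_r_distr smult_minus)

lemma adj_diff: "\<lbrakk>x \<in> carrier A; y \<in> carrier A\<rbrakk> \<Longrightarrow> adj A (x \<ominus> y) = adj A x \<ominus> adj A y"
  by (simp add: a_minus_def adj_add adj_minus)

end

text \<open>An isometric involution is required in place of the C*-identity, so that the calculus of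
  Cauchy sequences covers \<open>l1_norm\<close>, which need not satisfy that identity, together
  with all C*-seminorms.\<close>

locale star_seminorm = star_alg A for A :: "('a, 'm) star_algebra_scheme" (structure) +
  fixes p :: "'a \<Rightarrow> real"
  assumes nonneg: "x \<in> carrier A \<Longrightarrow> 0 \<le> p x"
    and triangle: "\<lbrakk>x \<in> carrier A; y \<in> carrier A\<rbrakk> \<Longrightarrow> p (x \<oplus> y) \<le> p x + p y"
    and submult: "\<lbrakk>x \<in> carrier A; y \<in> carrier A\<rbrakk> \<Longrightarrow> p (x \<otimes> y) \<le> p x * p y"
    and homogeneous: "x \<in> carrier A \<Longrightarrow> p (c \<odot> x) = cmod c * p x"
    and isometric_adj: "x \<in> carrier A \<Longrightarrow> p (adj A x) = p x"
begin

lemma p_zero: "p \<zero> = 0"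
  using homogeneous[of \<zero> 0] zero_smult[of \<zero>] by simp

lemma p_minus: "x \<in> carrier A \<Longrightarrow> p (\<ominus> x) = p x"
  by (simp add: minus_smult homogeneous)

lemma p_diff_commute: "\<lbrakk>x \<in> carrier A; y \<in> carrier A\<rbrakk> \<Longrightarrow> p (x \<ominus> y) = p (y \<ominus> x)"
  by (metis minus_diff p_minus diff_closed)

lemma p_diff_triangle:
  "\<lbrakk>x \<in> carrier A; y \<in> carrier A; z \<in> carrier A\<rbrakk> \<Longrightarrow> p (x \<ominus> z) \<le> p (x \<ominus> y) + p (y \<ominus> z)"
  by (metis diff_diff triangle diff_closed)

lemma p_le_diff: "\<lbrakk>x \<in> carrier A; y \<in> carrier A\<rbrakk> \<Longrightarrow> p x \<le> p (x \<ominus> y) + p y"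
  by (metis diff_add triangle diff_closed)

lemma abs_p_diff: "\<lbrakk>x \<in> carrier A; y \<in> carrier A\<rbrakk> \<Longrightarrow> \<bar>p x - p y\<bar> \<le> p (x \<ominus> y)"
  using p_le_diff[of x y] p_le_diff[of y x] p_diff_commute[of x y] by linarith

lemma p_add_diff:
  "\<lbrakk>x \<in> carrier A; y \<in> carrier A; x' \<in> carrier A; y' \<in> carrier A\<rbrakk> \<Longrightarrow>
    p ((x \<oplus> y) \<ominus> (x' \<oplus> y')) \<le> p (x \<ominus> x') + p (y \<ominus> y')"
  by (metis add_diff_add triangle diff_closed)

lemma p_mult_diff:
  assumes "x \<in> carrier A" "y \<in> carrier A" "x' \<in> carrier A" "y' \<in> carrier A"
  shows "p (x \<otimes> y \<ominus> x' \<otimes> y') \<le> p x * p (y \<ominus> y') + p (x \<ominus> x') * p y'"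
proof -
  have "p (x \<otimes> y \<ominus> x' \<otimes> y') \<le> p (x \<otimes> (y \<ominus> y')) + p ((x \<ominus> x') \<otimes> y')"
    using assms by (metis mult_diff_mult triangle diff_closed m_closed)
  also have "\<dots> \<le> p x * p (y \<ominus> y') + p (x \<ominus> x') * p y'"
    using assms by (intro add_mono submult diff_closed)
  finally show ?thesis .
qed

lemma p_smult_diff: "\<lbrakk>x \<in> carrier A; y \<in> carrier A\<rbrakk> \<Longrightarrow> p (c \<odot> x \<ominus> c \<odot> y) = cmod c * p (x \<ominus> y)"
  by (metis smult_diff homogeneous diff_closed)

lemma p_adj_diff: "\<lbrakk>x \<in> carrier A; y \<in> carrier A\<rbrakk> \<Longrightarrow> p (adj A x \<ominus> adj A y) = p (x \<ominus> y)"
  by (metis adj_diff isometric_adj diff_closed)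

section \<open>Cauchy sequences and null differences\<close>

definition Cauchy_seq :: "(nat \<Rightarrow> 'a) \<Rightarrow> bool" where
  "Cauchy_seq u \<longleftrightarrow> range u \<subseteq> carrier A \<and> (\<forall>\<epsilon>>0. \<exists>N. \<forall>m\<ge>N. \<forall>n\<ge>N. p (u m \<ominus> u n) < \<epsilon>)"

definition null_diff :: "(nat \<Rightarrow> 'a) \<Rightarrow> (nat \<Rightarrow> 'a) \<Rightarrow> bool" where
  "null_diff u v \<longleftrightarrow> (\<lambda>n. p (u n \<ominus> v n)) \<longlonglongrightarrow> 0"

lemma Cauchy_seq_closed: "Cauchy_seq u \<Longrightarrow> u n \<in> carrier A"
  by (auto simp: Cauchy_seq_def)

lemma Cauchy_seq_const: "x \<in> carrier A \<Longrightarrow> Cauchy_seq (\<lambda>_. x)"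
  by (auto simp: Cauchy_seq_def diff_self p_zero)

lemma Cauchy_seq_norm:
  assumes "Cauchy_seq u" shows "Cauchy (\<lambda>n. p (u n))"
proof (rule metric_CauchyI)
  fix e :: real assume "e > 0"
  then obtain N where N: "\<forall>m\<ge>N. \<forall>n\<ge>N. p (u m \<ominus> u n) < e"
    using assms unfolding Cauchy_seq_def by meson
  have "dist (p (u m)) (p (u n)) < e" if "m \<ge> N" "n \<ge> N" for m n
    using N that abs_p_diff[of "u m" "u n"] Cauchy_seq_closed[OF assms]
    by (fastforce simp: dist_real_def)
  then show "\<exists>M. \<forall>m\<ge>M. \<forall>n\<ge>M. dist (p (u m)) (p (u n)) < e" by blast
qed

lemma Cauchy_seq_bounded:
  assumes "Cauchy_seq u" obtains M where "M > 0" "\<And>n. p (u n) \<le> M"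
proof -
  have "Bseq (\<lambda>n. p (u n))"
    using Cauchy_seq_norm[OF assms] Cauchy_Bseq by blast
  then obtain M where M: "M > 0" "\<forall>n. norm (p (u n)) \<le> M" by (auto simp: Bseq_def)
  then have "p (u n) \<le> M" for n by (metis abs_le_iff real_norm_def)
  then show thesis using that[of M] M(1) by blast
qed

text \<open>The closure of Cauchy sequences under the algebra operations reduces to this
  Lipschitz-type bound; unary operations use it with the same sequence twice.\<close>

lemma Cauchy_seq_dominated:
  assumes "range w \<subseteq> carrier A" "K \<ge> 0"
    and "Cauchy_seq u" "Cauchy_seq v"
    and le: "\<And>m n. p (w m \<ominus> w n) \<le> K * (p (u m \<ominus> u n) + p (v m \<ominus> v n))"
  shows "Cauchy_seq w"
  unfolding Cauchy_seq_def
proof (intro conjI allI impI)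
  show "range w \<subseteq> carrier A" by fact
  fix e :: real assume e: "e > 0"
  \<comment> \<open>Taking K + 1 instead of K keeps the denominator positive for K = 0 and leaves
    room for the strict inequality.\<close>
  define d where "d = e / (2 * (K + 1))"
  have d: "d > 0" using e \<open>K \<ge> 0\<close> by (simp add: d_def)
  obtain M where M: "\<forall>m\<ge>M. \<forall>n\<ge>M. p (u m \<ominus> u n) < d"
    using assms(3) d unfolding Cauchy_seq_def by meson
  obtain N where N: "\<forall>m\<ge>N. \<forall>n\<ge>N. p (v m \<ominus> v n) < d"
    using assms(4) d unfolding Cauchy_seq_def by meson
  have "p (w m \<ominus> w n) < e" if "m \<ge> max M N" "n \<ge> max M N" for m n
  proof -
    have "p (u m \<ominus> u n) + p (v m \<ominus> v n) \<le> 2 * d" using M N that by (smt (verit) max.bounded_iff)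
    then have "p (w m \<ominus> w n) \<le> K * (2 * d)" using le[of m n] \<open>K \<ge> 0\<close>
      by (meson mult_left_mono order_trans)
    also have "\<dots> < (K + 1) * (2 * d)" using d by simp
    also have "\<dots> = e" using \<open>K \<ge> 0\<close> by (simp add: d_def field_simps)
    finally show ?thesis .
  qed
  then show "\<exists>N. \<forall>m\<ge>N. \<forall>n\<ge>N. p (w m \<ominus> w n) < e" by blast
qed

lemma Cauchy_seq_add:
  assumes "Cauchy_seq u" "Cauchy_seq v" shows "Cauchy_seq (\<lambda>n. u n \<oplus> v n)"
  by (rule Cauchy_seq_dominated[of _ 1 u v])
    (use assms p_add_diff in \<open>auto simp: Cauchy_seq_closed\<close>)

lemma Cauchy_seq_mult:
  assumes "Cauchy_seq u" "Cauchy_seq v" shows "Cauchy_seq (\<lambda>n. u n \<otimes> v n)"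
proof -
  obtain M where M: "M > 0" "\<And>n. p (u n) \<le> M" using Cauchy_seq_bounded[OF assms(1)] by blast
  obtain N where N: "N > 0" "\<And>n. p (v n) \<le> N" using Cauchy_seq_bounded[OF assms(2)] by blast
  note cl = Cauchy_seq_closed[OF assms(1)] Cauchy_seq_closed[OF assms(2)]
  show ?thesis
  proof (rule Cauchy_seq_dominated[of _ "M + N" u v])
    fix m n
    have "p (u m \<otimes> v m \<ominus> u n \<otimes> v n) \<le> p (u m) * p (v m \<ominus> v n) + p (u m \<ominus> u n) * p (v n)"
      using cl by (intro p_mult_diff)
    \<comment> \<open>Both bounds are weakened to M + N because \<open>Cauchy_seq_dominated\<close>
      takes one constant for the two sequences.\<close>
    also have "\<dots> \<le> (M + N) * p (v m \<ominus> v n) + p (u m \<ominus> u n) * (M + N)"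
      using M(1) N(1) M(2)[of m] N(2)[of n] cl
      by (intro add_mono mult_left_mono mult_right_mono nonneg diff_closed; linarith?)
    finally show "p (u m \<otimes> v m \<ominus> u n \<otimes> v n) \<le> (M + N) * (p (u m \<ominus> u n) + p (v m \<ominus> v n))"
      by (simp add: algebra_simps)
  qed (use assms M N cl in \<open>auto simp: m_closed\<close>)
qed

lemma Cauchy_seq_smult:
  assumes "Cauchy_seq u" shows "Cauchy_seq (\<lambda>n. c \<odot> u n)"
  by (rule Cauchy_seq_dominated[of _ "cmod c" u u])
    (use assms in \<open>auto simp: Cauchy_seq_closed smult_closed p_smult_diff algebra_simps nonneg diff_closed\<close>)

lemma Cauchy_seq_adj:
  assumes "Cauchy_seq u" shows "Cauchy_seq (\<lambda>n. adj A (u n))"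
  by (rule Cauchy_seq_dominated[of _ 1 u u])
    (use assms in \<open>auto simp: Cauchy_seq_closed adj_closed p_adj_diff nonneg diff_closed\<close>)

lemma null_diff_refl: "range u \<subseteq> carrier A \<Longrightarrow> null_diff u u"
  by (auto simp: null_diff_def diff_self p_zero image_subset_iff)

lemma null_diffI:
  assumes "range u \<subseteq> carrier A" "range v \<subseteq> carrier A" "b \<longlonglongrightarrow> 0" "\<And>n. p (u n \<ominus> v n) \<le> b n"
  shows "null_diff u v"
  unfolding null_diff_def
  by (rule tendsto_sandwich[OF _ _ tendsto_const assms(3)])
    (use assms in \<open>auto intro!: always_eventually nonneg diff_closed simp: image_subset_iff\<close>)

lemma null_diff_sym:
  assumes "null_diff u v" "range u \<subseteq> carrier A" "range v \<subseteq> carrier A" shows "null_diff v u"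
proof -
  have "(\<lambda>n. p (u n \<ominus> v n)) = (\<lambda>n. p (v n \<ominus> u n))"
    using assms by (auto simp: fun_eq_iff intro!: p_diff_commute)
  then show ?thesis using assms(1) by (simp add: null_diff_def)
qed

lemma null_diff_trans:
  assumes "null_diff u v" "null_diff v w"
    and cl: "range u \<subseteq> carrier A" "range v \<subseteq> carrier A" "range w \<subseteq> carrier A"
  shows "null_diff u w"
proof (rule null_diffI)
  show "(\<lambda>n. p (u n \<ominus> v n) + p (v n \<ominus> w n)) \<longlonglongrightarrow> 0"
    using tendsto_add assms(1,2) unfolding null_diff_def by fastforce
qed (use cl in \<open>auto intro!: p_diff_triangle simp: image_subset_iff\<close>)

lemma null_diff_add:
  assumes "null_diff u u'" "null_diff v v'"
    and "range u \<subseteq> carrier A" "range v \<subseteq> carrier A" "range u' \<subseteq> carrier A" "range v' \<subseteq> carrier A"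
  shows "null_diff (\<lambda>n. u n \<oplus> v n) (\<lambda>n. u' n \<oplus> v' n)"
proof (rule null_diffI)
  show "(\<lambda>n. p (u n \<ominus> u' n) + p (v n \<ominus> v' n)) \<longlonglongrightarrow> 0"
    using tendsto_add assms(1,2) unfolding null_diff_def by fastforce
qed (use assms in \<open>auto intro!: p_add_diff simp: image_subset_iff\<close>)

lemma null_diff_mult:
  assumes "null_diff u u'" "null_diff v v'" "Cauchy_seq u" "Cauchy_seq v'"
    and "range v \<subseteq> carrier A" "range u' \<subseteq> carrier A"
  shows "null_diff (\<lambda>n. u n \<otimes> v n) (\<lambda>n. u' n \<otimes> v' n)"
proof -
  obtain M where M: "M > 0" "\<And>n. p (u n) \<le> M" using Cauchy_seq_bounded[OF assms(3)] by blast
  obtain N where N: "N > 0" "\<And>n. p (v' n) \<le> N" using Cauchy_seq_bounded[OF assms(4)] by blast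
  have cl: "u n \<in> carrier A" "v n \<in> carrier A" "u' n \<in> carrier A" "v' n \<in> carrier A" for n
    using assms by (auto simp: Cauchy_seq_def)
  show ?thesis
  proof (rule null_diffI)
    show "(\<lambda>n. M * p (v n \<ominus> v' n) + p (u n \<ominus> u' n) * N) \<longlonglongrightarrow> 0"
      using assms(1,2) unfolding null_diff_def by (auto intro!: tendsto_eq_intros)
    fix n
    have "p (u n \<otimes> v n \<ominus> u' n \<otimes> v' n) \<le> p (u n) * p (v n \<ominus> v' n) + p (u n \<ominus> u' n) * p (v' n)"
      using cl by (intro p_mult_diff)
    also have "\<dots> \<le> M * p (v n \<ominus> v' n) + p (u n \<ominus> u' n) * N"
      using M N cl by (intro add_mono mult_left_mono mult_right_mono nonneg diff_closed)
    finally show "p (u n \<otimes> v n \<ominus> u' n \<otimes> v' n) \<le> M * p (v n \<ominus> v' n) + p (u n \<ominus> u' n) * N" .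
  qed (use cl m_closed in auto)
qed

lemma null_diff_smult:
  assumes "null_diff u v" "range u \<subseteq> carrier A" "range v \<subseteq> carrier A"
  shows "null_diff (\<lambda>n. c \<odot> u n) (\<lambda>n. c \<odot> v n)"
proof (rule null_diffI)
  show "(\<lambda>n. cmod c * p (u n \<ominus> v n)) \<longlonglongrightarrow> 0"
    using assms(1) unfolding null_diff_def by (auto intro!: tendsto_eq_intros)
qed (use assms smult_closed in \<open>auto simp: p_smult_diff image_subset_iff\<close>)

lemma null_diff_adj:
  assumes "null_diff u v" "range u \<subseteq> carrier A" "range v \<subseteq> carrier A"
  shows "null_diff (\<lambda>n. adj A (u n)) (\<lambda>n. adj A (v n))"
proof (rule null_diffI)
  show "(\<lambda>n. p (u n \<ominus> v n)) \<longlonglongrightarrow> 0" using assms(1) unfolding null_diff_def .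
qed (use assms adj_closed in \<open>auto simp: p_adj_diff image_subset_iff\<close>)

lemma null_diff_limit:
  assumes "null_diff u v" "range u \<subseteq> carrier A" "range v \<subseteq> carrier A" "(\<lambda>n. p (u n)) \<longlonglongrightarrow> r"
  shows "(\<lambda>n. p (v n)) \<longlonglongrightarrow> r"
proof -
  have "(\<lambda>n. p (u n) - p (v n)) \<longlonglongrightarrow> 0"
    by (rule Lim_null_comparison[OF _ assms(1)[unfolded null_diff_def]])
      (use assms in \<open>auto intro!: always_eventually abs_p_diff simp: image_subset_iff\<close>)
  from tendsto_diff[OF assms(4) this] show ?thesis by simp
qed

end

locale cstar_seminorm_alg = star_alg A for A :: "('a, 'm) star_algebra_scheme" (structure) +
  fixes p :: "'a \<Rightarrow> real"
  assumes cstar_seminorm: "cstar_seminorm A p"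

text \<open>Isometry of the involution is not a clause of \<open>cstar_seminorm\<close>. It follows
  from the C*-identity and submultiplicativity: the square of \<open>p x\<close> is at most
  \<open>p (adj A x) * p x\<close>, and a nonzero \<open>p x\<close> cancels. Applying this to
  \<open>adj A x\<close> as well gives equality.\<close>

sublocale cstar_seminorm_alg \<subseteq> star_seminorm
proof unfold_locales
  have le: "p x \<le> p (adj A x)" if "x \<in> carrier A" for x
  proof (cases "p x = 0")
    case False
    have "p x * p x \<le> p (adj A x) * p x"
      using cstar_seminorm that adj_closed[OF that] unfolding cstar_seminorm_def power2_eq_square by metis
    moreover have "p x \<ge> 0" using cstar_seminorm that unfolding cstar_seminorm_def by simp
    ultimately show ?thesis using False by (simp add: mult_le_cancel_right)
  qed (use cstar_seminorm adj_closed[OF that] in \<open>auto simp: cstar_seminorm_def\<close>)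
  show "p (adj A x) = p x" if "x \<in> carrier A" for x
    using le[OF that] le[OF adj_closed[OF that]] adj_adj[OF that] by simp
qed (use cstar_seminorm in \<open>auto simp: cstar_seminorm_def\<close>)

lemma (in cstar_seminorm_alg) cstar_identity: "x \<in> carrier A \<Longrightarrow> p (adj A x \<otimes> x) = (p x)\<^sup>2"
  using cstar_seminorm by (simp add: cstar_seminorm_def)


context star_seminorm
begin

text \<open>A three-epsilon estimate. It shows that a termwise approximation of a Cauchy sequence,
  such as one taken from a dense subset, is again Cauchy.\<close>

lemma null_diff_Cauchy:
  assumes "Cauchy_seq u" "null_diff u v" "range v \<subseteq> carrier A"
  shows "Cauchy_seq v"
  unfolding Cauchy_seq_def
proof (intro conjI allI impI)
  show "range v \<subseteq> carrier A" by fact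
  have cl: "u n \<in> carrier A" "v n \<in> carrier A" for n
    using assms by (auto simp: Cauchy_seq_def)
  fix e :: real assume e: "e > 0"
  obtain M where M: "\<forall>m\<ge>M. \<forall>n\<ge>M. p (u m \<ominus> u n) < e / 3"
    using assms(1) e unfolding Cauchy_seq_def by (meson divide_pos_pos zero_less_numeral)
  obtain N where N: "\<forall>n\<ge>N. p (u n \<ominus> v n) < e / 3"
    using order_tendstoD(2)[OF assms(2)[unfolded null_diff_def], of "e / 3"] e
    by (auto simp: eventually_sequentially)
  have "p (v m \<ominus> v n) < e" if "m \<ge> max M N" "n \<ge> max M N" for m n
  proof -
    have "p (v m \<ominus> v n) \<le> p (v m \<ominus> u m) + p (u m \<ominus> v n)" using cl by (intro p_diff_triangle)
    also have "p (u m \<ominus> v n) \<le> p (u m \<ominus> u n) + p (u n \<ominus> v n)" using cl by (intro p_diff_triangle)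
    also have "p (v m \<ominus> u m) = p (u m \<ominus> v m)" using cl by (intro p_diff_commute)
    also have "p (u m \<ominus> v m) + (p (u m \<ominus> u n) + p (u n \<ominus> v n)) < e / 3 + (e / 3 + e / 3)"
      using M N that by (intro add_strict_mono) auto
    finally show ?thesis by simp
  qed
  then show "\<exists>N. \<forall>m\<ge>N. \<forall>n\<ge>N. p (v m \<ominus> v n) < e" by blast
qed

end


section \<open>Completions\<close>

text \<open>\<open>conv u X\<close> expresses that the sequence \<open>u\<close> of \<open>A\<close> converges to the point \<open>X\<close> of the Hausdorff
  completion \<open>B\<close>. Envelopes, their quotients and \<open>C\<^sub>0(X)\<close> carry such relations, and \<open>B\<close> is determined
  by \<open>(A, p)\<close>.\<close>

locale completion = star_seminorm A p
  for A :: "('a, 'm) star_algebra_scheme" (structure) and p :: "'a \<Rightarrow> real" +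
  fixes B :: "'b cstar_algebra" and conv :: "(nat \<Rightarrow> 'a) \<Rightarrow> 'b \<Rightarrow> bool"
  assumes conv_Cauchy: "conv u X \<Longrightarrow> Cauchy_seq u"
    and conv_carrier: "conv u X \<Longrightarrow> X \<in> carrier B"
    and conv_total: "Cauchy_seq u \<Longrightarrow> \<exists>X. conv u X"
    and conv_surj: "X \<in> carrier B \<Longrightarrow> \<exists>u. conv u X"
    and conv_eq: "\<lbrakk>conv u X; conv v Y\<rbrakk> \<Longrightarrow> X = Y \<longleftrightarrow> null_diff u v"
    and conv_zero: "conv (\<lambda>_. \<zero>) \<zero>\<^bsub>B\<^esub>"
    and conv_add: "\<lbrakk>conv u X; conv v Y\<rbrakk> \<Longrightarrow> conv (\<lambda>n. u n \<oplus> v n) (X \<oplus>\<^bsub>B\<^esub> Y)"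
    and conv_mult: "\<lbrakk>conv u X; conv v Y\<rbrakk> \<Longrightarrow> conv (\<lambda>n. u n \<otimes> v n) (X \<otimes>\<^bsub>B\<^esub> Y)"
    and conv_smult: "conv u X \<Longrightarrow> conv (\<lambda>n. c \<odot> u n) (c \<odot>\<^bsub>B\<^esub> X)"
    and conv_adj: "conv u X \<Longrightarrow> conv (\<lambda>n. adj A (u n)) (adj B X)"
    and conv_nrm: "conv u X \<Longrightarrow> (\<lambda>n. p (u n)) \<longlonglongrightarrow> nrm B X"
begin

lemma conv_unique: "\<lbrakk>conv u X; conv u Y\<rbrakk> \<Longrightarrow> X = Y"
  by (metis conv_eq conv_Cauchy null_diff_refl Cauchy_seq_def)

lemma conv_range: "conv u X \<Longrightarrow> range u \<subseteq> carrier A"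
  using conv_Cauchy by (auto simp: Cauchy_seq_def)

text \<open>Each law holds because both sides are limits of one and the same sequence of A, and
  limits are unique. This makes \<open>finsum\<close> available in B, which the multiplication of a
  crossed product with coefficients in B is built from.\<close>

lemma abelian_monoid_completion: "abelian_monoid B"
proof (rule abelian_monoidI)
  fix X Y Z assume *: "X \<in> carrier B" "Y \<in> carrier B" "Z \<in> carrier B"
  then obtain u v w where uvw: "conv u X" "conv v Y" "conv w Z" using conv_surj by metis
  note cl = conv_range[OF uvw(1)] conv_range[OF uvw(2)] conv_range[OF uvw(3)]
  have "(\<lambda>n. (u n \<oplus> v n) \<oplus> w n) = (\<lambda>n. u n \<oplus> (v n \<oplus> w n))"
    using cl by (auto simp: fun_eq_iff image_subset_iff a_assoc)
  then show "X \<oplus>\<^bsub>B\<^esub> Y \<oplus>\<^bsub>B\<^esub> Z = X \<oplus>\<^bsub>B\<^esub> (Y \<oplus>\<^bsub>B\<^esub> Z)"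
    using conv_add[OF conv_add[OF uvw(1,2)] uvw(3)] conv_add[OF uvw(1) conv_add[OF uvw(2,3)]]
    by (auto intro: conv_unique)
next
  fix X Y assume *: "X \<in> carrier B" "Y \<in> carrier B"
  then obtain u v where uv: "conv u X" "conv v Y" using conv_surj by metis
  note cl = conv_range[OF uv(1)] conv_range[OF uv(2)]
  show "X \<oplus>\<^bsub>B\<^esub> Y \<in> carrier B" using conv_add[OF uv] conv_carrier by blast
  have "(\<lambda>n. u n \<oplus> v n) = (\<lambda>n. v n \<oplus> u n)"
    using cl by (auto simp: fun_eq_iff image_subset_iff a_comm)
  then show "X \<oplus>\<^bsub>B\<^esub> Y = Y \<oplus>\<^bsub>B\<^esub> X"
    using conv_add[OF uv] conv_add[OF uv(2,1)] by (auto intro: conv_unique)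
next
  fix X assume *: "X \<in> carrier B"
  then obtain u where u: "conv u X" using conv_surj by metis
  have "(\<lambda>n. \<zero> \<oplus> u n) = u"
    using conv_range[OF u] by (auto simp: fun_eq_iff image_subset_iff)
  then show "\<zero>\<^bsub>B\<^esub> \<oplus>\<^bsub>B\<^esub> X = X"
    using conv_add[OF conv_zero u] u by (auto intro: conv_unique)
qed (use conv_zero conv_carrier in auto)

lemma completion_closed:
  assumes "X \<in> carrier B"
  shows "Y \<in> carrier B \<Longrightarrow> X \<oplus>\<^bsub>B\<^esub> Y \<in> carrier B"
    and "Y \<in> carrier B \<Longrightarrow> X \<otimes>\<^bsub>B\<^esub> Y \<in> carrier B"
    and "c \<odot>\<^bsub>B\<^esub> X \<in> carrier B" and "adj B X \<in> carrier B"
  using assms conv_surj conv_carrier conv_add conv_mult conv_smult conv_adj by meson+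

end

text \<open>The map sends the limit in B of a sequence to its limit in B'. By
  \<open>conv_eq\<close>, equality of limits means the same null condition in (A, p) on either side,
  which gives well-definedness and injectivity at once. The second conclusion records how the map is
  computed, so that its values on generators can be read off.\<close>

theorem completion_unique:
  assumes "completion A p B c" "completion A p B' c'"
  obtains f where "cstar_iso B B' f" "\<And>u X Y. \<lbrakk>c u X; c' u Y\<rbrakk> \<Longrightarrow> f X = Y"
proof -
  interpret B: completion A p B c by fact
  interpret B': completion A p B' c' by fact
  define f where "f X = (THE Y. \<exists>u. c u X \<and> c' u Y)" for X
  have f: "f X = Y" if "c u X" "c' u Y" for u X Y
    unfolding f_def
  proof (rule the_equality)
    fix Z assume "\<exists>v. c v X \<and> c' v Z"
    then obtain v where v: "c v X" "c' v Z" by blast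
    then have "B.null_diff v u" using B.conv_eq[OF v(1) that(1)] by simp
    then show "Z = Y" using B'.conv_eq[OF v(2) that(2)] by simp
  qed (use that in blast)
  have ex: "\<exists>u. c u X \<and> c' u (f X)" if "X \<in> carrier B" for X
  proof -
    obtain u where u: "c u X" using B.conv_surj \<open>X \<in> carrier B\<close> by blast
    obtain Y where "c' u Y" using B'.conv_total B.conv_Cauchy[OF u] by blast
    then show ?thesis using f[OF u] u by blast
  qed
  have inj: "inj_on f (carrier B)"
  proof (rule inj_onI)
    fix X Y assume "X \<in> carrier B" "Y \<in> carrier B" "f X = f Y"
    then obtain u v where "c u X" "c' u (f X)" "c v Y" "c' v (f X)" using ex by metis
    then show "X = Y" using B.conv_eq B'.conv_eq by blast
  qed
  have img: "f ` carrier B = carrier B'"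
  proof (intro equalityI subsetI)
    fix Y assume "Y \<in> f ` carrier B"
    then show "Y \<in> carrier B'" using ex B'.conv_carrier by blast
  next
    fix Y assume "Y \<in> carrier B'"
    then obtain u where u: "c' u Y" using B'.conv_surj by blast
    obtain X where X: "c u X" using B.conv_total B'.conv_Cauchy[OF u] by blast
    then show "Y \<in> f ` carrier B" using f[OF X u] B.conv_carrier by blast
  qed
  have "cstar_iso B B' f"
    unfolding cstar_iso_def bij_betw_def
  proof (intro conjI ballI allI inj img)
    fix X assume "X \<in> carrier B"
    then obtain u where u: "c u X" "c' u (f X)" using ex by blast
    show "f (k \<odot>\<^bsub>B\<^esub> X) = k \<odot>\<^bsub>B'\<^esub> f X" for k
      using f[OF B.conv_smult[OF u(1)] B'.conv_smult[OF u(2)]] .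
    show "f (adj B X) = adj B' (f X)"
      using f[OF B.conv_adj[OF u(1)] B'.conv_adj[OF u(2)]] .
    show "nrm B' (f X) = nrm B X"
      using B.conv_nrm[OF u(1)] B'.conv_nrm[OF u(2)] LIMSEQ_unique by blast
    fix Y assume "Y \<in> carrier B"
    then obtain v where v: "c v Y" "c' v (f Y)" using ex by blast
    show "f (X \<oplus>\<^bsub>B\<^esub> Y) = f X \<oplus>\<^bsub>B'\<^esub> f Y"
      using f[OF B.conv_add[OF u(1) v(1)] B'.conv_add[OF u(2) v(2)]] .
    show "f (X \<otimes>\<^bsub>B\<^esub> Y) = f X \<otimes>\<^bsub>B'\<^esub> f Y"
      using f[OF B.conv_mult[OF u(1) v(1)] B'.conv_mult[OF u(2) v(2)]] .
  qed
  then show thesis using that f by blast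
qed

lemma completion_isomorphic:
  assumes "completion A p B c" "completion A p B' c'" shows "cstar_isomorphic B B'"
  unfolding cstar_isomorphic_def
  by (rule completion_unique[OF assms]) (rule exI)

definition star_hom ::
    "('a, 'm) star_algebra_scheme \<Rightarrow> ('b, 'n) star_algebra_scheme \<Rightarrow> ('a \<Rightarrow> 'b) \<Rightarrow> bool" where
  "star_hom A B h \<longleftrightarrow> h \<in> carrier A \<rightarrow> carrier B \<and>
     (\<forall>x\<in>carrier A. \<forall>y\<in>carrier A. h (x \<oplus>\<^bsub>A\<^esub> y) = h x \<oplus>\<^bsub>B\<^esub> h y \<and> h (x \<otimes>\<^bsub>A\<^esub> y) = h x \<otimes>\<^bsub>B\<^esub> h y) \<and>
     (\<forall>x\<in>carrier A. (\<forall>c. h (c \<odot>\<^bsub>A\<^esub> x) = c \<odot>\<^bsub>B\<^esub> h x) \<and> h (adj A x) = adj B (h x))"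

locale star_hom_alg = A: star_alg A + B: star_alg B
  for A :: "('a, 'm) star_algebra_scheme" and B :: "('b, 'n) star_algebra_scheme" +
  fixes h :: "'a \<Rightarrow> 'b"
  assumes star_hom: "star_hom A B h"
begin

lemma hom_closed: "x \<in> carrier A \<Longrightarrow> h x \<in> carrier B"
  and hom_add: "\<lbrakk>x \<in> carrier A; y \<in> carrier A\<rbrakk> \<Longrightarrow> h (x \<oplus>\<^bsub>A\<^esub> y) = h x \<oplus>\<^bsub>B\<^esub> h y"
  and hom_mult: "\<lbrakk>x \<in> carrier A; y \<in> carrier A\<rbrakk> \<Longrightarrow> h (x \<otimes>\<^bsub>A\<^esub> y) = h x \<otimes>\<^bsub>B\<^esub> h y"
  and hom_smult: "x \<in> carrier A \<Longrightarrow> h (c \<odot>\<^bsub>A\<^esub> x) = c \<odot>\<^bsub>B\<^esub> h x"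
  and hom_adj: "x \<in> carrier A \<Longrightarrow> h (adj A x) = adj B (h x)"
  using star_hom unfolding star_hom_def by blast+

lemma hom_minus: "x \<in> carrier A \<Longrightarrow> h (\<ominus>\<^bsub>A\<^esub> x) = \<ominus>\<^bsub>B\<^esub> h x"
  by (simp add: A.minus_smult B.minus_smult hom_smult hom_closed)

lemma hom_diff: "\<lbrakk>x \<in> carrier A; y \<in> carrier A\<rbrakk> \<Longrightarrow> h (x \<ominus>\<^bsub>A\<^esub> y) = h x \<ominus>\<^bsub>B\<^esub> h y"
  by (simp add: a_minus_def hom_add hom_minus A.smult_closed)

lemma hom_zero: "h \<zero>\<^bsub>A\<^esub> = \<zero>\<^bsub>B\<^esub>"
  by (metis A.zero_closed A.zero_smult B.zero_smult hom_closed hom_smult)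

lemma cstar_seminorm_pullback: "cstar_seminorm B p \<Longrightarrow> cstar_seminorm A (\<lambda>x. p (h x))"
  unfolding cstar_seminorm_def
  by (simp add: hom_closed hom_add hom_mult hom_smult hom_adj A.adj_closed)

end

text \<open>A *-algebra with dense image in B, carrying the pulled back seminorm, has the same
  completion as B: a sequence of B approaching X is replaced by one in the image of h whose n-th
  term is within 1/(n+1) of it. The kernel of h is harmless because p vanishes on it.\<close>

theorem completion_pullback:
  assumes "completion B q C conv" and "star_hom_alg A B h"
    and dense: "\<And>b e. \<lbrakk>b \<in> carrier B; e > 0\<rbrakk> \<Longrightarrow> \<exists>x\<in>carrier A. q (b \<ominus>\<^bsub>B\<^esub> h x) < e"
    and p: "\<And>x. x \<in> carrier A \<Longrightarrow> p x = q (h x)"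
  shows "completion A p C (\<lambda>u X. range u \<subseteq> carrier A \<and> conv (h \<circ> u) X)"
proof -
  interpret C: completion B q C conv by fact
  interpret h: star_hom_alg A B h by fact
  interpret p: star_seminorm A p
    by unfold_locales
      (simp_all add: p h.hom_closed h.hom_add h.hom_mult h.hom_smult h.hom_adj C.nonneg C.triangle
        C.submult C.homogeneous C.isometric_adj h.A.m_closed h.A.smult_closed h.A.adj_closed)
  have p_diff: "p (x \<ominus>\<^bsub>A\<^esub> y) = q (h x \<ominus>\<^bsub>B\<^esub> h y)" if "x \<in> carrier A" "y \<in> carrier A" for x y
    using that by (simp add: p h.hom_diff h.A.diff_closed)
  have Cauchy: "p.Cauchy_seq u \<longleftrightarrow> range u \<subseteq> carrier A \<and> C.Cauchy_seq (h \<circ> u)" for u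
    by (auto simp: p.Cauchy_seq_def C.Cauchy_seq_def p_diff h.hom_closed image_subset_iff)
  have null: "p.null_diff u v \<longleftrightarrow> C.null_diff (h \<circ> u) (h \<circ> v)"
    if "range u \<subseteq> carrier A" "range v \<subseteq> carrier A" for u v
    using that by (simp add: p.null_diff_def C.null_diff_def p_diff image_subset_iff)
  show ?thesis
  proof unfold_locales
    fix X assume "X \<in> carrier C"
    then obtain w where w: "conv w X" using C.conv_surj by blast
    then have wcl: "w n \<in> carrier B" for n using C.conv_range by blast
    have "\<exists>x\<in>carrier A. q (w n \<ominus>\<^bsub>B\<^esub> h x) < 1 / real (Suc n)" for n
      using dense[OF wcl, of "1 / real (Suc n)"] by simp
    then obtain u where u: "\<And>n. u n \<in> carrier A" "\<And>n. q (w n \<ominus>\<^bsub>B\<^esub> h (u n)) < 1 / real (Suc n)"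
      by metis
    have null: "C.null_diff w (h \<circ> u)"
      by (rule C.null_diffI[OF _ _ LIMSEQ_inverse_real_of_nat])
        (use u wcl h.hom_closed in \<open>auto simp: image_subset_iff inverse_eq_divide intro!: less_imp_le\<close>)
    then have "C.Cauchy_seq (h \<circ> u)"
      using C.null_diff_Cauchy[OF C.conv_Cauchy[OF w] null] u h.hom_closed by auto
    then obtain Y where Y: "conv (h \<circ> u) Y" using C.conv_total by blast
    then have "X = Y" using C.conv_eq[OF w Y] null by simp
    then show "\<exists>u. range u \<subseteq> carrier A \<and> conv (h \<circ> u) X" using Y u by auto
  next
    fix u assume "p.Cauchy_seq u"
    then show "\<exists>X. range u \<subseteq> carrier A \<and> conv (h \<circ> u) X"
      using Cauchy C.conv_total by blast
  next
    fix u X assume "range u \<subseteq> carrier A \<and> conv (h \<circ> u) X"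
    then show "p.Cauchy_seq u" using Cauchy C.conv_Cauchy by blast
  next
    fix u X v Y assume *: "range u \<subseteq> carrier A \<and> conv (h \<circ> u) X" "range v \<subseteq> carrier A \<and> conv (h \<circ> v) Y"
    then show "(X = Y) = p.null_diff u v" using null C.conv_eq by blast
    have "h \<circ> (\<lambda>n. u n \<oplus>\<^bsub>A\<^esub> v n) = (\<lambda>n. (h \<circ> u) n \<oplus>\<^bsub>B\<^esub> (h \<circ> v) n)"
      "h \<circ> (\<lambda>n. u n \<otimes>\<^bsub>A\<^esub> v n) = (\<lambda>n. (h \<circ> u) n \<otimes>\<^bsub>B\<^esub> (h \<circ> v) n)"
      using * by (auto simp: fun_eq_iff image_subset_iff h.hom_add h.hom_mult)
    then show "range (\<lambda>n. u n \<oplus>\<^bsub>A\<^esub> v n) \<subseteq> carrier A \<and> conv (h \<circ> (\<lambda>n. u n \<oplus>\<^bsub>A\<^esub> v n)) (X \<oplus>\<^bsub>C\<^esub> Y)"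
      "range (\<lambda>n. u n \<otimes>\<^bsub>A\<^esub> v n) \<subseteq> carrier A \<and> conv (h \<circ> (\<lambda>n. u n \<otimes>\<^bsub>A\<^esub> v n)) (X \<otimes>\<^bsub>C\<^esub> Y)"
      using * C.conv_add[of "h \<circ> u" X "h \<circ> v" Y] C.conv_mult[of "h \<circ> u" X "h \<circ> v" Y]
      by (auto simp: image_subset_iff h.A.m_closed)
  next
    fix u X assume *: "range u \<subseteq> carrier A \<and> conv (h \<circ> u) X"
    then show "X \<in> carrier C" using C.conv_carrier by blast
    have "h \<circ> (\<lambda>n. adj A (u n)) = (\<lambda>n. adj B ((h \<circ> u) n))"
      "h \<circ> (\<lambda>n. c \<odot>\<^bsub>A\<^esub> u n) = (\<lambda>n. c \<odot>\<^bsub>B\<^esub> (h \<circ> u) n)" for c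
      using * by (auto simp: fun_eq_iff image_subset_iff h.hom_adj h.hom_smult)
    then show "range (\<lambda>n. adj A (u n)) \<subseteq> carrier A \<and> conv (h \<circ> (\<lambda>n. adj A (u n))) (adj C X)"
      "range (\<lambda>n. c \<odot>\<^bsub>A\<^esub> u n) \<subseteq> carrier A \<and> conv (h \<circ> (\<lambda>n. c \<odot>\<^bsub>A\<^esub> u n)) (c \<odot>\<^bsub>C\<^esub> X)" for c
      using * C.conv_adj[of "h \<circ> u" X] C.conv_smult[of "h \<circ> u" X] by (auto simp: image_subset_iff h.A.adj_closed h.A.smult_closed)
    have "(\<lambda>n. p (u n)) = (\<lambda>n. q ((h \<circ> u) n))"
      using * by (auto simp: fun_eq_iff image_subset_iff p)
    then show "(\<lambda>n. p (u n)) \<longlonglongrightarrow> nrm C X"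
      using * C.conv_nrm[of "h \<circ> u" X] by metis
  next
    show "range (\<lambda>_. \<zero>\<^bsub>A\<^esub>) \<subseteq> carrier A \<and> conv (h \<circ> (\<lambda>_. \<zero>\<^bsub>A\<^esub>)) \<zero>\<^bsub>C\<^esub>"
      using C.conv_zero by (auto simp: h.hom_zero o_def)
  qed
qed


section \<open>Enveloping \<open>C\<^sup>*\<close>-algebras\<close>

text \<open>\<open>envelope\<close>, \<open>cstar_quotient\<close> and
  \<open>universal_group\<close> define operations as unions over all representatives; this
  collapses such a union once every representative yields the same class.\<close>

lemma UN_eqI: "\<lbrakk>x \<in> X; \<And>x. x \<in> X \<Longrightarrow> F x = Y\<rbrakk> \<Longrightarrow> (\<Union>x\<in>X. F x) = Y"
  by blast

text \<open>Boundedness at each element is what turns the \<open>Sup\<close> in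
  \<open>env_norm\<close> into a genuine supremum of real numbers.\<close>

locale bounded_star_alg = star_alg A for A :: "('a, 'm) star_algebra_scheme" (structure) +
  assumes bounded: "x \<in> carrier A \<Longrightarrow> \<exists>M. \<forall>p. cstar_seminorm A p \<longrightarrow> p x \<le> M"
begin

lemma le_env_norm:
  assumes "cstar_seminorm A p" "x \<in> carrier A" shows "p x \<le> env_norm A x"
  unfolding env_norm_def
proof (rule cSup_upper)
  show "bdd_above {p x |p. cstar_seminorm A p}"
    using bounded[OF assms(2)] by (auto simp: bdd_above_def)
qed (use assms in blast)

text \<open>Keeps the set under the supremum nonempty, and gives nonnegativity of
  \<open>env_norm\<close>.\<close>

lemma cstar_seminorm_zero: "cstar_seminorm A (\<lambda>_. 0)"
  by (simp add: cstar_seminorm_def)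

lemma env_norm_le:
  assumes "\<And>p. cstar_seminorm A p \<Longrightarrow> p x \<le> M" shows "env_norm A x \<le> M"
  unfolding env_norm_def
  by (rule cSup_least) (use assms cstar_seminorm_zero in blast)+

text \<open>Inequalities pass to suprema directly. The two equalities also need the reverse
  estimates, which are obtained by dividing by \<open>cmod c\<close> and by taking square roots
  before the supremum is formed.\<close>

lemma cstar_seminorm_env_norm: "cstar_seminorm A (env_norm A)"
  unfolding cstar_seminorm_def
proof (intro conjI ballI allI)
  fix x assume x: "x \<in> carrier A"
  show nn: "0 \<le> env_norm A x" using le_env_norm[OF cstar_seminorm_zero x] .
  have le: "env_norm A (c \<odot> x) \<le> cmod c * env_norm A x" if "x \<in> carrier A" for c x
  proof (rule env_norm_le)
    fix p assume p: "cstar_seminorm A p"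
    then have "p (c \<odot> x) = cmod c * p x" using that by (simp add: cstar_seminorm_def)
    also have "\<dots> \<le> cmod c * env_norm A x" using le_env_norm[OF p that] by (simp add: mult_left_mono)
    finally show "p (c \<odot> x) \<le> cmod c * env_norm A x" .
  qed
  show "env_norm A (c \<odot> x) = cmod c * env_norm A x" for c
  proof (rule antisym[OF le[OF x]])
    show "cmod c * env_norm A x \<le> env_norm A (c \<odot> x)"
    proof (cases "c = 0")
      case True then show ?thesis using le_env_norm[OF cstar_seminorm_zero] smult_closed[OF x] by simp
    next
      case False
      have "p x \<le> env_norm A (c \<odot> x) / cmod c" if p: "cstar_seminorm A p" for p
      proof -
        have "cmod c * p x = p (c \<odot> x)" using that x by (simp add: cstar_seminorm_def)
        also have "\<dots> \<le> env_norm A (c \<odot> x)" using le_env_norm[OF p smult_closed[OF x]] .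
        finally show ?thesis using False by (simp add: field_simps)
      qed
      then have "env_norm A x \<le> env_norm A (c \<odot> x) / cmod c" by (rule env_norm_le)
      then show ?thesis using False by (simp add: field_simps)
    qed
  qed
  show "env_norm A (adj A x \<otimes> x) = (env_norm A x)\<^sup>2"
  proof (rule antisym)
    show "env_norm A (adj A x \<otimes> x) \<le> (env_norm A x)\<^sup>2"
    proof (rule env_norm_le)
      fix p assume p: "cstar_seminorm A p"
      then have "p (adj A x \<otimes> x) = (p x)\<^sup>2" using x by (simp add: cstar_seminorm_def)
      also have "\<dots> \<le> (env_norm A x)\<^sup>2"
        using le_env_norm[OF p x] p x by (intro power_mono) (auto simp: cstar_seminorm_def)
      finally show "p (adj A x \<otimes> x) \<le> (env_norm A x)\<^sup>2" .
    qed
    have "p x \<le> sqrt (env_norm A (adj A x \<otimes> x))" if p: "cstar_seminorm A p" for p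
    proof (rule real_le_rsqrt)
      have "(p x)\<^sup>2 = p (adj A x \<otimes> x)" using p x by (simp add: cstar_seminorm_def)
      also have "\<dots> \<le> env_norm A (adj A x \<otimes> x)" using le_env_norm[OF p] m_closed adj_closed x by simp
      finally show "(p x)\<^sup>2 \<le> env_norm A (adj A x \<otimes> x)" .
    qed
    then have "env_norm A x \<le> sqrt (env_norm A (adj A x \<otimes> x))" by (rule env_norm_le)
    then have "(env_norm A x)\<^sup>2 \<le> (sqrt (env_norm A (adj A x \<otimes> x)))\<^sup>2" using nn by (intro power_mono)
    then show "(env_norm A x)\<^sup>2 \<le> env_norm A (adj A x \<otimes> x)"
      using le_env_norm[OF cstar_seminorm_zero] m_closed adj_closed x by simp
  qed
  fix y assume y: "y \<in> carrier A"
  show "env_norm A (x \<oplus> y) \<le> env_norm A x + env_norm A y"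
  proof (rule env_norm_le)
    fix p assume p: "cstar_seminorm A p"
    then have "p (x \<oplus> y) \<le> p x + p y" using x y by (simp add: cstar_seminorm_def)
    then show "p (x \<oplus> y) \<le> env_norm A x + env_norm A y"
      using le_env_norm[OF p x] le_env_norm[OF p y] by linarith
  qed
  show "env_norm A (x \<otimes> y) \<le> env_norm A x * env_norm A y"
  proof (rule env_norm_le)
    fix p assume p: "cstar_seminorm A p"
    then have "p (x \<otimes> y) \<le> p x * p y" using x y by (simp add: cstar_seminorm_def)
    also have "\<dots> \<le> env_norm A x * env_norm A y"
      using le_env_norm[OF p x] le_env_norm[OF p y] p x y nn
      by (intro mult_mono) (auto simp: cstar_seminorm_def)
    finally show "p (x \<otimes> y) \<le> env_norm A x * env_norm A y" .
  qed
qed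

end

sublocale bounded_star_alg \<subseteq> env: cstar_seminorm_alg A "env_norm A"
  by unfold_locales (rule cstar_seminorm_env_norm)

section \<open>Operations of the envelope on classes of Cauchy sequences\<close>

context bounded_star_alg
begin

lemma env_Cauchy_iff: "u \<in> env_Cauchy A \<longleftrightarrow> env.Cauchy_seq u"
  by (simp add: env_Cauchy_def env.Cauchy_seq_def)

lemma env_rel_iff: "(u, v) \<in> env_rel A \<longleftrightarrow> env.Cauchy_seq u \<and> env.Cauchy_seq v \<and> env.null_diff u v"
  by (simp add: env_rel_def env_Cauchy_iff env.null_diff_def)

lemma mem_env_class: "v \<in> env_class A u \<longleftrightarrow> env.Cauchy_seq u \<and> env.Cauchy_seq v \<and> env.null_diff u v"
  by (simp add: env_class_def env_rel_iff)

lemma env_class_eq_iff: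
  assumes "env.Cauchy_seq u" "env.Cauchy_seq v"
  shows "env_class A u = env_class A v \<longleftrightarrow> env.null_diff u v"
proof
  have "v \<in> env_class A v" using assms by (simp add: mem_env_class env.null_diff_refl env.Cauchy_seq_def)
  then show "env.null_diff u v" if "env_class A u = env_class A v" using that mem_env_class by blast
  assume uv: "env.null_diff u v"
  show "env_class A u = env_class A v"
    by (intro Set.set_eqI)
      (metis (no_types) uv assms mem_env_class env.Cauchy_seq_def env.null_diff_trans env.null_diff_sym)
qed

lemma env_carrier: "carrier (envelope A) = {env_class A u |u. env.Cauchy_seq u}"
  by (auto simp: envelope_def quotient_def env_class_def env_Cauchy_iff)

lemma env_class_self: "env.Cauchy_seq u \<Longrightarrow> u \<in> env_class A u"
  by (simp add: mem_env_class env.null_diff_refl env.Cauchy_seq_def)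

lemma env_class_congI: "\<lbrakk>env.Cauchy_seq u; env.Cauchy_seq v; env.null_diff u v\<rbrakk> \<Longrightarrow> env_class A v = env_class A u"
  using env_class_eq_iff[of u v] by simp

lemma env_add:
  assumes "env.Cauchy_seq u" "env.Cauchy_seq v"
  shows "env_class A u \<oplus>\<^bsub>envelope A\<^esub> env_class A v = env_class A (\<lambda>n. u n \<oplus> v n)"
proof -
  have "env_class A (\<lambda>n. u' n \<oplus> v' n) = env_class A (\<lambda>n. u n \<oplus> v n)"
    if "u' \<in> env_class A u" "v' \<in> env_class A v" for u' v'
    using that by (intro env_class_congI env.Cauchy_seq_add env.null_diff_add)
      (auto simp: mem_env_class env.Cauchy_seq_def)
  note * = UN_eqI[OF env_class_self[OF assms(1)] UN_eqI[OF env_class_self[OF assms(2)] this]]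
  show ?thesis unfolding envelope_def by (simp, rule *)
qed

lemma env_mult:
  assumes "env.Cauchy_seq u" "env.Cauchy_seq v"
  shows "env_class A u \<otimes>\<^bsub>envelope A\<^esub> env_class A v = env_class A (\<lambda>n. u n \<otimes> v n)"
proof -
  have "env_class A (\<lambda>n. u' n \<otimes> v' n) = env_class A (\<lambda>n. u n \<otimes> v n)"
    if "u' \<in> env_class A u" "v' \<in> env_class A v" for u' v'
    using that by (intro env_class_congI env.Cauchy_seq_mult env.null_diff_mult)
      (auto simp: mem_env_class env.Cauchy_seq_def)
  note * = UN_eqI[OF env_class_self[OF assms(1)] UN_eqI[OF env_class_self[OF assms(2)] this]]
  show ?thesis unfolding envelope_def by (simp, rule *)
qed

lemma env_smult:
  assumes "env.Cauchy_seq u"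
  shows "c \<odot>\<^bsub>envelope A\<^esub> env_class A u = env_class A (\<lambda>n. c \<odot> u n)"
proof -
  have "env_class A (\<lambda>n. c \<odot> u' n) = env_class A (\<lambda>n. c \<odot> u n)" if "u' \<in> env_class A u" for u'
    using that by (intro env_class_congI env.Cauchy_seq_smult env.null_diff_smult)
      (auto simp: mem_env_class env.Cauchy_seq_def)
  note * = UN_eqI[OF env_class_self[OF assms(1)] this]
  show ?thesis unfolding envelope_def by (simp, rule *)
qed

lemma env_adj:
  assumes "env.Cauchy_seq u"
  shows "adj (envelope A) (env_class A u) = env_class A (\<lambda>n. adj A (u n))"
proof -
  have "env_class A (\<lambda>n. adj A (u' n)) = env_class A (\<lambda>n. adj A (u n))" if "u' \<in> env_class A u" for u'
    using that by (intro env_class_congI env.Cauchy_seq_adj env.null_diff_adj)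
      (auto simp: mem_env_class env.Cauchy_seq_def)
  note * = UN_eqI[OF env_class_self[OF assms(1)] this]
  show ?thesis unfolding envelope_def by (simp, rule *)
qed

lemma env_nrm:
  assumes "env.Cauchy_seq u"
  shows "(\<lambda>n. env_norm A (u n)) \<longlonglongrightarrow> nrm (envelope A) (env_class A u)"
proof -
  obtain r where r: "(\<lambda>n. env_norm A (u n)) \<longlonglongrightarrow> r"
    using env.Cauchy_seq_norm[OF assms] real_Cauchy_convergent by (auto simp: convergent_def)
  have "(THE r. \<exists>u\<in>env_class A u. (\<lambda>n. env_norm A (u n)) \<longlonglongrightarrow> r) = r"
  proof (rule the_equality)
    show "\<exists>u\<in>env_class A u. (\<lambda>n. env_norm A (u n)) \<longlonglongrightarrow> r" using r env_class_self[OF assms] by blast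
    fix s assume "\<exists>v\<in>env_class A u. (\<lambda>n. env_norm A (v n)) \<longlonglongrightarrow> s"
    then obtain v where v: "v \<in> env_class A u" "(\<lambda>n. env_norm A (v n)) \<longlonglongrightarrow> s" by blast
    then have "(\<lambda>n. env_norm A (v n)) \<longlonglongrightarrow> r"
      using env.null_diff_limit[OF _ _ _ r] by (auto simp: mem_env_class env.Cauchy_seq_def)
    then show "s = r" using v(2) LIMSEQ_unique by blast
  qed
  then show ?thesis using r by (simp add: envelope_def)
qed

definition env_conv :: "(nat \<Rightarrow> 'a) \<Rightarrow> (nat \<Rightarrow> 'a) set \<Rightarrow> bool" where
  "env_conv u X \<longleftrightarrow> env.Cauchy_seq u \<and> X = env_class A u"

end

sublocale bounded_star_alg \<subseteq> env: completion A "env_norm A" "envelope A" env_conv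
proof unfold_locales
  show "env_conv (\<lambda>_. \<zero>) \<zero>\<^bsub>envelope A\<^esub>"
    by (simp add: env_conv_def envelope_def env_embed_def env.Cauchy_seq_const)
qed (auto simp: env_conv_def env_carrier env_class_eq_iff env_add env_mult env_smult env_adj env_nrm
    env.Cauchy_seq_add env.Cauchy_seq_mult env.Cauchy_seq_smult env.Cauchy_seq_adj)

text \<open>The value at b is the limit of p along any sequence u for which h(u n) tends to b in L.
  Since p is at most L along h, these values form a Cauchy sequence and the limit does not depend on
  u; in particular p descends to the image of h. The axioms of a C*-seminorm are closed conditions,
  so they survive the limit.\<close>

theorem cstar_seminorm_extension:
  assumes "star_seminorm B L" and "star_hom_alg A B h"
    and dense: "\<And>b e. \<lbrakk>b \<in> carrier B; e > 0\<rbrakk> \<Longrightarrow> \<exists>x\<in>carrier A. L (b \<ominus>\<^bsub>B\<^esub> h x) < e"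
    and p: "cstar_seminorm A p" and le: "\<And>x. x \<in> carrier A \<Longrightarrow> p x \<le> L (h x)"
  shows "\<exists>q. cstar_seminorm B q \<and> (\<forall>x\<in>carrier A. q (h x) = p x)"
proof -
  interpret L: star_seminorm B L by fact
  interpret h: star_hom_alg A B h by fact
  interpret p: cstar_seminorm_alg A p by unfold_locales (rule p)
  define approx where "approx u b \<longleftrightarrow> range u \<subseteq> carrier A \<and> L.null_diff (\<lambda>_. b) (h \<circ> u)" for u b
  have hcl: "range (h \<circ> u) \<subseteq> carrier B" if "range u \<subseteq> carrier A" for u
    using that h.hom_closed by auto
  have ex: "\<exists>u. approx u b" if b: "b \<in> carrier B" for b
  proof -
    have "\<exists>x\<in>carrier A. L (b \<ominus>\<^bsub>B\<^esub> h x) < 1 / real (Suc n)" for n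
      using dense[OF b, of "1 / real (Suc n)"] by simp
    then obtain u where u: "\<And>n. u n \<in> carrier A" "\<And>n. L (b \<ominus>\<^bsub>B\<^esub> h (u n)) < 1 / real (Suc n)"
      by metis
    have "L.null_diff (\<lambda>_. b) (h \<circ> u)"
      by (rule L.null_diffI[OF _ _ LIMSEQ_inverse_real_of_nat])
        (use u b h.hom_closed in \<open>auto simp: image_subset_iff inverse_eq_divide intro!: less_imp_le\<close>)
    then show ?thesis using u by (auto simp: approx_def)
  qed
  have Cauchy: "L.Cauchy_seq (h \<circ> u)" if "approx u b" "b \<in> carrier B" for u b
    using L.null_diff_Cauchy[OF L.Cauchy_seq_const] hcl that unfolding approx_def by blast
  have p_diff: "p (x \<ominus>\<^bsub>A\<^esub> y) \<le> L (h x \<ominus>\<^bsub>B\<^esub> h y)" if "x \<in> carrier A" "y \<in> carrier A" for x y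
    using le[of "x \<ominus>\<^bsub>A\<^esub> y"] that by (simp add: h.hom_diff h.A.diff_closed)
  have pCauchy: "p.Cauchy_seq u" if ap: "approx u b" "b \<in> carrier B" for u b
    unfolding p.Cauchy_seq_def
  proof (intro conjI allI impI)
    show ucl: "range u \<subseteq> carrier A" using ap by (simp add: approx_def)
    fix e :: real assume "e > 0"
    then obtain N where N: "\<forall>m\<ge>N. \<forall>n\<ge>N. L ((h \<circ> u) m \<ominus>\<^bsub>B\<^esub> (h \<circ> u) n) < e"
      using Cauchy[OF ap] unfolding L.Cauchy_seq_def by meson
    have "p (u m \<ominus>\<^bsub>A\<^esub> u n) < e" if "m \<ge> N" "n \<ge> N" for m n
      using N[rule_format, OF that] p_diff[of "u m" "u n"] ucl by (auto simp: image_subset_iff)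
    then show "\<exists>N. \<forall>m\<ge>N. \<forall>n\<ge>N. p (u m \<ominus>\<^bsub>A\<^esub> u n) < e" by blast
  qed
  \<comment> \<open>The chosen sequence is immaterial: the next fact shows that every approximating
    sequence of b gives the same limit.\<close>
  define q where "q b = lim (\<lambda>n. p ((SOME u. approx u b) n))" for b
  have q: "(\<lambda>n. p (u n)) \<longlonglongrightarrow> q b" if u: "approx u b" and b: "b \<in> carrier B" for u b
  proof -
    define v where "v = (SOME u. approx u b)"
    have v: "approx v b" unfolding v_def using ex[OF b] by (rule someI_ex)
    have lim: "(\<lambda>n. p (v n)) \<longlonglongrightarrow> q b"
      using p.Cauchy_seq_norm[OF pCauchy[OF v b]] real_Cauchy_convergent convergent_LIMSEQ_iff
      by (auto simp: q_def v_def)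
    have ucl: "range u \<subseteq> carrier A" and vcl: "range v \<subseteq> carrier A" using u v by (auto simp: approx_def)
    have "L.null_diff (h \<circ> v) (h \<circ> u)"
    proof (rule L.null_diff_trans[of _ "\<lambda>_. b"])
      show "L.null_diff (h \<circ> v) (\<lambda>_. b)"
        using v b hcl[OF vcl] by (intro L.null_diff_sym[of "\<lambda>_. b"]) (auto simp: approx_def)
      show "L.null_diff (\<lambda>_. b) (h \<circ> u)" using u by (simp add: approx_def)
    qed (use b hcl[OF ucl] hcl[OF vcl] in auto)
    then have "p.null_diff v u"
      using ucl vcl p_diff by (intro p.null_diffI[of v u "\<lambda>n. L ((h \<circ> v) n \<ominus>\<^bsub>B\<^esub> (h \<circ> u) n)"])
        (auto simp: L.null_diff_def image_subset_iff)
    then show ?thesis using p.null_diff_limit[OF _ vcl ucl lim] by blast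
  qed
  have qh: "q (h x) = p x" if x: "x \<in> carrier A" for x
  proof -
    have "approx (\<lambda>_. x) (h x)" using x h.hom_closed by (auto simp: approx_def o_def intro: L.null_diff_refl)
    then show ?thesis using q[of "\<lambda>_. x" "h x"] x h.hom_closed LIMSEQ_unique[OF _ tendsto_const] by blast
  qed
  have "cstar_seminorm B q"
    unfolding cstar_seminorm_def
  proof (intro conjI ballI allI)
    fix a assume a: "a \<in> carrier B"
    then obtain u where u: "approx u a" using ex by blast
    then have ucl: "u n \<in> carrier A" for n by (auto simp: approx_def)
    note qa = q[OF u a]
    have o: "h \<circ> (\<lambda>n. c \<odot>\<^bsub>A\<^esub> u n) = (\<lambda>n. c \<odot>\<^bsub>B\<^esub> (h \<circ> u) n)" "h \<circ> (\<lambda>n. adj A (u n)) = (\<lambda>n. adj B ((h \<circ> u) n))" for c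
      using ucl by (auto simp: h.hom_smult h.hom_adj)
    show "0 \<le> q a" using LIMSEQ_le_const[OF qa] p.nonneg ucl by blast
    have "approx (\<lambda>n. c \<odot>\<^bsub>A\<^esub> u n) (c \<odot>\<^bsub>B\<^esub> a)" for c
      using u a L.null_diff_smult[of "\<lambda>_. a" "h \<circ> u" c] h.hom_closed
      unfolding approx_def o by (auto simp: image_subset_iff h.A.smult_closed)
    then have "(\<lambda>n. p (c \<odot>\<^bsub>A\<^esub> u n)) \<longlonglongrightarrow> q (c \<odot>\<^bsub>B\<^esub> a)" for c
      using q L.smult_closed[OF a] by blast
    moreover have "(\<lambda>n. p (c \<odot>\<^bsub>A\<^esub> u n)) \<longlonglongrightarrow> cmod c * q a" for c
      using ucl qa by (auto simp: p.homogeneous intro: tendsto_mult_left)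
    ultimately show "q (c \<odot>\<^bsub>B\<^esub> a) = cmod c * q a" for c
      using LIMSEQ_unique by blast
    have prod: "approx (\<lambda>n. u n \<otimes>\<^bsub>A\<^esub> v n) (a \<otimes>\<^bsub>B\<^esub> b)"
      if "approx u a" "approx v b" "a \<in> carrier B" "b \<in> carrier B" for u v a b
    proof -
      have uv: "u n \<in> carrier A" "v n \<in> carrier A" for n using that by (auto simp: approx_def)
      then have o: "h \<circ> (\<lambda>n. u n \<otimes>\<^bsub>A\<^esub> v n) = (\<lambda>n. (h \<circ> u) n \<otimes>\<^bsub>B\<^esub> (h \<circ> v) n)" by (auto simp: h.hom_mult)
      show ?thesis
        using that L.null_diff_mult[of "\<lambda>_. a" "h \<circ> u" "\<lambda>_. b" "h \<circ> v"] Cauchy[of v b] h.hom_closed uv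
          L.Cauchy_seq_const[of a]
        unfolding approx_def o by (auto simp: image_subset_iff h.A.m_closed)
    qed
    have "approx (\<lambda>n. adj A (u n)) (adj B a)"
      using u a L.null_diff_adj[of "\<lambda>_. a" "h \<circ> u"] h.hom_closed
      unfolding approx_def o by (auto simp: image_subset_iff h.A.adj_closed)
    then have "approx (\<lambda>n. adj A (u n) \<otimes>\<^bsub>A\<^esub> u n) (adj B a \<otimes>\<^bsub>B\<^esub> a)"
      using prod u a L.adj_closed by blast
    then have "(\<lambda>n. p (adj A (u n) \<otimes>\<^bsub>A\<^esub> u n)) \<longlonglongrightarrow> q (adj B a \<otimes>\<^bsub>B\<^esub> a)"
      using q L.m_closed L.adj_closed a by blast
    moreover have "(\<lambda>n. p (adj A (u n) \<otimes>\<^bsub>A\<^esub> u n)) \<longlonglongrightarrow> (q a)\<^sup>2"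
      using tendsto_power[OF qa, of 2] ucl by (simp add: p.cstar_identity)
    ultimately show "q (adj B a \<otimes>\<^bsub>B\<^esub> a) = (q a)\<^sup>2" using LIMSEQ_unique by blast
    fix b assume b: "b \<in> carrier B"
    then obtain v where v: "approx v b" using ex by blast
    then have vcl: "v n \<in> carrier A" for n by (auto simp: approx_def)
    note qb = q[OF v b]
    have "h \<circ> (\<lambda>n. u n \<oplus>\<^bsub>A\<^esub> v n) = (\<lambda>n. (h \<circ> u) n \<oplus>\<^bsub>B\<^esub> (h \<circ> v) n)" using ucl vcl by (auto simp: h.hom_add)
    then have "approx (\<lambda>n. u n \<oplus>\<^bsub>A\<^esub> v n) (a \<oplus>\<^bsub>B\<^esub> b)"
      using u v a b L.null_diff_add[of "\<lambda>_. a" "h \<circ> u" "\<lambda>_. b" "h \<circ> v"] h.hom_closed ucl vcl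
      unfolding approx_def by (auto simp: image_subset_iff)
    then have "(\<lambda>n. p (u n \<oplus>\<^bsub>A\<^esub> v n)) \<longlonglongrightarrow> q (a \<oplus>\<^bsub>B\<^esub> b)"
      using q a b by blast
    then show "q (a \<oplus>\<^bsub>B\<^esub> b) \<le> q a + q b"
      using LIMSEQ_le[OF _ tendsto_add[OF qa qb]] p.triangle ucl vcl by blast
    have "(\<lambda>n. p (u n \<otimes>\<^bsub>A\<^esub> v n)) \<longlonglongrightarrow> q (a \<otimes>\<^bsub>B\<^esub> b)"
      using q[OF prod[OF u v a b]] a b L.m_closed by blast
    then show "q (a \<otimes>\<^bsub>B\<^esub> b) \<le> q a * q b"
      using LIMSEQ_le[OF _ tendsto_mult[OF qa qb]] p.submult ucl vcl by blast
  qed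
  then show ?thesis using qh by blast
qed

section \<open>Inverse semigroups\<close>

context inverse_semigroup0
begin

abbreviation star :: "'s \<Rightarrow> 's" (\<open>_\<^sup>\<star>\<close> [1000] 1000) where "s\<^sup>\<star> \<equiv> sinv S s"

lemma sinv:
  assumes "s \<in> carrier S"
  shows "s\<^sup>\<star> \<in> carrier S" and "s \<cdot> s\<^sup>\<star> \<cdot> s = s" and "s\<^sup>\<star> \<cdot> s \<cdot> s\<^sup>\<star> = s\<^sup>\<star>"
  using theI'[OF inverse[OF assms]] unfolding sinv_def by auto

lemma sinv_unique:
  assumes "s \<in> carrier S" "t \<in> carrier S" "s \<cdot> t \<cdot> s = s" "t \<cdot> s \<cdot> t = t"
  shows "s\<^sup>\<star> = t"
  using inverse[OF assms(1)] assms sinv[OF assms(1)] by metis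

lemma sinv_sinv: "s \<in> carrier S \<Longrightarrow> s\<^sup>\<star>\<^sup>\<star> = s"
  using sinv sinv_unique by metis

lemma sinv_mult_cancel:
  assumes "s \<in> carrier S"
  shows "s \<cdot> (s\<^sup>\<star> \<cdot> s) = s" and "s\<^sup>\<star> \<cdot> (s \<cdot> s\<^sup>\<star>) = s\<^sup>\<star>"
    and "t \<in> carrier S \<Longrightarrow> s \<cdot> (s\<^sup>\<star> \<cdot> (s \<cdot> t)) = s \<cdot> t"
    and "t \<in> carrier S \<Longrightarrow> s\<^sup>\<star> \<cdot> (s \<cdot> (s\<^sup>\<star> \<cdot> t)) = s\<^sup>\<star> \<cdot> t"
  using sinv[OF assms] assms by (metis assoc closed)+

lemma idem_closed: "e \<in> idem S \<Longrightarrow> e \<in> carrier S"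
  and idem_idem: "e \<in> idem S \<Longrightarrow> e \<cdot> e = e"
  by (auto simp: idem_def)

lemma sinv_idem: "e \<in> idem S \<Longrightarrow> e\<^sup>\<star> = e"
  by (rule sinv_unique) (auto simp: idem_def)

lemma zero_idem: "szero S \<in> idem S"
  by (simp add: idem_def zero_closed zero_mult)

lemma sinv_zero: "(szero S)\<^sup>\<star> = szero S"
  by (rule sinv_idem) (rule zero_idem)

text \<open>For the inverse x of e f, the element f x e is an inverse of e f as well, so x = f x e
  by uniqueness. From this form x is idempotent, hence its own inverse, and so is e f, which is the
  inverse of x.\<close>

lemma idem_mult_idem:
  assumes "e \<in> idem S" "f \<in> idem S" shows "e \<cdot> f \<in> idem S"
proof -
  note c = idem_closed[OF assms(1)] idem_closed[OF assms(2)]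
  define x where "x = (e \<cdot> f)\<^sup>\<star>"
  have xc: "x \<in> carrier S" and x1: "e \<cdot> f \<cdot> x \<cdot> (e \<cdot> f) = e \<cdot> f" and x2: "x \<cdot> (e \<cdot> f) \<cdot> x = x"
    using sinv[of "e \<cdot> f"] c closed by (auto simp: x_def)
  have ee: "e \<cdot> (e \<cdot> y) = e \<cdot> y" "f \<cdot> (f \<cdot> y) = f \<cdot> y" if "y \<in> carrier S" for y
    using that c assms idem_idem by (metis assoc)+
  have x1': "e \<cdot> (f \<cdot> (x \<cdot> (e \<cdot> f))) = e \<cdot> f" and x2': "x \<cdot> (e \<cdot> (f \<cdot> x)) = x"
    using x1 x2 c xc by (simp_all add: assoc closed)
  have x2'': "x \<cdot> (e \<cdot> (f \<cdot> (x \<cdot> y))) = x \<cdot> y" if "y \<in> carrier S" for y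
  proof -
    have "x \<cdot> (e \<cdot> (f \<cdot> (x \<cdot> y))) = (x \<cdot> (e \<cdot> (f \<cdot> x))) \<cdot> y" using that c xc by (simp add: assoc closed)
    then show ?thesis by (simp add: x2')
  qed
  have "x = f \<cdot> x \<cdot> e"
    unfolding x_def
  proof (rule sinv_unique, unfold x_def[symmetric])
    show "e \<cdot> f \<cdot> (f \<cdot> x \<cdot> e) \<cdot> (e \<cdot> f) = e \<cdot> f"
      using c xc by (simp add: assoc closed ee x1')
    show "f \<cdot> x \<cdot> e \<cdot> (e \<cdot> f) \<cdot> (f \<cdot> x \<cdot> e) = f \<cdot> x \<cdot> e"
      using c xc by (simp add: assoc closed ee x2'')
  qed (use c xc closed in auto)
  then have "x \<cdot> x = (f \<cdot> x \<cdot> e) \<cdot> (f \<cdot> x \<cdot> e)" by simp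
  also have "\<dots> = f \<cdot> x \<cdot> e" using c xc by (simp add: assoc closed x2'')
  finally have "x \<in> idem S" using xc \<open>x = f \<cdot> x \<cdot> e\<close> by (simp add: idem_def)
  then have "x\<^sup>\<star> \<in> idem S" by (simp add: sinv_idem)
  then show ?thesis using sinv_sinv[of "e \<cdot> f"] c closed by (simp add: x_def)
qed

text \<open>Both e f and f e are inverses of the idempotent e f, and inverses are unique.\<close>

lemma idem_comm:
  assumes "e \<in> idem S" "f \<in> idem S" shows "e \<cdot> f = f \<cdot> e"
proof -
  note c = idem_closed[OF assms(1)] idem_closed[OF assms(2)]
  have ee: "e \<cdot> (e \<cdot> y) = e \<cdot> y" "f \<cdot> (f \<cdot> y) = f \<cdot> y" if "y \<in> carrier S" for y
    using that c assms idem_idem by (metis assoc)+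
  have ef: "e \<cdot> (f \<cdot> (e \<cdot> f)) = e \<cdot> f" and fe: "f \<cdot> (e \<cdot> (f \<cdot> e)) = f \<cdot> e"
    using idem_idem[OF idem_mult_idem[OF assms]] idem_idem[OF idem_mult_idem[OF assms(2,1)]] c
    by (simp_all add: assoc closed)
  have "(e \<cdot> f)\<^sup>\<star> = f \<cdot> e"
    by (rule sinv_unique) (use c in \<open>simp_all add: assoc closed ee ef fe\<close>)
  then show ?thesis using sinv_idem[OF idem_mult_idem[OF assms]] by simp
qed

lemma idem_left_comm:
  "\<lbrakk>e \<in> idem S; f \<in> idem S; s \<in> carrier S\<rbrakk> \<Longrightarrow> e \<cdot> (f \<cdot> s) = f \<cdot> (e \<cdot> s)"
  by (metis assoc idem_closed idem_comm)

lemma idem_left_idem: "\<lbrakk>e \<in> idem S; s \<in> carrier S\<rbrakk> \<Longrightarrow> e \<cdot> (e \<cdot> s) = e \<cdot> s"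
  by (metis assoc idem_closed idem_idem)

lemma dom_idem: "s \<in> carrier S \<Longrightarrow> s\<^sup>\<star> \<cdot> s \<in> idem S"
  and ran_idem: "s \<in> carrier S \<Longrightarrow> s \<cdot> s\<^sup>\<star> \<in> idem S"
  using sinv sinv_mult_cancel by (simp_all add: idem_def closed assoc)

lemma conj_idem:
  assumes "s \<in> carrier S" "e \<in> idem S" shows "s\<^sup>\<star> \<cdot> e \<cdot> s \<in> idem S"
proof -
  note c = assms(1) sinv(1)[OF assms(1)] idem_closed[OF assms(2)]
  have "s\<^sup>\<star> \<cdot> e \<cdot> s \<cdot> (s\<^sup>\<star> \<cdot> e \<cdot> s) = s\<^sup>\<star> \<cdot> (e \<cdot> ((s \<cdot> s\<^sup>\<star>) \<cdot> (e \<cdot> s)))"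
    using c by (simp add: assoc closed)
  also have "\<dots> = s\<^sup>\<star> \<cdot> ((s \<cdot> s\<^sup>\<star>) \<cdot> (e \<cdot> (e \<cdot> s)))"
    using idem_left_comm[OF assms(2) ran_idem[OF assms(1)], of "e \<cdot> s"] c by (simp add: closed)
  also have "\<dots> = s\<^sup>\<star> \<cdot> e \<cdot> s"
    using assms c by (simp add: idem_left_idem closed assoc sinv_mult_cancel)
  finally show ?thesis using c by (simp add: idem_def closed)
qed

text \<open>Both inverse equations reduce to commuting the inner idempotents
  \<open>s\<^sup>\<star> \<cdot> s\<close> and \<open>t \<cdot> t\<^sup>\<star>\<close> past each
  other.\<close>

lemma sinv_mult:
  assumes "s \<in> carrier S" "t \<in> carrier S" shows "(s \<cdot> t)\<^sup>\<star> = t\<^sup>\<star> \<cdot> s\<^sup>\<star>"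
proof (rule sinv_unique)
  note c = assms sinv(1)[OF assms(1)] sinv(1)[OF assms(2)]
  have 1: "s\<^sup>\<star> \<cdot> s \<cdot> (t \<cdot> t\<^sup>\<star>) = t \<cdot> t\<^sup>\<star> \<cdot> (s\<^sup>\<star> \<cdot> s)"
    using assms by (intro idem_comm dom_idem ran_idem)
  have "s \<cdot> t \<cdot> (t\<^sup>\<star> \<cdot> s\<^sup>\<star>) \<cdot> (s \<cdot> t) = s \<cdot> (t \<cdot> t\<^sup>\<star> \<cdot> (s\<^sup>\<star> \<cdot> s)) \<cdot> t"
    using c by (simp add: assoc closed)
  also have "\<dots> = s \<cdot> t" using c by (simp add: 1[symmetric]) (simp add: assoc closed sinv_mult_cancel)
  finally show "s \<cdot> t \<cdot> (t\<^sup>\<star> \<cdot> s\<^sup>\<star>) \<cdot> (s \<cdot> t) = s \<cdot> t" .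
  have "t\<^sup>\<star> \<cdot> s\<^sup>\<star> \<cdot> (s \<cdot> t) \<cdot> (t\<^sup>\<star> \<cdot> s\<^sup>\<star>) = t\<^sup>\<star> \<cdot> (s\<^sup>\<star> \<cdot> s \<cdot> (t \<cdot> t\<^sup>\<star>)) \<cdot> s\<^sup>\<star>"
    using c by (simp add: assoc closed)
  also have "\<dots> = t\<^sup>\<star> \<cdot> s\<^sup>\<star>" using c by (simp add: 1) (simp add: assoc closed sinv_mult_cancel)
  finally show "t\<^sup>\<star> \<cdot> s\<^sup>\<star> \<cdot> (s \<cdot> t) \<cdot> (t\<^sup>\<star> \<cdot> s\<^sup>\<star>) = t\<^sup>\<star> \<cdot> s\<^sup>\<star>" .
qed (use assms sinv closed in auto)

lemma zero_ran: "s \<in> carrier S \<Longrightarrow> s \<cdot> s\<^sup>\<star> = szero S \<longleftrightarrow> s = szero S"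
  using sinv sinv_mult_cancel by (metis zero_mult mult_zero)

lemma zero_sinv: "s \<in> carrier S \<Longrightarrow> s\<^sup>\<star> = szero S \<longleftrightarrow> s = szero S"
  using sinv_sinv sinv_zero by metis

lemma nonzero_closed: "s \<in> nonzero S \<Longrightarrow> s \<in> carrier S"
  and nonzero_not_zero: "s \<in> nonzero S \<Longrightarrow> s \<noteq> szero S"
  and nonzero_sinv: "s \<in> nonzero S \<Longrightarrow> s\<^sup>\<star> \<in> nonzero S"
  by (auto simp: nonzero_def zero_sinv sinv)

lemma nonzeroI: "\<lbrakk>s \<in> carrier S; s \<noteq> szero S\<rbrakk> \<Longrightarrow> s \<in> nonzero S"
  by (simp add: nonzero_def)


subsection \<open>Characters\<close>

lemma char_01: "\<lbrakk>\<phi> \<in> characters S; e \<in> idem S\<rbrakk> \<Longrightarrow> \<phi> e = 0 \<or> \<phi> e = 1"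
  by (auto simp: characters_def PiE_def Pi_def)

lemma char_mult: "\<lbrakk>\<phi> \<in> characters S; e \<in> idem S; f \<in> idem S\<rbrakk> \<Longrightarrow> \<phi> (e \<cdot> f) = \<phi> e * \<phi> f"
  by (simp add: characters_def)

lemma char_zero: "\<phi> \<in> characters S \<Longrightarrow> \<phi> (szero S) = 0"
  by (simp add: characters_def)

lemma char_ext: "\<phi> \<in> characters S \<Longrightarrow> \<phi> \<in> extensional (idem S)"
  by (simp add: characters_def PiE_def)

lemma DD_char: "\<phi> \<in> DD S e \<Longrightarrow> \<phi> \<in> characters S"
  and DD_one: "\<phi> \<in> DD S e \<Longrightarrow> \<phi> e = 1"
  by (auto simp: DD_def)

lemma DD_zero: "DD S (szero S) = {}"
  by (auto simp: DD_def char_zero)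

lemma DD_mult: "\<lbrakk>e \<in> idem S; f \<in> idem S\<rbrakk> \<Longrightarrow> DD S (e \<cdot> f) = DD S e \<inter> DD S f"
  by (auto simp: DD_def char_mult dest: char_01)

lemma char_DD: "\<phi> \<in> characters S \<Longrightarrow> \<exists>e\<in>idem S. e \<noteq> szero S \<and> \<phi> \<in> DD S e"
proof -
  assume \<phi>: "\<phi> \<in> characters S"
  then obtain e where "e \<in> idem S" "\<phi> e \<noteq> 0" by (auto simp: characters_def)
  then show ?thesis using char_01[OF \<phi>, of e] char_zero[OF \<phi>] \<phi>
    by (intro bexI[of _ e]) (auto simp: DD_def)
qed

lemma act_apply: "e \<in> idem S \<Longrightarrow> act S s \<phi> e = \<phi> (s\<^sup>\<star> \<cdot> e \<cdot> s)"
  by (simp add: act_def)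

text \<open>Conjugation of idempotents by s is multiplicative because
  \<open>s \<cdot> s\<^sup>\<star>\<close> commutes past e. At
  \<open>s \<cdot> s\<^sup>\<star>\<close> the new character takes the value of \<phi> at
  \<open>s\<^sup>\<star> \<cdot> s\<close>, which is 1, so it is nonzero.\<close>

lemma act_char:
  assumes s: "s \<in> carrier S" and \<phi>: "\<phi> \<in> DD S (s\<^sup>\<star> \<cdot> s)"
  shows "act S s \<phi> \<in> DD S (s \<cdot> s\<^sup>\<star>)"
proof -
  note char = DD_char[OF \<phi>]
  note c = s sinv(1)[OF s]
  have mult: "\<phi> (s\<^sup>\<star> \<cdot> (e \<cdot> f) \<cdot> s) = \<phi> (s\<^sup>\<star> \<cdot> e \<cdot> s) * \<phi> (s\<^sup>\<star> \<cdot> f \<cdot> s)"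
    if e: "e \<in> idem S" and f: "f \<in> idem S" for e f
  proof -
    note c' = c idem_closed[OF e] idem_closed[OF f]
    have "s\<^sup>\<star> \<cdot> e \<cdot> s \<cdot> (s\<^sup>\<star> \<cdot> f \<cdot> s) = s\<^sup>\<star> \<cdot> (e \<cdot> ((s \<cdot> s\<^sup>\<star>) \<cdot> (f \<cdot> s)))"
      using c' by (simp add: assoc closed)
    also have "\<dots> = s\<^sup>\<star> \<cdot> ((s \<cdot> s\<^sup>\<star>) \<cdot> (e \<cdot> (f \<cdot> s)))"
      using c' by (simp add: idem_left_comm[OF e ran_idem[OF s]] closed)
    also have "\<dots> = s\<^sup>\<star> \<cdot> (e \<cdot> f) \<cdot> s"
      using c' by (simp add: assoc closed sinv_mult_cancel)
    finally show ?thesis using char_mult[OF char conj_idem[OF s e] conj_idem[OF s f]] by simp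
  qed
  have one: "act S s \<phi> (s \<cdot> s\<^sup>\<star>) = 1"
    using c DD_one[OF \<phi>] by (simp add: act_apply ran_idem assoc closed sinv_mult_cancel)
  have "act S s \<phi> \<in> idem S \<rightarrow>\<^sub>E {0, 1}"
    using char_01[OF char conj_idem[OF s]] by (auto simp: act_def)
  moreover have "act S s \<phi> (szero S) = 0"
    using c by (simp add: act_apply zero_idem zero_mult mult_zero char_zero[OF char])
  moreover have "act S s \<phi> (e \<cdot> f) = act S s \<phi> e * act S s \<phi> f" if "e \<in> idem S" "f \<in> idem S" for e f
    using that by (simp add: act_apply idem_mult_idem mult)
  ultimately have "act S s \<phi> \<in> characters S"
    using one ran_idem[OF s] by (auto simp: characters_def intro!: bexI[of _ "s \<cdot> s\<^sup>\<star>"])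
  then show ?thesis using one by (simp add: DD_def)
qed

lemma act_act:
  assumes "s \<in> carrier S" "t \<in> carrier S"
  shows "act S s (act S t \<phi>) = act S (s \<cdot> t) \<phi>"
proof
  fix e show "act S s (act S t \<phi>) e = act S (s \<cdot> t) \<phi> e"
  proof (cases "e \<in> idem S")
    case True
    have "act S s (act S t \<phi>) e = \<phi> (t\<^sup>\<star> \<cdot> (s\<^sup>\<star> \<cdot> e \<cdot> s) \<cdot> t)"
      using True assms by (simp add: act_apply conj_idem)
    also have "\<dots> = act S (s \<cdot> t) \<phi> e"
      using assms sinv(1)[OF assms(1)] sinv(1)[OF assms(2)] idem_closed[OF True] True
      by (simp add: act_apply sinv_mult assoc closed)
    finally show ?thesis .
  qed (simp add: act_def)
qed

text \<open>The domain of a composite action is exactly the domain of the product: the idempotent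
  \<open>(s \<cdot> t)\<^sup>\<star> \<cdot> (s \<cdot> t)\<close> is the conjugate of
  \<open>s\<^sup>\<star> \<cdot> s\<close> by t and lies below
  \<open>t\<^sup>\<star> \<cdot> t\<close>. Composition in the groupoid and in the partial action
  both rely on this.\<close>

lemma act_DD_iff:
  assumes "s \<in> carrier S" "t \<in> carrier S"
  shows "\<phi> \<in> DD S (t\<^sup>\<star> \<cdot> t) \<and> act S t \<phi> \<in> DD S (s\<^sup>\<star> \<cdot> s) \<longleftrightarrow> \<phi> \<in> DD S ((s \<cdot> t)\<^sup>\<star> \<cdot> (s \<cdot> t))"
proof -
  note c = assms sinv(1)[OF assms(1)] sinv(1)[OF assms(2)]
  have eq: "(s \<cdot> t)\<^sup>\<star> \<cdot> (s \<cdot> t) = t\<^sup>\<star> \<cdot> (s\<^sup>\<star> \<cdot> s) \<cdot> t"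
    using c by (simp add: sinv_mult assoc closed)
  have eq2: "t\<^sup>\<star> \<cdot> (s\<^sup>\<star> \<cdot> s) \<cdot> t = (t\<^sup>\<star> \<cdot> (s\<^sup>\<star> \<cdot> s) \<cdot> t) \<cdot> (t\<^sup>\<star> \<cdot> t)"
    using c by (simp add: assoc closed sinv_mult_cancel)
  have sub: "DD S ((s \<cdot> t)\<^sup>\<star> \<cdot> (s \<cdot> t)) \<subseteq> DD S (t\<^sup>\<star> \<cdot> t)"
    unfolding eq by (subst eq2, subst DD_mult) (use assms conj_idem dom_idem in auto)
  have "act S t \<phi> (s\<^sup>\<star> \<cdot> s) = \<phi> ((s \<cdot> t)\<^sup>\<star> \<cdot> (s \<cdot> t))"
    using assms by (simp add: act_apply dom_idem eq)
  then show ?thesis using sub act_char[OF assms(2)] by (auto simp: DD_def)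
qed

lemma act_idem:
  assumes "e \<in> idem S" "\<phi> \<in> DD S e" shows "act S e \<phi> = \<phi>"
proof
  fix f show "act S e \<phi> f = \<phi> f"
    using assms DD_char[OF assms(2)] DD_one[OF assms(2)] char_ext[of \<phi>]
    by (cases "f \<in> idem S")
      (simp_all add: act_apply sinv_idem char_mult idem_mult_idem act_def extensional_def)
qed

lemma act_mult_idem:
  assumes "s \<in> carrier S" "e \<in> idem S" "\<phi> \<in> DD S e" shows "act S (s \<cdot> e) \<phi> = act S s \<phi>"
  using assms by (simp add: act_act[symmetric] idem_closed act_idem)

lemma act_sinv_act:
  assumes "s \<in> carrier S" "\<phi> \<in> DD S (s\<^sup>\<star> \<cdot> s)" shows "act S s\<^sup>\<star> (act S s \<phi>) = \<phi>"
  using assms by (simp add: act_act sinv act_idem dom_idem)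

section \<open>Topology of the spectrum\<close>

lemma topspace_spectrum: "topspace (spectrum S) = characters S"
  by (auto simp: spectrum_def characters_def)

lemma continuous_map_eval: "e \<in> idem S \<Longrightarrow> continuous_map (spectrum S) (discrete_topology {0, 1}) (\<lambda>\<phi>. \<phi> e)"
  unfolding spectrum_def
  by (intro continuous_map_from_subtopology continuous_map_product_projection)

lemma openin_eval:
  assumes "e \<in> idem S" shows "openin (spectrum S) {\<phi> \<in> characters S. \<phi> e = k}"
proof -
  have "openin (spectrum S) {\<phi> \<in> topspace (spectrum S). \<phi> e \<in> {k} \<inter> {0, 1}}"
    using assms by (intro openin_continuous_map_preimage[OF continuous_map_eval]) auto
  also have "{\<phi> \<in> topspace (spectrum S). \<phi> e \<in> {k} \<inter> {0, 1}} = {\<phi> \<in> characters S. \<phi> e = k}"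
    using char_01[OF _ assms] by (auto simp: topspace_spectrum)
  finally show ?thesis .
qed

lemma openin_DD: "e \<in> idem S \<Longrightarrow> openin (spectrum S) (DD S e)"
  using openin_eval by (simp add: DD_def)

lemma DD_subset: "DD S e \<subseteq> characters S"
  by (auto simp: DD_def)

text \<open>The condition \<phi>(e) = 1 already excludes the zero function, so D(e) is cut out of
  the compact space of all maps E(S) to {0, 1} by closed conditions. The spectrum as a whole is in
  general only locally compact.\<close>

lemma compactin_DD:
  assumes e: "e \<in> idem S" shows "compactin (spectrum S) (DD S e)"
proof -
  let ?P = "product_topology (\<lambda>_. discrete_topology {0, 1::nat}) (idem S)"
  have eval: "continuous_map ?P (discrete_topology {0, 1}) (\<lambda>\<phi>. \<phi> f)" if "f \<in> idem S" for f
    using that by (rule continuous_map_product_projection)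
  have 1: "closedin ?P {\<phi> \<in> topspace ?P. \<phi> f = k}" if f: "f \<in> idem S" for f k
  proof -
    have "closedin ?P {\<phi> \<in> topspace ?P. \<phi> f \<in> {k} \<inter> {0, 1}}"
      by (rule closedin_continuous_map_preimage[OF eval[OF f]]) auto
    also have "{\<phi> \<in> topspace ?P. \<phi> f \<in> {k} \<inter> {0, 1}} = {\<phi> \<in> topspace ?P. \<phi> f = k}"
      using f by (auto simp: PiE_def Pi_def)
    finally show ?thesis .
  qed
  have 2: "closedin ?P {\<phi> \<in> topspace ?P. \<phi> (f \<cdot> g) = \<phi> f * \<phi> g}" if f: "f \<in> idem S" and g: "g \<in> idem S" for f g
  proof -
    \<comment> \<open>With values in {0, 1}, multiplicativity at the pair (f, g) splits into
      finitely many conditions on single coordinates, each of them closed.\<close>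
    have "{\<phi> \<in> topspace ?P. \<phi> (f \<cdot> g) = \<phi> f * \<phi> g} =
      ({\<phi> \<in> topspace ?P. \<phi> (f \<cdot> g) = 0} \<inter> {\<phi> \<in> topspace ?P. \<phi> f = 0}) \<union>
      ({\<phi> \<in> topspace ?P. \<phi> (f \<cdot> g) = 0} \<inter> {\<phi> \<in> topspace ?P. \<phi> g = 0}) \<union>
      ({\<phi> \<in> topspace ?P. \<phi> (f \<cdot> g) = 1} \<inter> {\<phi> \<in> topspace ?P. \<phi> f = 1} \<inter> {\<phi> \<in> topspace ?P. \<phi> g = 1})"
      (is "?L = ?R")
    proof (rule Set.set_eqI)
      fix \<phi> show "\<phi> \<in> ?L \<longleftrightarrow> \<phi> \<in> ?R"
      proof (cases "\<phi> \<in> topspace ?P")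
        case True
        have "\<phi> h = 0 \<or> \<phi> h = 1" if "h \<in> idem S" for h using True that by (auto simp: PiE_def Pi_def)
        from this[OF f] this[OF g] this[OF idem_mult_idem[OF f g]] True show ?thesis
          by (auto simp del: topspace_product_topology)
      qed (simp del: topspace_product_topology)
    qed
    then show ?thesis by (simp only:) (intro closedin_Un closedin_Int 1 f g idem_mult_idem)
  qed
  let ?F = "insert {\<phi> \<in> topspace ?P. \<phi> e = 1} (insert {\<phi> \<in> topspace ?P. \<phi> (szero S) = 0}
     {{\<phi> \<in> topspace ?P. \<phi> (f \<cdot> g) = \<phi> f * \<phi> g} |f g. f \<in> idem S \<and> g \<in> idem S})"
  have "DD S e = \<Inter>?F"
    using e by (auto simp: DD_def characters_def)
  moreover have "closedin ?P (\<Inter>?F)"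
    by (rule closedin_Inter) (use 1 2 e zero_idem in auto)
  moreover have "compact_space ?P"
    by (auto simp: compact_space_product_topology compact_space_discrete_topology)
  ultimately have "compactin ?P (DD S e)" using closedin_compact_space by metis
  then show ?thesis using DD_subset by (simp add: spectrum_def compactin_subtopology)
qed

lemma Hausdorff_spectrum: "Hausdorff_space (spectrum S)"
  unfolding spectrum_def
  by (intro Hausdorff_space_subtopology) (simp add: Hausdorff_space_product_topology Hausdorff_space_discrete_topology)

lemma locally_compact_spectrum: "locally_compact_space (spectrum S)"
  unfolding locally_compact_space_def topspace_spectrum
  using char_DD openin_DD compactin_DD by (metis order_refl)

text \<open>Continuity into a product is coordinatewise, and the coordinate at e is evaluation at
  the idempotent \<open>s\<^sup>\<star> \<cdot> e \<cdot> s\<close>.\<close>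

lemma continuous_map_act:
  assumes "s \<in> carrier S"
  shows "continuous_map (subtopology (spectrum S) (DD S (s\<^sup>\<star> \<cdot> s))) (spectrum S) (act S s)"
proof -
  have "continuous_map (subtopology (spectrum S) (DD S (s\<^sup>\<star> \<cdot> s)))
      (product_topology (\<lambda>_. discrete_topology {0, 1}) (idem S)) (act S s)"
    unfolding continuous_map_componentwise
  proof (intro conjI ballI)
    show "act S s ` topspace (subtopology (spectrum S) (DD S (s\<^sup>\<star> \<cdot> s))) \<subseteq> extensional (idem S)"
      by (auto simp: act_def)
    fix e assume e: "e \<in> idem S"
    show "continuous_map (subtopology (spectrum S) (DD S (s\<^sup>\<star> \<cdot> s))) (discrete_topology {0, 1}) (\<lambda>\<phi>. act S s \<phi> e)"
      using e assms by (simp only: act_apply)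
        (intro continuous_map_from_subtopology continuous_map_eval conj_idem)
  qed
  moreover have "act S s \<in> topspace (subtopology (spectrum S) (DD S (s\<^sup>\<star> \<cdot> s))) \<rightarrow> characters S"
    using act_char[OF assms] DD_char by (auto simp: topspace_spectrum)
  ultimately show ?thesis
    by (simp add: spectrum_def[of S] continuous_map_in_subtopology flip: spectrum_def)
qed

lemma openin_act_preimage:
  assumes "s \<in> carrier S" "openin (spectrum S) W"
  shows "openin (spectrum S) {\<phi> \<in> DD S (s\<^sup>\<star> \<cdot> s). act S s \<phi> \<in> W}"
proof -
  have "openin (subtopology (spectrum S) (DD S (s\<^sup>\<star> \<cdot> s)))
      {\<phi> \<in> topspace (subtopology (spectrum S) (DD S (s\<^sup>\<star> \<cdot> s))). act S s \<phi> \<in> W}"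
    using continuous_map_act[OF assms(1)] assms(2) by (rule openin_continuous_map_preimage)
  also have "topspace (subtopology (spectrum S) (DD S (s\<^sup>\<star> \<cdot> s))) = DD S (s\<^sup>\<star> \<cdot> s)"
    using DD_subset by (auto simp: topspace_spectrum)
  finally show ?thesis
    using openin_trans_full openin_DD dom_idem assms(1) by blast
qed

end


section \<open>The universal group\<close>

context inverse_semigroup0
begin

lemma ug_eq_words: "ug_eq S v w \<Longrightarrow> v \<in> ug_words S \<and> w \<in> ug_words S"
  by (induction rule: ug_eq.induct) (auto simp: ug_words_def nonzero_def closed)

lemma equiv_ug_rel: "equiv (ug_words S) (ug_rel S)"
proof (rule equivI)
  show "ug_rel S \<subseteq> ug_words S \<times> ug_words S" using ug_eq_words by (auto simp: ug_rel_def)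
  show "refl_on (ug_words S) (ug_rel S)" by (auto simp: refl_on_def ug_rel_def intro: ug_eq.refl)
  show "sym (ug_rel S)" by (auto simp: sym_def ug_rel_def intro: ug_eq.sym)
  show "trans (ug_rel S)" by (auto simp: trans_def ug_rel_def intro: ug_eq.trans)
qed

definition ug_class :: "('s \<times> bool) list \<Rightarrow> ('s \<times> bool) list set" where
  "ug_class w = ug_rel S `` {w}"

lemma ug_class_eq_iff: "\<lbrakk>v \<in> ug_words S; w \<in> ug_words S\<rbrakk> \<Longrightarrow> ug_class v = ug_class w \<longleftrightarrow> ug_eq S v w"
  using eq_equiv_class_iff[OF equiv_ug_rel] by (simp add: ug_class_def ug_rel_def)

lemma ug_carrier: "carrier (universal_group S) = ug_class ` ug_words S"
  by (auto simp: universal_group_def quotient_def ug_class_def)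

lemma ug_words_append: "\<lbrakk>v \<in> ug_words S; w \<in> ug_words S\<rbrakk> \<Longrightarrow> v @ w \<in> ug_words S"
  by (simp add: ug_words_def)

lemma ug_mult:
  assumes "v \<in> ug_words S" "w \<in> ug_words S"
  shows "ug_class v \<otimes>\<^bsub>universal_group S\<^esub> ug_class w = ug_class (v @ w)"
proof -
  have self: "v \<in> ug_class v" "w \<in> ug_class w"
    using assms by (auto simp: ug_class_def ug_rel_def intro: ug_eq.refl)
  have "ug_class (v' @ w') = ug_class (v @ w)" if "v' \<in> ug_class v" "w' \<in> ug_class w" for v' w'
  proof -
    have "ug_eq S v v'" "ug_eq S w w'" using that by (auto simp: ug_class_def ug_rel_def)
    then have "ug_eq S (v @ w) (v' @ w')" by (rule ug_eq.append)
    then show ?thesis using ug_class_eq_iff ug_eq_words by metis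
  qed
  note * = UN_eqI[OF self(1) UN_eqI[OF self(2) this]]
  show ?thesis unfolding universal_group_def by (simp add: ug_class_def[symmetric], rule *)
qed

text \<open>Reversing a word and flipping its signs gives its formal inverse. The innermost pair, at
  the junction of the two words, cancels first and leaves the induction hypothesis.\<close>

lemma ug_inverse_word:
  "w \<in> ug_words S \<Longrightarrow> ug_eq S (map (\<lambda>(s, b). (s, \<not> b)) (rev w) @ w) []"
proof (induction w)
  case Nil then show ?case by (auto intro: ug_eq.refl)
next
  case (Cons a w)
  obtain s b where a: "a = (s, b)" by fastforce
  let ?i = "\<lambda>w :: ('s \<times> bool) list. map (\<lambda>(s, b). (s, \<not> b)) (rev w)"
  have w: "w \<in> ug_words S" and s: "s \<in> nonzero S" using Cons.prems a by (auto simp: ug_words_def)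
  have iw: "?i w \<in> ug_words S" using w by (auto simp: ug_words_def)
  have "ug_eq S ([(s, \<not> b), (s, b)] @ w) ([] @ w)"
    using ug_eq.cancel[OF s, of "\<not> b"] by (intro ug_eq.append ug_eq.refl w) simp
  then have "ug_eq S (?i w @ ([(s, \<not> b), (s, b)] @ w)) (?i w @ ([] @ w))"
    by (intro ug_eq.append[OF ug_eq.refl[OF iw]])
  moreover have "?i (a # w) @ (a # w) = ?i w @ ([(s, \<not> b), (s, b)] @ w)" by (simp add: a)
  ultimately show ?case using Cons.IH[OF w] ug_eq.trans by simp
qed

lemma group_universal_group: "group (universal_group S)"
proof (rule groupI)
  have one: "\<one>\<^bsub>universal_group S\<^esub> = ug_class []" by (simp add: universal_group_def ug_class_def)
  have nil: "[] \<in> ug_words S" by (simp add: ug_words_def)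
  show "\<one>\<^bsub>universal_group S\<^esub> \<in> carrier (universal_group S)" using nil by (auto simp: one ug_carrier)
  fix x assume "x \<in> carrier (universal_group S)"
  then obtain u where u: "u \<in> ug_words S" "x = ug_class u" by (auto simp: ug_carrier)
  show "\<one>\<^bsub>universal_group S\<^esub> \<otimes>\<^bsub>universal_group S\<^esub> x = x" using u nil by (simp add: one ug_mult)
  have iu: "map (\<lambda>(s, b). (s, \<not> b)) (rev u) \<in> ug_words S" using u by (auto simp: ug_words_def)
  show "\<exists>y\<in>carrier (universal_group S). y \<otimes>\<^bsub>universal_group S\<^esub> x = \<one>\<^bsub>universal_group S\<^esub>"
    using ug_inverse_word[OF u(1)] u iu nil
    by (intro bexI[of _ "ug_class (map (\<lambda>(s, b). (s, \<not> b)) (rev u))"])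
      (simp_all add: ug_mult one ug_class_eq_iff ug_words_append ug_carrier)
  fix y assume "y \<in> carrier (universal_group S)"
  then obtain v where v: "v \<in> ug_words S" "y = ug_class v" by (auto simp: ug_carrier)
  show "x \<otimes>\<^bsub>universal_group S\<^esub> y \<in> carrier (universal_group S)"
    using u v by (simp add: ug_mult ug_words_append ug_carrier)
  fix z assume "z \<in> carrier (universal_group S)"
  then obtain w where w: "w \<in> ug_words S" "z = ug_class w" by (auto simp: ug_carrier)
  show "x \<otimes>\<^bsub>universal_group S\<^esub> y \<otimes>\<^bsub>universal_group S\<^esub> z = x \<otimes>\<^bsub>universal_group S\<^esub> (y \<otimes>\<^bsub>universal_group S\<^esub> z)"
    using u v w by (simp add: ug_mult ug_words_append)
qed

definition ug_gen :: "'s \<Rightarrow> ('s \<times> bool) list set" where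
  "ug_gen s = ug_class [(s, True)]"

lemma ug_words_single: "s \<in> nonzero S \<Longrightarrow> [(s, b)] \<in> ug_words S"
  by (simp add: ug_words_def)

lemma partial_hom_ug_gen: "partial_hom S (universal_group S) ug_gen"
  unfolding partial_hom_def
proof (intro conjI ballI impI)
  show "ug_gen \<in> nonzero S \<rightarrow> carrier (universal_group S)"
    by (auto simp: ug_gen_def ug_carrier ug_words_def)
  fix s t assume *: "s \<in> nonzero S" "t \<in> nonzero S" "s \<cdot> t \<noteq> szero S"
  then have "ug_eq S [(s, True), (t, True)] [(s \<cdot> t, True)]" by (rule ug_eq.mult)
  then show "ug_gen (s \<cdot> t) = ug_gen s \<otimes>\<^bsub>universal_group S\<^esub> ug_gen t"
    using * ug_class_eq_iff[of "[(s, True), (t, True)]" "[(s \<cdot> t, True)]"] ug_eq_words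
    by (metis (no_types) append_Cons append_Nil ug_gen_def ug_mult ug_words_single nonzeroI nonzero_closed closed)
qed

text \<open>A partial homomorphism extends to words and is constant on their classes.\<close>

lemma ug_gen_eq_one:
  assumes "group H" "partial_hom S H \<phi>" "s \<in> nonzero S" "ug_gen s = \<one>\<^bsub>universal_group S\<^esub>"
  shows "\<phi> s = \<one>\<^bsub>H\<^esub>"
proof -
  interpret H: group H by fact
  define ev where "ev w = foldr (\<lambda>(s, b) x. (if b then \<phi> s else inv\<^bsub>H\<^esub> \<phi> s) \<otimes>\<^bsub>H\<^esub> x) w \<one>\<^bsub>H\<^esub>" for w
  have cl: "\<phi> s \<in> carrier H" if "s \<in> nonzero S" for s using assms(2) that by (auto simp: partial_hom_def)
  have ev_closed: "ev w \<in> carrier H" if "w \<in> ug_words S" for w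
    using that unfolding ug_words_def by (induction w) (auto simp: ev_def cl)
  have ev_append: "ev (v @ w) = ev v \<otimes>\<^bsub>H\<^esub> ev w" if "v \<in> ug_words S" "w \<in> ug_words S" for v w
    using that(1)
  proof (induction v)
    case Nil then show ?case using ev_closed[OF that(2)] by (simp add: ev_def)
  next
    case (Cons a v)
    then have "v \<in> ug_words S" "fst a \<in> nonzero S" by (auto simp: ug_words_def)
    moreover have "ev (a # u) = (if snd a then \<phi> (fst a) else inv\<^bsub>H\<^esub> \<phi> (fst a)) \<otimes>\<^bsub>H\<^esub> ev u" for u
      by (simp add: ev_def case_prod_unfold)
    ultimately show ?case using Cons.IH ev_closed that(2) cl by (simp add: H.m_assoc)
  qed
  have "ev v = ev w" if "ug_eq S v w" for v w
    using that
  proof (induction rule: ug_eq.induct)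
    case (append v v' w w')
    then show ?case using ug_eq_words by (metis ev_append)
  next
    case (cancel s b) then show ?case using cl by (cases b) (simp_all add: ev_def)
  next
    case (mult s t)
    then have "s \<cdot> t \<in> nonzero S" by (simp add: nonzero_def closed)
    then show ?case using mult cl assms(2) by (simp add: ev_def partial_hom_def)
  qed simp_all
  moreover have "ug_eq S [(s, True)] []"
    using assms(3,4) by (subst ug_class_eq_iff[symmetric])
      (auto simp: ug_words_def ug_gen_def universal_group_def ug_class_def)
  ultimately have "ev [(s, True)] = ev []" by blast
  then show ?thesis using cl[OF assms(3)] by (simp add: ev_def)
qed

text \<open>For nonzero e the relation e e = e survives in the group, where 1 is the only
  idempotent.\<close>

lemma partial_hom_idem:
  assumes "group H" "partial_hom S H \<phi>" "e \<in> idem S" "e \<noteq> szero S"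
  shows "\<phi> e = \<one>\<^bsub>H\<^esub>"
proof -
  interpret H: group H by fact
  have "e \<in> nonzero S" "e \<cdot> e = e" using assms by (auto simp: idem_def nonzero_def)
  then have "\<phi> e = \<phi> e \<otimes>\<^bsub>H\<^esub> \<phi> e" "\<phi> e \<in> carrier H"
    using assms(2,4) unfolding partial_hom_def by (metis, blast)
  then show ?thesis using H.r_cancel_one by metis
qed

text \<open>If the generator of s is trivial, then every partial homomorphism sends s to 1, in
  particular the given idempotent pure one, so s is idempotent. The other inclusion holds for any
  partial homomorphism.\<close>

lemma idempotent_pure_ug_gen:
  assumes "group H" "partial_hom S H \<phi>" "idempotent_pure S H \<phi>"
  shows "idempotent_pure S (universal_group S) ug_gen"
  unfolding idempotent_pure_def
proof (intro equalityI subsetI)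
  fix s assume "s \<in> {s \<in> nonzero S. ug_gen s = \<one>\<^bsub>universal_group S\<^esub>}"
  then show "s \<in> idem S - {szero S}"
    using ug_gen_eq_one[OF assms(1,2)] assms(3) unfolding idempotent_pure_def by blast
next
  fix e assume "e \<in> idem S - {szero S}"
  then show "e \<in> {s \<in> nonzero S. ug_gen s = \<one>\<^bsub>universal_group S\<^esub>}"
    using partial_hom_idem[OF group_universal_group partial_hom_ug_gen] by (auto simp: nonzero_def idem_def)
qed

end

section \<open>The partial action and the universal groupoid\<close>

text \<open>The grading group is kept abstract. The arguments use only that \<iota> is an idempotent
  pure partial homomorphism; the presentation of the universal group enters in the final
  instantiation.\<close>

locale idempotent_pure_grading = inverse_semigroup0 S + G: group G
  for S :: "'s semigroup0" (structure) and G :: "'g monoid" +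
  fixes \<iota> :: "'s \<Rightarrow> 'g"
  assumes partial_hom: "partial_hom S G \<iota>" and idempotent_pure: "idempotent_pure S G \<iota>"
begin

lemma \<iota>_closed: "s \<in> nonzero S \<Longrightarrow> \<iota> s \<in> carrier G"
  using partial_hom by (auto simp: partial_hom_def)

lemma \<iota>_mult: "\<lbrakk>s \<in> nonzero S; t \<in> nonzero S; s \<cdot> t \<noteq> szero S\<rbrakk> \<Longrightarrow> \<iota> (s \<cdot> t) = \<iota> s \<otimes>\<^bsub>G\<^esub> \<iota> t"
  using partial_hom by (auto simp: partial_hom_def)

lemma \<iota>_one_iff: "s \<in> nonzero S \<Longrightarrow> \<iota> s = \<one>\<^bsub>G\<^esub> \<longleftrightarrow> s \<in> idem S"
  using idempotent_pure by (auto simp: idempotent_pure_def nonzero_def)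

lemma mult_nonzeroD:
  assumes "s \<in> carrier S" "t \<in> carrier S" "s \<cdot> t \<in> nonzero S"
  shows "s \<in> nonzero S" "t \<in> nonzero S"
  using assms by (auto simp: nonzero_def zero_mult mult_zero)

lemma \<iota>_mult': "\<lbrakk>s \<in> carrier S; t \<in> carrier S; s \<cdot> t \<in> nonzero S\<rbrakk> \<Longrightarrow> \<iota> (s \<cdot> t) = \<iota> s \<otimes>\<^bsub>G\<^esub> \<iota> t"
  using mult_nonzeroD \<iota>_mult nonzero_not_zero by blast

lemma \<iota>_sinv:
  assumes "s \<in> nonzero S" shows "\<iota> (s\<^sup>\<star>) = inv\<^bsub>G\<^esub> \<iota> s"
proof -
  note c = nonzero_closed[OF assms]
  have nz: "s \<cdot> s\<^sup>\<star> \<in> nonzero S" using assms c sinv closed by (auto simp: nonzero_def zero_ran)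
  then have "\<iota> s \<otimes>\<^bsub>G\<^esub> \<iota> (s\<^sup>\<star>) = \<one>\<^bsub>G\<^esub>"
    using \<iota>_mult'[OF c sinv(1)[OF c] nz] \<iota>_one_iff[OF nz] ran_idem[OF c] by simp
  then show ?thesis using \<iota>_closed assms nonzero_sinv by (metis G.inv_equality G.inv_inv)
qed

lemma \<iota>_mult_idem: "\<lbrakk>s \<in> carrier S; e \<in> idem S; s \<cdot> e \<in> nonzero S\<rbrakk> \<Longrightarrow> \<iota> (s \<cdot> e) = \<iota> s"
  using \<iota>_mult' mult_nonzeroD \<iota>_one_iff \<iota>_closed idem_closed by (metis G.r_one)

lemma \<iota>_idem_mult: "\<lbrakk>s \<in> carrier S; e \<in> idem S; e \<cdot> s \<in> nonzero S\<rbrakk> \<Longrightarrow> \<iota> (e \<cdot> s) = \<iota> s"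
  using \<iota>_mult' mult_nonzeroD \<iota>_one_iff \<iota>_closed idem_closed by (metis G.l_one)

lemma DD_nonzero: "\<lbrakk>e \<in> idem S; \<phi> \<in> DD S e\<rbrakk> \<Longrightarrow> e \<in> nonzero S"
  using DD_zero idem_closed by (auto simp: nonzero_def)

lemma DD_dom_nonzero: "\<lbrakk>s \<in> carrier S; \<phi> \<in> DD S (s\<^sup>\<star> \<cdot> s)\<rbrakk> \<Longrightarrow> s \<in> nonzero S"
  and DD_ran_nonzero: "\<lbrakk>s \<in> carrier S; \<phi> \<in> DD S (s \<cdot> s\<^sup>\<star>)\<rbrakk> \<Longrightarrow> s \<in> nonzero S"
  using DD_zero sinv by (auto simp: nonzero_def mult_zero zero_mult)

text \<open>With \<open>e = s\<^sup>\<star>st\<^sup>\<star>t \<noteq> 0\<close> the element \<open>set\<^sup>\<star>\<close> is nonzero and of degree \<open>1\<close>, hence idempotent.\<close>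

lemma common_restriction:
  assumes s: "s \<in> nonzero S" and t: "t \<in> nonzero S" and eq: "\<iota> s = \<iota> t"
    and \<phi>: "\<phi> \<in> DD S (s\<^sup>\<star> \<cdot> s)" "\<phi> \<in> DD S (t\<^sup>\<star> \<cdot> t)"
  shows "s \<cdot> (s\<^sup>\<star> \<cdot> s \<cdot> (t\<^sup>\<star> \<cdot> t)) = t \<cdot> (s\<^sup>\<star> \<cdot> s \<cdot> (t\<^sup>\<star> \<cdot> t))"
proof -
  note sc = nonzero_closed[OF s] and tc = nonzero_closed[OF t]
  note c = sc tc sinv(1)[OF sc] sinv(1)[OF tc]
  define e where "e = s\<^sup>\<star> \<cdot> s \<cdot> (t\<^sup>\<star> \<cdot> t)"
  have e: "e \<in> idem S" using dom_idem[OF sc] dom_idem[OF tc] idem_mult_idem by (simp add: e_def)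
  note ec = idem_closed[OF e]
  have "\<phi> \<in> DD S e" using \<phi> DD_mult dom_idem c by (simp add: e_def)
  then have enz: "e \<in> nonzero S" using DD_nonzero e by blast
  have et: "e \<cdot> (t\<^sup>\<star> \<cdot> t) = e"
    using c by (simp add: e_def assoc closed sinv_mult_cancel)
  have se: "s\<^sup>\<star> \<cdot> (s \<cdot> e) = e"
    using c by (simp add: e_def assoc closed sinv_mult_cancel)
  define f where "f = s \<cdot> e \<cdot> t\<^sup>\<star>"
  have fc: "f \<in> carrier S" using c ec by (simp add: f_def closed)
  have "s\<^sup>\<star> \<cdot> f \<cdot> t = s\<^sup>\<star> \<cdot> (s \<cdot> e) \<cdot> (t\<^sup>\<star> \<cdot> t)"
    using c ec by (simp add: f_def assoc closed)
  also have "\<dots> = e" by (simp add: se et)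
  finally have sft: "s\<^sup>\<star> \<cdot> f \<cdot> t = e" .
  then have "f \<noteq> szero S" using enz c by (auto simp: nonzero_def mult_zero zero_mult)
  then have fnz: "s \<cdot> e \<cdot> t\<^sup>\<star> \<in> nonzero S" using fc by (simp add: nonzero_def f_def)
  then have senz: "s \<cdot> e \<in> nonzero S" using mult_nonzeroD(1)[OF _ _ fnz] c ec closed by simp
  have "\<iota> f = \<iota> s \<otimes>\<^bsub>G\<^esub> inv\<^bsub>G\<^esub> \<iota> t"
    using \<iota>_mult'[OF _ _ fnz] \<iota>_mult_idem[OF sc e senz] \<iota>_sinv[OF t] c ec closed by (simp add: f_def)
  also have "\<dots> = \<one>\<^bsub>G\<^esub>" using eq \<iota>_closed[OF t] by simp
  finally have f: "f \<in> idem S" using \<iota>_one_iff fnz by (simp add: f_def)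
  have ft: "f \<cdot> t = s \<cdot> e"
    using c ec et by (simp add: f_def assoc closed)
  \<comment> \<open>As f is idempotent, f t = s e exhibits s e as a restriction of t; f is moved to
    the right of t at the cost of conjugation by t.\<close>
  have 1: "s \<cdot> e = t \<cdot> (t\<^sup>\<star> \<cdot> f \<cdot> t)"
  proof -
    have "t \<cdot> (t\<^sup>\<star> \<cdot> f \<cdot> t) = (t \<cdot> t\<^sup>\<star>) \<cdot> (f \<cdot> t)" using c fc by (simp add: assoc closed)
    also have "\<dots> = f \<cdot> ((t \<cdot> t\<^sup>\<star>) \<cdot> t)" using idem_left_comm[OF ran_idem[OF tc] f tc] .
    also have "\<dots> = s \<cdot> e" using c by (simp add: ft sinv)
    finally show ?thesis ..
  qed
  define e' where "e' = t\<^sup>\<star> \<cdot> f \<cdot> t"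
  have e': "e' \<in> idem S" using conj_idem[OF tc f] by (simp add: e'_def)
  note ec' = idem_closed[OF e']
  have e't: "t\<^sup>\<star> \<cdot> (t \<cdot> e') = e'" using c fc by (simp add: e'_def assoc closed sinv_mult_cancel)
  \<comment> \<open>The restricting idempotents can be recovered from the restricted element: e and
    e' are both the domain idempotent of s e = t e', hence equal.\<close>
  have dom: "(s \<cdot> e)\<^sup>\<star> \<cdot> (s \<cdot> e) = e"
    using c ec e se by (simp add: sinv_mult sinv_idem assoc closed idem_idem)
  have "(t \<cdot> e')\<^sup>\<star> \<cdot> (t \<cdot> e') = e'"
    using c ec' e' e't by (simp add: sinv_mult sinv_idem assoc closed idem_idem)
  then have "e' = e" using dom 1 by (simp add: e'_def)
  then show ?thesis using 1 by (simp add: e'_def e_def)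
qed

lemma act_unique:
  assumes "s \<in> nonzero S" "t \<in> nonzero S" "\<iota> s = \<iota> t" "\<phi> \<in> DD S (s\<^sup>\<star> \<cdot> s)" "\<phi> \<in> DD S (t\<^sup>\<star> \<cdot> t)"
  shows "act S s \<phi> = act S t \<phi>"
proof -
  let ?e = "s\<^sup>\<star> \<cdot> s \<cdot> (t\<^sup>\<star> \<cdot> t)"
  note c = nonzero_closed[OF assms(1)] nonzero_closed[OF assms(2)]
  have e: "?e \<in> idem S" "\<phi> \<in> DD S ?e" using c assms dom_idem DD_mult idem_mult_idem by auto
  have "act S s \<phi> = act S (s \<cdot> ?e) \<phi>" using act_mult_idem[OF c(1) e] by simp
  also have "\<dots> = act S (t \<cdot> ?e) \<phi>" using common_restriction[OF assms] by simp
  also have "\<dots> = act S t \<phi>" using act_mult_idem[OF c(2) e] by simp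
  finally show ?thesis .
qed

text \<open>The union of the partial maps \<open>act S s\<close> over all s of degree g. By
  \<open>act_unique\<close> these agree where several are defined, so the choice made by
  \<open>SOME\<close> is immaterial; \<open>\<theta>_Some_iff\<close> is the choice-free
  form.\<close>

definition \<theta> :: "'g \<Rightarrow> ('s \<Rightarrow> nat) \<rightharpoonup> ('s \<Rightarrow> nat)" where
  "\<theta> g \<phi> = (if \<exists>s\<in>nonzero S. \<iota> s = g \<and> \<phi> \<in> DD S (s\<^sup>\<star> \<cdot> s)
     then Some (act S (SOME s. s \<in> nonzero S \<and> \<iota> s = g \<and> \<phi> \<in> DD S (s\<^sup>\<star> \<cdot> s)) \<phi>) else None)"

lemma \<theta>_Some_iff:
  "\<theta> g \<phi> = Some \<psi> \<longleftrightarrow> (\<exists>s\<in>nonzero S. \<iota> s = g \<and> \<phi> \<in> DD S (s\<^sup>\<star> \<cdot> s) \<and> \<psi> = act S s \<phi>)" (is "_ \<longleftrightarrow> ?R")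
proof
  let ?P = "\<lambda>s. s \<in> nonzero S \<and> \<iota> s = g \<and> \<phi> \<in> DD S (s\<^sup>\<star> \<cdot> s)"
  have eq: "\<theta> g \<phi> = Some (act S s \<phi>)" if "?P s" for s
  proof -
    have *: "?P (SOME s. ?P s)" using that by (rule someI)
    have "act S (SOME s. ?P s) \<phi> = act S s \<phi>" by (rule act_unique) (use that * in auto)
    then show ?thesis using that by (auto simp: \<theta>_def)
  qed
  then show "?R \<Longrightarrow> \<theta> g \<phi> = Some \<psi>" by blast
  show ?R if "\<theta> g \<phi> = Some \<psi>"
  proof -
    obtain s where "?P s" using \<open>\<theta> g \<phi> = Some \<psi>\<close> by (auto simp: \<theta>_def split: if_splits)
    then show ?thesis using eq[of s] \<open>\<theta> g \<phi> = Some \<psi>\<close> by auto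
  qed
qed

lemma \<theta>_eq: "\<lbrakk>s \<in> nonzero S; \<phi> \<in> DD S (s\<^sup>\<star> \<cdot> s)\<rbrakk> \<Longrightarrow> \<theta> (\<iota> s) \<phi> = Some (act S s \<phi>)"
  using \<theta>_Some_iff by blast

lemma dom_\<theta>: "dom (\<theta> g) = (\<Union>s\<in>{s \<in> nonzero S. \<iota> s = g}. DD S (s\<^sup>\<star> \<cdot> s))"
  by (auto simp: dom_def \<theta>_Some_iff)

lemma dom_\<theta>_subset: "dom (\<theta> g) \<subseteq> characters S"
  using DD_char by (auto simp: dom_\<theta>)

text \<open>Every character takes the value 1 at some nonzero idempotent e, and e has degree 1 and
  acts trivially on D(e).\<close>

lemma \<theta>_one: "\<theta> \<one>\<^bsub>G\<^esub> = (\<lambda>\<phi>. if \<phi> \<in> topspace (spectrum S) then Some \<phi> else None)"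
proof
  fix \<phi> show "\<theta> \<one>\<^bsub>G\<^esub> \<phi> = (if \<phi> \<in> topspace (spectrum S) then Some \<phi> else None)"
  proof (cases "\<phi> \<in> characters S")
    case True
    then obtain e where e: "e \<in> idem S" "e \<noteq> szero S" "\<phi> \<in> DD S e" using char_DD by blast
    then have "e \<in> nonzero S" by (simp add: nonzeroI idem_closed)
    then have "\<theta> (\<iota> e) \<phi> = Some \<phi>"
      using \<theta>_eq[of e \<phi>] e act_idem by (simp add: sinv_idem idem_idem)
    moreover have "\<iota> e = \<one>\<^bsub>G\<^esub>" using \<iota>_one_iff \<open>e \<in> nonzero S\<close> e by blast
    ultimately show ?thesis using True by (simp add: topspace_spectrum)
  next
    case False
    then have "\<theta> \<one>\<^bsub>G\<^esub> \<phi> = None" using dom_\<theta>_subset by blast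
    then show ?thesis using False by (simp add: topspace_spectrum)
  qed
qed

lemma \<theta>_inv_imp:
  assumes "\<theta> g \<phi> = Some \<psi>" shows "\<theta> (inv\<^bsub>G\<^esub> g) \<psi> = Some \<phi>"
proof -
  obtain s where s: "s \<in> nonzero S" "\<iota> s = g" "\<phi> \<in> DD S (s\<^sup>\<star> \<cdot> s)" "\<psi> = act S s \<phi>"
    using assms \<theta>_Some_iff by blast
  note c = nonzero_closed[OF s(1)]
  have "\<psi> \<in> DD S (s\<^sup>\<star>\<^sup>\<star> \<cdot> s\<^sup>\<star>)" using act_char[OF c s(3)] s(4) c by (simp add: sinv_sinv)
  then have "\<theta> (\<iota> (s\<^sup>\<star>)) \<psi> = Some (act S (s\<^sup>\<star>) \<psi>)" using \<theta>_eq nonzero_sinv[OF s(1)] by blast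
  then show ?thesis using s c act_sinv_act by (simp add: \<iota>_sinv)
qed

lemma \<theta>_inv: "g \<in> carrier G \<Longrightarrow> \<theta> (inv\<^bsub>G\<^esub> g) \<psi> = Some \<phi> \<longleftrightarrow> \<theta> g \<phi> = Some \<psi>"
  using \<theta>_inv_imp G.inv_inv by metis

text \<open>The composite is the action of s t. This product is nonzero because the character lies
  in its domain, and only for nonzero products is \<iota> multiplicative.\<close>

lemma \<theta>_mult:
  assumes "\<theta> h \<phi> = Some \<psi>" "\<theta> g \<psi> = Some \<omega>" shows "\<theta> (g \<otimes>\<^bsub>G\<^esub> h) \<phi> = Some \<omega>"
proof -
  obtain t where t: "t \<in> nonzero S" "\<iota> t = h" "\<phi> \<in> DD S (t\<^sup>\<star> \<cdot> t)" "\<psi> = act S t \<phi>"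
    using assms \<theta>_Some_iff by blast
  obtain s where s: "s \<in> nonzero S" "\<iota> s = g" "\<psi> \<in> DD S (s\<^sup>\<star> \<cdot> s)" "\<omega> = act S s \<psi>"
    using assms \<theta>_Some_iff by blast
  note c = nonzero_closed[OF s(1)] nonzero_closed[OF t(1)]
  have d: "\<phi> \<in> DD S ((s \<cdot> t)\<^sup>\<star> \<cdot> (s \<cdot> t))" using act_DD_iff[OF c] s t by blast
  then have nz: "s \<cdot> t \<in> nonzero S" using DD_dom_nonzero c closed by blast
  have "\<theta> (\<iota> (s \<cdot> t)) \<phi> = Some (act S (s \<cdot> t) \<phi>)" using \<theta>_eq[OF nz d] .
  then show ?thesis using \<iota>_mult'[OF c nz] s t c by (simp add: act_act)
qed

lemma openin_dom_\<theta>: "openin (spectrum S) (dom (\<theta> g))"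
  unfolding dom_\<theta> using nonzero_closed dom_idem openin_DD by (intro openin_Union) blast

lemma ran_\<theta>: "g \<in> carrier G \<Longrightarrow> ran (\<theta> g) = dom (\<theta> (inv\<^bsub>G\<^esub> g))"
  using \<theta>_inv by (force simp: ran_def dom_def)

text \<open>The preimage of an open set is the union, over all s of degree g, of its preimages under
  \<open>act S s\<close>, each of which is open.\<close>

lemma continuous_map_\<theta>:
  assumes g: "g \<in> carrier G"
  shows "continuous_map (subtopology (spectrum S) (dom (\<theta> g))) (subtopology (spectrum S) (ran (\<theta> g))) (\<lambda>\<phi>. the (\<theta> g \<phi>))"
  unfolding continuous_map_in_subtopology
proof (intro conjI)
  have top: "topspace (subtopology (spectrum S) (dom (\<theta> g))) = dom (\<theta> g)"
    using dom_\<theta>_subset by (auto simp: topspace_spectrum)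
  have mem: "the (\<theta> g \<phi>) \<in> ran (\<theta> g)" if "\<phi> \<in> dom (\<theta> g)" for \<phi> using that by (auto simp: ran_def)
  then show "(\<lambda>\<phi>. the (\<theta> g \<phi>)) \<in> topspace (subtopology (spectrum S) (dom (\<theta> g))) \<rightarrow> ran (\<theta> g)"
    unfolding top by blast
  show "continuous_map (subtopology (spectrum S) (dom (\<theta> g))) (spectrum S) (\<lambda>\<phi>. the (\<theta> g \<phi>))"
    unfolding continuous_map_def
  proof (intro conjI allI impI)
    show "(\<lambda>\<phi>. the (\<theta> g \<phi>)) \<in> topspace (subtopology (spectrum S) (dom (\<theta> g))) \<rightarrow> topspace (spectrum S)"
      using mem dom_\<theta>_subset ran_\<theta>[OF g] unfolding top topspace_spectrum by blast
    fix W assume W: "openin (spectrum S) W"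
    have "{\<phi> \<in> dom (\<theta> g). the (\<theta> g \<phi>) \<in> W} =
      (\<Union>s\<in>{s \<in> nonzero S. \<iota> s = g}. {\<phi> \<in> DD S (s\<^sup>\<star> \<cdot> s). act S s \<phi> \<in> W})"
      using \<theta>_eq by (force simp: dom_\<theta>)
    moreover have "openin (spectrum S) \<dots>"
      using openin_act_preimage[OF nonzero_closed W] by (intro openin_Union) blast
    ultimately have "openin (spectrum S) {\<phi> \<in> dom (\<theta> g). the (\<theta> g \<phi>) \<in> W}" by simp
    then show "openin (subtopology (spectrum S) (dom (\<theta> g)))
        {\<phi> \<in> topspace (subtopology (spectrum S) (dom (\<theta> g))). the (\<theta> g \<phi>) \<in> W}"
      unfolding top openin_open_subtopology[OF openin_dom_\<theta>] by blast
  qed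
qed

lemma partial_homeo_\<theta>:
  assumes g: "g \<in> carrier G" shows "partial_homeo (spectrum S) (\<theta> g)"
  unfolding partial_homeo_def
proof (intro conjI)
  let ?X = "subtopology (spectrum S) (dom (\<theta> g))" and ?Y = "subtopology (spectrum S) (ran (\<theta> g))"
  have top: "topspace ?X = dom (\<theta> g)" "topspace ?Y = ran (\<theta> g)"
    using dom_\<theta>_subset ran_\<theta>[OF g] by (auto simp: topspace_spectrum)
  have ran_inv: "ran (\<theta> (inv\<^bsub>G\<^esub> g)) = dom (\<theta> g)" using ran_\<theta>[of "inv\<^bsub>G\<^esub> g"] g by simp
  have "homeomorphic_maps ?X ?Y (\<lambda>\<phi>. the (\<theta> g \<phi>)) (\<lambda>\<phi>. the (\<theta> (inv\<^bsub>G\<^esub> g) \<phi>))"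
    unfolding homeomorphic_maps_def top
  proof (intro conjI ballI)
    show "continuous_map ?X ?Y (\<lambda>\<phi>. the (\<theta> g \<phi>))" by (rule continuous_map_\<theta>[OF g])
    show "continuous_map ?Y ?X (\<lambda>\<phi>. the (\<theta> (inv\<^bsub>G\<^esub> g) \<phi>))"
      using continuous_map_\<theta>[of "inv\<^bsub>G\<^esub> g"] g ran_\<theta>[OF g] ran_inv by simp
    show "the (\<theta> (inv\<^bsub>G\<^esub> g) (the (\<theta> g \<phi>))) = \<phi>" if "\<phi> \<in> dom (\<theta> g)" for \<phi>
      using that \<theta>_inv_imp by fastforce
    show "the (\<theta> g (the (\<theta> (inv\<^bsub>G\<^esub> g) \<phi>))) = \<phi>" if ran: "\<phi> \<in> ran (\<theta> g)" for \<phi>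
    proof -
      obtain \<psi> where "\<theta> g \<psi> = Some \<phi>" using ran by (auto simp: ran_def)
      then show ?thesis using \<theta>_inv_imp[of g \<psi> \<phi>] by simp
    qed
  qed
  then show "homeomorphic_map ?X ?Y (\<lambda>\<phi>. the (\<theta> g \<phi>))" using homeomorphic_maps_map by blast
qed (use openin_dom_\<theta> ran_\<theta>[OF g] in auto)

lemma partial_action_\<theta>: "partial_action G (spectrum S) \<theta>"
proof unfold_locales
  show "\<theta> g \<circ>\<^sub>m \<theta> h \<subseteq>\<^sub>m \<theta> (g \<otimes>\<^bsub>G\<^esub> h)" for g h
    using \<theta>_mult by (auto simp: map_le_def map_comp_def split: option.splits)
qed (use locally_compact_spectrum Hausdorff_spectrum partial_homeo_\<theta> \<theta>_one \<theta>_inv in auto)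

text \<open>A germ is determined by degree and character. A common restriction u whose domain
  contains \<phi> is nonzero and has the degree of both s and t. Conversely, for equal degrees
  \<open>common_restriction\<close> provides u, namely s and t cut down by the product of their
  domain idempotents.\<close>

lemma germ_eq:
  assumes s: "s \<in> carrier S" and \<phi>: "\<phi> \<in> DD S (s\<^sup>\<star> \<cdot> s)"
  shows "germ S s \<phi> = {(t, \<phi>) |t. t \<in> nonzero S \<and> \<iota> t = \<iota> s \<and> \<phi> \<in> DD S (t\<^sup>\<star> \<cdot> t)}"
proof -
  have snz: "s \<in> nonzero S" using DD_dom_nonzero s \<phi> by blast
  have 1: "\<iota> u = \<iota> t" if "u \<in> carrier S" "nat_le S u t" "t \<in> carrier S" "\<phi> \<in> DD S (u\<^sup>\<star> \<cdot> u)" for u t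
    using that DD_dom_nonzero[OF that(1,4)] \<iota>_mult_idem by (auto simp: nat_le_def)
  have 2: "\<exists>u\<in>carrier S. nat_le S u s \<and> nat_le S u t \<and> \<phi> \<in> DD S (u\<^sup>\<star> \<cdot> u)"
    if t: "t \<in> nonzero S" "\<iota> t = \<iota> s" "\<phi> \<in> DD S (t\<^sup>\<star> \<cdot> t)" for t
  proof -
    let ?e = "s\<^sup>\<star> \<cdot> s \<cdot> (t\<^sup>\<star> \<cdot> t)"
    note c = s sinv(1)[OF s] nonzero_closed[OF t(1)] sinv(1)[OF nonzero_closed[OF t(1)]]
    have e: "?e \<in> idem S" using c dom_idem idem_mult_idem by auto
    have "\<phi> \<in> DD S ((s \<cdot> ?e)\<^sup>\<star> \<cdot> (s \<cdot> ?e))"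
    proof -
      have "\<phi> \<in> DD S ?e" using c \<phi> t(3) dom_idem by (simp add: DD_mult)
      moreover from this have "act S ?e \<phi> \<in> DD S (s\<^sup>\<star> \<cdot> s)" using act_idem[OF e] \<phi> by simp
      ultimately show ?thesis
        using act_DD_iff[OF s idem_closed[OF e], of \<phi>] by (simp only: sinv_idem[OF e] idem_idem[OF e]) blast
    qed
    moreover have "nat_le S (s \<cdot> ?e) s" "nat_le S (s \<cdot> ?e) t"
      using e common_restriction[OF snz t(1) t(2)[symmetric] \<phi> t(3)]
      unfolding nat_le_def by blast+
    ultimately show ?thesis using c e idem_closed closed by blast
  qed
  have "((s, \<phi>), (t, \<psi>)) \<in> germ_rel S \<longleftrightarrow>
      t \<in> nonzero S \<and> \<iota> t = \<iota> s \<and> \<phi> \<in> DD S (t\<^sup>\<star> \<cdot> t) \<and> \<psi> = \<phi>" for t \<psi>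
  proof
    assume "((s, \<phi>), (t, \<psi>)) \<in> germ_rel S"
    then obtain u where t: "t \<in> carrier S" "\<psi> = \<phi>" "\<phi> \<in> DD S (t\<^sup>\<star> \<cdot> t)"
      and u: "u \<in> carrier S" "nat_le S u s" "nat_le S u t" "\<phi> \<in> DD S (u\<^sup>\<star> \<cdot> u)"
      by (auto simp: germ_rel_def)
    then show "t \<in> nonzero S \<and> \<iota> t = \<iota> s \<and> \<phi> \<in> DD S (t\<^sup>\<star> \<cdot> t) \<and> \<psi> = \<phi>"
      using 1[OF u(1,2) s u(4)] 1[OF u(1,3) t(1) u(4)] DD_dom_nonzero[OF t(1,3)] by simp
  next
    assume "t \<in> nonzero S \<and> \<iota> t = \<iota> s \<and> \<phi> \<in> DD S (t\<^sup>\<star> \<cdot> t) \<and> \<psi> = \<phi>"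
    then show "((s, \<phi>), (t, \<psi>)) \<in> germ_rel S"
      using 2[of t] s \<phi> nonzero_closed by (simp add: germ_rel_def)
  qed
  then show ?thesis by (auto simp: germ_def)
qed

lemma germ_self: "\<lbrakk>s \<in> carrier S; \<phi> \<in> DD S (s\<^sup>\<star> \<cdot> s)\<rbrakk> \<Longrightarrow> (s, \<phi>) \<in> germ S s \<phi>"
  using DD_dom_nonzero by (simp add: germ_eq)

lemma germ_eq_iff:
  assumes "s \<in> carrier S" "\<phi> \<in> DD S (s\<^sup>\<star> \<cdot> s)" "t \<in> carrier S" "\<psi> \<in> DD S (t\<^sup>\<star> \<cdot> t)"
  shows "germ S s \<phi> = germ S t \<psi> \<longleftrightarrow> \<iota> s = \<iota> t \<and> \<phi> = \<psi>"
  using germ_self[OF assms(1,2)] germ_self[OF assms(3,4)] assms by (auto simp: germ_eq)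

section \<open>Comparison of the universal groupoid with the transformation groupoid\<close>

abbreviation "\<G> \<equiv> universal_groupoid S"
abbreviation "\<T> \<equiv> transformation_groupoid G (spectrum S) \<theta>"

text \<open>Any representative may be taken, since by \<open>germ_eq\<close> all members of a germ
  share degree and character.\<close>

definition graded_germ :: "('s \<times> ('s \<Rightarrow> nat)) set \<Rightarrow> 'g \<times> ('s \<Rightarrow> nat)" where
  "graded_germ X = (case SOME p. p \<in> X of (s, \<phi>) \<Rightarrow> (\<iota> s, \<phi>))"

lemma graded_germ:
  assumes "s \<in> carrier S" "\<phi> \<in> DD S (s\<^sup>\<star> \<cdot> s)" shows "graded_germ (germ S s \<phi>) = (\<iota> s, \<phi>)"
proof -
  have "(SOME p. p \<in> germ S s \<phi>) \<in> germ S s \<phi>" using germ_self[OF assms] by (rule someI)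
  then show ?thesis by (auto simp: graded_germ_def germ_eq[OF assms])
qed

lemma topspace_\<G>: "topspace (arrows \<G>) = {germ S s \<phi> |s \<phi>. s \<in> nonzero S \<and> \<phi> \<in> DD S (s\<^sup>\<star> \<cdot> s)}"
proof -
  have "topspace (arrows \<G>) = {germ S s \<phi> |s \<phi>. s \<in> carrier S \<and> \<phi> \<in> DD S (s\<^sup>\<star> \<cdot> s)}"
    using openin_DD dom_idem
    by (simp add: universal_groupoid_def slice_def) blast
  moreover have "s \<in> carrier S \<and> \<phi> \<in> DD S (s\<^sup>\<star> \<cdot> s) \<longleftrightarrow> s \<in> nonzero S \<and> \<phi> \<in> DD S (s\<^sup>\<star> \<cdot> s)" for s \<phi>
    using DD_dom_nonzero nonzero_closed by blast
  ultimately show ?thesis by simp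
qed

lemma topspace_\<T>: "topspace (arrows \<T>) = {(\<iota> s, \<phi>) |s \<phi>. s \<in> nonzero S \<and> \<phi> \<in> DD S (s\<^sup>\<star> \<cdot> s)}"
  using \<iota>_closed DD_char by (auto simp: transformation_groupoid_def topspace_spectrum dom_\<theta>)

lemma openin_slice:
  assumes "s \<in> carrier S" "openin (spectrum S) U" "U \<subseteq> DD S (s\<^sup>\<star> \<cdot> s)"
  shows "openin (arrows \<G>) (slice S s U)"
  unfolding universal_groupoid_def using assms by (auto intro!: topology_generated_by_Basis)

text \<open>Slices (s, U) correspond to the sets {\<iota>(s)} x U. Preimages of open sets are
  therefore unions of slices, while continuity of the inverse has to be checked only on slices,
  since these generate the topology.\<close>

lemma homeomorphic_map_graded_germ: "homeomorphic_map (arrows \<G>) (arrows \<T>) graded_germ"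
proof -
  define F' where "F' p = germ S (SOME s. s \<in> nonzero S \<and> \<iota> s = fst p \<and> snd p \<in> DD S (s\<^sup>\<star> \<cdot> s)) (snd p)"
    for p :: "'g \<times> ('s \<Rightarrow> nat)"
  have F': "F' (\<iota> s, \<phi>) = germ S s \<phi>" if s: "s \<in> nonzero S" "\<phi> \<in> DD S (s\<^sup>\<star> \<cdot> s)" for s \<phi>
  proof -
    let ?P = "\<lambda>t. t \<in> nonzero S \<and> \<iota> t = \<iota> s \<and> \<phi> \<in> DD S (t\<^sup>\<star> \<cdot> t)"
    have "?P (SOME t. ?P t)" using s by (intro someI[of ?P s]) auto
    then show ?thesis using s nonzero_closed by (simp add: F'_def germ_eq_iff)
  qed
  have "continuous_map (arrows \<G>) (arrows \<T>) graded_germ"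
    unfolding continuous_map_def
  proof (intro conjI allI impI)
    show "graded_germ \<in> topspace (arrows \<G>) \<rightarrow> topspace (arrows \<T>)"
      using graded_germ nonzero_closed by (auto simp: topspace_\<G> topspace_\<T>)
    fix W assume "openin (arrows \<T>) W"
    then obtain W' where W': "openin (prod_topology (discrete_topology (carrier G)) (spectrum S)) W'"
      and W: "W = W' \<inter> {(g, x). g \<in> carrier G \<and> x \<in> dom (\<theta> g)}"
      by (auto simp: transformation_groupoid_def openin_subtopology)
    \<comment> \<open>The fibre of W' over the degree of s, cut down to the domain of s; the slices
      over these fibres cover the preimage.\<close>
    define U where "U s = {\<phi> \<in> DD S (s\<^sup>\<star> \<cdot> s). (\<iota> s, \<phi>) \<in> W'}" for s
    have U: "openin (spectrum S) (U s)" if s: "s \<in> nonzero S" for s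
    proof -
      have "continuous_map (spectrum S) (prod_topology (discrete_topology (carrier G)) (spectrum S)) (\<lambda>\<phi>. (\<iota> s, \<phi>))"
        using \<iota>_closed[OF s] by (intro continuous_map_pairedI) auto
      from openin_continuous_map_preimage[OF this W']
      have "openin (spectrum S) ({\<phi> \<in> topspace (spectrum S). (\<iota> s, \<phi>) \<in> W'} \<inter> DD S (s\<^sup>\<star> \<cdot> s))"
        using openin_DD[OF dom_idem[OF nonzero_closed[OF s]]] by (rule openin_Int)
      moreover have "{\<phi> \<in> topspace (spectrum S). (\<iota> s, \<phi>) \<in> W'} \<inter> DD S (s\<^sup>\<star> \<cdot> s) = U s"
        using DD_char by (auto simp: U_def topspace_spectrum)
      ultimately show ?thesis by simp
    qed
    have "{X \<in> topspace (arrows \<G>). graded_germ X \<in> W} = (\<Union>s\<in>nonzero S. slice S s (U s))"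
    proof (intro equalityI subsetI)
      fix X assume "X \<in> {X \<in> topspace (arrows \<G>). graded_germ X \<in> W}"
      then obtain s \<phi> where "s \<in> nonzero S" "\<phi> \<in> DD S (s\<^sup>\<star> \<cdot> s)" "X = germ S s \<phi>" "(\<iota> s, \<phi>) \<in> W"
        using graded_germ nonzero_closed by (auto simp: topspace_\<G>)
      then show "X \<in> (\<Union>s\<in>nonzero S. slice S s (U s))" by (auto simp: slice_def U_def W)
    next
      fix X assume "X \<in> (\<Union>s\<in>nonzero S. slice S s (U s))"
      then obtain s \<phi> where *: "s \<in> nonzero S" "\<phi> \<in> DD S (s\<^sup>\<star> \<cdot> s)" "(\<iota> s, \<phi>) \<in> W'" "X = germ S s \<phi>"
        by (auto simp: slice_def U_def)
      then show "X \<in> {X \<in> topspace (arrows \<G>). graded_germ X \<in> W}"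
        using graded_germ[of s \<phi>] nonzero_closed[of s] \<iota>_closed[of s] by (auto simp: topspace_\<G> W dom_\<theta>)
    qed
    moreover have "openin (arrows \<G>) \<dots>"
      using U openin_slice nonzero_closed by (intro openin_Union) (auto simp: U_def)
    ultimately show "openin (arrows \<G>) {X \<in> topspace (arrows \<G>). graded_germ X \<in> W}" by simp
  qed
  moreover have "continuous_map (arrows \<T>) (arrows \<G>) F'"
  proof -
    let ?B = "{slice S s U |s U. s \<in> carrier S \<and> openin (spectrum S) U \<and> U \<subseteq> DD S (s\<^sup>\<star> \<cdot> s)}"
    have \<G>: "arrows \<G> = topology_generated_by ?B" by (simp add: universal_groupoid_def)
    show ?thesis
      unfolding \<G>
    proof (rule continuous_on_generated_topo)
      have "F' ` topspace (arrows \<T>) \<subseteq> topspace (arrows \<G>)"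
        unfolding topspace_\<T> topspace_\<G> using F' by fastforce
      then show "F' ` topspace (arrows \<T>) \<subseteq> \<Union> ?B" by (simp add: \<G>)
      fix V assume "V \<in> ?B"
      then obtain s U where V: "V = slice S s U" and s: "s \<in> carrier S" and U: "openin (spectrum S) U" "U \<subseteq> DD S (s\<^sup>\<star> \<cdot> s)"
        by blast
      show "openin (arrows \<T>) (F' -` V \<inter> topspace (arrows \<T>))"
      \<comment> \<open>Slices of the zero are empty because D(0) is empty; they are split off since
        nothing is known about \<iota> at the zero.\<close>
      proof (cases "s = szero S")
        case True
        then have "V = {}" using U(2) sinv_zero by (auto simp: V slice_def zero_mult zero_closed DD_zero)
        then show ?thesis by simp
      next
        case False
        then have snz: "s \<in> nonzero S" using s by (simp add: nonzero_def)
        have "F' -` V \<inter> topspace (arrows \<T>) = ({\<iota> s} \<times> U) \<inter> {(g, x). g \<in> carrier G \<and> x \<in> dom (\<theta> g)}"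
        proof (intro equalityI subsetI)
          fix p assume "p \<in> F' -` V \<inter> topspace (arrows \<T>)"
          then obtain t \<phi> where t: "t \<in> nonzero S" "\<phi> \<in> DD S (t\<^sup>\<star> \<cdot> t)" "p = (\<iota> t, \<phi>)" "F' p \<in> V"
            by (auto simp: topspace_\<T>)
          then obtain \<psi> where "\<psi> \<in> U" "germ S t \<phi> = germ S s \<psi>" using F' by (auto simp: V slice_def)
          then have "\<iota> t = \<iota> s" "\<phi> = \<psi>" using germ_eq_iff t s U nonzero_closed by blast+
          then show "p \<in> ({\<iota> s} \<times> U) \<inter> {(g, x). g \<in> carrier G \<and> x \<in> dom (\<theta> g)}"
            using t \<open>\<psi> \<in> U\<close> \<iota>_closed[OF snz] by (auto simp: dom_\<theta>)
        next
          fix p assume "p \<in> ({\<iota> s} \<times> U) \<inter> {(g, x). g \<in> carrier G \<and> x \<in> dom (\<theta> g)}"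
          then obtain \<phi> where "p = (\<iota> s, \<phi>)" "\<phi> \<in> U" by auto
          then show "p \<in> F' -` V \<inter> topspace (arrows \<T>)"
            using F'[OF snz, of \<phi>] U(2) snz by (auto simp: V slice_def topspace_\<T>)
        qed
        moreover have "openin (prod_topology (discrete_topology (carrier G)) (spectrum S)) ({\<iota> s} \<times> U)"
          using U(1) \<iota>_closed[OF snz] by (simp add: openin_prod_Times_iff)
        ultimately show ?thesis by (auto simp: transformation_groupoid_def openin_subtopology)
      qed
    qed
  qed
  ultimately have "homeomorphic_maps (arrows \<G>) (arrows \<T>) graded_germ F'"
    using F' graded_germ nonzero_closed by (auto simp: homeomorphic_maps_def topspace_\<G> topspace_\<T>)
  then show ?thesis using homeomorphic_maps_map by blast
qed

text \<open>All representatives of a germ share the character and, by \<open>act_unique\<close>, its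
  image. The definite descriptions and unions in \<open>universal_groupoid\<close> can therefore be
  evaluated at a single representative.\<close>

lemma \<G>_maps:
  assumes s: "s \<in> carrier S" and \<phi>: "\<phi> \<in> DD S (s\<^sup>\<star> \<cdot> s)"
  shows "gdom \<G> (germ S s \<phi>) = \<phi>" and "grng \<G> (germ S s \<phi>) = act S s \<phi>"
    and "ginv \<G> (germ S s \<phi>) = germ S (s\<^sup>\<star>) (act S s \<phi>)"
proof -
  have snz: "s \<in> nonzero S" using DD_dom_nonzero s \<phi> by blast
  note self = germ_self[OF s \<phi>]
  show "gdom \<G> (germ S s \<phi>) = \<phi>"
  proof -
    have "\<psi> = \<phi>" if "(t, \<psi>) \<in> germ S s \<phi>" for t \<psi> using that by (simp add: germ_eq[OF s \<phi>])
    then have "(THE \<psi>. \<exists>s'. (s', \<psi>) \<in> germ S s \<phi>) = \<phi>" using self by (intro the_equality) blast+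
    then show ?thesis by (simp add: universal_groupoid_def)
  qed
  have act: "act S t \<psi> = act S s \<phi>" if "(t, \<psi>) \<in> germ S s \<phi>" for t \<psi>
  proof -
    have "t \<in> nonzero S" "\<iota> t = \<iota> s" "\<phi> \<in> DD S (t\<^sup>\<star> \<cdot> t)" "\<psi> = \<phi>"
      using that by (simp_all add: germ_eq[OF s \<phi>])
    then show ?thesis using act_unique[of t s \<phi>] snz \<phi> by simp
  qed
  show "grng \<G> (germ S s \<phi>) = act S s \<phi>"
  proof -
    have "(THE \<omega>. \<exists>t \<psi>. (t, \<psi>) \<in> germ S s \<phi> \<and> \<omega> = act S t \<psi>) = act S s \<phi>"
      using self act by (intro the_equality) blast+
    then show ?thesis by (simp add: universal_groupoid_def)
  qed
  have "germ S (t\<^sup>\<star>) (act S t \<psi>) = germ S (s\<^sup>\<star>) (act S s \<phi>)" if "(t, \<psi>) \<in> germ S s \<phi>" for t \<psi>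
  proof -
    have t: "t \<in> nonzero S" "\<iota> t = \<iota> s" "\<phi> \<in> DD S (t\<^sup>\<star> \<cdot> t)" "\<psi> = \<phi>" using that by (auto simp: germ_eq[OF s \<phi>])
    note tc = nonzero_closed[OF t(1)]
    show ?thesis
      using act[OF that] act_char[OF s \<phi>] act_char[OF tc t(3)] t tc s sinv
      by (subst germ_eq_iff) (simp_all add: sinv_sinv \<iota>_sinv snz)
  qed
  then have "\<Union>{germ S (t\<^sup>\<star>) (act S t \<psi>) |t \<psi>. (t, \<psi>) \<in> germ S s \<phi>} = germ S (s\<^sup>\<star>) (act S s \<phi>)"
    using self by blast
  then show "ginv \<G> (germ S s \<phi>) = germ S (s\<^sup>\<star>) (act S s \<phi>)" by (simp add: universal_groupoid_def)
qed

lemma gcomp_\<G>: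
  assumes s: "s \<in> carrier S" and t: "t \<in> carrier S"
    and \<phi>: "\<phi> \<in> DD S (t\<^sup>\<star> \<cdot> t)" and st: "act S t \<phi> \<in> DD S (s\<^sup>\<star> \<cdot> s)"
  shows "gcomp \<G> (germ S s (act S t \<phi>)) (germ S t \<phi>) = germ S (s \<cdot> t) \<phi>"
proof -
  have "germ S (s' \<cdot> t') \<psi> = germ S (s \<cdot> t) \<phi>"
    if "(s', act S t' \<psi>) \<in> germ S s (act S t \<phi>)" "(t', \<psi>) \<in> germ S t \<phi>" for s' t' \<psi>
  proof -
    have *: "t' \<in> nonzero S" "\<iota> t' = \<iota> t" "\<phi> \<in> DD S (t'\<^sup>\<star> \<cdot> t')" "\<psi> = \<phi>"
      "s' \<in> nonzero S" "\<iota> s' = \<iota> s" "act S t' \<phi> \<in> DD S (s'\<^sup>\<star> \<cdot> s')"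
      using that by (auto simp: germ_eq[OF t \<phi>] germ_eq[OF s st])
    note c = nonzero_closed[OF *(1)] nonzero_closed[OF *(5)]
    have d: "\<phi> \<in> DD S ((s' \<cdot> t')\<^sup>\<star> \<cdot> (s' \<cdot> t'))" "\<phi> \<in> DD S ((s \<cdot> t)\<^sup>\<star> \<cdot> (s \<cdot> t))"
      using act_DD_iff c s t * \<phi> st by blast+
    then have "s' \<cdot> t' \<in> nonzero S" "s \<cdot> t \<in> nonzero S" using DD_dom_nonzero closed c s t by blast+
    then have "\<iota> (s' \<cdot> t') = \<iota> (s \<cdot> t)" using \<iota>_mult' c s t * by simp
    then show ?thesis using germ_eq_iff d c s t closed *(4) by blast
  qed
  then have "\<Union>{germ S (s' \<cdot> t') \<psi> |s' t' \<psi>. (s', act S t' \<psi>) \<in> germ S s (act S t \<phi>) \<and> (t', \<psi>) \<in> germ S t \<phi>}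
      = germ S (s \<cdot> t) \<phi>"
    using germ_self[OF t \<phi>] germ_self[OF s st] by blast
  then show ?thesis by (simp add: universal_groupoid_def)
qed

theorem topgroupoid_iso_graded_germ: "topgroupoid_iso \<G> \<T> graded_germ id"
  unfolding topgroupoid_iso_def
proof (intro conjI ballI impI)
  show "homeomorphic_map (arrows \<G>) (arrows \<T>) graded_germ" by (rule homeomorphic_map_graded_germ)
  show "homeomorphic_map (units \<G>) (units \<T>) id"
    by (simp add: universal_groupoid_def transformation_groupoid_def)
  fix X assume "X \<in> topspace (arrows \<G>)"
  then obtain s \<phi> where X: "X = germ S s \<phi>" and snz: "s \<in> nonzero S" and \<phi>: "\<phi> \<in> DD S (s\<^sup>\<star> \<cdot> s)"
    by (auto simp: topspace_\<G>)
  note s = nonzero_closed[OF snz]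
  have F: "graded_germ X = (\<iota> s, \<phi>)" using graded_germ[OF s \<phi>] X by simp
  show "gdom \<T> (graded_germ X) = id (gdom \<G> X)" "grng \<T> (graded_germ X) = id (grng \<G> X)"
    using \<theta>_eq[OF snz \<phi>] by (simp_all add: F \<G>_maps[OF s \<phi>] X[symmetric]) (simp_all add: X \<G>_maps[OF s \<phi>] transformation_groupoid_def)
  have "graded_germ (ginv \<G> X) = (inv\<^bsub>G\<^esub> \<iota> s, act S s \<phi>)"
    unfolding X \<G>_maps[OF s \<phi>]
    using act_char[OF s \<phi>] s sinv snz by (subst graded_germ) (simp_all add: sinv_sinv \<iota>_sinv)
  then show "ginv \<T> (graded_germ X) = graded_germ (ginv \<G> X)"
    using \<theta>_eq[OF snz \<phi>] by (simp add: F transformation_groupoid_def)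
  fix Y assume "Y \<in> topspace (arrows \<G>)" and eq: "gdom \<G> X = grng \<G> Y"
  then obtain t \<psi> where Y: "Y = germ S t \<psi>" and tnz: "t \<in> nonzero S" and \<psi>: "\<psi> \<in> DD S (t\<^sup>\<star> \<cdot> t)"
    by (auto simp: topspace_\<G>)
  note t = nonzero_closed[OF tnz]
  have \<phi>_eq: "\<phi> = act S t \<psi>" using eq by (simp add: X Y \<G>_maps s t \<phi> \<psi>)
  have d: "\<psi> \<in> DD S ((s \<cdot> t)\<^sup>\<star> \<cdot> (s \<cdot> t))" using act_DD_iff s t \<phi> \<psi> \<phi>_eq by blast
  then have nz: "s \<cdot> t \<in> nonzero S" using DD_dom_nonzero s t closed by blast
  have "graded_germ (gcomp \<G> X Y) = (\<iota> (s \<cdot> t), \<psi>)"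
    using gcomp_\<G>[OF s t \<psi>] \<phi> graded_germ[OF closed[OF s t] d] by (simp add: X Y \<phi>_eq)
  then show "graded_germ (gcomp \<G> X Y) = gcomp \<T> (graded_germ X) (graded_germ Y)"
    using graded_germ[OF t \<psi>] \<iota>_mult'[OF s t nz] by (simp add: F Y transformation_groupoid_def)
qed

text \<open>Universal groupoids of inverse semigroups are not Hausdorff in general. Here the
  property is inherited from the product of a discrete group with the Hausdorff spectrum.\<close>

lemma Hausdorff_\<G>: "Hausdorff_space (arrows \<G>)"
proof -
  have "Hausdorff_space (arrows \<T>)"
    by (simp add: transformation_groupoid_def Hausdorff_space_subtopology Hausdorff_space_prod_topology
        Hausdorff_space_discrete_topology Hausdorff_spectrum)
  then show ?thesis
    using homeomorphic_Hausdorff_space homeomorphic_map_imp_homeomorphic_space[OF homeomorphic_map_graded_germ]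
    by blast
qed

end

section \<open>The semigroup algebra\<close>

text \<open>The linear extension of g from the point masses. The augmentation \<epsilon>, the
  transform \<open>gelf\<close> and the map \<Phi> are all of this form, so linearity is settled
  once for all of them.\<close>

definition lin :: "('s \<Rightarrow> complex) \<Rightarrow> ('s \<Rightarrow> complex) \<Rightarrow> complex" where
  "lin g x = (\<Sum>s | x s \<noteq> 0. x s * g s)"

lemma lin_eq_sum: "\<lbrakk>finite A; {s. x s \<noteq> 0} \<subseteq> A\<rbrakk> \<Longrightarrow> lin g x = (\<Sum>s\<in>A. x s * g s)"
  unfolding lin_def by (rule sum.mono_neutral_left) auto

lemma lin_cong: "(\<And>s. x s \<noteq> 0 \<Longrightarrow> g s = h s) \<Longrightarrow> lin g x = lin h x"
  by (simp add: lin_def)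

lemma lin_add:
  assumes "finite {s. x s \<noteq> 0}" "finite {s. y s \<noteq> 0}"
  shows "lin g (\<lambda>s. x s + y s) = lin g x + lin g y"
proof -
  let ?A = "{s. x s \<noteq> 0} \<union> {s. y s \<noteq> 0}"
  have "lin g (\<lambda>s. x s + y s) = (\<Sum>s\<in>?A. (x s + y s) * g s)" using assms by (intro lin_eq_sum) auto
  also have "\<dots> = (\<Sum>s\<in>?A. x s * g s) + (\<Sum>s\<in>?A. y s * g s)" by (simp add: distrib_right sum.distrib)
  also have "\<dots> = lin g x + lin g y" using assms by (subst (1 2) lin_eq_sum[of ?A]) auto
  finally show ?thesis .
qed

lemma lin_smult: "lin g (\<lambda>s. c * x s) = c * lin g x"
  by (cases "c = 0") (simp_all add: lin_def sum_distrib_left mult.assoc)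

lemma lin_zero: "lin g (\<lambda>_. 0) = 0"
  by (simp add: lin_def)

lemma lin_point_mass: "lin g (point_mass s) = g s"
  by (simp add: lin_def point_mass_def)

context inverse_semigroup0
begin

abbreviation "CS \<equiv> semigroup_algebra S"
abbreviation supp :: "('s \<Rightarrow> complex) \<Rightarrow> 's set" where "supp x \<equiv> {s. x s \<noteq> 0}"

lemma CS_carrier: "x \<in> carrier CS \<longleftrightarrow> finite (supp x) \<and> supp x \<subseteq> carrier S"
  and CS_zero: "\<zero>\<^bsub>CS\<^esub> = (\<lambda>_. 0)"
  and CS_add: "x \<oplus>\<^bsub>CS\<^esub> y = (\<lambda>s. x s + y s)"
  and CS_smult: "c \<odot>\<^bsub>CS\<^esub> x = (\<lambda>s. c * x s)"
  and CS_adj: "adj CS x = (\<lambda>s. if s \<in> carrier S then cnj (x (s\<^sup>\<star>)) else 0)"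
  by (simp_all add: semigroup_algebra_def)

lemma CS_mult:
  assumes "finite A" "finite B" "supp x \<subseteq> A" "supp y \<subseteq> B"
  shows "(x \<otimes>\<^bsub>CS\<^esub> y) u = (\<Sum>s\<in>A. \<Sum>t\<in>B. if s \<cdot> t = u then x s * y t else 0)"
proof -
  have "(x \<otimes>\<^bsub>CS\<^esub> y) u = (\<Sum>(s, t)\<in>{(s, t). x s \<noteq> 0 \<and> y t \<noteq> 0 \<and> s \<cdot> t = u}. x s * y t)"
    by (simp add: semigroup_algebra_def)
  also have "\<dots> = (\<Sum>(s, t)\<in>A \<times> B. if s \<cdot> t = u then x s * y t else 0)"
    using assms by (intro sum.mono_neutral_cong_left) (auto split: if_splits)
  finally show ?thesis by (simp add: sum.cartesian_product)
qed

lemma supp_mult: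
  assumes "x \<in> carrier CS" "y \<in> carrier CS"
  shows "supp (x \<otimes>\<^bsub>CS\<^esub> y) \<subseteq> (\<lambda>(s, t). s \<cdot> t) ` (supp x \<times> supp y)"
proof
  fix u assume "u \<in> supp (x \<otimes>\<^bsub>CS\<^esub> y)"
  then have ne: "(\<Sum>s\<in>supp x. \<Sum>t\<in>supp y. if s \<cdot> t = u then x s * y t else 0) \<noteq> 0"
    using CS_mult[of "supp x" "supp y"] assms by (simp add: CS_carrier)
  have "\<exists>s\<in>supp x. \<exists>t\<in>supp y. s \<cdot> t = u"
  proof (rule ccontr)
    assume "\<not> (\<exists>s\<in>supp x. \<exists>t\<in>supp y. s \<cdot> t = u)"
    then have "(\<Sum>s\<in>supp x. \<Sum>t\<in>supp y. if s \<cdot> t = u then x s * y t else 0) = 0"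
      by (intro sum.neutral ballI) auto
    then show False using ne by contradiction
  qed
  then show "u \<in> (\<lambda>(s, t). s \<cdot> t) ` (supp x \<times> supp y)" by auto
qed

lemma lin_mult:
  assumes "x \<in> carrier CS" "y \<in> carrier CS"
  shows "lin g (x \<otimes>\<^bsub>CS\<^esub> y) = (\<Sum>s\<in>supp x. \<Sum>t\<in>supp y. x s * y t * g (s \<cdot> t))"
proof -
  have fin: "finite (supp x)" "finite (supp y)" using assms by (auto simp: CS_carrier)
  let ?U = "(\<lambda>(s, t). s \<cdot> t) ` (supp x \<times> supp y)"
  have "lin g (x \<otimes>\<^bsub>CS\<^esub> y) = (\<Sum>u\<in>?U. (x \<otimes>\<^bsub>CS\<^esub> y) u * g u)"
    using supp_mult[OF assms] fin by (intro lin_eq_sum) auto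
  also have "\<dots> = (\<Sum>u\<in>?U. \<Sum>s\<in>supp x. \<Sum>t\<in>supp y. if u = s \<cdot> t then x s * y t * g u else 0)"
    using fin by (subst CS_mult[of "supp x" "supp y"])
      (auto simp: sum_distrib_right intro!: sum.cong)
  also have "\<dots> = (\<Sum>s\<in>supp x. \<Sum>u\<in>?U. \<Sum>t\<in>supp y. if u = s \<cdot> t then x s * y t * g u else 0)"
    by (rule sum.swap)
  also have "\<dots> = (\<Sum>s\<in>supp x. \<Sum>t\<in>supp y. \<Sum>u\<in>?U. if u = s \<cdot> t then x s * y t * g u else 0)"
    by (rule sum.cong[OF HOL.refl], rule sum.swap)
  also have "\<dots> = (\<Sum>s\<in>supp x. \<Sum>t\<in>supp y. x s * y t * g (s \<cdot> t))"
    using fin by (intro sum.cong HOL.refl) (force simp: sum.delta)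
  finally show ?thesis .
qed

lemma lin_mult_hom:
  assumes "x \<in> carrier CS" "y \<in> carrier CS"
    and "\<And>s t. \<lbrakk>s \<in> supp x; t \<in> supp y\<rbrakk> \<Longrightarrow> g (s \<cdot> t) = g s * g t"
  shows "lin g (x \<otimes>\<^bsub>CS\<^esub> y) = lin g x * lin g y"
proof -
  have "lin g (x \<otimes>\<^bsub>CS\<^esub> y) = (\<Sum>s\<in>supp x. \<Sum>t\<in>supp y. x s * y t * (g s * g t))"
    unfolding lin_mult[OF assms(1,2)] using assms(3) by (intro sum.cong HOL.refl) simp
  also have "\<dots> = lin g x * lin g y" unfolding lin_def by (simp add: sum_product algebra_simps)
  finally show ?thesis .
qed

lemma supp_adj:
  assumes "x \<in> carrier CS" shows "supp (adj CS x) = star ` supp x"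
proof -
  have c: "s \<in> carrier S" if "s \<in> supp x" for s using that assms by (auto simp: CS_carrier)
  show ?thesis
  proof (intro equalityI subsetI)
    fix s assume "s \<in> supp (adj CS x)"
    then have "s \<in> carrier S" "s\<^sup>\<star> \<in> supp x" by (simp_all add: CS_adj split: if_splits)
    then show "s \<in> star ` supp x" by (intro image_eqI[of _ _ "s\<^sup>\<star>"]) (simp_all add: sinv_sinv)
  next
    fix s assume "s \<in> star ` supp x"
    then obtain t where "t \<in> supp x" "s = t\<^sup>\<star>" by blast
    then show "s \<in> supp (adj CS x)" using c[of t] sinv(1)[of t] by (simp add: CS_adj sinv_sinv)
  qed
qed

lemma lin_adj:
  assumes "x \<in> carrier CS"
  shows "lin g (adj CS x) = (\<Sum>s\<in>supp x. cnj (x s) * g (s\<^sup>\<star>))"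
proof -
  have c: "s \<in> carrier S" if "s \<in> supp x" for s using that assms by (auto simp: CS_carrier)
  have inj: "inj_on star (supp x)" by (intro inj_onI) (metis c sinv_sinv)
  have "lin g (adj CS x) = (\<Sum>s\<in>star ` supp x. adj CS x s * g s)"
    unfolding lin_def supp_adj[OF assms] ..
  also have "\<dots> = (\<Sum>s\<in>supp x. cnj (x s) * g (s\<^sup>\<star>))"
    using c by (subst sum.reindex[OF inj]) (auto intro!: sum.cong simp: CS_adj sinv sinv_sinv)
  finally show ?thesis .
qed

lemma star_alg_CS: "star_alg CS"
proof -
  have fin_add: "finite (supp (\<lambda>s. x s + y s)) \<and> supp (\<lambda>s. x s + y s) \<subseteq> carrier S"
    if "x \<in> carrier CS" "y \<in> carrier CS" for x y :: "'s \<Rightarrow> complex"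
  proof -
    have "supp (\<lambda>s. x s + y s) \<subseteq> supp x \<union> supp y" by auto
    then show ?thesis using that finite_subset[OF _ finite_UnI] by (auto simp: CS_carrier)
  qed
  have ab: "abelian_group CS"
  proof (rule abelian_groupI)
    fix x assume x: "x \<in> carrier CS"
    show "\<exists>y\<in>carrier CS. y \<oplus>\<^bsub>CS\<^esub> x = \<zero>\<^bsub>CS\<^esub>"
      using x by (intro bexI[of _ "\<lambda>s. - x s"]) (auto simp: CS_carrier CS_add CS_zero)
  qed (auto simp: CS_carrier CS_add CS_zero fin_add algebra_simps)
  have mult_closed: "x \<otimes>\<^bsub>CS\<^esub> y \<in> carrier CS" if "x \<in> carrier CS" "y \<in> carrier CS" for x y
  proof -
    have "(\<lambda>(s, t). s \<cdot> t) ` (supp x \<times> supp y) \<subseteq> carrier S"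
      using that closed by (auto simp: CS_carrier)
    moreover have "finite ((\<lambda>(s, t). s \<cdot> t) ` (supp x \<times> supp y))"
      using that by (auto simp: CS_carrier)
    ultimately show ?thesis
      using supp_mult[OF that] unfolding CS_carrier by (blast intro: finite_subset)
  qed
  have l_distr: "(x \<oplus>\<^bsub>CS\<^esub> y) \<otimes>\<^bsub>CS\<^esub> z = x \<otimes>\<^bsub>CS\<^esub> z \<oplus>\<^bsub>CS\<^esub> y \<otimes>\<^bsub>CS\<^esub> z"
    if "x \<in> carrier CS" "y \<in> carrier CS" "z \<in> carrier CS" for x y z
  proof
    fix u
    let ?A = "supp x \<union> supp y" and ?B = "supp z"
    have fin: "finite ?A" "finite ?B" using that by (auto simp: CS_carrier)
    have m: "(w \<otimes>\<^bsub>CS\<^esub> z) u = (\<Sum>s\<in>?A. \<Sum>t\<in>?B. if s \<cdot> t = u then w s * z t else 0)" if "supp w \<subseteq> ?A" for w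
      by (rule CS_mult[OF fin that]) simp
    have "(x \<otimes>\<^bsub>CS\<^esub> z) u + (y \<otimes>\<^bsub>CS\<^esub> z) u = ((x \<oplus>\<^bsub>CS\<^esub> y) \<otimes>\<^bsub>CS\<^esub> z) u"
      by (subst (1 2 3) m) (auto simp: CS_add sum.distrib[symmetric] algebra_simps intro!: sum.cong)
    then show "((x \<oplus>\<^bsub>CS\<^esub> y) \<otimes>\<^bsub>CS\<^esub> z) u = (x \<otimes>\<^bsub>CS\<^esub> z \<oplus>\<^bsub>CS\<^esub> y \<otimes>\<^bsub>CS\<^esub> z) u" by (simp add: CS_add)
  qed
  have r_distr: "z \<otimes>\<^bsub>CS\<^esub> (x \<oplus>\<^bsub>CS\<^esub> y) = z \<otimes>\<^bsub>CS\<^esub> x \<oplus>\<^bsub>CS\<^esub> z \<otimes>\<^bsub>CS\<^esub> y"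
    if "x \<in> carrier CS" "y \<in> carrier CS" "z \<in> carrier CS" for x y z
  proof
    fix u
    let ?A = "supp z" and ?B = "supp x \<union> supp y"
    have fin: "finite ?A" "finite ?B" using that by (auto simp: CS_carrier)
    have m: "(z \<otimes>\<^bsub>CS\<^esub> w) u = (\<Sum>s\<in>?A. \<Sum>t\<in>?B. if s \<cdot> t = u then z s * w t else 0)" if "supp w \<subseteq> ?B" for w
      by (rule CS_mult[OF fin _ that]) simp
    have "(z \<otimes>\<^bsub>CS\<^esub> x) u + (z \<otimes>\<^bsub>CS\<^esub> y) u = (z \<otimes>\<^bsub>CS\<^esub> (x \<oplus>\<^bsub>CS\<^esub> y)) u"
      by (subst (1 2 3) m) (auto simp: CS_add sum.distrib[symmetric] algebra_simps intro!: sum.cong)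
    then show "(z \<otimes>\<^bsub>CS\<^esub> (x \<oplus>\<^bsub>CS\<^esub> y)) u = (z \<otimes>\<^bsub>CS\<^esub> x \<oplus>\<^bsub>CS\<^esub> z \<otimes>\<^bsub>CS\<^esub> y) u" by (simp add: CS_add)
  qed
  have smult_closed: "c \<odot>\<^bsub>CS\<^esub> x \<in> carrier CS" if "x \<in> carrier CS" for c x
    using that by (cases "c = 0") (auto simp: CS_carrier CS_smult)
  have adj_closed: "adj CS x \<in> carrier CS" if "x \<in> carrier CS" for x
    using that supp_adj[OF that] sinv by (auto simp: CS_carrier)
  have adj_adj: "adj CS (adj CS x) = x" if "x \<in> carrier CS" for x
    using that sinv(1) sinv_sinv by (auto simp: CS_adj CS_carrier fun_eq_iff)
  show ?thesis
    using ab mult_closed l_distr r_distr smult_closed adj_closed adj_adj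
    by (intro star_alg.intro star_alg_axioms.intro)
      (auto simp: CS_smult CS_add CS_adj sinv algebra_simps)
qed

end

sublocale inverse_semigroup0 \<subseteq> CS: star_alg CS
  by (rule star_alg_CS)

context inverse_semigroup0
begin

lemma CS_diff: "\<lbrakk>x \<in> carrier CS; y \<in> carrier CS\<rbrakk> \<Longrightarrow> x \<ominus>\<^bsub>CS\<^esub> y = (\<lambda>s. x s - y s)"
  by (simp add: a_minus_def CS.minus_smult CS_add CS_smult)

lemma point_mass_closed: "s \<in> carrier S \<Longrightarrow> point_mass s \<in> carrier CS"
  by (simp add: CS_carrier point_mass_def)

lemma point_mass_mult:
  assumes "s \<in> carrier S" "t \<in> carrier S"
  shows "point_mass s \<otimes>\<^bsub>CS\<^esub> point_mass t = point_mass (s \<cdot> t)"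
proof
  fix u show "(point_mass s \<otimes>\<^bsub>CS\<^esub> point_mass t) u = point_mass (s \<cdot> t) u"
    by (subst CS_mult[of "{s}" "{t}"]) (auto simp: point_mass_def)
qed

lemma point_mass_adj: "s \<in> carrier S \<Longrightarrow> adj CS (point_mass s) = point_mass (s\<^sup>\<star>)"
  using sinv sinv_sinv by (auto simp: CS_adj point_mass_def fun_eq_iff)

text \<open>For the projection e given by \<open>s\<^sup>\<star> \<cdot> s\<close> the C*-identity
  says that p(e) equals its own square, so p(e) is 0 or 1; the same identity for s says that p(e) is
  the square of p(s).\<close>

lemma seminorm_point_mass_le_1:
  assumes p: "cstar_seminorm CS p" and s: "s \<in> carrier S" shows "p (point_mass s) \<le> 1"
proof -
  interpret p: cstar_seminorm_alg CS p by unfold_locales (rule p)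
  have sq: "p (point_mass (t\<^sup>\<star> \<cdot> t)) = (p (point_mass t))\<^sup>2" if "t \<in> carrier S" for t
    using p.cstar_identity[OF point_mass_closed[OF that]] that sinv by (simp add: point_mass_adj point_mass_mult)
  have d: "s\<^sup>\<star> \<cdot> s \<in> idem S" using dom_idem[OF s] .
  have "p (point_mass (s\<^sup>\<star> \<cdot> s)) = (p (point_mass (s\<^sup>\<star> \<cdot> s)))\<^sup>2"
    using sq[OF idem_closed[OF d]] d by (simp add: sinv_idem idem_idem)
  then have "p (point_mass (s\<^sup>\<star> \<cdot> s)) \<le> 1"
    by (cases "p (point_mass (s\<^sup>\<star> \<cdot> s)) = 0") (auto simp: power2_eq_square)
  then have "(p (point_mass s))\<^sup>2 \<le> 1" using sq[OF s] by simp
  then show ?thesis using p.nonneg[OF point_mass_closed[OF s]] by (simp add: abs_square_le_1)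
qed

text \<open>The factors \<open>p (point_mass s)\<close> are kept instead of their bound 1, so that
  the term at the zero of S drops out for seminorms vanishing there.\<close>

lemma seminorm_le_sum:
  assumes p: "cstar_seminorm CS p"
  shows "\<lbrakk>finite A; A \<subseteq> carrier S; supp x \<subseteq> A\<rbrakk> \<Longrightarrow> p x \<le> (\<Sum>s\<in>A. cmod (x s) * p (point_mass s))"
proof (induction A arbitrary: x rule: finite_induct)
  interpret p: cstar_seminorm_alg CS p by unfold_locales (rule p)
  case empty
  then have "x = \<zero>\<^bsub>CS\<^esub>" by (auto simp: CS_zero)
  then show ?case using p.p_zero by simp
next
  interpret p: cstar_seminorm_alg CS p by unfold_locales (rule p)
  case (insert s A)
  let ?y = "x(s := 0)"
  have fin: "finite (supp ?y)" "supp ?y \<subseteq> A" using insert by (auto intro: finite_subset[of _ A])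
  then have y: "?y \<in> carrier CS" using insert.prems by (auto simp: CS_carrier)
  have pm: "point_mass s \<in> carrier CS" using insert.prems point_mass_closed by auto
  have "x = ?y \<oplus>\<^bsub>CS\<^esub> x s \<odot>\<^bsub>CS\<^esub> point_mass s" by (auto simp: CS_add CS_smult point_mass_def)
  then have "p x \<le> p ?y + p (x s \<odot>\<^bsub>CS\<^esub> point_mass s)"
    using p.triangle[OF y CS.smult_closed[OF pm]] by metis
  also have "p (x s \<odot>\<^bsub>CS\<^esub> point_mass s) = cmod (x s) * p (point_mass s)" using p.homogeneous[OF pm] .
  also have "p ?y \<le> (\<Sum>s\<in>A. cmod (?y s) * p (point_mass s))"
    by (rule insert.IH) (use insert.prems fin in blast)+
  also have "\<dots> = (\<Sum>s\<in>A. cmod (x s) * p (point_mass s))"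
    using insert.hyps by (intro sum.cong) auto
  finally show ?case using insert.hyps by (simp add: add.commute)
qed

lemma bounded_star_alg_CS: "bounded_star_alg CS"
proof unfold_locales
  fix x assume x: "x \<in> carrier CS"
  have "p x \<le> (\<Sum>s\<in>supp x. cmod (x s))" if p: "cstar_seminorm CS p" for p
  proof -
    have "p x \<le> (\<Sum>s\<in>supp x. cmod (x s) * p (point_mass s))"
      using seminorm_le_sum[OF p, of "supp x" x] x by (auto simp: CS_carrier)
    also have "\<dots> \<le> (\<Sum>s\<in>supp x. cmod (x s) * 1)"
      using seminorm_point_mass_le_1[OF p] x by (intro sum_mono mult_left_mono) (auto simp: CS_carrier)
    finally show ?thesis by simp
  qed
  then show "\<exists>M. \<forall>p. cstar_seminorm CS p \<longrightarrow> p x \<le> M" by blast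
qed

end

sublocale inverse_semigroup0 \<subseteq> CS: bounded_star_alg CS
  by (rule bounded_star_alg_CS)


section \<open>The contracted algebra\<close>

text \<open>The zero \<open>z\<close> of \<open>S\<close> is a central projection of \<open>CS\<close> with \<open>xz = \<epsilon>(x)z\<close>, and \<open>\<kappa>(x) = x - \<epsilon>(x)z\<close> splits
  off the summand \<open>\<complex>z\<close>.\<close>

context inverse_semigroup0
begin

abbreviation zz :: "'s \<Rightarrow> complex" where "zz \<equiv> point_mass (szero S)"

abbreviation \<epsilon> :: "('s \<Rightarrow> complex) \<Rightarrow> complex" where "\<epsilon> \<equiv> lin (\<lambda>_. 1)"

definition \<kappa> :: "('s \<Rightarrow> complex) \<Rightarrow> ('s \<Rightarrow> complex)" where
  "\<kappa> x = (\<lambda>s. x s - \<epsilon> x * zz s)"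

text \<open>The largest C*-seminorm vanishing at \<open>zz\<close>, see
  \<open>le_contracted_norm\<close>. It is given through \<kappa> rather than as a supremum, so that
  the C*-axioms come from pulling back along a *-homomorphism.\<close>

definition contracted_norm :: "('s \<Rightarrow> complex) \<Rightarrow> real" where
  "contracted_norm x = env_norm CS (\<kappa> x)"

lemma zz_closed: "zz \<in> carrier CS"
  by (simp add: point_mass_closed zero_closed)

lemma zz_adj: "adj CS zz = zz"
  by (simp add: point_mass_adj zero_closed sinv_zero)

lemma \<epsilon>_add: "\<lbrakk>x \<in> carrier CS; y \<in> carrier CS\<rbrakk> \<Longrightarrow> \<epsilon> (x \<oplus>\<^bsub>CS\<^esub> y) = \<epsilon> x + \<epsilon> y"
  and \<epsilon>_smult: "\<epsilon> (c \<odot>\<^bsub>CS\<^esub> x) = c * \<epsilon> x"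
  and \<epsilon>_mult: "\<lbrakk>x \<in> carrier CS; y \<in> carrier CS\<rbrakk> \<Longrightarrow> \<epsilon> (x \<otimes>\<^bsub>CS\<^esub> y) = \<epsilon> x * \<epsilon> y"
  and \<epsilon>_adj: "x \<in> carrier CS \<Longrightarrow> \<epsilon> (adj CS x) = cnj (\<epsilon> x)"
  and \<epsilon>_zz: "\<epsilon> zz = 1"
  by (simp_all add: CS_add CS_smult CS_carrier lin_add lin_smult lin_mult_hom lin_adj lin_point_mass)
    (simp add: lin_def)

lemma mult_zz: "x \<in> carrier CS \<Longrightarrow> x \<otimes>\<^bsub>CS\<^esub> zz = \<epsilon> x \<odot>\<^bsub>CS\<^esub> zz"
  and zz_mult: "x \<in> carrier CS \<Longrightarrow> zz \<otimes>\<^bsub>CS\<^esub> x = \<epsilon> x \<odot>\<^bsub>CS\<^esub> zz"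
proof -
  assume x: "x \<in> carrier CS"
  have c: "s \<in> carrier S" if "s \<in> supp x" for s using that x by (auto simp: CS_carrier)
  show "x \<otimes>\<^bsub>CS\<^esub> zz = \<epsilon> x \<odot>\<^bsub>CS\<^esub> zz"
  proof
    fix u show "(x \<otimes>\<^bsub>CS\<^esub> zz) u = (\<epsilon> x \<odot>\<^bsub>CS\<^esub> zz) u"
      using x c by (subst CS_mult[of "supp x" "{szero S}"])
        (auto simp: CS_carrier CS_smult lin_def point_mass_def mult_zero sum_distrib_right intro!: sum.cong)
  qed
  show "zz \<otimes>\<^bsub>CS\<^esub> x = \<epsilon> x \<odot>\<^bsub>CS\<^esub> zz"
  proof
    fix u show "(zz \<otimes>\<^bsub>CS\<^esub> x) u = (\<epsilon> x \<odot>\<^bsub>CS\<^esub> zz) u"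
      using x c by (subst CS_mult[of "{szero S}" "supp x"])
        (auto simp: CS_carrier CS_smult lin_def point_mass_def zero_mult sum_distrib_right intro!: sum.cong)
  qed
qed

lemma \<kappa>_eq: "x \<in> carrier CS \<Longrightarrow> \<kappa> x = x \<ominus>\<^bsub>CS\<^esub> \<epsilon> x \<odot>\<^bsub>CS\<^esub> zz"
  using CS_diff[of x "\<epsilon> x \<odot>\<^bsub>CS\<^esub> zz"] CS.smult_closed[OF zz_closed] by (simp add: \<kappa>_def CS_smult)

lemma \<kappa>_closed: "x \<in> carrier CS \<Longrightarrow> \<kappa> x \<in> carrier CS"
  by (simp add: \<kappa>_eq CS.diff_closed CS.smult_closed zz_closed)

lemma \<kappa>_decomp: "x \<in> carrier CS \<Longrightarrow> \<epsilon> x \<odot>\<^bsub>CS\<^esub> zz \<oplus>\<^bsub>CS\<^esub> \<kappa> x = x"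
  by (simp add: CS_add CS_smult \<kappa>_def)

lemma \<epsilon>_\<kappa>: "x \<in> carrier CS \<Longrightarrow> \<epsilon> (\<kappa> x) = 0"
proof -
  assume x: "x \<in> carrier CS"
  have "\<epsilon> x = \<epsilon> (\<epsilon> x \<odot>\<^bsub>CS\<^esub> zz \<oplus>\<^bsub>CS\<^esub> \<kappa> x)" by (simp add: \<kappa>_decomp x)
  also have "\<dots> = \<epsilon> x + \<epsilon> (\<kappa> x)"
    by (subst \<epsilon>_add) (simp_all add: x \<kappa>_closed CS.smult_closed zz_closed \<epsilon>_smult \<epsilon>_zz)
  finally show ?thesis by simp
qed

lemma \<kappa>_zz: "\<kappa> zz = \<zero>\<^bsub>CS\<^esub>"
  by (simp add: \<kappa>_def \<epsilon>_zz CS_zero)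

lemma \<kappa>_\<kappa>: "x \<in> carrier CS \<Longrightarrow> \<kappa> (\<kappa> x) = \<kappa> x"
  unfolding \<kappa>_def[of "\<kappa> x"] by (simp add: \<epsilon>_\<kappa>)

text \<open>Multiplicativity is the only real point. In the product of x = \<epsilon>(x) zz +
  \<kappa>(x) with the corresponding form of y, the cross term of \<open>zz\<close> with \<kappa>(y)
  vanishes because \<kappa>(y) has augmentation 0, and everything multiplied by \<open>zz\<close>
  from the right is a multiple of \<open>zz\<close> that \<epsilon> determines.\<close>

lemma star_hom_\<kappa>: "star_hom_alg CS CS \<kappa>"
proof unfold_locales
  have mult: "\<kappa> (x \<otimes>\<^bsub>CS\<^esub> y) = \<kappa> x \<otimes>\<^bsub>CS\<^esub> \<kappa> y" if x: "x \<in> carrier CS" and y: "y \<in> carrier CS" for x y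
  proof -
    note cl = x y \<kappa>_closed[OF x] \<kappa>_closed[OF y] zz_closed CS.smult_closed CS.m_closed
    have "x \<otimes>\<^bsub>CS\<^esub> y = (\<epsilon> x \<odot>\<^bsub>CS\<^esub> zz \<oplus>\<^bsub>CS\<^esub> \<kappa> x) \<otimes>\<^bsub>CS\<^esub> (\<epsilon> y \<odot>\<^bsub>CS\<^esub> zz \<oplus>\<^bsub>CS\<^esub> \<kappa> y)"
      by (simp add: \<kappa>_decomp x y)
    also have "\<dots> = (\<epsilon> x \<odot>\<^bsub>CS\<^esub> zz \<oplus>\<^bsub>CS\<^esub> \<kappa> x) \<otimes>\<^bsub>CS\<^esub> (\<epsilon> y \<odot>\<^bsub>CS\<^esub> zz) \<oplus>\<^bsub>CS\<^esub>
        (\<epsilon> x \<odot>\<^bsub>CS\<^esub> zz \<oplus>\<^bsub>CS\<^esub> \<kappa> x) \<otimes>\<^bsub>CS\<^esub> \<kappa> y"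
      by (simp add: cl CS.r_distr)
    also have "(\<epsilon> x \<odot>\<^bsub>CS\<^esub> zz \<oplus>\<^bsub>CS\<^esub> \<kappa> x) \<otimes>\<^bsub>CS\<^esub> \<kappa> y = (\<epsilon> x \<odot>\<^bsub>CS\<^esub> zz) \<otimes>\<^bsub>CS\<^esub> \<kappa> y \<oplus>\<^bsub>CS\<^esub> \<kappa> x \<otimes>\<^bsub>CS\<^esub> \<kappa> y"
      by (simp add: cl CS.l_distr)
    finally have *: "x \<otimes>\<^bsub>CS\<^esub> y = (\<epsilon> x \<odot>\<^bsub>CS\<^esub> zz \<oplus>\<^bsub>CS\<^esub> \<kappa> x) \<otimes>\<^bsub>CS\<^esub> (\<epsilon> y \<odot>\<^bsub>CS\<^esub> zz) \<oplus>\<^bsub>CS\<^esub>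
        ((\<epsilon> x \<odot>\<^bsub>CS\<^esub> zz) \<otimes>\<^bsub>CS\<^esub> \<kappa> y \<oplus>\<^bsub>CS\<^esub> \<kappa> x \<otimes>\<^bsub>CS\<^esub> \<kappa> y)" .
    \<comment> \<open>Compatibility of scalars with products is no axiom of \<open>star_alg\<close>,
      so it is computed from the coefficients.\<close>
    have sm: "x \<otimes>\<^bsub>CS\<^esub> (c \<odot>\<^bsub>CS\<^esub> y) = c \<odot>\<^bsub>CS\<^esub> (x \<otimes>\<^bsub>CS\<^esub> y)" "(c \<odot>\<^bsub>CS\<^esub> x) \<otimes>\<^bsub>CS\<^esub> y = c \<odot>\<^bsub>CS\<^esub> (x \<otimes>\<^bsub>CS\<^esub> y)"
      if "x \<in> carrier CS" "y \<in> carrier CS" for c x y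
    proof -
      have fin: "finite (supp x)" "finite (supp y)" using that by (auto simp: CS_carrier)
      have 1: "(x \<otimes>\<^bsub>CS\<^esub> y) u = (\<Sum>s\<in>supp x. \<Sum>t\<in>supp y. if s \<cdot> t = u then x s * y t else 0)" for u
        by (rule CS_mult) (use fin in auto)
      have 2: "(x \<otimes>\<^bsub>CS\<^esub> (c \<odot>\<^bsub>CS\<^esub> y)) u = (\<Sum>s\<in>supp x. \<Sum>t\<in>supp y. if s \<cdot> t = u then x s * (c * y t) else 0)" for u
        by (subst CS_mult[of "supp x" "supp y"]) (use fin in \<open>auto simp: CS_smult intro!: sum.cong\<close>)
      have 3: "((c \<odot>\<^bsub>CS\<^esub> x) \<otimes>\<^bsub>CS\<^esub> y) u = (\<Sum>s\<in>supp x. \<Sum>t\<in>supp y. if s \<cdot> t = u then c * x s * y t else 0)" for u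
        by (subst CS_mult[of "supp x" "supp y"]) (use fin in \<open>auto simp: CS_smult intro!: sum.cong\<close>)
      show "x \<otimes>\<^bsub>CS\<^esub> (c \<odot>\<^bsub>CS\<^esub> y) = c \<odot>\<^bsub>CS\<^esub> (x \<otimes>\<^bsub>CS\<^esub> y)" "(c \<odot>\<^bsub>CS\<^esub> x) \<otimes>\<^bsub>CS\<^esub> y = c \<odot>\<^bsub>CS\<^esub> (x \<otimes>\<^bsub>CS\<^esub> y)"
      proof -
        have 4: "(c \<odot>\<^bsub>CS\<^esub> (x \<otimes>\<^bsub>CS\<^esub> y)) u = c * (x \<otimes>\<^bsub>CS\<^esub> y) u" for u by (simp add: CS_smult)
        show "x \<otimes>\<^bsub>CS\<^esub> (c \<odot>\<^bsub>CS\<^esub> y) = c \<odot>\<^bsub>CS\<^esub> (x \<otimes>\<^bsub>CS\<^esub> y)"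
          by (rule ext) (simp only: 2 4 1 sum_distrib_left, auto intro!: sum.cong)
        show "(c \<odot>\<^bsub>CS\<^esub> x) \<otimes>\<^bsub>CS\<^esub> y = c \<odot>\<^bsub>CS\<^esub> (x \<otimes>\<^bsub>CS\<^esub> y)"
          by (rule ext) (simp only: 3 4 1 sum_distrib_left, auto intro!: sum.cong)
      qed
    qed
    have 1: "(\<epsilon> x \<odot>\<^bsub>CS\<^esub> zz \<oplus>\<^bsub>CS\<^esub> \<kappa> x) \<otimes>\<^bsub>CS\<^esub> (\<epsilon> y \<odot>\<^bsub>CS\<^esub> zz) = (\<epsilon> x * \<epsilon> y) \<odot>\<^bsub>CS\<^esub> zz"
      using x y by (simp add: \<kappa>_decomp sm mult_zz zz_closed) (simp add: CS_smult mult_ac)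
    have 2: "(\<epsilon> x \<odot>\<^bsub>CS\<^esub> zz) \<otimes>\<^bsub>CS\<^esub> \<kappa> y = \<zero>\<^bsub>CS\<^esub>"
      using x y by (simp add: sm zz_mult zz_closed \<kappa>_closed \<epsilon>_\<kappa> CS.zero_smult CS.smult_zero)
    have "x \<otimes>\<^bsub>CS\<^esub> y = (\<epsilon> x * \<epsilon> y) \<odot>\<^bsub>CS\<^esub> zz \<oplus>\<^bsub>CS\<^esub> \<kappa> x \<otimes>\<^bsub>CS\<^esub> \<kappa> y"
      by (subst *) (simp add: 1 2 cl)
    from fun_cong[OF this] have "(x \<otimes>\<^bsub>CS\<^esub> y) s = \<epsilon> x * \<epsilon> y * zz s + (\<kappa> x \<otimes>\<^bsub>CS\<^esub> \<kappa> y) s" for s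
      by (simp add: CS_add CS_smult)
    then show ?thesis by (auto simp: \<kappa>_def[of "x \<otimes>\<^bsub>CS\<^esub> y"] \<epsilon>_mult x y)
  qed
  have zz_star: "zz s = (if s \<in> carrier S then cnj (zz (s\<^sup>\<star>)) else 0)" for s
    using zz_adj by (metis CS_adj)
  show "star_hom CS CS \<kappa>"
    unfolding star_hom_def
  proof (intro conjI ballI allI)
    show "\<kappa> \<in> carrier CS \<rightarrow> carrier CS" using \<kappa>_closed by blast
    fix x assume x: "x \<in> carrier CS"
    show "\<kappa> (c \<odot>\<^bsub>CS\<^esub> x) = c \<odot>\<^bsub>CS\<^esub> \<kappa> x" for c
      by (simp add: \<kappa>_def \<epsilon>_smult) (simp add: CS_smult algebra_simps)
    show "\<kappa> (adj CS x) = adj CS (\<kappa> x)"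
    proof
      fix s show "\<kappa> (adj CS x) s = adj CS (\<kappa> x) s"
        using zz_star[of s] x by (cases "s \<in> carrier S") (simp_all add: \<kappa>_def \<epsilon>_adj, simp_all add: CS_adj)
    qed
    fix y assume y: "y \<in> carrier CS"
    show "\<kappa> (x \<oplus>\<^bsub>CS\<^esub> y) = \<kappa> x \<oplus>\<^bsub>CS\<^esub> \<kappa> y"
      using x y by (simp add: \<kappa>_def \<epsilon>_add) (simp add: CS_add algebra_simps)
    show "\<kappa> (x \<otimes>\<^bsub>CS\<^esub> y) = \<kappa> x \<otimes>\<^bsub>CS\<^esub> \<kappa> y" by (rule mult[OF x y])
  qed
qed

end

sublocale inverse_semigroup0 \<subseteq> \<kappa>: star_hom_alg CS CS \<kappa>
  by (rule star_hom_\<kappa>)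

context inverse_semigroup0
begin

lemma cstar_seminorm_contracted: "cstar_seminorm CS contracted_norm"
  unfolding contracted_norm_def by (rule \<kappa>.cstar_seminorm_pullback) (rule CS.cstar_seminorm_env_norm)

lemma contracted_norm_zz: "contracted_norm zz = 0"
  by (simp add: contracted_norm_def \<kappa>_zz CS.env.p_zero)

lemma contracted_norm_le: "x \<in> carrier CS \<Longrightarrow> contracted_norm x \<le> env_norm CS x"
  using CS.le_env_norm cstar_seminorm_contracted by blast

text \<open>Since x and \<kappa>(x) differ by a multiple of \<open>zz\<close>, where p vanishes,
  p(x) is at most p(\<kappa> x), and this is bounded by the envelope norm.\<close>

lemma le_contracted_norm:
  assumes p: "cstar_seminorm CS p" and z: "p zz = 0" and x: "x \<in> carrier CS"
  shows "p x \<le> contracted_norm x"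
proof -
  interpret p: cstar_seminorm_alg CS p by unfold_locales (rule p)
  have "p x \<le> p (\<epsilon> x \<odot>\<^bsub>CS\<^esub> zz) + p (\<kappa> x)"
    using p.triangle[of "\<epsilon> x \<odot>\<^bsub>CS\<^esub> zz" "\<kappa> x"] x
    by (simp add: \<kappa>_decomp \<kappa>_closed CS.smult_closed zz_closed)
  also have "p (\<epsilon> x \<odot>\<^bsub>CS\<^esub> zz) = 0" by (simp add: p.homogeneous zz_closed z)
  also have "p (\<kappa> x) \<le> env_norm CS (\<kappa> x)" using CS.le_env_norm[OF p \<kappa>_closed[OF x]] .
  finally show ?thesis by (simp add: contracted_norm_def)
qed


section \<open>Cosets of the line spanned by the zero\<close>

lemma contracted_norm_diff_le:
  "\<lbrakk>x \<in> carrier CS; y \<in> carrier CS\<rbrakk> \<Longrightarrow> contracted_norm (x \<ominus>\<^bsub>CS\<^esub> y) \<le> env_norm CS (x \<ominus>\<^bsub>CS\<^esub> y)"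
  by (simp add: contracted_norm_le CS.diff_closed)

definition contracted_class :: "(nat \<Rightarrow> 's \<Rightarrow> complex) \<Rightarrow> (nat \<Rightarrow> 's \<Rightarrow> complex) set set" where
  "contracted_class v = zero_ideal S +>\<^bsub>univ_cstar S\<^esub> env_class CS v"

text \<open>As c varies, the classes of these sequences are exactly the members of the coset of
  v.\<close>

abbreviation shift :: "complex \<Rightarrow> (nat \<Rightarrow> 's \<Rightarrow> complex) \<Rightarrow> nat \<Rightarrow> 's \<Rightarrow> complex" where
  "shift c v \<equiv> (\<lambda>n. c \<odot>\<^bsub>CS\<^esub> zz \<oplus>\<^bsub>CS\<^esub> v n)"

lemma Cauchy_czz: "CS.env.Cauchy_seq (\<lambda>_. c \<odot>\<^bsub>CS\<^esub> zz)"
  by (simp add: CS.env.Cauchy_seq_const CS.smult_closed zz_closed)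

lemma Cauchy_shift: "CS.env.Cauchy_seq v \<Longrightarrow> CS.env.Cauchy_seq (shift c v)"
  by (rule CS.env.Cauchy_seq_add[OF Cauchy_czz])

lemma zero_ideal_eq: "zero_ideal S = {env_class CS (\<lambda>_. c \<odot>\<^bsub>CS\<^esub> zz) |c. True}"
  by (simp add: zero_ideal_def univ_cstar_def univ_cstar_gen_def env_embed_def CS.env_smult
      CS.env.Cauchy_seq_const zz_closed)

lemma contracted_class_eq:
  assumes "CS.env.Cauchy_seq v" shows "contracted_class v = {env_class CS (shift c v) |c. True}"
proof -
  have "env_class CS (\<lambda>_. c \<odot>\<^bsub>CS\<^esub> zz) \<oplus>\<^bsub>univ_cstar S\<^esub> env_class CS v = env_class CS (shift c v)" for c
    by (simp add: univ_cstar_def CS.env_add[OF Cauchy_czz assms])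
  then show ?thesis by (auto simp: contracted_class_def a_r_coset_def' zero_ideal_eq)
qed

lemma Collect_add_complex: "{f (c + d) |c. True} = {f c |c. True}" for d :: complex
proof safe
  show "\<exists>c'. f c = f (c' + d) \<and> True" for c by (rule exI[of _ "c - d"]) simp
qed blast

lemma contracted_class_shift:
  assumes "CS.env.Cauchy_seq v" shows "contracted_class (shift d v) = contracted_class v"
proof -
  have eq: "shift c (shift d v) = shift (c + d) v" for c
    by (auto simp: CS_add CS_smult fun_eq_iff algebra_simps)
  have "contracted_class (shift d v) = {env_class CS (shift (c + d) v) |c. True}"
    by (simp add: contracted_class_eq[OF Cauchy_shift[OF assms]] eq)
  also have "\<dots> = {env_class CS (shift c v) |c. True}"
    by (rule Collect_add_complex)
  finally show ?thesis by (simp add: contracted_class_eq assms)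
qed

lemma contracted_class_self: "CS.env.Cauchy_seq v \<Longrightarrow> env_class CS v \<in> contracted_class v"
  by (auto simp: contracted_class_eq CS_add CS_smult intro!: exI[of _ 0])

sublocale contracted: cstar_seminorm_alg CS contracted_norm
  by unfold_locales (rule cstar_seminorm_contracted)

lemma contracted_Cauchy_iff:
  "contracted.Cauchy_seq u \<longleftrightarrow> range u \<subseteq> carrier CS \<and> CS.env.Cauchy_seq (\<kappa> \<circ> u)"
  by (auto simp: contracted.Cauchy_seq_def CS.env.Cauchy_seq_def contracted_norm_def \<kappa>.hom_diff \<kappa>_closed
      image_subset_iff)

lemma contracted_null_iff:
  "\<lbrakk>range u \<subseteq> carrier CS; range v \<subseteq> carrier CS\<rbrakk> \<Longrightarrow>
    contracted.null_diff u v \<longleftrightarrow> CS.env.null_diff (\<kappa> \<circ> u) (\<kappa> \<circ> v)"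
  by (simp add: contracted.null_diff_def CS.env.null_diff_def contracted_norm_def \<kappa>.hom_diff
      image_subset_iff)

definition contracted_conv :: "(nat \<Rightarrow> 's \<Rightarrow> complex) \<Rightarrow> (nat \<Rightarrow> 's \<Rightarrow> complex) set set \<Rightarrow> bool" where
  "contracted_conv u X \<longleftrightarrow> contracted.Cauchy_seq u \<and> X = contracted_class (\<kappa> \<circ> u)"

text \<open>The augmentation is a *-homomorphism to the complex numbers, so its modulus is a
  C*-seminorm and hence at most \<open>env_norm\<close>. It therefore takes Cauchy sequences to
  convergent ones.\<close>

lemma \<epsilon>_limit:
  assumes "CS.env.Cauchy_seq v" obtains c where "(\<lambda>n. \<epsilon> (v n)) \<longlonglongrightarrow> c"
proof -
  have "cstar_seminorm CS (\<lambda>x. cmod (\<epsilon> x))"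
    by (auto simp: cstar_seminorm_def \<epsilon>_add \<epsilon>_mult \<epsilon>_smult \<epsilon>_adj CS.adj_closed norm_mult norm_triangle_ineq
        power2_eq_square)
  then have le: "cmod (\<epsilon> x) \<le> env_norm CS x" if "x \<in> carrier CS" for x using CS.le_env_norm that by blast
  have "Cauchy (\<lambda>n. \<epsilon> (v n))"
  proof (rule metric_CauchyI)
    fix e :: real assume "e > 0"
    then obtain N where N: "\<forall>m\<ge>N. \<forall>n\<ge>N. env_norm CS (v m \<ominus>\<^bsub>CS\<^esub> v n) < e"
      using assms unfolding CS.env.Cauchy_seq_def by meson
    have "dist (\<epsilon> (v m)) (\<epsilon> (v n)) < e" if "m \<ge> N" "n \<ge> N" for m n
    proof -
      note cl = CS.env.Cauchy_seq_closed[OF assms, of m] CS.env.Cauchy_seq_closed[OF assms, of n]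
      have "\<epsilon> (v m \<ominus>\<^bsub>CS\<^esub> v n) = \<epsilon> (v m) - \<epsilon> (v n)"
        using cl by (simp add: a_minus_def CS.minus_smult \<epsilon>_add \<epsilon>_smult CS.smult_closed)
      then show ?thesis
        using le[OF CS.diff_closed[OF cl]] N[rule_format, OF that] by (simp add: dist_norm)
    qed
    then show "\<exists>M. \<forall>m\<ge>M. \<forall>n\<ge>M. dist (\<epsilon> (v m)) (\<epsilon> (v n)) < e" by blast
  qed
  then show thesis using that Cauchy_convergent convergent_def by blast
qed

text \<open>In the decomposition of \<open>v n\<close> into \<epsilon>(v n) zz and \<kappa>(v n) the
  first part converges to some c zz. Thus v is equivalent to
  \<open>shift c (\<kappa> \<circ> v)\<close>, which lies in the coset of
  \<open>\<kappa> \<circ> v\<close>.\<close>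

lemma contracted_class_\<kappa>:
  assumes v: "CS.env.Cauchy_seq v" shows "contracted_class v = contracted_class (\<kappa> \<circ> v)" and "CS.env.Cauchy_seq (\<kappa> \<circ> v)"
proof -
  note cl = CS.env.Cauchy_seq_closed[OF v]
  have vr: "range v \<subseteq> carrier CS" using cl by blast
  show \<kappa>v: "CS.env.Cauchy_seq (\<kappa> \<circ> v)"
  proof (rule CS.env.Cauchy_seq_dominated[of _ 1 v v])
    fix m n
    have "env_norm CS ((\<kappa> \<circ> v) m \<ominus>\<^bsub>CS\<^esub> (\<kappa> \<circ> v) n) = contracted_norm (v m \<ominus>\<^bsub>CS\<^esub> v n)"
      using cl by (simp add: contracted_norm_def \<kappa>.hom_diff)
    also have "\<dots> \<le> env_norm CS (v m \<ominus>\<^bsub>CS\<^esub> v n)" using cl by (intro contracted_norm_diff_le)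
    also have "\<dots> \<le> 1 * (env_norm CS (v m \<ominus>\<^bsub>CS\<^esub> v n) + env_norm CS (v m \<ominus>\<^bsub>CS\<^esub> v n))"
      using CS.env.nonneg[OF CS.diff_closed[OF cl cl]] by simp
    finally show "env_norm CS ((\<kappa> \<circ> v) m \<ominus>\<^bsub>CS\<^esub> (\<kappa> \<circ> v) n) \<le>
      1 * (env_norm CS (v m \<ominus>\<^bsub>CS\<^esub> v n) + env_norm CS (v m \<ominus>\<^bsub>CS\<^esub> v n))" .
  qed (use v cl \<kappa>_closed in auto)
  obtain c where c: "(\<lambda>n. \<epsilon> (v n)) \<longlonglongrightarrow> c" using \<epsilon>_limit[OF v] .
  have "CS.env.null_diff v (shift c (\<kappa> \<circ> v))"
  proof (rule CS.env.null_diffI)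
    show "range (shift c (\<kappa> \<circ> v)) \<subseteq> carrier CS"
      using cl by (auto simp: \<kappa>_closed CS.smult_closed zz_closed)
    have "(\<lambda>n. cmod (\<epsilon> (v n) - c) * env_norm CS zz) \<longlonglongrightarrow> cmod (c - c) * env_norm CS zz"
      by (intro tendsto_intros c)
    then show "(\<lambda>n. cmod (\<epsilon> (v n) - c) * env_norm CS zz) \<longlonglongrightarrow> 0" by simp
    fix n
    have "v n \<ominus>\<^bsub>CS\<^esub> shift c (\<kappa> \<circ> v) n = (\<epsilon> (v n) - c) \<odot>\<^bsub>CS\<^esub> zz"
    proof -
      have w: "shift c (\<kappa> \<circ> v) n \<in> carrier CS" using cl by (simp add: \<kappa>_closed CS.smult_closed zz_closed)
      show ?thesis
        by (rule ext) (simp only: CS_diff[OF cl w], simp add: CS_add CS_smult \<kappa>_def algebra_simps)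
    qed
    then show "env_norm CS (v n \<ominus>\<^bsub>CS\<^esub> shift c (\<kappa> \<circ> v) n) \<le> cmod (\<epsilon> (v n) - c) * env_norm CS zz"
      by (simp add: CS.env.homogeneous zz_closed)
  qed (rule vr)
  then have "env_class CS v = env_class CS (shift c (\<kappa> \<circ> v))"
    using CS.env_class_eq_iff[OF v Cauchy_shift[OF \<kappa>v]] by simp
  then have eq: "contracted_class v = contracted_class (shift c (\<kappa> \<circ> v))" by (simp only: contracted_class_def)
  show "contracted_class v = contracted_class (\<kappa> \<circ> v)" by (simp only: eq contracted_class_shift[OF \<kappa>v])
qed

text \<open>An element is determined by its images under \<epsilon> and \<kappa>, and both maps are
  multiplicative.\<close>

lemma CS_shift_mult:
  assumes "x \<in> carrier CS" "y \<in> carrier CS"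
  shows "(c \<odot>\<^bsub>CS\<^esub> zz \<oplus>\<^bsub>CS\<^esub> \<kappa> x) \<otimes>\<^bsub>CS\<^esub> (d \<odot>\<^bsub>CS\<^esub> zz \<oplus>\<^bsub>CS\<^esub> \<kappa> y) = (c * d) \<odot>\<^bsub>CS\<^esub> zz \<oplus>\<^bsub>CS\<^esub> \<kappa> (x \<otimes>\<^bsub>CS\<^esub> y)"
proof -
  let ?x = "c \<odot>\<^bsub>CS\<^esub> zz \<oplus>\<^bsub>CS\<^esub> \<kappa> x" and ?y = "d \<odot>\<^bsub>CS\<^esub> zz \<oplus>\<^bsub>CS\<^esub> \<kappa> y"
  note cl = CS.smult_closed[OF zz_closed] \<kappa>_closed[OF assms(1)] \<kappa>_closed[OF assms(2)]
  have xy: "?x \<in> carrier CS" "?y \<in> carrier CS" using cl by auto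
  have \<epsilon>: "\<epsilon> ?x = c" "\<epsilon> ?y = d" using cl assms by (simp_all add: \<epsilon>_add \<epsilon>_smult \<epsilon>_zz \<epsilon>_\<kappa>)
  have "\<kappa> ?x = \<kappa> x" "\<kappa> ?y = \<kappa> y" using \<kappa>_def[of ?x] \<kappa>_def[of ?y] \<epsilon> by (simp_all add: CS_add CS_smult)
  then have "\<kappa> (?x \<otimes>\<^bsub>CS\<^esub> ?y) = \<kappa> (x \<otimes>\<^bsub>CS\<^esub> y)" using xy assms by (simp add: \<kappa>.hom_mult)
  then show ?thesis using \<kappa>_decomp[OF CS.m_closed[OF xy]] \<epsilon> xy by (simp add: \<epsilon>_mult)
qed

text \<open>Scalar multiples, adjoints and products in the quotient are unions over all members of a
  coset, and a sum is the set of all sums of members, so each has to be controlled for every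
  \<open>shift c\<close>. The canonical member is the class of \<open>\<kappa> \<circ> u\<close>, on
  which the envelope norm is \<open>contracted_norm\<close> by definition.\<close>

theorem completion_contracted: "completion CS contracted_norm (contracted_cstar S) contracted_conv"
proof unfold_locales
  let ?B = "contracted_cstar S"
  have coset: "zero_ideal S +>\<^bsub>univ_cstar S\<^esub> env_class CS v = contracted_class v" for v by (simp add: contracted_class_def)
  have cd: "\<kappa> \<circ> u = (\<lambda>n. \<kappa> (u n))" for u by auto
  have carrier: "carrier ?B = {contracted_class v |v. CS.env.Cauchy_seq v}"
    by (auto simp: contracted_cstar_def cstar_quotient_def A_RCOSETS_def' univ_cstar_def CS.env_carrier contracted_class_def)
  have conv_iff: "contracted_conv u X \<longleftrightarrow> range u \<subseteq> carrier CS \<and> CS.env.Cauchy_seq (\<kappa> \<circ> u) \<and> X = contracted_class (\<kappa> \<circ> u)" for u X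
    by (auto simp: contracted_conv_def contracted_Cauchy_iff)
  show "contracted_conv u X \<Longrightarrow> contracted.Cauchy_seq u" for u X by (simp add: contracted_conv_def)
  show "contracted.Cauchy_seq u \<Longrightarrow> \<exists>X. contracted_conv u X" for u by (simp add: contracted_conv_def)
  show "contracted_conv u X \<Longrightarrow> X \<in> carrier ?B" for u X by (auto simp: conv_iff carrier)
  show "\<exists>u. contracted_conv u X" if XB: "X \<in> carrier ?B" for X
  proof -
    obtain v where v: "CS.env.Cauchy_seq v" "X = contracted_class v" using XB carrier by blast
    then show ?thesis using contracted_class_\<kappa>[OF v(1)] CS.env.Cauchy_seq_closed[OF v(1)]
      by (auto simp: conv_iff image_subset_iff)
  qed
  show "contracted_conv (\<lambda>_. \<zero>\<^bsub>CS\<^esub>) \<zero>\<^bsub>?B\<^esub>"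
  proof -
    have "zero_ideal S = contracted_class (\<lambda>_. \<zero>\<^bsub>CS\<^esub>)"
      by (subst contracted_class_eq) (simp_all add: zero_ideal_eq CS.env.Cauchy_seq_const CS.smult_closed zz_closed)
    then show ?thesis
      by (simp add: contracted_conv_def contracted.Cauchy_seq_const contracted_cstar_def cstar_quotient_def cd \<kappa>.hom_zero)
  qed
  fix u X assume "contracted_conv u X"
  then have ur: "range u \<subseteq> carrier CS" and u: "CS.env.Cauchy_seq (\<kappa> \<circ> u)" and X: "X = contracted_class (\<kappa> \<circ> u)"
    by (auto simp: conv_iff)
  then have ucl: "u n \<in> carrier CS" for n by blast
  have memX: "Y \<in> X \<longleftrightarrow> (\<exists>c. Y = env_class CS (shift c (\<kappa> \<circ> u)))" for Y
    by (auto simp: X contracted_class_eq[OF u])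
  show "contracted_conv (\<lambda>n. k \<odot>\<^bsub>CS\<^esub> u n) (k \<odot>\<^bsub>?B\<^esub> X)" for k
  proof -
    have eq: "(\<lambda>n. k \<odot>\<^bsub>CS\<^esub> shift c (\<kappa> \<circ> u) n) = shift (k * c) (\<kappa> \<circ> (\<lambda>n. k \<odot>\<^bsub>CS\<^esub> u n))" for c
      using ucl by (simp add: \<kappa>.hom_smult fun_eq_iff) (simp add: CS_add CS_smult algebra_simps)
    have k: "CS.env.Cauchy_seq (\<kappa> \<circ> (\<lambda>n. k \<odot>\<^bsub>CS\<^esub> u n))"
      using CS.env.Cauchy_seq_smult[OF u, of k] ucl by (simp add: cd \<kappa>.hom_smult)
    have "zero_ideal S +>\<^bsub>univ_cstar S\<^esub> (k \<odot>\<^bsub>univ_cstar S\<^esub> Y) = contracted_class (\<kappa> \<circ> (\<lambda>n. k \<odot>\<^bsub>CS\<^esub> u n))" if YX: "Y \<in> X" for Y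
    proof -
      obtain c where Y: "Y = env_class CS (shift c (\<kappa> \<circ> u))" using YX memX by blast
      have "k \<odot>\<^bsub>univ_cstar S\<^esub> Y = env_class CS (shift (k * c) (\<kappa> \<circ> (\<lambda>n. k \<odot>\<^bsub>CS\<^esub> u n)))"
        unfolding Y univ_cstar_def by (simp only: CS.env_smult[OF Cauchy_shift[OF u]] eq)
      then show ?thesis by (simp only: coset contracted_class_shift[OF k])
    qed
    note * = UN_eqI[OF contracted_class_self[OF u, folded X] this]
    have "k \<odot>\<^bsub>?B\<^esub> X = (\<Union>Y\<in>X. zero_ideal S +>\<^bsub>univ_cstar S\<^esub> (k \<odot>\<^bsub>univ_cstar S\<^esub> Y))"
      by (simp add: contracted_cstar_def cstar_quotient_def)
    also have "\<dots> = contracted_class (\<kappa> \<circ> (\<lambda>n. k \<odot>\<^bsub>CS\<^esub> u n))" by (rule *)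
    finally have "k \<odot>\<^bsub>?B\<^esub> X = contracted_class (\<kappa> \<circ> (\<lambda>n. k \<odot>\<^bsub>CS\<^esub> u n))" .
    then show ?thesis using k ucl by (auto simp: conv_iff CS.smult_closed)
  qed
  show "contracted_conv (\<lambda>n. adj CS (u n)) (adj ?B X)"
  proof -
    have eq: "(\<lambda>n. adj CS (shift c (\<kappa> \<circ> u) n)) = shift (cnj c) (\<kappa> \<circ> (\<lambda>n. adj CS (u n)))" for c
    proof
      fix n
      have "adj CS (c \<odot>\<^bsub>CS\<^esub> zz) = cnj c \<odot>\<^bsub>CS\<^esub> zz"
        using zz_adj by (auto simp: CS_adj CS_smult fun_eq_iff split: if_splits)
      then show "adj CS (shift c (\<kappa> \<circ> u) n) = shift (cnj c) (\<kappa> \<circ> (\<lambda>n. adj CS (u n))) n"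
        using ucl by (simp add: CS.adj_add CS.smult_closed zz_closed \<kappa>_closed \<kappa>.hom_adj)
    qed
    have k: "CS.env.Cauchy_seq (\<kappa> \<circ> (\<lambda>n. adj CS (u n)))"
      using CS.env.Cauchy_seq_adj[OF u] ucl by (simp add: cd \<kappa>.hom_adj)
    have "zero_ideal S +>\<^bsub>univ_cstar S\<^esub> (adj (univ_cstar S) Y) = contracted_class (\<kappa> \<circ> (\<lambda>n. adj CS (u n)))" if YX: "Y \<in> X" for Y
    proof -
      obtain c where Y: "Y = env_class CS (shift c (\<kappa> \<circ> u))" using YX memX by blast
      have "adj (univ_cstar S) Y = env_class CS (shift (cnj c) (\<kappa> \<circ> (\<lambda>n. adj CS (u n))))"
        unfolding Y univ_cstar_def by (simp only: CS.env_adj[OF Cauchy_shift[OF u]] eq)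
      then show ?thesis by (simp only: coset contracted_class_shift[OF k])
    qed
    note * = UN_eqI[OF contracted_class_self[OF u, folded X] this]
    have "adj ?B X = (\<Union>Y\<in>X. zero_ideal S +>\<^bsub>univ_cstar S\<^esub> adj (univ_cstar S) Y)"
      by (simp add: contracted_cstar_def cstar_quotient_def)
    also have "\<dots> = contracted_class (\<kappa> \<circ> (\<lambda>n. adj CS (u n)))" by (rule *)
    finally have "adj ?B X = contracted_class (\<kappa> \<circ> (\<lambda>n. adj CS (u n)))" .
    then show ?thesis using k ucl by (auto simp: conv_iff CS.adj_closed)
  qed
  show "(\<lambda>n. contracted_norm (u n)) \<longlonglongrightarrow> nrm ?B X"
  proof -
    let ?r = "nrm (univ_cstar S) (env_class CS (\<kappa> \<circ> u))"
    have lim: "(\<lambda>n. contracted_norm (u n)) \<longlonglongrightarrow> ?r"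
      using CS.env_nrm[OF u] by (simp add: contracted_norm_def univ_cstar_def)
    \<comment> \<open>Applying \<kappa> to a shifted sequence removes the multiple of
      \<open>zz\<close> and does not increase the norm, so the infimum defining the quotient norm is
      attained at c = 0.\<close>
    have le: "?r \<le> nrm (univ_cstar S) Y" if YX: "Y \<in> X" for Y
    proof -
      obtain c where Y: "Y = env_class CS (shift c (\<kappa> \<circ> u))" using YX memX by blast
      have lim': "(\<lambda>n. env_norm CS (shift c (\<kappa> \<circ> u) n)) \<longlonglongrightarrow> nrm (univ_cstar S) Y"
        using CS.env_nrm[OF Cauchy_shift[OF u]] by (simp add: Y univ_cstar_def)
      have "contracted_norm (u n) \<le> env_norm CS (shift c (\<kappa> \<circ> u) n)" for n
      proof -
        have cl: "c \<odot>\<^bsub>CS\<^esub> zz \<in> carrier CS" "\<kappa> (u n) \<in> carrier CS"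
          using ucl by (auto simp: CS.smult_closed zz_closed \<kappa>_closed)
        have "\<kappa> (shift c (\<kappa> \<circ> u) n) = \<kappa> (u n)"
          using cl ucl by (simp add: \<kappa>.hom_add \<kappa>_\<kappa> \<kappa>.hom_smult zz_closed \<kappa>_zz CS.smult_zero)
        then have "contracted_norm (u n) = contracted_norm (shift c (\<kappa> \<circ> u) n)" by (simp add: contracted_norm_def)
        then show ?thesis using contracted_norm_le cl by simp
      qed
      then show ?thesis using LIMSEQ_le[OF lim lim'] by blast
    qed
    have "nrm ?B X = Inf (nrm (univ_cstar S) ` X)" by (simp add: contracted_cstar_def cstar_quotient_def)
    also have "\<dots> = ?r"
      by (rule cInf_eq_minimum) (use contracted_class_self[OF u] le X in auto)
    finally show ?thesis using lim by simp
  qed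
  fix v Y assume "contracted_conv v Y"
  then have vr: "range v \<subseteq> carrier CS" and v: "CS.env.Cauchy_seq (\<kappa> \<circ> v)" and Y: "Y = contracted_class (\<kappa> \<circ> v)"
    by (auto simp: conv_iff)
  then have vcl: "v n \<in> carrier CS" for n by blast
  have memY: "Z \<in> Y \<longleftrightarrow> (\<exists>c. Z = env_class CS (shift c (\<kappa> \<circ> v)))" for Z
    by (auto simp: Y contracted_class_eq[OF v])
  show "(X = Y) = contracted.null_diff u v"
  proof
    assume "contracted.null_diff u v"
    then have "env_class CS (\<kappa> \<circ> u) = env_class CS (\<kappa> \<circ> v)"
      using CS.env_class_eq_iff[OF u v] contracted_null_iff[OF ur vr] by simp
    then show "X = Y" by (simp add: X Y contracted_class_def)
  next
    assume "X = Y"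
    \<comment> \<open>Membership in the coset yields some c for which \<kappa>(u n) and c zz +
      \<kappa>(v n) have null difference; one more application of \<kappa> kills c zz.\<close>
    then have "env_class CS (\<kappa> \<circ> u) \<in> Y" using contracted_class_self[OF u] X by simp
    then obtain c where c: "env_class CS (\<kappa> \<circ> u) = env_class CS (shift c (\<kappa> \<circ> v))" using memY by blast
    note nd = CS.env_class_eq_iff[OF u Cauchy_shift[OF v], THEN iffD1, OF c]
    show "contracted.null_diff u v"
    proof (rule contracted.null_diffI[OF ur vr])
      show "(\<lambda>n. env_norm CS ((\<kappa> \<circ> u) n \<ominus>\<^bsub>CS\<^esub> shift c (\<kappa> \<circ> v) n)) \<longlonglongrightarrow> 0"
        using nd by (simp add: CS.env.null_diff_def)
      fix n
      have cl: "c \<odot>\<^bsub>CS\<^esub> zz \<in> carrier CS" "\<kappa> (v n) \<in> carrier CS" "\<kappa> (u n) \<in> carrier CS"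
        using ucl vcl by (auto simp: CS.smult_closed zz_closed \<kappa>_closed)
      have "\<kappa> ((\<kappa> \<circ> u) n \<ominus>\<^bsub>CS\<^esub> shift c (\<kappa> \<circ> v) n) = \<kappa> (u n) \<ominus>\<^bsub>CS\<^esub> \<kappa> (v n)"
        using cl ucl vcl by (simp add: \<kappa>.hom_diff \<kappa>.hom_add \<kappa>_\<kappa> \<kappa>.hom_smult zz_closed \<kappa>_zz CS.smult_zero)
      then have "contracted_norm (u n \<ominus>\<^bsub>CS\<^esub> v n) = contracted_norm ((\<kappa> \<circ> u) n \<ominus>\<^bsub>CS\<^esub> shift c (\<kappa> \<circ> v) n)"
        using ucl vcl by (simp add: contracted_norm_def \<kappa>.hom_diff)
      then show "contracted_norm (u n \<ominus>\<^bsub>CS\<^esub> v n) \<le> env_norm CS ((\<kappa> \<circ> u) n \<ominus>\<^bsub>CS\<^esub> shift c (\<kappa> \<circ> v) n)"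
        using contracted_norm_le cl by (simp add: CS.diff_closed)
    qed
  qed
  show "contracted_conv (\<lambda>n. u n \<oplus>\<^bsub>CS\<^esub> v n) (X \<oplus>\<^bsub>?B\<^esub> Y)"
  proof -
    let ?w = "\<kappa> \<circ> (\<lambda>n. u n \<oplus>\<^bsub>CS\<^esub> v n)"
    have w: "CS.env.Cauchy_seq ?w"
      using CS.env.Cauchy_seq_add[OF u v] ucl vcl by (simp add: cd \<kappa>.hom_add)
    have "(\<lambda>n. shift c (\<kappa> \<circ> u) n \<oplus>\<^bsub>CS\<^esub> shift d (\<kappa> \<circ> v) n) = shift (c + d) ?w" for c d
      using ucl vcl by (simp add: \<kappa>.hom_add fun_eq_iff) (simp add: CS_add CS_smult algebra_simps)
    then have add: "env_class CS (shift c (\<kappa> \<circ> u)) \<oplus>\<^bsub>univ_cstar S\<^esub> env_class CS (shift d (\<kappa> \<circ> v)) = env_class CS (shift (c + d) ?w)" for c d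
      using CS.env_add[OF Cauchy_shift[OF u] Cauchy_shift[OF v], folded univ_cstar_def] by simp
    have "X \<oplus>\<^bsub>?B\<^esub> Y = {Z \<oplus>\<^bsub>univ_cstar S\<^esub> Z' |Z Z'. Z \<in> X \<and> Z' \<in> Y}"
      by (auto simp: contracted_cstar_def cstar_quotient_def set_add_def' )
    also have "\<dots> = {env_class CS (shift (c + d) ?w) |c d. True}"
    proof -
      define E E' W where "E c = env_class CS (shift c (\<kappa> \<circ> u))" and "E' c = env_class CS (shift c (\<kappa> \<circ> v))"
        and "W c = env_class CS (shift c ?w)" for c
      have "Z \<in> X \<longleftrightarrow> (\<exists>c. Z = E c)" "Z \<in> Y \<longleftrightarrow> (\<exists>c. Z = E' c)" for Z
        using memX memY by (simp_all only: E_def E'_def)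
      moreover have "E c \<oplus>\<^bsub>univ_cstar S\<^esub> E' d = W (c + d)" for c d by (simp only: add E_def E'_def W_def)
      ultimately have "{Z \<oplus>\<^bsub>univ_cstar S\<^esub> Z' |Z Z'. Z \<in> X \<and> Z' \<in> Y} = {W (c + d) |c d. True}"
        by (intro equalityI subsetI; simp only: mem_Collect_eq; metis)
      then show ?thesis by (simp only: W_def)
    qed
    \<comment> \<open>The sums c + d already run through all complex numbers, so the set of sums is
      a full coset.\<close>
    also have "\<dots> = {env_class CS (shift c ?w) |c. True}"
      using Collect_add_complex[of "\<lambda>c. env_class CS (shift c ?w)"] by blast
    also have "\<dots> = contracted_class ?w" by (simp add: contracted_class_eq w)
    finally show ?thesis using w ucl vcl by (auto simp: conv_iff)
  qed
  show "contracted_conv (\<lambda>n. u n \<otimes>\<^bsub>CS\<^esub> v n) (X \<otimes>\<^bsub>?B\<^esub> Y)"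
  proof -
    let ?w = "\<kappa> \<circ> (\<lambda>n. u n \<otimes>\<^bsub>CS\<^esub> v n)"
    have w: "CS.env.Cauchy_seq ?w"
      using CS.env.Cauchy_seq_mult[OF u v] ucl vcl by (simp add: cd \<kappa>.hom_mult)
    have "(\<lambda>n. shift c (\<kappa> \<circ> u) n \<otimes>\<^bsub>CS\<^esub> shift d (\<kappa> \<circ> v) n) = shift (c * d) ?w" for c d
      using ucl vcl CS_shift_mult by (simp add: fun_eq_iff)
    then have mult: "env_class CS (shift c (\<kappa> \<circ> u)) \<otimes>\<^bsub>univ_cstar S\<^esub> env_class CS (shift d (\<kappa> \<circ> v)) = env_class CS (shift (c * d) ?w)" for c d
      using CS.env_mult[OF Cauchy_shift[OF u] Cauchy_shift[OF v], folded univ_cstar_def] by simp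
    have *: "zero_ideal S +>\<^bsub>univ_cstar S\<^esub> (Z \<otimes>\<^bsub>univ_cstar S\<^esub> Z') = contracted_class ?w" if ZZ: "Z \<in> X" "Z' \<in> Y" for Z Z'
    proof -
      obtain c where Z: "Z = env_class CS (shift c (\<kappa> \<circ> u))" using ZZ(1) memX by blast
      obtain d where Z': "Z' = env_class CS (shift d (\<kappa> \<circ> v))" using ZZ(2) memY by blast
      show ?thesis by (simp only: Z Z' mult coset contracted_class_shift[OF w])
    qed
    have "X \<otimes>\<^bsub>?B\<^esub> Y = (\<Union>Z\<in>X. \<Union>Z'\<in>Y. zero_ideal S +>\<^bsub>univ_cstar S\<^esub> (Z \<otimes>\<^bsub>univ_cstar S\<^esub> Z'))"
      by (simp add: contracted_cstar_def cstar_quotient_def rcoset_mult_def)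
    also have "\<dots> = contracted_class ?w"
      by (rule UN_eqI[OF contracted_class_self[OF u, folded X] UN_eqI[OF contracted_class_self[OF v, folded Y] *]])
    finally have "X \<otimes>\<^bsub>?B\<^esub> Y = contracted_class ?w" .
    then show ?thesis using w ucl vcl by (auto simp: conv_iff CS.m_closed)
  qed
qed

lemma contracted_conv_gen:
  assumes s: "s \<in> carrier S" shows "contracted_conv (\<lambda>_. point_mass s) (contracted_gen S s)"
proof -
  note c = CS.env.Cauchy_seq_const[OF point_mass_closed[OF s]]
  have "contracted_gen S s = contracted_class (\<lambda>_. point_mass s)"
    by (simp add: contracted_gen_def contracted_class_def univ_cstar_gen_def env_embed_def)
  also have "\<dots> = contracted_class (\<kappa> \<circ> (\<lambda>_. point_mass s))" using contracted_class_\<kappa>(1)[OF c] .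
  finally show ?thesis
    by (simp add: contracted_conv_def contracted.Cauchy_seq_const point_mass_closed s)
qed

end


section \<open>Seminorms on the idempotents\<close>

context inverse_semigroup0
begin

text \<open>The Gelfand transform on combinations of idempotents; the value 0 off the spectrum is
  the convention of \<open>C0\<close>. Characters are \<open>undefined\<close> outside E(S), which
  is why the lemmas restrict the support of y to E(S).\<close>

definition gelf :: "('s \<Rightarrow> complex) \<Rightarrow> ('s \<Rightarrow> nat) \<Rightarrow> complex" where
  "gelf y \<phi> = (if \<phi> \<in> characters S then lin (\<lambda>e. of_nat (\<phi> e)) y else 0)"

lemma gelf_mult:
  assumes "x \<in> carrier CS" "supp x \<subseteq> idem S" "y \<in> carrier CS" "supp y \<subseteq> idem S"
  shows "gelf (x \<otimes>\<^bsub>CS\<^esub> y) \<phi> = gelf x \<phi> * gelf y \<phi>"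
  unfolding gelf_def using assms by (auto simp: subset_iff char_mult intro!: lin_mult_hom)

lemma gelf_adj:
  assumes "x \<in> carrier CS" "supp x \<subseteq> idem S" shows "gelf (adj CS x) \<phi> = cnj (gelf x \<phi>)"
  using assms(2) by (simp add: gelf_def lin_adj[OF assms(1)])
    (auto simp: lin_def sinv_idem subset_iff intro!: sum.cong)

lemma gelf_point_mass: "gelf (point_mass e) = indicator (DD S e)" if "e \<in> idem S"
  using char_01[OF _ that] by (fastforce simp: gelf_def lin_point_mass DD_def fun_eq_iff indicator_def)

text \<open>The characters \<open>f \<mapsto> [f \<ge> e]\<close> recover the coefficients of a combination of idempotents.\<close>

lemma principal_character:
  assumes e: "e \<in> idem S" "e \<noteq> szero S"
  shows "(\<lambda>f\<in>idem S. if e \<cdot> f = e then 1 else 0) \<in> characters S"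
proof -
  have eq: "e \<cdot> (f \<cdot> g) = e \<longleftrightarrow> e \<cdot> f = e \<and> e \<cdot> g = e" if "f \<in> idem S" "g \<in> idem S" for f g
  proof -
    note c = idem_closed[OF e(1)] idem_closed[OF that(1)] idem_closed[OF that(2)]
    have fg: "f \<cdot> g \<cdot> f = f \<cdot> g" "f \<cdot> g \<cdot> g = f \<cdot> g"
    proof -
      have "f \<cdot> g \<cdot> f = f \<cdot> (f \<cdot> g)" using c idem_comm[OF that] by (metis assoc)
      then show "f \<cdot> g \<cdot> f = f \<cdot> g" using idem_left_idem[OF that(1) c(3)] by simp
      show "f \<cdot> g \<cdot> g = f \<cdot> g" using c that by (simp add: assoc idem_idem)
    qed
    show ?thesis
    proof
      assume h: "e \<cdot> (f \<cdot> g) = e"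
      have "e \<cdot> f = e \<cdot> (f \<cdot> g \<cdot> f)" using h c by (metis assoc closed)
      moreover have "e \<cdot> g = e \<cdot> (f \<cdot> g \<cdot> g)" using h c by (metis assoc closed)
      ultimately show "e \<cdot> f = e \<and> e \<cdot> g = e" using h by (simp add: fg)
    next
      assume "e \<cdot> f = e \<and> e \<cdot> g = e"
      then show "e \<cdot> (f \<cdot> g) = e" using c by (simp add: assoc[symmetric])
    qed
  qed
  show ?thesis
    using e by (auto simp: characters_def idem_mult_idem zero_idem idem_closed mult_zero eq idem_idem
        intro!: bexI[of _ e])
qed

text \<open>Moebius inversion in F. At the principal character of e the transform is the sum of the
  \<open>y f\<close> over all f in F above e; solving for \<open>y e\<close> and inserting the
  bounds for the f strictly above e gives K, by induction on the number of elements above e. The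
  zero is excluded because its principal function is constantly 1 and hence no character.\<close>

lemma coeff_bound:
  assumes F: "finite F" "F \<subseteq> idem S" and e: "e \<in> F" "e \<noteq> szero S"
  shows "\<exists>K\<ge>0. \<forall>y M. supp y \<subseteq> F \<longrightarrow> (\<forall>\<phi>. cmod (gelf y \<phi>) \<le> M) \<longrightarrow> cmod (y e) \<le> K * M"
  using e
proof (induction "card {f \<in> F. e \<cdot> f = e}" arbitrary: e rule: less_induct)
  case less
  let ?up = "\<lambda>e. {f \<in> F. e \<cdot> f = e}"
  have eE: "e \<in> idem S" using less.prems F by auto
  have up: "\<exists>K\<ge>0. \<forall>y M. supp y \<subseteq> F \<longrightarrow> (\<forall>\<phi>. cmod (gelf y \<phi>) \<le> M) \<longrightarrow> cmod (y f) \<le> K * M"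
    if f: "f \<in> ?up e - {e}" for f
  proof (rule less.hyps)
    have fE: "f \<in> idem S" using f F by auto
    have "?up f \<subseteq> ?up e"
    proof safe
      fix g assume g: "g \<in> F" "f \<cdot> g = f"
      have "e \<cdot> g = e \<cdot> f \<cdot> g" using f by simp
      also have "\<dots> = e \<cdot> (f \<cdot> g)" using idem_closed eE fE g F by (intro assoc) auto
      finally show "e \<cdot> g = e" using g f by simp
    qed
    moreover have "e \<notin> ?up f" using f idem_comm[OF eE fE] by auto
    moreover have "e \<in> ?up e" using less.prems idem_idem[OF eE] by simp
    ultimately have "?up f \<subset> ?up e" by blast
    then show "card (?up f) < card (?up e)" using F by (intro psubset_card_mono) auto
    show "f \<in> F" using f by simp
    show "f \<noteq> szero S" using f less.prems idem_closed[OF eE] by (auto simp: mult_zero)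
  qed
  have "\<exists>K. \<forall>f\<in>?up e - {e}. K f \<ge> 0 \<and>
      (\<forall>y M. supp y \<subseteq> F \<longrightarrow> (\<forall>\<phi>. cmod (gelf y \<phi>) \<le> M) \<longrightarrow> cmod (y f) \<le> K f * M)"
    using up by (intro bchoice ballI)
  then obtain K where K: "\<And>f. f \<in> ?up e - {e} \<Longrightarrow> K f \<ge> 0"
    "\<And>f y M. \<lbrakk>f \<in> ?up e - {e}; supp y \<subseteq> F; \<forall>\<phi>. cmod (gelf y \<phi>) \<le> M\<rbrakk> \<Longrightarrow> cmod (y f) \<le> K f * M"
    by blast
  let ?K = "1 + (\<Sum>f\<in>?up e - {e}. K f)"
  have "cmod (y e) \<le> ?K * M" if y: "supp y \<subseteq> F" and M: "\<forall>\<phi>. cmod (gelf y \<phi>) \<le> M" for y M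
  proof -
    let ?\<phi> = "\<lambda>f\<in>idem S. if e \<cdot> f = e then 1 else 0"
    have "gelf y ?\<phi> = (\<Sum>f\<in>F. y f * of_nat (?\<phi> f))"
      using principal_character[OF eE less.prems(2)] F y by (simp add: gelf_def lin_eq_sum)
    also have "\<dots> = (\<Sum>f\<in>?up e. y f)"
      using F by (intro sum.mono_neutral_cong_right) auto
    also have "\<dots> = y e + (\<Sum>f\<in>?up e - {e}. y f)"
      using F less.prems idem_idem[OF eE] by (intro sum.remove) auto
    finally have "cmod (y e) = cmod (gelf y ?\<phi> - (\<Sum>f\<in>?up e - {e}. y f))" by simp
    also have "\<dots> \<le> cmod (gelf y ?\<phi>) + cmod (\<Sum>f\<in>?up e - {e}. y f)" by (rule norm_triangle_ineq4)
    also have "\<dots> \<le> M + (\<Sum>f\<in>?up e - {e}. K f * M)"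
      using M K(2)[OF _ y M] by (intro add_mono sum_norm_le) auto
    also have "(\<Sum>f\<in>?up e - {e}. K f * M) = (\<Sum>f\<in>?up e - {e}. K f) * M" by (simp only: sum_distrib_right)
    finally show ?thesis by (simp only: distrib_right mult_1)
  qed
  moreover have "?K \<ge> 0" using K(1) by (intro add_nonneg_nonneg sum_nonneg) auto
  ultimately show ?case by blast
qed

text \<open>Adjoining an idempotent e to a closed set F only requires e itself and the products e f
  with f in F, because idempotents commute and e e = e.\<close>

lemma finite_subsemilattice:
  assumes "finite T" "T \<subseteq> idem S"
  obtains F where "finite F" "T \<subseteq> F" "F \<subseteq> idem S" "\<And>e f. \<lbrakk>e \<in> F; f \<in> F\<rbrakk> \<Longrightarrow> e \<cdot> f \<in> F"
proof -
  have "\<exists>F. finite F \<and> T \<subseteq> F \<and> F \<subseteq> idem S \<and> (\<forall>e\<in>F. \<forall>f\<in>F. e \<cdot> f \<in> F)"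
    using assms
  proof (induction T rule: finite_induct)
    case (insert e T)
    then obtain F where F: "finite F" "T \<subseteq> F" "F \<subseteq> idem S" "\<forall>e\<in>F. \<forall>f\<in>F. e \<cdot> f \<in> F"
      by (metis insert_subset)
    have e: "e \<in> idem S" using insert.prems by simp
    let ?F = "F \<union> insert e ((\<cdot>) e ` F)"
    have c: "f \<in> idem S" if "f \<in> F" for f using that F by auto
    have mult: "f \<cdot> g \<in> ?F" if fg: "f \<in> ?F" "g \<in> ?F" for f g
    proof -
      have 1: "f \<cdot> (e \<cdot> g) = e \<cdot> (f \<cdot> g)" if "f \<in> F" "g \<in> F" for f g
        using that c e idem_left_comm idem_closed by metis
      have 2: "e \<cdot> f \<cdot> g = e \<cdot> (f \<cdot> g)" if "f \<in> F" "g \<in> F" for f g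
        using that c e assoc idem_closed by metis
      have 3: "e \<cdot> f \<cdot> (e \<cdot> g) = e \<cdot> (f \<cdot> g)" if "f \<in> F" "g \<in> F" for f g
      proof -
        have "e \<cdot> f \<cdot> (e \<cdot> g) = e \<cdot> (f \<cdot> (e \<cdot> g))"
          using that c e idem_closed closed by (intro assoc) auto
        also have "\<dots> = e \<cdot> (f \<cdot> g)" using 1[OF that] that c e idem_left_idem idem_closed closed by metis
        finally show ?thesis .
      qed
      have 4: "f \<cdot> e = e \<cdot> f" "e \<cdot> f \<cdot> e = e \<cdot> f" "e \<cdot> (e \<cdot> f) = e \<cdot> f" if "f \<in> F" for f
        using idem_comm[OF c[OF that] e] idem_comm[OF idem_mult_idem[OF e c[OF that]] e]
          idem_left_idem[OF e idem_closed[OF c[OF that]]] by simp_all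
      have mem: "x \<in> ?F" "e \<cdot> x \<in> ?F" if "x \<in> F" for x using that by auto
      have \<Phi>: "x \<cdot> y \<in> F" if "x \<in> F" "y \<in> F" for x y using that F(4) by blast
      have a: "x \<cdot> (e \<cdot> y) \<in> ?F" "e \<cdot> x \<cdot> y \<in> ?F" "e \<cdot> x \<cdot> (e \<cdot> y) \<in> ?F" "x \<cdot> y \<in> ?F"
        if "x \<in> F" "y \<in> F" for x y
        unfolding 1[OF that] 2[OF that] 3[OF that] using mem[OF \<Phi>[OF that]] by blast+
      have b: "x \<cdot> e \<in> ?F" "e \<cdot> x \<cdot> e \<in> ?F" "e \<cdot> (e \<cdot> x) \<in> ?F" if "x \<in> F" for x
        using mem(2)[OF that] by (simp_all only: 4[OF that])
      have ee: "e \<cdot> e \<in> ?F" using idem_idem[OF e] by simp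
      consider "f \<in> F" | "f = e" | x where "x \<in> F" "f = e \<cdot> x" using fg(1) by blast
      then show ?thesis
      proof cases
        case 1
        consider "g \<in> F" | "g = e" | y where "y \<in> F" "g = e \<cdot> y" using fg(2) by blast
        then show ?thesis using a b(1) 1 by cases (simp_all only:)
      next
        case 2
        consider "g \<in> F" | "g = e" | y where "y \<in> F" "g = e \<cdot> y" using fg(2) by blast
        then show ?thesis using mem(2) ee b(3) 2 by cases (simp_all only:)
      next
        case (3 x)
        consider "g \<in> F" | "g = e" | y where "y \<in> F" "g = e \<cdot> y" using fg(2) by blast
        then show ?thesis using a b(2) 3 by cases (simp_all only:)
      qed
    qed
    have "finite ?F" using F(1) by simp
    moreover have "insert e T \<subseteq> ?F" using F(2) by blast
    moreover have "?F \<subseteq> idem S" using F(3) e idem_mult_idem[OF e c] by blast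
    ultimately show ?case using mult by (intro exI[of _ ?F] conjI ballI)
  qed auto
  then show thesis using that by blast
qed

text \<open>On the finite-dimensional span of a finite semilattice \<open>F\<close> any \<open>p\<close> is dominated by a multiple \<open>K\<close> of
  the sup norm, and \<open>K\<close> disappears on taking \<open>2\<^sup>n\<close>-th powers by means of the \<open>C\<^sup>*\<close>-identity.\<close>

lemma seminorm_le_gelf:
  assumes p: "cstar_seminorm CS p" and z: "p zz = 0"
    and y: "y \<in> carrier CS" "supp y \<subseteq> idem S" and M: "\<And>\<phi>. cmod (gelf y \<phi>) \<le> M"
  shows "p y \<le> M"
proof -
  interpret p: cstar_seminorm_alg CS p by unfold_locales (rule p)
  obtain F where F: "finite F" "supp y \<subseteq> F" "F \<subseteq> idem S" "\<And>e f. \<lbrakk>e \<in> F; f \<in> F\<rbrakk> \<Longrightarrow> e \<cdot> f \<in> F"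
    using finite_subsemilattice[of "supp y"] y by (auto simp: CS_carrier)
  have FS: "F \<subseteq> carrier S" using F(3) idem_closed by auto
  have "\<exists>K. \<forall>e\<in>F - {szero S}. K e \<ge> 0 \<and>
      (\<forall>y M. supp y \<subseteq> F \<longrightarrow> (\<forall>\<phi>. cmod (gelf y \<phi>) \<le> M) \<longrightarrow> cmod (y e) \<le> K e * M)"
    using coeff_bound[OF F(1,3)] by (intro bchoice ballI) blast
  then obtain K where K: "\<And>e. e \<in> F - {szero S} \<Longrightarrow> K e \<ge> 0"
    "\<And>e y M. \<lbrakk>e \<in> F - {szero S}; supp y \<subseteq> F; \<forall>\<phi>. cmod (gelf y \<phi>) \<le> M\<rbrakk> \<Longrightarrow> cmod (y e) \<le> K e * M"
    by blast
  define K' where "K' = (\<Sum>e\<in>F - {szero S}. K e)"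
  \<comment> \<open>Characters give no control over the coefficient at the zero of S; the assumption
    on \<open>zz\<close> removes its term from the sum.\<close>
  have weak: "p x \<le> K' * M" if x: "supp x \<subseteq> F" and M: "\<forall>\<phi>. cmod (gelf x \<phi>) \<le> M" for x M
  proof -
    have "p x \<le> (\<Sum>s\<in>F. cmod (x s) * p (point_mass s))" by (rule seminorm_le_sum[OF p F(1) FS x])
    also have "\<dots> = (\<Sum>s\<in>F - {szero S}. cmod (x s) * p (point_mass s))"
      using F(1) z by (intro sum.mono_neutral_right) auto
    also have "\<dots> \<le> (\<Sum>s\<in>F - {szero S}. K s * M)"
    proof (rule sum_mono)
      fix s assume s: "s \<in> F - {szero S}"
      have "cmod (x s) * p (point_mass s) \<le> cmod (x s) * 1"
        using seminorm_point_mass_le_1[OF p] s FS by (intro mult_left_mono) auto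
      then show "cmod (x s) * p (point_mass s) \<le> K s * M" using K(2)[OF s x M] by simp
    qed
    finally show ?thesis by (simp add: K'_def sum_distrib_right)
  qed
  have inF: "supp x \<subseteq> F \<Longrightarrow> x \<in> carrier CS \<and> supp x \<subseteq> idem S" for x :: "'s \<Rightarrow> complex"
    using FS F(1,3) by (auto simp: CS_carrier intro: finite_subset)
  \<comment> \<open>Passing from x to \<open>adj CS x \<otimes> x\<close> squares p by the
    C*-identity and squares the sup norm of the transform, while the support stays in F. So the same
    constant K' serves for all k.\<close>
  define pow where "pow k = ((\<lambda>x. adj CS x \<otimes>\<^bsub>CS\<^esub> x) ^^ k) y" for k
  have pow: "supp (pow k) \<subseteq> F \<and> p (pow k) = p y ^ 2 ^ k \<and> (\<forall>\<phi>. cmod (gelf (pow k) \<phi>) \<le> M ^ 2 ^ k)" for k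
  proof (induction k)
    case 0 then show ?case using F(2) M by (simp add: pow_def)
  next
    case (Suc k)
    let ?x = "pow k"
    have x: "?x \<in> carrier CS" "supp ?x \<subseteq> idem S" using inF Suc by blast+
    have sa: "supp (adj CS ?x) = supp ?x"
      using supp_adj[OF x(1)] x(2) sinv_idem by (force simp: image_iff)
    have eq: "pow (Suc k) = adj CS ?x \<otimes>\<^bsub>CS\<^esub> ?x" by (simp add: pow_def)
    have "supp (pow (Suc k)) \<subseteq> F"
      using supp_mult[OF CS.adj_closed[OF x(1)] x(1)] Suc F(4) unfolding eq sa by fastforce
    moreover have "p (pow (Suc k)) = p y ^ 2 ^ Suc k"
      using Suc x by (simp add: eq p.cstar_identity power_mult[symmetric] mult.commute)
    moreover have "cmod (gelf (pow (Suc k)) \<phi>) \<le> M ^ 2 ^ Suc k" for \<phi>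
    proof -
      have "cmod (gelf (pow (Suc k)) \<phi>) = (cmod (gelf ?x \<phi>))\<^sup>2"
        using x sa by (simp add: eq gelf_mult CS.adj_closed gelf_adj norm_mult power2_eq_square)
      also have "\<dots> \<le> (M ^ 2 ^ k)\<^sup>2" using Suc by (intro power_mono) auto
      also have "\<dots> = M ^ 2 ^ Suc k" by (simp add: power_mult[symmetric] mult.commute)
      finally show ?thesis .
    qed
    ultimately show ?case by blast
  qed
  have M0: "M \<ge> 0" using M order_trans norm_ge_zero by blast
  have bound: "p y ^ 2 ^ k \<le> K' * M ^ 2 ^ k" for k
    using weak[of "pow k" "M ^ 2 ^ k"] pow[of k] by simp
  show ?thesis
  proof (rule ccontr)
    assume "\<not> p y \<le> M"
    then have lt: "M < p y" by simp
    show False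
    proof (cases "M = 0")
      case True
      then show ?thesis using bound[of 0] lt by simp
    next
      case False
      then have Mpos: "M > 0" using M0 by simp
      then have r: "p y / M > 1" using lt by simp
      \<comment> \<open>Since n is at most 2^n and the base exceeds 1, the exponent may be raised to
        2^n, which contradicts \<open>bound\<close> at n.\<close>
      obtain n where n: "K' < (p y / M) ^ n" using real_arch_pow[OF r] by blast
      also have "\<dots> \<le> (p y / M) ^ 2 ^ n" using r by (intro power_increasing) (auto intro: less_imp_le)
      also have "\<dots> \<le> K'" using bound[of n] Mpos by (simp add: power_divide field_simps)
      finally show False by simp
    qed
  qed
qed

end

section \<open>Functions vanishing at infinity\<close>

lemma continuous_map_binop:
  fixes h :: "'a::topological_space \<Rightarrow> 'b::topological_space \<Rightarrow> 'c::topological_space"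
  assumes "continuous_map X euclidean f" "continuous_map X euclidean g" "continuous_on UNIV (\<lambda>p. h (fst p) (snd p))"
  shows "continuous_map X euclidean (\<lambda>x. h (f x) (g x))"
proof -
  have "continuous_map X (prod_topology euclidean euclidean) (\<lambda>x. (f x, g x))"
    using assms by (intro continuous_map_pairedI)
  moreover have "continuous_map (prod_topology euclidean euclidean) euclidean (\<lambda>p. h (fst p) (snd p))"
    using assms(3) by simp
  ultimately have "continuous_map X euclidean ((\<lambda>p. h (fst p) (snd p)) \<circ> (\<lambda>x. (f x, g x)))"
    by (rule continuous_map_compose)
  then show ?thesis by (simp add: o_def)
qed

lemma continuous_map_unop:
  fixes h :: "'a::topological_space \<Rightarrow> 'b::topological_space"
  assumes "continuous_map X euclidean f" "continuous_on UNIV h"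
  shows "continuous_map X euclidean (\<lambda>x. h (f x))"
  using continuous_map_compose[OF assms(1), of euclidean h] assms(2) by (simp add: o_def)

lemma continuous_map_metric_iff:
  fixes f :: "'x \<Rightarrow> 'm::metric_space"
  shows "continuous_map X euclidean f \<longleftrightarrow>
    (\<forall>x\<in>topspace X. \<forall>e>0. \<exists>U. openin X U \<and> x \<in> U \<and> (\<forall>y\<in>U. dist (f y) (f x) < e))"
proof (intro iffI ballI allI impI)
  fix x and e :: real assume f: "continuous_map X euclidean f" and x: "x \<in> topspace X" "e > 0"
  have "openin X {y \<in> topspace X. f y \<in> ball (f x) e}"
    using f by (rule openin_continuous_map_preimage) simp
  then show "\<exists>U. openin X U \<and> x \<in> U \<and> (\<forall>y\<in>U. dist (f y) (f x) < e)"
    using x by (intro exI[of _ "{y \<in> topspace X. f y \<in> ball (f x) e}"]) (auto simp: dist_commute)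
next
  assume *: "\<forall>x\<in>topspace X. \<forall>e>0. \<exists>U. openin X U \<and> x \<in> U \<and> (\<forall>y\<in>U. dist (f y) (f x) < e)"
  show "continuous_map X euclidean f"
    unfolding continuous_map_def
  proof (intro conjI allI impI)
    fix W :: "'m set" assume "openin euclidean W"
    then have W: "open W" by simp
    show "openin X {x \<in> topspace X. f x \<in> W}"
    proof (subst openin_subopen, intro ballI)
      fix x assume x: "x \<in> {x \<in> topspace X. f x \<in> W}"
      then obtain e where e: "e > 0" and eW: "\<forall>z. dist z (f x) < e \<longrightarrow> z \<in> W"
        using W unfolding open_dist by auto
      obtain U where "openin X U" "x \<in> U" "\<forall>y\<in>U. dist (f y) (f x) < e" using *[rule_format, of x e] x e by auto
      then show "\<exists>T. openin X T \<and> x \<in> T \<and> T \<subseteq> {x \<in> topspace X. f x \<in> W}"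
        using openin_subset[of X U] eW by (intro exI[of _ U]) auto
    qed
  qed auto
qed

section \<open>The algebra C0(X) and its norm\<close>

lemma C0_carrier: "f \<in> carrier (C0 X) \<longleftrightarrow> continuous_map X euclidean f \<and>
    (\<forall>\<epsilon>>0. compactin X {x \<in> topspace X. \<epsilon> \<le> cmod (f x)}) \<and> (\<forall>x. x \<notin> topspace X \<longrightarrow> f x = 0)"
  and C0_mult: "f \<otimes>\<^bsub>C0 X\<^esub> g = (\<lambda>x. f x * g x)"
  and C0_zero: "\<zero>\<^bsub>C0 X\<^esub> = (\<lambda>_. 0)"
  and C0_add: "f \<oplus>\<^bsub>C0 X\<^esub> g = (\<lambda>x. f x + g x)"
  and C0_smult: "c \<odot>\<^bsub>C0 X\<^esub> f = (\<lambda>x. c * f x)"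
  and C0_adj: "adj (C0 X) f = (\<lambda>x. cnj (f x))"
  and C0_nrm: "nrm (C0 X) f = Sup (insert 0 ((\<lambda>x. cmod (f x)) ` topspace X))"
  by (simp_all add: C0_def)

text \<open>It suffices that each superlevel set lies in some compact set: continuity makes the
  superlevel set closed, and closed subsets of compact sets are compact.\<close>

lemma C0I:
  assumes "continuous_map X euclidean g" "\<And>x. x \<notin> topspace X \<Longrightarrow> g x = 0"
    and "\<And>e. e > 0 \<Longrightarrow> \<exists>K. compactin X K \<and> (\<forall>x\<in>topspace X. e \<le> cmod (g x) \<longrightarrow> x \<in> K)"
  shows "g \<in> carrier (C0 X)"
  unfolding C0_carrier
proof (intro conjI allI impI)
  fix e :: real assume "e > 0"
  then obtain K where K: "compactin X K" "\<forall>x\<in>topspace X. e \<le> cmod (g x) \<longrightarrow> x \<in> K" using assms(3) by blast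
  have "closed {z. e \<le> cmod z}" by (intro closed_Collect_le continuous_intros)
  then have "closedin X {x \<in> topspace X. g x \<in> {z. e \<le> cmod z}}"
    by (intro closedin_continuous_map_preimage[OF assms(1)]) simp
  then show "compactin X {x \<in> topspace X. e \<le> cmod (g x)}"
    using closed_compactin[OF K(1)] K(2) by (simp add: subset_iff)
qed (use assms in auto)

lemma C0_vanish: "\<lbrakk>f \<in> carrier (C0 X); x \<notin> topspace X\<rbrakk> \<Longrightarrow> f x = 0"
  and C0_continuous: "f \<in> carrier (C0 X) \<Longrightarrow> continuous_map X euclidean f"
  and C0_compact: "\<lbrakk>f \<in> carrier (C0 X); e > 0\<rbrakk> \<Longrightarrow> compactin X {x \<in> topspace X. e \<le> cmod (f x)}"
  by (auto simp: C0_carrier)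

lemma C0_dominated:
  assumes f: "f \<in> carrier (C0 X)" and g: "continuous_map X euclidean g" and le: "\<And>x. cmod (g x) \<le> M * cmod (f x)"
  shows "g \<in> carrier (C0 X)"
proof (rule C0I[OF g])
  show "g x = 0" if "x \<notin> topspace X" for x using le[of x] C0_vanish[OF f that] by simp
  fix e :: real assume e: "e > 0"
  let ?d = "e / (\<bar>M\<bar> + 1)"
  have d: "?d > 0" using e by (simp add: add_nonneg_pos)
  have "?d \<le> cmod (f x)" if "e \<le> cmod (g x)" for x
  proof -
    have "e \<le> M * cmod (f x)" using that le[of x] by linarith
    also have "\<dots> \<le> (\<bar>M\<bar> + 1) * cmod (f x)" by (intro mult_right_mono) auto
    finally show ?thesis by (simp add: field_simps)
  qed
  then show "\<exists>K. compactin X K \<and> (\<forall>x\<in>topspace X. e \<le> cmod (g x) \<longrightarrow> x \<in> K)"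
    using C0_compact[OF f d] by blast
qed

lemma C0_bounded:
  assumes f: "f \<in> carrier (C0 X)" obtains M where "M \<ge> 0" "\<And>x. cmod (f x) \<le> M"
proof -
  have "compact (f ` {x \<in> topspace X. 1 \<le> cmod (f x)})"
    using image_compactin[OF C0_compact[OF f] C0_continuous[OF f], of 1] by simp
  then have "bounded (f ` {x \<in> topspace X. 1 \<le> cmod (f x)})" by (rule compact_imp_bounded)
  then obtain B where "\<forall>z\<in>f ` {x \<in> topspace X. 1 \<le> cmod (f x)}. cmod z \<le> B" unfolding bounded_iff ..
  then have B: "cmod (f x) \<le> B" if "x \<in> topspace X" "1 \<le> cmod (f x)" for x using that by blast
  have "cmod (f x) \<le> max 1 B" for x
    using B[of x] C0_vanish[OF f, of x] by (cases "x \<in> topspace X") force+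
  then show thesis using that[of "max 1 B"] by simp
qed

lemma C0_nrm_le: "\<lbrakk>\<And>x. cmod (f x) \<le> M; M \<ge> 0\<rbrakk> \<Longrightarrow> nrm (C0 X) f \<le> M"
  unfolding C0_nrm by (rule cSup_least) auto

lemma norm_le_C0_nrm:
  assumes f: "f \<in> carrier (C0 X)" shows "cmod (f x) \<le> nrm (C0 X) f"
proof -
  obtain M where M: "M \<ge> 0" "\<And>x. cmod (f x) \<le> M" using C0_bounded[OF f] by blast
  have bdd: "bdd_above (insert 0 ((\<lambda>x. cmod (f x)) ` topspace X))"
    using M by (intro bdd_aboveI[of _ M]) auto
  show ?thesis unfolding C0_nrm
    by (cases "x \<in> topspace X") (auto simp: C0_vanish[OF f] intro!: cSup_upper bdd)
qed

lemma star_alg_C0: "star_alg (C0 X)"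
proof -
  have add: "(\<lambda>x. f x + g x) \<in> carrier (C0 X)" if f: "f \<in> carrier (C0 X)" and g: "g \<in> carrier (C0 X)" for f g
  proof (rule C0I)
    show "continuous_map X euclidean (\<lambda>x. f x + g x)"
      by (rule continuous_map_binop[OF C0_continuous[OF f] C0_continuous[OF g]]) (intro continuous_intros)
    fix e :: real assume "e > 0"
    then have "compactin X ({x \<in> topspace X. e / 2 \<le> cmod (f x)} \<union> {x \<in> topspace X. e / 2 \<le> cmod (g x)})"
      using C0_compact[OF f, of "e / 2"] C0_compact[OF g, of "e / 2"] by (intro compactin_Un) auto
    moreover have "e / 2 \<le> cmod (f x) \<or> e / 2 \<le> cmod (g x)" if "e \<le> cmod (f x + g x)" for x
      using that norm_triangle_ineq[of "f x" "g x"] by linarith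
    ultimately show "\<exists>K. compactin X K \<and> (\<forall>x\<in>topspace X. e \<le> cmod (f x + g x) \<longrightarrow> x \<in> K)" by blast
  qed (simp add: C0_vanish[OF f] C0_vanish[OF g])
  have smult: "(\<lambda>x. c * f x) \<in> carrier (C0 X)" if f: "f \<in> carrier (C0 X)" for c f
    by (rule C0_dominated[OF f continuous_map_unop[OF C0_continuous[OF f]], of _ "cmod c"])
      (auto simp: norm_mult intro!: continuous_intros)
  have mult: "(\<lambda>x. f x * g x) \<in> carrier (C0 X)" if f: "f \<in> carrier (C0 X)" and g: "g \<in> carrier (C0 X)" for f g
  proof -
    obtain M where M: "M \<ge> 0" "\<And>x. cmod (f x) \<le> M" using C0_bounded[OF f] by blast
    show ?thesis
    proof (rule C0_dominated[OF g])
      show "continuous_map X euclidean (\<lambda>x. f x * g x)"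
        by (rule continuous_map_binop[OF C0_continuous[OF f] C0_continuous[OF g]]) (intro continuous_intros)
      show "cmod (f x * g x) \<le> M * cmod (g x)" for x using M by (simp add: norm_mult mult_right_mono)
    qed
  qed
  have cnj: "(\<lambda>x. cnj (f x)) \<in> carrier (C0 X)" if f: "f \<in> carrier (C0 X)" for f
    by (rule C0_dominated[OF f continuous_map_unop[OF C0_continuous[OF f]], of _ 1])
      (auto intro!: continuous_intros)
  have zero: "(\<lambda>_. 0) \<in> carrier (C0 X)" by (simp add: C0_carrier)
  have ab: "abelian_group (C0 X)"
  proof (rule abelian_groupI)
    fix f assume "f \<in> carrier (C0 X)"
    then show "\<exists>g\<in>carrier (C0 X). g \<oplus>\<^bsub>C0 X\<^esub> f = \<zero>\<^bsub>C0 X\<^esub>"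
      using smult[of f "-1"] by (intro bexI[of _ "\<lambda>x. - f x"]) (auto simp: C0_add C0_zero)
  qed (auto simp: C0_add C0_zero add zero algebra_simps)
  then show ?thesis
    using smult mult cnj add
    by (intro star_alg.intro star_alg_axioms.intro)
      (auto simp: C0_add C0_mult C0_smult C0_adj algebra_simps)
qed

lemma cstar_seminorm_C0: "cstar_seminorm (C0 X) (nrm (C0 X))"
proof -
  interpret C0: star_alg "C0 X" by (rule star_alg_C0)
  have nn: "0 \<le> nrm (C0 X) f" if "f \<in> carrier (C0 X)" for f
    using norm_le_C0_nrm[OF that] order_trans norm_ge_zero by blast
  show ?thesis
    unfolding cstar_seminorm_def
  proof (intro conjI ballI allI)
    fix f assume f: "f \<in> carrier (C0 X)"
    show "0 \<le> nrm (C0 X) f" using nn[OF f] .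
    note le = norm_le_C0_nrm[OF f]
    show "nrm (C0 X) (c \<odot>\<^bsub>C0 X\<^esub> f) = cmod c * nrm (C0 X) f" for c
    proof (rule antisym)
      show "nrm (C0 X) (c \<odot>\<^bsub>C0 X\<^esub> f) \<le> cmod c * nrm (C0 X) f"
        using le nn[OF f] by (intro C0_nrm_le) (auto simp: C0_smult norm_mult intro!: mult_left_mono)
      show "cmod c * nrm (C0 X) f \<le> nrm (C0 X) (c \<odot>\<^bsub>C0 X\<^esub> f)"
      proof (cases "c = 0")
        case True then show ?thesis using nn[OF C0.smult_closed[OF f]] by simp
      next
        case False
        have "nrm (C0 X) f \<le> nrm (C0 X) (c \<odot>\<^bsub>C0 X\<^esub> f) / cmod c"
          using norm_le_C0_nrm[OF C0.smult_closed[OF f], of c] nn[OF C0.smult_closed[OF f]] False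
          by (intro C0_nrm_le) (auto simp: C0_smult norm_mult field_simps)
        then show ?thesis using False by (simp add: field_simps)
      qed
    qed
    have cl: "adj (C0 X) f \<otimes>\<^bsub>C0 X\<^esub> f \<in> carrier (C0 X)" using f by (simp add: C0.m_closed C0.adj_closed)
    show "nrm (C0 X) (adj (C0 X) f \<otimes>\<^bsub>C0 X\<^esub> f) = (nrm (C0 X) f)\<^sup>2"
    proof (rule antisym)
      show "nrm (C0 X) (adj (C0 X) f \<otimes>\<^bsub>C0 X\<^esub> f) \<le> (nrm (C0 X) f)\<^sup>2"
        using le nn[OF f] by (intro C0_nrm_le) (auto simp: C0_mult C0_adj norm_mult power2_eq_square intro!: mult_mono)
      have "nrm (C0 X) f \<le> sqrt (nrm (C0 X) (adj (C0 X) f \<otimes>\<^bsub>C0 X\<^esub> f))"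
        using norm_le_C0_nrm[OF cl] nn[OF cl]
        by (intro C0_nrm_le real_le_rsqrt) (auto simp: C0_mult C0_adj norm_mult power2_eq_square)
      then have "(nrm (C0 X) f)\<^sup>2 \<le> (sqrt (nrm (C0 X) (adj (C0 X) f \<otimes>\<^bsub>C0 X\<^esub> f)))\<^sup>2"
        using nn[OF f] by (intro power_mono)
      then show "(nrm (C0 X) f)\<^sup>2 \<le> nrm (C0 X) (adj (C0 X) f \<otimes>\<^bsub>C0 X\<^esub> f)" using nn[OF cl] by simp
    qed
    fix g assume g: "g \<in> carrier (C0 X)"
    note le' = norm_le_C0_nrm[OF g]
    show "nrm (C0 X) (f \<oplus>\<^bsub>C0 X\<^esub> g) \<le> nrm (C0 X) f + nrm (C0 X) g"
      using le le' nn[OF f] nn[OF g]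
      by (intro C0_nrm_le) (auto simp: C0_add intro: norm_triangle_mono)
    show "nrm (C0 X) (f \<otimes>\<^bsub>C0 X\<^esub> g) \<le> nrm (C0 X) f * nrm (C0 X) g"
      using le le' nn[OF f] nn[OF g]
      by (intro C0_nrm_le) (auto simp: C0_mult norm_mult intro!: mult_mono)
  qed
qed

interpretation C0: cstar_seminorm_alg "C0 X" "nrm (C0 X)" for X :: "'x topology"
  by (intro cstar_seminorm_alg.intro star_alg_C0 cstar_seminorm_alg_axioms.intro cstar_seminorm_C0)

lemma C0_diff: "\<lbrakk>f \<in> carrier (C0 X); g \<in> carrier (C0 X)\<rbrakk> \<Longrightarrow> f \<ominus>\<^bsub>C0 X\<^esub> g = (\<lambda>x. f x - g x)"
  by (simp add: a_minus_def C0.minus_smult C0_add C0_smult)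

text \<open>Norm-Cauchy sequences are uniformly Cauchy, so they have a pointwise limit that is
  approached uniformly; continuity and vanishing at infinity pass to uniform limits.\<close>

lemma C0_complete:
  assumes u: "C0.Cauchy_seq X u"
  shows "\<exists>f\<in>carrier (C0 X). C0.null_diff X u (\<lambda>_. f)"
proof -
  have cl: "u n \<in> carrier (C0 X)" for n using C0.Cauchy_seq_closed[OF u] .
  have le: "cmod (u m x - u n x) \<le> nrm (C0 X) (u m \<ominus>\<^bsub>C0 X\<^esub> u n)" for m n x
    using norm_le_C0_nrm[OF C0.diff_closed[OF cl cl], of m n x] by (simp add: C0_diff cl)
  have unif: "\<exists>N. \<forall>m\<ge>N. \<forall>n\<ge>N. \<forall>x. cmod (u m x - u n x) < e" if "e > 0" for e
  proof -
    obtain N where "\<forall>m\<ge>N. \<forall>n\<ge>N. nrm (C0 X) (u m \<ominus>\<^bsub>C0 X\<^esub> u n) < e"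
      using u \<open>e > 0\<close> unfolding C0.Cauchy_seq_def by meson
    then show ?thesis using le le_less_trans by blast
  qed
  have "Cauchy (\<lambda>n. u n x)" for x
    using unif by (intro metric_CauchyI) (metis dist_norm)
  then have "\<exists>y. (\<lambda>n. u n x) \<longlonglongrightarrow> y" for x using Cauchy_convergent convergent_def by blast
  then obtain f where f: "\<And>x. (\<lambda>n. u n x) \<longlonglongrightarrow> f x" by metis
  have lim: "\<exists>N. \<forall>n\<ge>N. \<forall>x. cmod (u n x - f x) \<le> e" if e: "e > 0" for e
  proof -
    obtain N where N: "\<forall>m\<ge>N. \<forall>n\<ge>N. \<forall>x. cmod (u m x - u n x) < e" using unif[OF e] by blast
    have "cmod (u n x - f x) \<le> e" if n: "n \<ge> N" for n x
    proof (rule LIMSEQ_le_const2)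
      show "(\<lambda>m. cmod (u n x - u m x)) \<longlonglongrightarrow> cmod (u n x - f x)" by (intro tendsto_intros f)
      show "\<exists>M. \<forall>m\<ge>M. cmod (u n x - u m x) \<le> e" using N n by (meson less_imp_le)
    qed
    then show ?thesis by blast
  qed
  have fC: "f \<in> carrier (C0 X)"
  proof (rule C0I)
    show "f x = 0" if "x \<notin> topspace X" for x
      using f[of x] C0_vanish[OF cl that] LIMSEQ_unique[OF _ tendsto_const] by simp
    show "continuous_map X euclidean f"
      unfolding continuous_map_metric_iff
    proof (intro ballI allI impI)
      fix x and e :: real assume x: "x \<in> topspace X" and e: "e > 0"
      obtain N where N: "\<forall>n\<ge>N. \<forall>x. cmod (u n x - f x) \<le> e / 4" using lim[of "e / 4"] e by auto
      obtain U where U: "openin X U" "x \<in> U" "\<forall>y\<in>U. dist (u N y) (u N x) < e / 4"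
        using C0_continuous[OF cl[of N], unfolded continuous_map_metric_iff, rule_format, OF x, of "e / 4"] e by auto
      have "dist (f y) (f x) < e" if "y \<in> U" for y
      proof -
        have "f y - f x = (u N y - u N x) - (u N y - f y) + (u N x - f x)" by simp
        then have "cmod (f y - f x) \<le> cmod (u N y - u N x) + cmod (u N y - f y) + cmod (u N x - f x)"
          by (metis (no_types, lifting) add_mono_thms_linordered_semiring(3) norm_triangle_ineq norm_triangle_ineq4 order_trans)
        moreover have "cmod (u N y - f y) \<le> e / 4" "cmod (u N x - f x) \<le> e / 4" using N by auto
        moreover have "cmod (u N y - u N x) < e / 4" using U that by (simp add: dist_norm)
        ultimately show ?thesis using e by (simp add: dist_norm)
      qed
      then show "\<exists>U. openin X U \<and> x \<in> U \<and> (\<forall>y\<in>U. dist (f y) (f x) < e)" using U by blast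
    qed
    fix e :: real assume e: "e > 0"
    obtain N where N: "\<forall>n\<ge>N. \<forall>x. cmod (u n x - f x) \<le> e / 2" using lim[of "e / 2"] e by auto
    \<comment> \<open>A superlevel set of the limit lies in the superlevel set of \<open>u N\<close>
      at half the level, which is compact.\<close>
    have "e / 2 \<le> cmod (u N x)" if "e \<le> cmod (f x)" for x
      using N[rule_format, of N x] that norm_triangle_ineq2[of "f x" "u N x"] by (simp add: norm_minus_commute)
    then show "\<exists>K. compactin X K \<and> (\<forall>x\<in>topspace X. e \<le> cmod (f x) \<longrightarrow> x \<in> K)"
      using C0_compact[OF cl[of N], of "e / 2"] e by auto
  qed
  have "C0.null_diff X u (\<lambda>_. f)"
    unfolding C0.null_diff_def
  proof (rule LIMSEQ_I)
    fix e :: real assume e: "e > 0"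
    obtain N where N: "\<forall>n\<ge>N. \<forall>x. cmod (u n x - f x) \<le> e / 2" using lim[of "e / 2"] e by auto
    have "norm (nrm (C0 X) (u n \<ominus>\<^bsub>C0 X\<^esub> f) - 0) < e" if "n \<ge> N" for n
    proof -
      have "nrm (C0 X) (u n \<ominus>\<^bsub>C0 X\<^esub> f) \<le> e / 2"
        using N that e by (intro C0_nrm_le) (auto simp: C0_diff cl fC)
      then show ?thesis using C0.nonneg[OF C0.diff_closed[OF cl fC], of n] e by simp
    qed
    then show "\<exists>N. \<forall>n\<ge>N. norm (nrm (C0 X) (u n \<ominus>\<^bsub>C0 X\<^esub> f) - 0) < e" by blast
  qed
  then show ?thesis using fC by blast
qed

definition C0_conv :: "'x topology \<Rightarrow> (nat \<Rightarrow> 'x \<Rightarrow> complex) \<Rightarrow> ('x \<Rightarrow> complex) \<Rightarrow> bool" where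
  "C0_conv X u f \<longleftrightarrow> C0.Cauchy_seq X u \<and> f \<in> carrier (C0 X) \<and> C0.null_diff X u (\<lambda>_. f)"

text \<open>By completeness C0(X) is its own completion; every element is the limit of its constant
  sequence.\<close>

lemma completion_C0: "completion (C0 X) (nrm (C0 X)) (C0 X) (C0_conv X)"
proof unfold_locales
  have const: "f \<in> carrier (C0 X) \<Longrightarrow> C0.Cauchy_seq X (\<lambda>_. f)" for f by (rule C0.Cauchy_seq_const)
  have cr: "C0.Cauchy_seq X u \<Longrightarrow> range u \<subseteq> carrier (C0 X)" for u by (simp add: C0.Cauchy_seq_def)
  show "\<exists>f. C0_conv X u f" if "C0.Cauchy_seq X u" for u using C0_complete[OF that] that by (auto simp: C0_conv_def)
  show "\<exists>u. C0_conv X u f" if "f \<in> carrier (C0 X)" for f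
    using that by (intro exI[of _ "\<lambda>_. f"]) (auto simp: C0_conv_def const intro!: C0.null_diff_refl)
  show "C0_conv X (\<lambda>_. \<zero>\<^bsub>C0 X\<^esub>) \<zero>\<^bsub>C0 X\<^esub>"
    by (auto simp: C0_conv_def const C0.zero_closed intro!: C0.null_diff_refl)
  fix u f assume u: "C0_conv X u f"
  then show "C0.Cauchy_seq X u" "f \<in> carrier (C0 X)" by (auto simp: C0_conv_def)
  note ucl = cr[OF this(1)] and uf = u[unfolded C0_conv_def]
  show "C0_conv X (\<lambda>n. c \<odot>\<^bsub>C0 X\<^esub> u n) (c \<odot>\<^bsub>C0 X\<^esub> f)" for c
    using uf ucl C0.null_diff_smult[of X u "\<lambda>_. f" c] by (auto simp: C0_conv_def C0.smult_closed C0.Cauchy_seq_smult)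
  show "C0_conv X (\<lambda>n. adj (C0 X) (u n)) (adj (C0 X) f)"
    using uf ucl C0.null_diff_adj[of X u "\<lambda>_. f"] by (auto simp: C0_conv_def C0.adj_closed C0.Cauchy_seq_adj)
  show "(\<lambda>n. nrm (C0 X) (u n)) \<longlonglongrightarrow> nrm (C0 X) f"
    using C0.null_diff_limit[OF C0.null_diff_sym, of X u "\<lambda>_. f" "nrm (C0 X) f"] uf ucl by auto
  fix v g assume v: "C0_conv X v g"
  then have vg: "C0.Cauchy_seq X v" "g \<in> carrier (C0 X)" "C0.null_diff X v (\<lambda>_. g)" by (auto simp: C0_conv_def)
  note vcl = cr[OF vg(1)]
  show "C0_conv X (\<lambda>n. u n \<oplus>\<^bsub>C0 X\<^esub> v n) (f \<oplus>\<^bsub>C0 X\<^esub> g)"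
    using uf vg ucl vcl C0.null_diff_add[of X u "\<lambda>_. f" v "\<lambda>_. g"] by (auto simp: C0_conv_def C0.Cauchy_seq_add)
  show "C0_conv X (\<lambda>n. u n \<otimes>\<^bsub>C0 X\<^esub> v n) (f \<otimes>\<^bsub>C0 X\<^esub> g)"
    using uf vg ucl vcl const C0.null_diff_mult[of X u "\<lambda>_. f" v "\<lambda>_. g"]
    by (auto simp: C0_conv_def C0.Cauchy_seq_mult C0.m_closed)
  show "(f = g) = C0.null_diff X u v"
  proof
    assume "f = g"
    show "C0.null_diff X u v"
    proof (rule C0.null_diff_trans[of X u "\<lambda>_. g" v])
      show "C0.null_diff X (\<lambda>_. g) v" using vg vcl by (intro C0.null_diff_sym[of X v]) auto
    qed (use uf vg ucl vcl \<open>f = g\<close> in auto)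
  next
    assume uv: "C0.null_diff X u v"
    have "C0.null_diff X (\<lambda>_. f) u" using uf ucl by (intro C0.null_diff_sym[of X u]) auto
    then have "C0.null_diff X (\<lambda>_. f) v" using C0.null_diff_trans[of X "\<lambda>_. f" u v] uv uf ucl vcl by auto
    then have "C0.null_diff X (\<lambda>_. f) (\<lambda>_. g)" using C0.null_diff_trans[of X "\<lambda>_. f" v "\<lambda>_. g"] uf vg vcl by auto
    then have "nrm (C0 X) (f \<ominus>\<^bsub>C0 X\<^esub> g) = 0" by (simp add: C0.null_diff_def LIMSEQ_const_iff)
    then show "f = g"
      using norm_le_C0_nrm[OF C0.diff_closed[of f X g]] uf vg by (force simp: C0_diff fun_eq_iff)
  qed
qed


section \<open>Density of the idempotents\<close>

context inverse_semigroup0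
begin

abbreviation "\<EE> \<equiv> spectrum S"

lemma continuous_map_gelf:
  assumes "y \<in> carrier CS" "supp y \<subseteq> idem S"
  shows "continuous_map \<EE> euclidean (gelf y)"
proof -
  have 1: "continuous_map \<EE> euclidean (\<lambda>\<phi>. y e * of_nat (\<phi> e))" if "e \<in> idem S" for e
  proof -
    have "continuous_map (discrete_topology {0, 1}) euclidean (\<lambda>n. y e * of_nat n)" by simp
    from continuous_map_compose[OF continuous_map_eval[OF that] this] show ?thesis by (simp add: o_def)
  qed
  have "continuous_map \<EE> euclidean (\<lambda>\<phi>. \<Sum>e\<in>supp y. y e * of_nat (\<phi> e))"
    using assms 1 by (intro continuous_map_sum) (auto simp: CS_carrier)
  then show ?thesis
    by (rule continuous_map_eq) (simp add: topspace_spectrum gelf_def lin_def)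
qed

lemma gelf_nonzeroD:
  assumes "gelf y \<phi> \<noteq> 0" "supp y \<subseteq> idem S" shows "\<exists>e\<in>supp y. \<phi> \<in> DD S e"
proof -
  have \<phi>: "\<phi> \<in> characters S" "lin (\<lambda>e. of_nat (\<phi> e)) y \<noteq> 0" using assms by (auto simp: gelf_def split: if_splits)
  then obtain e where "e \<in> supp y" "y e * of_nat (\<phi> e) \<noteq> 0"
    unfolding lin_def by (meson sum.not_neutral_contains_not_neutral)
  then show ?thesis using char_01[OF \<phi>(1), of e] assms(2) \<phi>(1) by (auto simp: DD_def)
qed

lemma gelf_C0:
  assumes "y \<in> carrier CS" "supp y \<subseteq> idem S" shows "gelf y \<in> carrier (C0 \<EE>)"
proof (rule C0I[OF continuous_map_gelf[OF assms]])
  show "gelf y \<phi> = 0" if "\<phi> \<notin> topspace \<EE>" for \<phi> using that by (simp add: gelf_def topspace_spectrum)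
  fix e :: real assume e: "e > 0"
  have "compactin \<EE> (\<Union>e\<in>supp y. DD S e)"
    using assms compactin_DD by (intro compactin_Union) (auto simp: CS_carrier)
  moreover have "\<phi> \<in> (\<Union>e\<in>supp y. DD S e)" if "e \<le> cmod (gelf y \<phi>)" for \<phi>
    using gelf_nonzeroD[OF _ assms(2), of \<phi>] that e by force
  ultimately show "\<exists>K. compactin \<EE> K \<and> (\<forall>\<phi>\<in>topspace \<EE>. e \<le> cmod (gelf y \<phi>) \<longrightarrow> \<phi> \<in> K)" by blast
qed

lemma spectrum_basis:
  assumes "openin \<EE> W" "\<phi> \<in> W"
  obtains I where "finite I" "I \<subseteq> idem S" "{\<psi> \<in> characters S. \<forall>e\<in>I. \<psi> e = \<phi> e} \<subseteq> W"
proof -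
  let ?P = "product_topology (\<lambda>_. discrete_topology {0, 1 :: nat}) (idem S)"
  obtain T where T: "openin ?P T" "W = T \<inter> characters S" using assms(1) by (auto simp: spectrum_def openin_subtopology)
  then obtain U where U: "finite {i \<in> idem S. U i \<noteq> topspace (discrete_topology {0, 1 :: nat})}"
    "\<phi> \<in> Pi\<^sub>E (idem S) U" "Pi\<^sub>E (idem S) U \<subseteq> T"
    using assms(2) unfolding openin_product_topology_alt by blast
  let ?I = "{i \<in> idem S. U i \<noteq> topspace (discrete_topology {0, 1 :: nat})}"
  have "\<psi> \<in> W" if \<psi>: "\<psi> \<in> characters S" "\<forall>e\<in>?I. \<psi> e = \<phi> e" for \<psi>
  proof -
    have "\<psi> e \<in> U e" if e: "e \<in> idem S" for e
    proof (cases "e \<in> ?I")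
      case True then show ?thesis using \<psi>(2) U(2) e by auto
    next
      case False then show ?thesis using e char_01[OF \<psi>(1) e] by auto
    qed
    then have "\<psi> \<in> Pi\<^sub>E (idem S) U" using char_ext[OF \<psi>(1)] by (auto simp: PiE_def)
    then show ?thesis using U(3) T(2) \<psi>(1) by blast
  qed
  then show thesis using that[of ?I] U(1) by blast
qed

text \<open>The functions \<open>gelf y\<close> with \<open>y\<close> supported in \<open>J\<close> are closed under multiplication by the indicators of
  basic compact open sets, so a finite cover by such sets suffices for a direct approximation.\<close>

lemma gelf_dense:
  assumes J: "J \<subseteq> idem S" "\<And>e f. \<lbrakk>e \<in> idem S; f \<in> J\<rbrakk> \<Longrightarrow> e \<cdot> f \<in> J"
    and f: "f \<in> carrier (C0 (subtopology \<EE> (\<Union>e\<in>J. DD S e)))" and r: "r > 0"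
  obtains y where "y \<in> carrier CS" "supp y \<subseteq> J" "\<And>\<phi>. cmod (f \<phi> - gelf y \<phi>) \<le> r"
proof -
  define U where "U = (\<Union>e\<in>J. DD S e)"
  have U: "openin \<EE> U" using J openin_DD unfolding U_def by (intro openin_Union) blast
  have top: "topspace (subtopology \<EE> U) = U"
    using DD_subset by (auto simp: U_def topspace_spectrum)
  have fC: "f \<in> carrier (C0 (subtopology \<EE> U))" using f by (simp add: U_def)
  define V where "V = gelf ` {y \<in> carrier CS. supp y \<subseteq> J}"
  have V_add: "(\<lambda>\<phi>. v \<phi> + w \<phi>) \<in> V" if vw: "v \<in> V" "w \<in> V" for v w
  proof -
    obtain x y where xy: "x \<in> carrier CS" "supp x \<subseteq> J" "v = gelf x" "y \<in> carrier CS" "supp y \<subseteq> J" "w = gelf y"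
      using vw by (auto simp: V_def)
    have "(\<lambda>\<phi>. v \<phi> + w \<phi>) = gelf (x \<oplus>\<^bsub>CS\<^esub> y)"
      using xy by (auto simp: gelf_def CS_add CS_carrier lin_add)
    moreover have "supp (x \<oplus>\<^bsub>CS\<^esub> y) \<subseteq> supp x \<union> supp y" by (auto simp: CS_add)
    ultimately show ?thesis using xy CS.a_closed[OF xy(1,4)] unfolding V_def by blast
  qed
  have V_smult: "(\<lambda>\<phi>. c * v \<phi>) \<in> V" if "v \<in> V" for c v
  proof -
    obtain x where x: "x \<in> carrier CS" "supp x \<subseteq> J" "v = gelf x" using \<open>v \<in> V\<close> by (auto simp: V_def)
    have "(\<lambda>\<phi>. c * v \<phi>) = gelf (c \<odot>\<^bsub>CS\<^esub> x)" using x by (auto simp: gelf_def CS_smult lin_smult)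
    moreover have "supp (c \<odot>\<^bsub>CS\<^esub> x) \<subseteq> J" using x by (auto simp: CS_smult)
    ultimately show ?thesis using x CS.smult_closed by (auto simp: V_def)
  qed
  have V_zero: "(\<lambda>_. 0) \<in> V"
    unfolding V_def by (rule image_eqI[of _ _ "\<lambda>_. 0"]) (auto simp: gelf_def lin_zero CS_carrier)
  \<comment> \<open>Multiplication by an idempotent keeps supports in J because J absorbs
    E(S).\<close>
  have V_DD: "(\<lambda>\<phi>. indicator (DD S e) \<phi> * v \<phi>) \<in> V" if e: "e \<in> idem S" and v: "v \<in> V" for e v
  proof -
    obtain x where x: "x \<in> carrier CS" "supp x \<subseteq> J" "v = gelf x" using v by (auto simp: V_def)
    note pm = point_mass_closed[OF idem_closed[OF e]]
    have s: "supp (point_mass e) = {e}" by (auto simp: point_mass_def)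
    have "gelf (point_mass e \<otimes>\<^bsub>CS\<^esub> x) = (\<lambda>\<phi>. indicator (DD S e) \<phi> * v \<phi>)"
      using gelf_mult[OF pm _ x(1)] x J e by (auto simp: s gelf_point_mass[OF e])
    moreover have "supp (point_mass e \<otimes>\<^bsub>CS\<^esub> x) \<subseteq> J"
      using supp_mult[OF pm x(1)] x(2) J(2)[OF e] by (fastforce simp: s)
    ultimately show ?thesis using CS.m_closed[OF pm x(1)] unfolding V_def by (intro image_eqI[OF HOL.sym]) auto
  qed
  \<comment> \<open>The sets whose indicators are multipliers of V. They are closed under
    intersection and complement and include all D(e), although the indicator of such a set need not
    itself lie in V.\<close>
  define \<M> where "\<M> = {W. \<forall>v\<in>V. (\<lambda>\<phi>. indicator W \<phi> * v \<phi>) \<in> V}"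
  have M_DD: "DD S e \<in> \<M>" if "e \<in> idem S" for e using V_DD[OF that] by (simp add: \<M>_def)
  have M_Int: "W \<inter> W' \<in> \<M>" if "W \<in> \<M>" "W' \<in> \<M>" for W W'
    using that by (simp add: \<M>_def indicator_inter_arith mult.assoc)
  have M_Compl: "- W \<in> \<M>" if W: "W \<in> \<M>" for W
  proof -
    have "(\<lambda>\<phi>. indicator (- W) \<phi> * v \<phi>) \<in> V" if v: "v \<in> V" for v
    proof -
      have "(\<lambda>\<phi>. v \<phi> + (-1) * (indicator W \<phi> * v \<phi>)) \<in> V"
        using W v by (intro V_add V_smult) (auto simp: \<M>_def)
      also have "(\<lambda>\<phi>. v \<phi> + (-1) * (indicator W \<phi> * v \<phi>)) = (\<lambda>\<phi>. indicator (- W) \<phi> * v \<phi>)"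
        by (auto simp: indicator_def)
      finally show ?thesis .
    qed
    then show ?thesis by (simp add: \<M>_def)
  qed
  \<comment> \<open>Off K the function is so small that 0 approximates it; the positive level makes
    K compact.\<close>
  define K where "K = {\<phi> \<in> U. r / 2 \<le> cmod (f \<phi>)}"
  have K: "compactin \<EE> K"
    using C0_compact[OF fC, of "r / 2"] r unfolding top by (simp add: K_def compactin_subtopology)
  define good where "good W \<longleftrightarrow> W \<in> \<M> \<and> indicator W \<in> V \<and> openin \<EE> W \<and> W \<subseteq> U \<and>
    (\<exists>c. \<forall>\<psi>\<in>W. cmod (f \<psi> - c) < r)" for W
  have ex: "\<exists>W. good W \<and> \<phi> \<in> W" if \<phi>: "\<phi> \<in> U" for \<phi>
  proof -
    obtain e where e: "e \<in> J" "\<phi> \<in> DD S e" using \<phi> by (auto simp: U_def)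
    have eE: "e \<in> idem S" using e J by auto
    obtain N where N: "openin (subtopology \<EE> U) N" "\<phi> \<in> N" "\<forall>\<psi>\<in>N. dist (f \<psi>) (f \<phi>) < r"
      using C0_continuous[OF fC, unfolded continuous_map_metric_iff top, rule_format, OF \<phi> r] by auto
    have NE: "openin \<EE> N" using N(1) U openin_trans_full by blast
    obtain I where I: "finite I" "I \<subseteq> idem S" "{\<psi> \<in> characters S. \<forall>e\<in>I. \<psi> e = \<phi> e} \<subseteq> N"
      using spectrum_basis[OF NE N(2)] .
    have \<phi>c: "\<phi> \<in> characters S" using DD_char[OF e(2)] .
    \<comment> \<open>A basic neighbourhood of \<phi>: the factor D(e) with e in J keeps it inside
      U, and prescribing the values on I pushes it into N. The induction on I builds it from
      intersections and complements, so it stays in \<M>.\<close>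
    let ?W = "\<lambda>I. DD S e \<inter> {\<psi>. \<forall>i\<in>I. \<psi> \<in> DD S i \<longleftrightarrow> \<phi> \<in> DD S i}"
    have W: "?W I \<in> \<M> \<and> openin \<EE> (?W I)"
      using I(1,2)
    proof (induction I rule: finite_induct)
      case empty then show ?case using M_DD[OF eE] openin_DD[OF eE] by simp
    next
      case (insert i I)
      then have i: "i \<in> idem S" and IH: "?W I \<in> \<M>" "openin \<EE> (?W I)" by auto
      show ?case
      proof (cases "\<phi> \<in> DD S i")
        case True
        then have "?W (insert i I) = ?W I \<inter> DD S i" by auto
        then show ?thesis using IH M_Int M_DD[OF i] openin_DD[OF i] by auto
      next
        case False
        then have eq: "?W (insert i I) = ?W I \<inter> - DD S i" by auto
        have "?W I \<inter> - DD S i = ?W I \<inter> {\<psi> \<in> characters S. \<psi> i = 0}"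
          using char_01[OF _ i] by (fastforce simp: DD_def)
        then have "openin \<EE> (?W I \<inter> - DD S i)" using openin_Int[OF IH(2) openin_eval[OF i]] by (simp only:)
        then show ?thesis using M_Int[OF IH(1) M_Compl[OF M_DD[OF i]]] by (simp only: eq)
      qed
    qed
    have WN: "?W I \<subseteq> N"
    proof
      fix \<psi> assume \<psi>: "\<psi> \<in> ?W I"
      then have \<psi>c: "\<psi> \<in> characters S" using DD_char by blast
      have "\<psi> i = \<phi> i" if "i \<in> I" for i
      proof -
        have "i \<in> idem S" "\<psi> \<in> DD S i \<longleftrightarrow> \<phi> \<in> DD S i" using \<psi> that I(2) by auto
        then show ?thesis
          using char_01[OF \<psi>c, of i] char_01[OF \<phi>c, of i] \<phi>c \<psi>c by (auto simp: DD_def)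
      qed
      then show "\<psi> \<in> N" using I(3) \<psi>c by blast
    qed
    have "indicator (DD S e) \<in> V"
      unfolding V_def gelf_point_mass[OF eE, symmetric] using e point_mass_closed[OF idem_closed[OF eE]]
      by (intro imageI) (auto simp: point_mass_def)
    then have "(\<lambda>\<phi>. indicator (?W I) \<phi> * indicator (DD S e) \<phi>) \<in> V" using W by (simp add: \<M>_def)
    also have "(\<lambda>\<phi>. indicator (?W I) \<phi> * indicator (DD S e) \<phi>) = (indicator (?W I) :: _ \<Rightarrow> complex)"
      by (auto simp: indicator_def fun_eq_iff)
    finally have "good (?W I)"
      using W WN N(3) e(1) by (auto simp: good_def U_def dist_norm intro!: exI[of _ "f \<phi>"])
    then show ?thesis using e(2) by (intro exI[of _ "?W I"]) auto
  qed
  have "\<exists>\<C>. finite \<C> \<and> \<C> \<subseteq> Collect good \<and> K \<subseteq> \<Union>\<C>"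
    using K ex unfolding compactin_def
    by (elim conjE allE[of _ "Collect good"]) (force simp: good_def K_def)
  then obtain \<C> where \<C>: "finite \<C>" "\<C> \<subseteq> Collect good" "K \<subseteq> \<Union>\<C>" by blast
  have "\<exists>v\<in>V. (\<forall>\<psi>\<in>\<Union>\<C>. cmod (f \<psi> - v \<psi>) < r) \<and> (\<forall>\<psi>. \<psi> \<notin> \<Union>\<C> \<longrightarrow> v \<psi> = 0)"
    using \<C>(1,2)
  proof (induction \<C> rule: finite_induct)
    case empty then show ?case using V_zero by auto
  next
    case (insert W \<C>)
    then obtain v where v: "v \<in> V" "\<forall>\<psi>\<in>\<Union>\<C>. cmod (f \<psi> - v \<psi>) < r" "\<forall>\<psi>. \<psi> \<notin> \<Union>\<C> \<longrightarrow> v \<psi> = 0" by auto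
    obtain c where W: "W \<in> \<M>" "indicator W \<in> V" "\<forall>\<psi>\<in>W. cmod (f \<psi> - c) < r"
      using insert.prems by (auto simp: good_def)
    \<comment> \<open>On the newly added set W the approximation is overwritten by a constant within
      r of f; off W nothing changes. Overlaps in the cover thus do no harm.\<close>
    define w where "w = (\<lambda>\<psi>. indicator (- W) \<psi> * v \<psi> + c * indicator W \<psi>)"
    have "w \<in> V" unfolding w_def using M_Compl[OF W(1)] v(1) W(2) by (intro V_add V_smult) (auto simp: \<M>_def)
    moreover have "w \<psi> = c" if "\<psi> \<in> W" for \<psi> using that by (simp add: w_def)
    moreover have "w \<psi> = v \<psi>" if "\<psi> \<notin> W" for \<psi> using that by (simp add: w_def)
    ultimately show ?case using v W by (intro bexI[of _ w]) (metis Union_insert Un_iff)+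
  qed
  then obtain v where v: "v \<in> V" "\<forall>\<psi>\<in>\<Union>\<C>. cmod (f \<psi> - v \<psi>) < r" "\<forall>\<psi>. \<psi> \<notin> \<Union>\<C> \<longrightarrow> v \<psi> = 0" by blast
  obtain y where y: "y \<in> carrier CS" "supp y \<subseteq> J" "v = gelf y" using v(1) by (auto simp: V_def)
  have "cmod (f \<phi> - gelf y \<phi>) \<le> r" for \<phi>
  proof (cases "\<phi> \<in> \<Union>\<C>")
    case True then show ?thesis using v(2) y(3) by (meson less_imp_le)
  next
    case False
    then have "\<phi> \<notin> K" using \<C>(3) by blast
    then have "cmod (f \<phi>) \<le> r"
      using C0_vanish[OF fC, of \<phi>] r unfolding top K_def by (cases "\<phi> \<in> U") auto
    then show ?thesis using v(3) False y(3) by simp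
  qed
  then show thesis using that y by blast
qed

text \<open>Both bounds come from extremality: \<open>seminorm_le_gelf\<close> puts every
  C*-seminorm vanishing at \<open>zz\<close> below the sup norm of the transform, and that sup norm
  is itself such a C*-seminorm.\<close>

lemma contracted_norm_eq_gelf:
  assumes "carrier S = idem S" "x \<in> carrier CS"
  shows "contracted_norm x = nrm (C0 \<EE>) (gelf x)" and "star_hom_alg CS (C0 \<EE>) gelf"
proof -
  have supp: "supp y \<subseteq> idem S" if "y \<in> carrier CS" for y using that assms(1) by (simp add: CS_carrier)
  show hom: "star_hom_alg CS (C0 \<EE>) gelf"
  proof unfold_locales
    show "star_hom CS (C0 \<EE>) gelf"
      unfolding star_hom_def
      using supp gelf_C0 gelf_mult gelf_adj
      by (auto simp: C0_add C0_mult C0_smult C0_adj fun_eq_iff)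
        (auto simp: gelf_def CS_add CS_smult CS_carrier lin_add lin_smult)
  qed
  interpret hom: star_hom_alg CS "C0 \<EE>" gelf by (rule hom)
  show "contracted_norm x = nrm (C0 \<EE>) (gelf x)"
  proof (rule antisym)
    show "contracted_norm x \<le> nrm (C0 \<EE>) (gelf x)"
      by (rule seminorm_le_gelf[OF cstar_seminorm_contracted contracted_norm_zz assms(2)])
        (use assms(2) supp norm_le_C0_nrm[OF gelf_C0] in auto)
    have "gelf zz = \<zero>\<^bsub>C0 \<EE>\<^esub>" by (simp add: gelf_point_mass zero_idem DD_zero C0_zero fun_eq_iff)
    then show "nrm (C0 \<EE>) (gelf x) \<le> contracted_norm x"
      using assms(2) by (intro le_contracted_norm[of "\<lambda>x. nrm (C0 \<EE>) (gelf x)"] hom.cstar_seminorm_pullback cstar_seminorm_C0)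
        (auto simp: C0.p_zero)
  qed
qed

theorem completion_semilattice:
  assumes E: "carrier S = idem S"
  shows "completion CS contracted_norm (C0 \<EE>) (\<lambda>u f. range u \<subseteq> carrier CS \<and> C0_conv \<EE> (gelf \<circ> u) f)"
proof (rule completion_pullback[OF completion_C0])
  show "star_hom_alg CS (C0 \<EE>) gelf"
    using contracted_norm_eq_gelf(2)[OF E zz_closed] .
  show "contracted_norm x = nrm (C0 \<EE>) (gelf x)" if "x \<in> carrier CS" for x
    using contracted_norm_eq_gelf(1)[OF E that] .
  fix b and e :: real assume b: "b \<in> carrier (C0 \<EE>)" and e: "e > 0"
  have "(\<Union>e\<in>idem S. DD S e) = topspace \<EE>"
    using DD_char char_DD unfolding topspace_spectrum by blast
  then have "b \<in> carrier (C0 (subtopology \<EE> (\<Union>e\<in>idem S. DD S e)))" using b by simp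
  then obtain y where y: "y \<in> carrier CS" "supp y \<subseteq> idem S" "\<And>\<phi>. cmod (b \<phi> - gelf y \<phi>) \<le> e / 2"
    using gelf_dense[of "idem S" b "e / 2"] idem_mult_idem e by auto
  have "nrm (C0 \<EE>) (b \<ominus>\<^bsub>C0 \<EE>\<^esub> gelf y) \<le> e / 2"
    using y e by (intro C0_nrm_le) (auto simp: C0_diff b gelf_C0)
  then show "\<exists>x\<in>carrier CS. nrm (C0 \<EE>) (b \<ominus>\<^bsub>C0 \<EE>\<^esub> gelf x) < e" using y e by (intro bexI[of _ y]) auto
qed

section \<open>The semigroup of idempotents and its contracted algebra\<close>

lemma inverse_semigroup0_idem: "inverse_semigroup0 (idem_semigroup S)"
proof -
  have m: "smul (idem_semigroup S) = smul S" "szero (idem_semigroup S) = szero S" "carrier (idem_semigroup S) = idem S"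
    by (simp_all add: idem_semigroup_def)
  show ?thesis
  proof (unfold_locales, unfold m)
    fix e assume e: "e \<in> idem S"
    show "\<exists>!t. t \<in> idem S \<and> e = e \<cdot> t \<cdot> e \<and> t = t \<cdot> e \<cdot> t"
    proof (rule ex1I[of _ e])
      show "e \<in> idem S \<and> e = e \<cdot> e \<cdot> e \<and> e = e \<cdot> e \<cdot> e" using e by (simp add: idem_idem)
      fix t assume "t \<in> idem S \<and> e = e \<cdot> t \<cdot> e \<and> t = t \<cdot> e \<cdot> t"
      then have "e\<^sup>\<star> = t" using e by (intro sinv_unique) (auto simp: idem_closed)
      then show "t = e" using sinv_idem[OF e] by simp
    qed
  qed (auto simp: idem_closed idem_mult_idem zero_idem assoc zero_mult mult_zero)
qed

lemma idem_idem_semigroup: "idem (idem_semigroup S) = idem S"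
  by (auto simp: idem_def idem_semigroup_def)

lemma DD_idem_semigroup: "DD (idem_semigroup S) = DD S"
  and spectrum_idem_semigroup: "spectrum (idem_semigroup S) = spectrum S"
proof -
  have "characters (idem_semigroup S) = characters S"
    unfolding characters_def idem_idem_semigroup by (simp add: idem_semigroup_def)
  then show "DD (idem_semigroup S) = DD S" "spectrum (idem_semigroup S) = spectrum S"
    unfolding DD_def spectrum_def idem_idem_semigroup by (auto simp: fun_eq_iff)
qed

text \<open>Both algebras complete the algebra of E(S) in the same norm. The generators are limits
  of constant sequences of point masses, whose transforms are the indicators; this fixes \<gamma> on
  them.\<close>

theorem gelfand_contracted:
  obtains \<gamma> where "cstar_iso (contracted_cstar (idem_semigroup S)) (C0 \<EE>) \<gamma>"
    and "\<And>e. e \<in> idem S \<Longrightarrow> \<gamma> (contracted_gen (idem_semigroup S) e) = indicator (DD S e)"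
proof -
  interpret E: inverse_semigroup0 "idem_semigroup S" by (rule inverse_semigroup0_idem)
  have ES: "carrier (idem_semigroup S) = idem (idem_semigroup S)"
    by (simp add: idem_idem_semigroup) (simp add: idem_semigroup_def)
  obtain \<gamma> where \<gamma>: "cstar_iso (contracted_cstar (idem_semigroup S)) (C0 (spectrum (idem_semigroup S))) \<gamma>"
    and eq: "\<And>u X f. \<lbrakk>E.contracted_conv u X; range u \<subseteq> carrier E.CS \<and> C0_conv (spectrum (idem_semigroup S)) (E.gelf \<circ> u) f\<rbrakk> \<Longrightarrow> \<gamma> X = f"
    using completion_unique[OF E.completion_contracted E.completion_semilattice[OF ES]] by blast
  have "\<gamma> (contracted_gen (idem_semigroup S) e) = indicator (DD S e)" if e: "e \<in> idem S" for e
  proof (rule eq[OF E.contracted_conv_gen])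
    show ec: "e \<in> carrier (idem_semigroup S)" using e by (simp add: idem_semigroup_def)
    have eE: "e \<in> idem (idem_semigroup S)" using e by (simp add: idem_idem_semigroup)
    have "E.gelf (point_mass e) = indicator (DD S e)"
      using E.gelf_point_mass[OF eE] by (simp add: DD_idem_semigroup)
    moreover have "E.gelf (point_mass e) \<in> carrier (C0 (spectrum (idem_semigroup S)))"
      using E.gelf_C0[OF E.point_mass_closed[OF ec]] eE by (simp add: point_mass_def)
    ultimately show "range (\<lambda>_. point_mass e) \<subseteq> carrier E.CS \<and>
        C0_conv (spectrum (idem_semigroup S)) (E.gelf \<circ> (\<lambda>_. point_mass e)) (indicator (DD S e))"
      using E.point_mass_closed[OF ec] C0.Cauchy_seq_const
      by (auto simp: C0_conv_def o_def intro!: C0.null_diff_refl)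
  qed
  then show thesis using that \<gamma> by (simp add: spectrum_idem_semigroup)
qed

end

section \<open>Partial crossed products of \<open>C\<^sub>0(X)\<close>\<close>

text \<open>The delicate point is continuity, at points outside U, of the extension by zero: the
  superlevel sets of f inside U are compact, hence closed in the Hausdorff space X, and their
  complements are the required neighbourhoods.\<close>

lemma C0_subtopology_iff:
  assumes X: "Hausdorff_space X" and U: "openin X U"
  shows "f \<in> carrier (C0 (subtopology X U)) \<longleftrightarrow> f \<in> carrier (C0 X) \<and> (\<forall>x. x \<notin> U \<longrightarrow> f x = 0)"
proof -
  have top: "topspace (subtopology X U) = U" using openin_subset[OF U] by auto
  show ?thesis
  proof (intro iffI conjI)
    assume f: "f \<in> carrier (C0 (subtopology X U))"
    show van: "\<forall>x. x \<notin> U \<longrightarrow> f x = 0" using C0_vanish[OF f] top by simp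
    have comp: "compactin X {x \<in> U. e \<le> cmod (f x)}" if "e > 0" for e
      using C0_compact[OF f that] unfolding top by (simp add: compactin_subtopology)
    show "f \<in> carrier (C0 X)"
    proof (rule C0I)
      show "f x = 0" if "x \<notin> topspace X" for x using van openin_subset[OF U] that by blast
      show "continuous_map X euclidean f"
        unfolding continuous_map_metric_iff
      proof (intro ballI allI impI)
        fix x and e :: real assume x: "x \<in> topspace X" and e: "e > 0"
        show "\<exists>W. openin X W \<and> x \<in> W \<and> (\<forall>y\<in>W. dist (f y) (f x) < e)"
        proof (cases "x \<in> U")
          case True
          then obtain W where "openin (subtopology X U) W" "x \<in> W" "\<forall>y\<in>W. dist (f y) (f x) < e"
            using C0_continuous[OF f, unfolded continuous_map_metric_iff top, rule_format, of x e] e by auto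
          then show ?thesis using openin_trans_full[OF _ U] by blast
        next
          case False
          let ?W = "topspace X - {y \<in> U. e \<le> cmod (f y)}"
          have "openin X ?W"
            using compactin_imp_closedin[OF X comp[OF e]] by (simp add: openin_diff)
          moreover have "dist (f y) (f x) < e" if "y \<in> ?W" for y
            using that van False e by (cases "y \<in> U") (auto simp: dist_norm)
          ultimately show ?thesis using x False by (intro exI[of _ ?W]) auto
        qed
      qed
      fix e :: real assume e: "e > 0"
      have "x \<in> U" if "e \<le> cmod (f x)" for x
        using van that e by (metis norm_zero not_less)
      then show "\<exists>K. compactin X K \<and> (\<forall>x\<in>topspace X. e \<le> cmod (f x) \<longrightarrow> x \<in> K)" using comp[OF e] by blast
    qed
  next
    assume f: "f \<in> carrier (C0 X) \<and> (\<forall>x. x \<notin> U \<longrightarrow> f x = 0)"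
    then have fC: "f \<in> carrier (C0 X)" and van: "\<And>x. x \<notin> U \<Longrightarrow> f x = 0" by auto
    show "f \<in> carrier (C0 (subtopology X U))"
    proof (rule C0I)
      show "continuous_map (subtopology X U) euclidean f"
        using C0_continuous[OF fC] by (rule continuous_map_from_subtopology)
      show "f x = 0" if "x \<notin> topspace (subtopology X U)" for x using that van top by auto
      fix e :: real assume e: "e > 0"
      have "x \<in> U" if "e \<le> cmod (f x)" for x
        using van that e by (metis norm_zero not_less)
      then show "\<exists>K. compactin (subtopology X U) K \<and> (\<forall>x\<in>topspace (subtopology X U). e \<le> cmod (f x) \<longrightarrow> x \<in> K)"
        using C0_compact[OF fC e]
        by (intro exI[of _ "{x \<in> topspace X. e \<le> cmod (f x)}"]) (auto simp: compactin_subtopology)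
    qed
  qed
qed

lemma C0_homeomorphic:
  assumes \<tau>: "homeomorphic_map Y Z \<tau>" and f: "f \<in> carrier (C0 Z)"
  shows "(\<lambda>x. if x \<in> topspace Y then f (\<tau> x) else 0) \<in> carrier (C0 Y)" (is "?h \<in> _")
proof (rule C0I)
  have "continuous_map Y euclidean (f \<circ> \<tau>)"
    using continuous_map_compose[OF homeomorphic_imp_continuous_map[OF \<tau>] C0_continuous[OF f]] .
  then show "continuous_map Y euclidean ?h" by (rule continuous_map_eq) simp
  fix e :: real assume e: "e > 0"
  let ?K = "{x \<in> topspace Y. e \<le> cmod (f (\<tau> x))}"
  have "\<tau> ` ?K = {z \<in> topspace Z. e \<le> cmod (f z)}"
    using homeomorphic_imp_surjective_map[OF \<tau>] by auto
  then have "compactin Y ?K"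
    using homeomorphic_map_compactness_eq[OF \<tau>, of ?K] C0_compact[OF f e] by auto
  then show "\<exists>K. compactin Y K \<and> (\<forall>x\<in>topspace Y. e \<le> cmod (?h x) \<longrightarrow> x \<in> K)" by auto
qed auto

lemma finsum_C0:
  assumes "finite I" "\<And>i. i \<in> I \<Longrightarrow> F i \<in> carrier (C0 X)"
  shows "finsum (C0 X) F I = (\<lambda>x. \<Sum>i\<in>I. F i x)" and "(\<lambda>x. \<Sum>i\<in>I. F i x) \<in> carrier (C0 X)"
proof -
  have "finsum (C0 X) F I = (\<lambda>x. \<Sum>i\<in>I. F i x) \<and> finsum (C0 X) F I \<in> carrier (C0 X)"
    using assms
  proof (induction I rule: finite_induct)
    case empty then show ?case using C0.zero_closed[of X] by (simp add: C0_zero)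
  next
    case (insert i I)
    have IH: "finsum (C0 X) F I = (\<lambda>x. \<Sum>i\<in>I. F i x)" "finsum (C0 X) F I \<in> carrier (C0 X)"
      using insert.IH insert.prems by blast+
    have eq: "finsum (C0 X) F (insert i I) = F i \<oplus>\<^bsub>C0 X\<^esub> finsum (C0 X) F I"
      using insert by (intro C0.finsum_insert) auto
    have "F i \<oplus>\<^bsub>C0 X\<^esub> finsum (C0 X) F I \<in> carrier (C0 X)"
      using insert.prems IH(2) by (intro C0.a_closed) auto
    then show ?case unfolding eq using insert.hyps IH(1) by (simp add: C0_add)
  qed
  then show "finsum (C0 X) F I = (\<lambda>x. \<Sum>i\<in>I. F i x)" "(\<lambda>x. \<Sum>i\<in>I. F i x) \<in> carrier (C0 X)" by auto
qed

text \<open>A contraction \<open>h\<close> with real values is the mean of the unitaries \<open>h \<plusminus> i\<surd>(1 - h\<^sup>2)\<close>, and multiplication by a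
  unitary does not change a \<open>C\<^sup>*\<close>-seminorm.\<close>

lemma cstar_seminorm_le_C0_nrm:
  assumes q: "cstar_seminorm (C0 X) q" and f: "f \<in> carrier (C0 X)"
  shows "q f \<le> nrm (C0 X) f"
proof -
  interpret q: cstar_seminorm_alg "C0 X" q by unfold_locales (rule q)
  have sq: "q (\<lambda>x. cnj (y x) * y x) = (q y)\<^sup>2" if "y \<in> carrier (C0 X)" for y
    using q.cstar_identity[OF that] by (simp add: C0_mult C0_adj)
  \<comment> \<open>A function of modulus 1 acts only as a multiplier, for it lies in C0(X) just
    when X is compact. The C*-identity for the product does not see u because it cancels against its
    conjugate.\<close>
  have unitary: "q (\<lambda>x. u x * y x) = q y \<and> (\<lambda>x. u x * y x) \<in> carrier (C0 X)"
    if u: "continuous_map X euclidean u" "\<And>x. cmod (u x) = 1" and y: "y \<in> carrier (C0 X)" for u y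
  proof -
    have uy: "(\<lambda>x. u x * y x) \<in> carrier (C0 X)"
    proof (rule C0_dominated[OF y, of _ 1])
      show "continuous_map X euclidean (\<lambda>x. u x * y x)"
        by (rule continuous_map_binop[OF u(1) C0_continuous[OF y]]) (intro continuous_intros)
    qed (simp add: norm_mult u)
    have eq: "(\<lambda>x. cnj (u x * y x) * (u x * y x)) = (\<lambda>x. cnj (y x) * y x)"
    proof
      fix x
      have "cnj (u x) * u x = 1" using complex_norm_square[of "u x"] u(2)[of x] by (simp add: mult.commute)
      then have "cnj (u x) * u x * (cnj (y x) * y x) = cnj (y x) * y x" by simp
      then show "cnj (u x * y x) * (u x * y x) = cnj (y x) * y x" by (simp add: mult_ac)
    qed
    have "(q (\<lambda>x. u x * y x))\<^sup>2 = (q y)\<^sup>2" using sq[OF uy] sq[OF y] unfolding eq by simp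
    then show ?thesis using q.nonneg[OF uy] q.nonneg[OF y] uy by simp
  qed
  define M where "M = nrm (C0 X) f"
  have le: "cmod (f x) \<le> M" for x using norm_le_C0_nrm[OF f] by (simp add: M_def)
  have M0: "M \<ge> 0" using C0.nonneg[OF f] by (simp add: M_def)
  show ?thesis
  proof (cases "M = 0")
    case True
    then have "f = \<zero>\<^bsub>C0 X\<^esub>" using le by (auto simp: C0_zero)
    then show ?thesis using q.p_zero True by (simp add: M_def)
  next
    case False
    then have M: "M > 0" using M0 by simp
    \<comment> \<open>The modulus of f may replace f: both have the same square
      \<open>cnj (f x) * f x\<close>, hence the same value of q.\<close>
    define a where "a = (\<lambda>x. complex_of_real (cmod (f x)))"
    define h where "h x = cmod (f x) / M" for x
    have cont_f: "continuous_map X euclidean f" using C0_continuous[OF f] .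
    have a: "a \<in> carrier (C0 X)"
      unfolding a_def by (rule C0_dominated[OF f continuous_map_unop[OF cont_f], of _ 1]) (auto intro!: continuous_intros)
    have h01: "0 \<le> h x" "h x \<le> 1" for x using le M by (auto simp: h_def)
    then have h2: "(h x)\<^sup>2 \<le> 1" for x by (simp add: power_le_one)
    define u where "u x = Complex (h x) (sqrt (1 - (h x)\<^sup>2))" for x
    have u1: "cmod (u x) = 1" for x using h2[of x] by (simp add: u_def cmod_def)
    have "continuous_on UNIV (\<lambda>z. Complex (cmod z / M) (sqrt (1 - (cmod z / M)\<^sup>2)))"
      by (intro continuous_on_Complex continuous_intros) (use M in auto)
    from continuous_map_unop[OF cont_f this] have u: "continuous_map X euclidean u"
      by (simp add: u_def[abs_def] h_def)
    have cu: "continuous_map X euclidean (\<lambda>x. cnj (u x))"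
      by (rule continuous_map_unop[OF u]) (intro continuous_intros)
    have cu1: "cmod (cnj (u x)) = 1" for x using u1 by simp
    note U = unitary[OF u u1 a] and U' = unitary[OF cu cu1 a]
    have "(\<lambda>x. of_real (h x) * a x) = (1/2) \<odot>\<^bsub>C0 X\<^esub> ((\<lambda>x. u x * a x) \<oplus>\<^bsub>C0 X\<^esub> (\<lambda>x. cnj (u x) * a x))"
      by (auto simp: C0_smult C0_add u_def fun_eq_iff complex_eq_iff field_simps)
    then have "q (\<lambda>x. of_real (h x) * a x) = 1/2 * q ((\<lambda>x. u x * a x) \<oplus>\<^bsub>C0 X\<^esub> (\<lambda>x. cnj (u x) * a x))"
      using q.homogeneous[OF C0.a_closed, of "\<lambda>x. u x * a x" "\<lambda>x. cnj (u x) * a x" "1/2"] U U' by simp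
    also have "\<dots> \<le> 1/2 * (q a + q a)"
      using q.triangle[of "\<lambda>x. u x * a x" "\<lambda>x. cnj (u x) * a x"] U U' by simp
    finally have ha: "q (\<lambda>x. of_real (h x) * a x) \<le> q a" by simp
    have "cnj (a x) * a x = cnj (f x) * f x" for x
      using complex_norm_square[of "f x"] by (simp add: a_def power2_eq_square mult.commute)
    then have qa: "q a = q f" using sq[OF a] sq[OF f] q.nonneg[OF a] q.nonneg[OF f] by simp
    \<comment> \<open>The square of a is M h a, and multiplication by the contraction h does not
      increase q. So the square of q(a) is at most M q(a).\<close>
    have "(\<lambda>x. cnj (a x) * a x) = of_real M \<odot>\<^bsub>C0 X\<^esub> (\<lambda>x. of_real (h x) * a x)"
      using M by (auto simp: C0_smult a_def h_def fun_eq_iff)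
    moreover have "(\<lambda>x. of_real (h x) * a x) \<in> carrier (C0 X)"
    proof (rule C0_dominated[OF a, of _ 1])
      have "continuous_map X euclidean (\<lambda>x. complex_of_real (h x))"
        unfolding h_def by (rule continuous_map_unop[OF cont_f]) (intro continuous_intros, use M in auto)
      then show "continuous_map X euclidean (\<lambda>x. of_real (h x) * a x)"
        by (rule continuous_map_binop[OF _ C0_continuous[OF a]]) (intro continuous_intros)
      show "cmod (of_real (h x) * a x) \<le> 1 * cmod (a x)" for x
        using h01[of x] by (simp add: norm_mult mult_left_le_one_le)
    qed
    ultimately have "(q a)\<^sup>2 = M * q (\<lambda>x. of_real (h x) * a x)"
      using sq[OF a] q.homogeneous M by simp
    also have "\<dots> \<le> M * q a" using ha M by simp
    finally have "q a * q a \<le> M * q a" by (simp add: power2_eq_square)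
    then have "q a \<le> M" using q.nonneg[OF a] M by (cases "q a = 0") (auto simp: mult_le_cancel_right)
    then show ?thesis by (simp add: qa M_def)
  qed
qed

section \<open>The algebraic crossed product\<close>

context partial_action
begin

abbreviation "CR \<equiv> crossed_star_algebra (C0 X) G (C0_ideal G X \<theta>) (C0_act G \<theta>)"

lemma openin_dom: "g \<in> carrier G \<Longrightarrow> openin X (dom (\<theta> g))"
  using partial_homeo by (simp add: partial_homeo_def)

lemma ran_eq: "g \<in> carrier G \<Longrightarrow> ran (\<theta> g) = dom (\<theta> (inv g))"
  using act_inv by (force simp: ran_def dom_def)

lemma ideal_iff:
  "g \<in> carrier G \<Longrightarrow> f \<in> C0_ideal G X \<theta> g \<longleftrightarrow> f \<in> carrier (C0 X) \<and> (\<forall>x. \<theta> (inv g) x = None \<longrightarrow> f x = 0)"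
  using C0_subtopology_iff[OF Hausdorff openin_dom, of "inv g" f] by (auto simp: C0_ideal_def)

lemma ideal_C0: "\<lbrakk>g \<in> carrier G; f \<in> C0_ideal G X \<theta> g\<rbrakk> \<Longrightarrow> f \<in> carrier (C0 X)"
  by (simp add: ideal_iff)

lemma ideal_one: "C0_ideal G X \<theta> \<one> = carrier (C0 X)"
  using C0_vanish by (fastforce simp: ideal_iff act_one split: if_splits)

lemma C0_act_apply: "\<theta> (inv g) x = Some y \<Longrightarrow> C0_act G \<theta> g f x = f y"
  and C0_act_None: "\<theta> (inv g) x = None \<Longrightarrow> C0_act G \<theta> g f x = 0"
  by (simp_all add: C0_act_def)

lemma C0_act_one: "f \<in> carrier (C0 X) \<Longrightarrow> C0_act G \<theta> \<one> f = f"
  using C0_vanish by (fastforce simp: C0_act_def act_one)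

lemma C0_act_zero: "C0_act G \<theta> g (\<lambda>_. 0) = (\<lambda>_. 0)"
  by (auto simp: C0_act_def split: option.splits)

lemma C0_act_ideal:
  assumes g: "g \<in> carrier G" and f: "f \<in> C0_ideal G X \<theta> (inv g)"
  shows "C0_act G \<theta> g f \<in> C0_ideal G X \<theta> g"
proof -
  let ?Y = "subtopology X (dom (\<theta> (inv g)))" and ?Z = "subtopology X (ran (\<theta> (inv g)))"
  have g': "inv g \<in> carrier G" using g by simp
  have "homeomorphic_map ?Y ?Z (\<lambda>x. the (\<theta> (inv g) x))"
    using partial_homeo[OF g'] by (simp add: partial_homeo_def)
  moreover have "f \<in> carrier (C0 ?Z)" using f g by (simp add: C0_ideal_def ran_eq)
  ultimately have "(\<lambda>x. if x \<in> topspace ?Y then f (the (\<theta> (inv g) x)) else 0) \<in> carrier (C0 ?Y)"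
    by (rule C0_homeomorphic)
  also have "(\<lambda>x. if x \<in> topspace ?Y then f (the (\<theta> (inv g) x)) else 0) = C0_act G \<theta> g f"
    using openin_subset[OF openin_dom[OF g']]
    by (auto simp: C0_act_def fun_eq_iff domIff split: option.splits)
  finally show ?thesis by (simp add: C0_ideal_def)
qed

lemma C0_act_inverse:
  assumes g: "g \<in> carrier G" and f: "f \<in> C0_ideal G X \<theta> g"
  shows "C0_act G \<theta> g (C0_act G \<theta> (inv g) f) = f"
proof
  fix x show "C0_act G \<theta> g (C0_act G \<theta> (inv g) f) x = f x"
  proof (cases "\<theta> (inv g) x")
    case None
    then show ?thesis using f g by (simp add: C0_act_None ideal_iff)
  next
    case (Some y)
    then have "\<theta> g y = Some x" using act_inv g by simp
    then show ?thesis using Some g by (simp add: C0_act_apply)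
  qed
qed

lemma C0_act_norm_le: "f \<in> carrier (C0 X) \<Longrightarrow> nrm (C0 X) (C0_act G \<theta> g f) \<le> nrm (C0 X) f"
  using norm_le_C0_nrm[of f X] C0.nonneg[of f X]
  by (intro C0_nrm_le) (auto simp: C0_act_def split: option.splits)

abbreviation gsupp :: "('g \<Rightarrow> 'x \<Rightarrow> complex) \<Rightarrow> 'g set" where "gsupp a \<equiv> {g. a g \<noteq> (\<lambda>_. 0)}"

lemma CR_carrier: "a \<in> carrier CR \<longleftrightarrow> (\<forall>g\<in>carrier G. a g \<in> C0_ideal G X \<theta> g) \<and> gsupp a \<subseteq> carrier G \<and> finite (gsupp a)"
  and CR_zero: "\<zero>\<^bsub>CR\<^esub> = (\<lambda>_ _. 0)"
  and CR_add: "a \<oplus>\<^bsub>CR\<^esub> b = (\<lambda>g x. a g x + b g x)"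
  and CR_smult: "c \<odot>\<^bsub>CR\<^esub> a = (\<lambda>g x. c * a g x)"
  and CR_adj: "adj CR a = (\<lambda>g. if g \<in> carrier G then C0_act G \<theta> g (\<lambda>x. cnj (a (inv g) x)) else (\<lambda>_. 0))"
  by (auto simp: crossed_star_algebra_def C0_zero C0_add C0_smult C0_adj)

lemma CR_ideal: "\<lbrakk>a \<in> carrier CR; g \<in> carrier G\<rbrakk> \<Longrightarrow> a g \<in> C0_ideal G X \<theta> g"
  and CR_finite: "a \<in> carrier CR \<Longrightarrow> finite (gsupp a)"
  and CR_supp: "a \<in> carrier CR \<Longrightarrow> gsupp a \<subseteq> carrier G"
  by (auto simp: CR_carrier)

lemma CR_C0:
  assumes "a \<in> carrier CR" shows "a g \<in> carrier (C0 X)"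
proof (cases "g \<in> carrier G")
  case True then show ?thesis using CR_ideal ideal_C0 assms by blast
next
  case False
  then have "a g = \<zero>\<^bsub>C0 X\<^esub>" using CR_supp[OF assms] by (auto simp: C0_zero)
  then show ?thesis by simp
qed

text \<open>The product formula in simplified form: \<alpha>_g(\<alpha>_{g^-1}(f) f') is f
  \<alpha>_g(f') because f vanishes off X_g. In the second form \<open>C0_act\<close> is applied to
  a function outside its ideal and is just an extension by zero.\<close>

definition cterm :: "'g \<Rightarrow> ('x \<Rightarrow> complex) \<Rightarrow> ('x \<Rightarrow> complex) \<Rightarrow> 'x \<Rightarrow> complex" where
  "cterm g f f' = (\<lambda>x. f x * C0_act G \<theta> g f' x)"

lemma cterm_eq:
  assumes g: "g \<in> carrier G" and f: "f \<in> C0_ideal G X \<theta> g"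
  shows "C0_act G \<theta> g (C0_act G \<theta> (inv g) f \<otimes>\<^bsub>C0 X\<^esub> f') = cterm g f f'"
proof
  fix x show "C0_act G \<theta> g (C0_act G \<theta> (inv g) f \<otimes>\<^bsub>C0 X\<^esub> f') x = cterm g f f' x"
  proof (cases "\<theta> (inv g) x")
    case None
    then show ?thesis by (simp add: C0_act_None cterm_def)
  next
    case (Some y)
    then have "\<theta> g y = Some x" using act_inv g by simp
    then show ?thesis using Some g by (simp add: C0_act_apply cterm_def C0_mult)
  qed
qed

text \<open>The factor \<open>C0_act G \<theta> g f'\<close> alone may be discontinuous. Membership
  is read off from the original form of the product, where each intermediate function lies in an
  ideal.\<close>

lemma cterm_C0:
  assumes g: "g \<in> carrier G" and f: "f \<in> C0_ideal G X \<theta> g" and f': "f' \<in> carrier (C0 X)"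
  shows "cterm g f f' \<in> carrier (C0 X)"
proof -
  have g': "inv g \<in> carrier G" using g by simp
  have 1: "C0_act G \<theta> (inv g) f \<in> C0_ideal G X \<theta> (inv g)" using C0_act_ideal[OF g'] f g by simp
  then have "C0_act G \<theta> (inv g) f \<otimes>\<^bsub>C0 X\<^esub> f' \<in> C0_ideal G X \<theta> (inv g)"
    using f' g' C0.m_closed by (auto simp: ideal_iff) (simp add: C0_mult)
  then show ?thesis using C0_act_ideal[OF g] ideal_C0[OF g] cterm_eq[OF g f] by metis
qed

text \<open>Solving g h = k for h leaves a sum over g alone; a flexible index set A allows several
  products to be compared term by term.\<close>

lemma CR_mult:
  assumes a: "a \<in> carrier CR" and b: "b \<in> carrier CR" and A: "finite A" "A \<subseteq> carrier G" "gsupp a \<subseteq> A"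
    and k: "k \<in> carrier G"
  shows "(a \<otimes>\<^bsub>CR\<^esub> b) k x = (\<Sum>g\<in>A. a g x * C0_act G \<theta> g (b (inv g \<otimes> k)) x)"
proof -
  let ?I = "{(g, h). a g \<noteq> \<zero>\<^bsub>C0 X\<^esub> \<and> b h \<noteq> \<zero>\<^bsub>C0 X\<^esub> \<and> g \<otimes> h = k}"
  have G: "g \<in> carrier G" "h \<in> carrier G" if "(g, h) \<in> ?I" for g h
    using that CR_supp[OF a] CR_supp[OF b] by (auto simp: C0_zero)
  have fin: "finite ?I"
    by (rule finite_subset[of _ "gsupp a \<times> gsupp b"]) (use CR_finite a b in \<open>auto simp: C0_zero\<close>)
  have "(a \<otimes>\<^bsub>CR\<^esub> b) k = finsum (C0 X) (\<lambda>(g, h). C0_act G \<theta> g (C0_act G \<theta> (inv g) (a g) \<otimes>\<^bsub>C0 X\<^esub> b h)) ?I"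
    by (simp add: crossed_star_algebra_def)
  also have "\<dots> = (\<lambda>x. \<Sum>i\<in>?I. (case i of (g, h) \<Rightarrow> C0_act G \<theta> g (C0_act G \<theta> (inv g) (a g) \<otimes>\<^bsub>C0 X\<^esub> b h)) x)"
  proof (rule finsum_C0(1)[OF fin])
    fix i assume "i \<in> ?I"
    then obtain g h where i: "i = (g, h)" "(g, h) \<in> ?I" by auto
    show "(case i of (g, h) \<Rightarrow> C0_act G \<theta> g (C0_act G \<theta> (inv g) (a g) \<otimes>\<^bsub>C0 X\<^esub> b h)) \<in> carrier (C0 X)"
      using cterm_C0[OF G(1) CR_ideal[OF a G(1)] CR_C0[OF b, of h]] cterm_eq[OF G(1) CR_ideal[OF a G(1)]] i by auto
  qed
  finally have "(a \<otimes>\<^bsub>CR\<^esub> b) k x = (\<Sum>i\<in>?I. (case i of (g, h) \<Rightarrow> C0_act G \<theta> g (C0_act G \<theta> (inv g) (a g) \<otimes>\<^bsub>C0 X\<^esub> b h)) x)" by simp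
  also have "\<dots> =
      (\<Sum>i\<in>?I. a (fst i) x * C0_act G \<theta> (fst i) (b (snd i)) x)"
  proof (intro sum.cong HOL.refl)
    fix i assume "i \<in> ?I"
    then obtain g h where i: "i = (g, h)" "(g, h) \<in> ?I" by auto
    show "(case i of (g, h) \<Rightarrow> C0_act G \<theta> g (C0_act G \<theta> (inv g) (a g) \<otimes>\<^bsub>C0 X\<^esub> b h)) x =
        a (fst i) x * C0_act G \<theta> (fst i) (b (snd i)) x"
      by (simp add: i(1) cterm_eq[OF G(1)[OF i(2)] CR_ideal[OF a G(1)[OF i(2)]]] cterm_def)
  qed
  also have "\<dots> =
      (\<Sum>g\<in>{g. a g \<noteq> (\<lambda>_. 0) \<and> b (inv g \<otimes> k) \<noteq> (\<lambda>_. 0)}. a g x * C0_act G \<theta> g (b (inv g \<otimes> k)) x)"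
  proof (rule sum.reindex_bij_witness[of _ "\<lambda>g. (g, inv g \<otimes> k)" fst])
    fix i assume "i \<in> ?I"
    then obtain g h where i: "i = (g, h)" "(g, h) \<in> ?I" by auto
    then have "inv g \<otimes> k = h" using G[OF i(2)] by (auto simp flip: m_assoc)
    then show "(fst i, inv (fst i) \<otimes> k) = i" "fst i \<in> {g. a g \<noteq> (\<lambda>_. 0) \<and> b (inv g \<otimes> k) \<noteq> (\<lambda>_. 0)}"
      "a (fst i) x * C0_act G \<theta> (fst i) (b (inv (fst i) \<otimes> k)) x = a (fst i) x * C0_act G \<theta> (fst i) (b (snd i)) x"
      using i by (auto simp: C0_zero)
  next
    fix g assume g: "g \<in> {g. a g \<noteq> (\<lambda>_. 0) \<and> b (inv g \<otimes> k) \<noteq> (\<lambda>_. 0)}"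
    then have "g \<in> carrier G" using CR_supp[OF a] by auto
    then have "g \<otimes> (inv g \<otimes> k) = k" using k by (simp flip: m_assoc)
    then show "(g, inv g \<otimes> k) \<in> ?I" using g by (auto simp: C0_zero)
  qed simp
  also have "\<dots> =
      (\<Sum>g\<in>A. a g x * C0_act G \<theta> g (b (inv g \<otimes> k)) x)"
    using A by (intro sum.mono_neutral_left) (auto simp: C0_act_zero)
  finally show ?thesis .
qed

lemma CR_mult_supp:
  assumes "a \<in> carrier CR" "b \<in> carrier CR"
  shows "gsupp (a \<otimes>\<^bsub>CR\<^esub> b) \<subseteq> (\<lambda>(g, h). g \<otimes> h) ` (gsupp a \<times> gsupp b)"
proof
  fix k assume k: "k \<in> gsupp (a \<otimes>\<^bsub>CR\<^esub> b)"
  let ?I = "{(g, h). a g \<noteq> \<zero>\<^bsub>C0 X\<^esub> \<and> b h \<noteq> \<zero>\<^bsub>C0 X\<^esub> \<and> g \<otimes> h = k}"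
  have "?I \<noteq> {}"
  proof
    assume e: "?I = {}"
    have "(a \<otimes>\<^bsub>CR\<^esub> b) k = finsum (C0 X) (\<lambda>(g, h). C0_act G \<theta> g (C0_act G \<theta> (inv g) (a g) \<otimes>\<^bsub>C0 X\<^esub> b h)) ?I"
      by (simp add: crossed_star_algebra_def)
    then show False using k unfolding e by (simp add: C0_zero)
  qed
  then show "k \<in> (\<lambda>(g, h). g \<otimes> h) ` (gsupp a \<times> gsupp b)" by (auto simp: C0_zero image_iff)
qed

lemma gsupp_prod:
  assumes "a \<in> carrier CR" "b \<in> carrier CR"
  shows "finite ((\<lambda>(g, h). g \<otimes> h) ` (gsupp a \<times> gsupp b))" "(\<lambda>(g, h). g \<otimes> h) ` (gsupp a \<times> gsupp b) \<subseteq> carrier G"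
  using CR_finite assms CR_supp[OF assms(1)] CR_supp[OF assms(2)] by auto

lemma CR_mult_closed:
  assumes a: "a \<in> carrier CR" and b: "b \<in> carrier CR" shows "a \<otimes>\<^bsub>CR\<^esub> b \<in> carrier CR"
proof -
  have "(a \<otimes>\<^bsub>CR\<^esub> b) k \<in> C0_ideal G X \<theta> k" if k: "k \<in> carrier G" for k
  proof -
    have eq: "(a \<otimes>\<^bsub>CR\<^esub> b) k = (\<lambda>x. \<Sum>g\<in>gsupp a. cterm g (a g) (b (inv g \<otimes> k)) x)"
      using CR_mult[OF a b CR_finite[OF a] CR_supp[OF a] subset_refl k] by (auto simp: cterm_def)
    have "(\<lambda>x. \<Sum>g\<in>gsupp a. cterm g (a g) (b (inv g \<otimes> k)) x) \<in> carrier (C0 X)"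
      using CR_supp[OF a] CR_ideal[OF a] CR_C0[OF b] by (intro finsum_C0(2) CR_finite a cterm_C0) auto
    \<comment> \<open>A nonzero value at x means that g^-1 x is defined and lies in X_h for h = g^-1
      k. By \<open>act_mult\<close> the composite k^-1 x is then defined, so the coefficient at k is
      supported in X_k.\<close>
    moreover have "cterm g (a g) (b (inv g \<otimes> k)) x = 0" if g: "g \<in> gsupp a" and x: "\<theta> (inv k) x = None" for g x
    proof (rule ccontr)
      assume nz: "cterm g (a g) (b (inv g \<otimes> k)) x \<noteq> 0"
      have gG: "g \<in> carrier G" using g CR_supp[OF a] by auto
      obtain y where y: "\<theta> (inv g) x = Some y" "b (inv g \<otimes> k) y \<noteq> 0"
        using nz by (auto simp: cterm_def C0_act_def split: option.splits)
      have hG: "inv g \<otimes> k \<in> carrier G" using gG k by simp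
      have "\<theta> (inv (inv g \<otimes> k)) y \<noteq> None" using y(2) CR_ideal[OF b hG] ideal_iff[OF hG] by blast
      then obtain z where "\<theta> (inv (inv g \<otimes> k)) y = Some z" by blast
      then have "(\<theta> (inv (inv g \<otimes> k)) \<circ>\<^sub>m \<theta> (inv g)) x = Some z" using y(1) by simp
      then have "\<theta> (inv (inv g \<otimes> k) \<otimes> inv g) x = Some z"
        using act_mult[of "inv (inv g \<otimes> k)" "inv g"] gG hG by (auto simp: map_le_def dom_def)
      moreover have "inv (inv g \<otimes> k) \<otimes> inv g = inv k"
        using gG k by (simp add: inv_mult_group m_assoc)
      ultimately show False using x by simp
    qed
    ultimately show ?thesis unfolding ideal_iff[OF k] eq by (auto intro: sum.neutral)
  qed
  then show ?thesis
    using CR_mult_supp[OF a b] gsupp_prod[OF a b] by (auto simp: CR_carrier intro: finite_subset)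
qed

lemma C0_act_add: "C0_act G \<theta> g (\<lambda>x. f x + f' x) = (\<lambda>x. C0_act G \<theta> g f x + C0_act G \<theta> g f' x)"
  by (auto simp: C0_act_def split: option.splits)

lemma C0_act_cnj: "C0_act G \<theta> g (\<lambda>x. cnj (f x)) = (\<lambda>x. cnj (C0_act G \<theta> g f x))"
  by (auto simp: C0_act_def split: option.splits)

lemma ideal_ops:
  assumes g: "g \<in> carrier G" and f: "f \<in> C0_ideal G X \<theta> g"
  shows "f' \<in> C0_ideal G X \<theta> g \<Longrightarrow> (\<lambda>x. f x + f' x) \<in> C0_ideal G X \<theta> g"
    and "(\<lambda>x. c * f x) \<in> C0_ideal G X \<theta> g"
    and "(\<lambda>x. cnj (f x)) \<in> C0_ideal G X \<theta> g"
  using f C0.a_closed[of f X f'] C0.smult_closed[of f X c] C0.adj_closed[of f X]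
  by (auto simp: ideal_iff[OF g] C0_add C0_smult C0_adj)

lemma star_alg_CR: "star_alg CR"
proof -
  have zero: "(\<lambda>_ _. 0) \<in> carrier CR"
  proof -
    have "(\<lambda>_. 0) \<in> carrier (C0 X)" using C0.zero_closed[of X] by (simp add: C0_zero)
    then show ?thesis by (simp add: CR_carrier ideal_iff)
  qed
  have add: "a \<oplus>\<^bsub>CR\<^esub> b \<in> carrier CR" if "a \<in> carrier CR" "b \<in> carrier CR" for a b
  proof -
    have "gsupp (\<lambda>g x. a g x + b g x) \<subseteq> gsupp a \<union> gsupp b" by auto
    then show ?thesis
      using that finite_subset[OF _ finite_UnI] ideal_ops(1) unfolding CR_carrier CR_add by blast
  qed
  have smult: "c \<odot>\<^bsub>CR\<^esub> a \<in> carrier CR" if "a \<in> carrier CR" for c a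
  proof -
    have "gsupp (\<lambda>g x. c * a g x) \<subseteq> gsupp a" by auto
    then show ?thesis
      using that finite_subset ideal_ops(2) unfolding CR_carrier CR_smult by blast
  qed
  have adj: "adj CR a \<in> carrier CR" if a: "a \<in> carrier CR" for a
  proof -
    have "gsupp (adj CR a) \<subseteq> (\<lambda>g. inv g) ` gsupp a"
    proof
      fix g assume g: "g \<in> gsupp (adj CR a)"
      then have "g \<in> carrier G" "a (inv g) \<noteq> (\<lambda>_. 0)"
        using C0_act_zero by (auto simp: CR_adj split: if_splits)
      then show "g \<in> (\<lambda>g. inv g) ` gsupp a" by (intro image_eqI[of _ _ "inv g"]) auto
    qed
    moreover have "adj CR a g \<in> C0_ideal G X \<theta> g" if g: "g \<in> carrier G" for g
      using C0_act_ideal[OF g] ideal_ops(3) CR_ideal[OF a, of "inv g"] g by (simp add: CR_adj)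
    ultimately show ?thesis
      using CR_finite[OF a] CR_supp[OF a] by (auto simp: CR_carrier intro: finite_subset)
  qed
  have ab: "abelian_group CR"
  proof (rule abelian_groupI)
    fix a assume a: "a \<in> carrier CR"
    show "\<exists>b\<in>carrier CR. b \<oplus>\<^bsub>CR\<^esub> a = \<zero>\<^bsub>CR\<^esub>"
      using smult[OF a, of "-1"] by (intro bexI[of _ "(-1) \<odot>\<^bsub>CR\<^esub> a"]) (auto simp: CR_add CR_zero CR_smult)
  qed (use add zero in \<open>auto simp: CR_add CR_zero algebra_simps\<close>)
  have outside: "(a \<otimes>\<^bsub>CR\<^esub> b) k = (\<lambda>_. 0)" if "a \<in> carrier CR" "b \<in> carrier CR" "k \<notin> carrier G" for a b k
    using CR_supp[OF CR_mult_closed[OF that(1,2)]] that(3) by blast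
  have l_distr: "(a \<oplus>\<^bsub>CR\<^esub> b) \<otimes>\<^bsub>CR\<^esub> c = a \<otimes>\<^bsub>CR\<^esub> c \<oplus>\<^bsub>CR\<^esub> b \<otimes>\<^bsub>CR\<^esub> c"
    if abc: "a \<in> carrier CR" "b \<in> carrier CR" "c \<in> carrier CR" for a b c
  proof (intro ext)
    fix k x
    let ?A = "gsupp a \<union> gsupp b"
    have A: "finite ?A" "?A \<subseteq> carrier G" using abc CR_finite CR_supp by auto
    show "((a \<oplus>\<^bsub>CR\<^esub> b) \<otimes>\<^bsub>CR\<^esub> c) k x = (a \<otimes>\<^bsub>CR\<^esub> c \<oplus>\<^bsub>CR\<^esub> b \<otimes>\<^bsub>CR\<^esub> c) k x"
    proof (cases "k \<in> carrier G")
      case True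
      have "((a \<oplus>\<^bsub>CR\<^esub> b) \<otimes>\<^bsub>CR\<^esub> c) k x = (\<Sum>g\<in>?A. (a \<oplus>\<^bsub>CR\<^esub> b) g x * C0_act G \<theta> g (c (inv g \<otimes> k)) x)"
        by (rule CR_mult[OF add[OF abc(1,2)] abc(3) A _ True]) (auto simp: CR_add)
      also have "\<dots> = (a \<otimes>\<^bsub>CR\<^esub> c) k x + (b \<otimes>\<^bsub>CR\<^esub> c) k x"
        unfolding CR_mult[OF abc(1,3) A Un_upper1 True] CR_mult[OF abc(2,3) A Un_upper2 True]
        by (simp add: CR_add sum.distrib[symmetric] distrib_right)
      finally show ?thesis by (simp add: CR_add)
    next
      case False
      then show ?thesis using outside[OF add[OF abc(1,2)] abc(3)] outside abc by (simp add: CR_add)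
    qed
  qed
  have r_distr: "c \<otimes>\<^bsub>CR\<^esub> (a \<oplus>\<^bsub>CR\<^esub> b) = c \<otimes>\<^bsub>CR\<^esub> a \<oplus>\<^bsub>CR\<^esub> c \<otimes>\<^bsub>CR\<^esub> b"
    if abc: "a \<in> carrier CR" "b \<in> carrier CR" "c \<in> carrier CR" for a b c
  proof (intro ext)
    fix k x
    have A: "finite (gsupp c)" "gsupp c \<subseteq> carrier G" using abc CR_finite CR_supp by auto
    show "(c \<otimes>\<^bsub>CR\<^esub> (a \<oplus>\<^bsub>CR\<^esub> b)) k x = (c \<otimes>\<^bsub>CR\<^esub> a \<oplus>\<^bsub>CR\<^esub> c \<otimes>\<^bsub>CR\<^esub> b) k x"
    proof (cases "k \<in> carrier G")
      case True
      have "(c \<otimes>\<^bsub>CR\<^esub> (a \<oplus>\<^bsub>CR\<^esub> b)) k x = (\<Sum>g\<in>gsupp c. c g x * C0_act G \<theta> g ((a \<oplus>\<^bsub>CR\<^esub> b) (inv g \<otimes> k)) x)"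
        by (rule CR_mult[OF abc(3) add[OF abc(1,2)] A subset_refl True])
      also have "\<dots> = (c \<otimes>\<^bsub>CR\<^esub> a) k x + (c \<otimes>\<^bsub>CR\<^esub> b) k x"
        unfolding CR_mult[OF abc(3,1) A subset_refl True] CR_mult[OF abc(3,2) A subset_refl True]
        by (simp add: CR_add C0_act_add sum.distrib[symmetric] distrib_left)
      finally show ?thesis by (simp add: CR_add)
    next
      case False
      then show ?thesis using outside[OF abc(3) add[OF abc(1,2)]] outside abc by (simp add: CR_add)
    qed
  qed
  have adj_adj: "adj CR (adj CR a) = a" if a: "a \<in> carrier CR" for a
  proof
    fix g show "adj CR (adj CR a) g = a g"
    proof (cases "g \<in> carrier G")
      case True
      then have "adj CR (adj CR a) g = C0_act G \<theta> g (C0_act G \<theta> (inv g) (a g))"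
        by (simp add: CR_adj C0_act_cnj)
      then show ?thesis using C0_act_inverse[OF True CR_ideal[OF a True]] by simp
    next
      case False
      then have "a g = (\<lambda>_. 0)" using CR_supp[OF a] by blast
      then show ?thesis using False by (simp add: CR_adj)
    qed
  qed
  have adj_add: "adj CR (a \<oplus>\<^bsub>CR\<^esub> b) = adj CR a \<oplus>\<^bsub>CR\<^esub> adj CR b" for a b
    by (auto simp: CR_adj CR_add C0_act_cnj C0_act_add fun_eq_iff)
  show ?thesis
    using ab smult adj l_distr r_distr adj_adj adj_add CR_mult_closed
    by (intro star_alg.intro star_alg_axioms.intro)
      (auto simp: CR_smult CR_add algebra_simps)
qed


section \<open>The l1 norm and its domination of C*-seminorms\<close>

definition l1_norm :: "('g \<Rightarrow> 'x \<Rightarrow> complex) \<Rightarrow> real" where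
  "l1_norm a = (\<Sum>g\<in>gsupp a. nrm (C0 X) (a g))"

lemma nrm_zero: "nrm (C0 X) (\<lambda>_. 0) = 0"
  using C0.p_zero[of X] by (simp add: C0_zero)

lemma nrm_nonneg: "a \<in> carrier CR \<Longrightarrow> 0 \<le> nrm (C0 X) (a g)"
  using C0.nonneg CR_C0 by blast

lemma l1_norm_eq: "\<lbrakk>finite A; gsupp a \<subseteq> A\<rbrakk> \<Longrightarrow> l1_norm a = (\<Sum>g\<in>A. nrm (C0 X) (a g))"
  unfolding l1_norm_def by (intro sum.mono_neutral_left) (auto simp: nrm_zero)

text \<open>The injective reindexing \<sigma> is the inversion of G for the involution and a left
  translation for the product.\<close>

lemma sum_le_l1_norm:
  assumes "b \<in> carrier CR" "finite B" "inj_on \<sigma> B" shows "(\<Sum>g\<in>B. nrm (C0 X) (b (\<sigma> g))) \<le> l1_norm b"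
proof -
  have "(\<Sum>g\<in>B. nrm (C0 X) (b (\<sigma> g))) = (\<Sum>h\<in>\<sigma> ` B. nrm (C0 X) (b h))"
    using assms(3) by (simp add: sum.reindex)
  also have "\<dots> \<le> (\<Sum>h\<in>\<sigma> ` B \<union> gsupp b. nrm (C0 X) (b h))"
    using assms CR_finite nrm_nonneg by (intro sum_mono2) auto
  also have "\<dots> = l1_norm b" using assms CR_finite by (intro l1_norm_eq[symmetric]) auto
  finally show ?thesis .
qed

lemma norm_C0_act_le: "f \<in> carrier (C0 X) \<Longrightarrow> cmod (C0_act G \<theta> g f x) \<le> nrm (C0 X) f"
  using norm_le_C0_nrm[of f X] C0.nonneg[of f X] by (auto simp: C0_act_def split: option.splits)

end

sublocale partial_action \<subseteq> CR: star_alg CR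
  by (rule star_alg_CR)

context partial_action
begin

lemma star_seminorm_l1_norm: "star_seminorm CR l1_norm"
proof unfold_locales
  fix a assume a: "a \<in> carrier CR"
  note fa = CR_finite[OF a] CR_supp[OF a]
  show "0 \<le> l1_norm a" unfolding l1_norm_def using nrm_nonneg[OF a] by (simp add: sum_nonneg)
  show "l1_norm (c \<odot>\<^bsub>CR\<^esub> a) = cmod c * l1_norm a" for c
  proof -
    have "nrm (C0 X) ((c \<odot>\<^bsub>CR\<^esub> a) g) = cmod c * nrm (C0 X) (a g)" for g
      using C0.homogeneous[OF CR_C0[OF a, of g], of c] by (simp add: CR_smult C0_smult)
    moreover have "l1_norm (c \<odot>\<^bsub>CR\<^esub> a) = (\<Sum>g\<in>gsupp a. nrm (C0 X) ((c \<odot>\<^bsub>CR\<^esub> a) g))"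
      using fa by (intro l1_norm_eq) (auto simp: CR_smult)
    ultimately show ?thesis by (simp add: l1_norm_def sum_distrib_left)
  qed
  have adj_le: "l1_norm (adj CR a) \<le> l1_norm a" if a: "a \<in> carrier CR" for a
  proof -
    have aa: "adj CR a \<in> carrier CR" using CR.adj_closed[OF a] .
    have "l1_norm (adj CR a) \<le> (\<Sum>g\<in>gsupp (adj CR a). nrm (C0 X) (a (inv g)))"
      unfolding l1_norm_def
    proof (rule sum_mono)
      fix g assume "g \<in> gsupp (adj CR a)"
      then have g: "g \<in> carrier G" using CR_supp[OF aa] by auto
      have c: "(\<lambda>x. cnj (a (inv g) x)) \<in> carrier (C0 X)"
        using C0.adj_closed[OF CR_C0[OF a, of "inv g"]] by (simp add: C0_adj)
      have "nrm (C0 X) (adj CR a g) \<le> nrm (C0 X) (\<lambda>x. cnj (a (inv g) x))"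
        using C0_act_norm_le[OF c, of g] g by (simp add: CR_adj)
      also have "\<dots> = nrm (C0 X) (a (inv g))"
        using C0.isometric_adj[OF CR_C0[OF a, of "inv g"]] by (simp add: C0_adj)
      finally show "nrm (C0 X) (adj CR a g) \<le> nrm (C0 X) (a (inv g))" .
    qed
    also have "\<dots> \<le> l1_norm a"
      using CR_finite[OF aa] CR_supp[OF aa] by (intro sum_le_l1_norm[OF a]) (auto intro!: inj_onI)
    finally show ?thesis .
  qed
  show "l1_norm (adj CR a) = l1_norm a"
    using adj_le[OF a] adj_le[OF CR.adj_closed[OF a]] by (simp add: CR.adj_adj[OF a])
  fix b assume b: "b \<in> carrier CR"
  note fb = CR_finite[OF b] CR_supp[OF b]
  show "l1_norm (a \<oplus>\<^bsub>CR\<^esub> b) \<le> l1_norm a + l1_norm b"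
  proof -
    let ?A = "gsupp a \<union> gsupp b"
    have "l1_norm (a \<oplus>\<^bsub>CR\<^esub> b) = (\<Sum>g\<in>?A. nrm (C0 X) ((a \<oplus>\<^bsub>CR\<^esub> b) g))"
      using fa fb by (intro l1_norm_eq) (auto simp: CR_add)
    also have "\<dots> \<le> (\<Sum>g\<in>?A. nrm (C0 X) (a g) + nrm (C0 X) (b g))"
    proof (rule sum_mono)
      fix g show "nrm (C0 X) ((a \<oplus>\<^bsub>CR\<^esub> b) g) \<le> nrm (C0 X) (a g) + nrm (C0 X) (b g)"
        using C0.triangle[OF CR_C0[OF a, of g] CR_C0[OF b, of g]] by (simp add: CR_add C0_add)
    qed
    also have "\<dots> = l1_norm a + l1_norm b" using fa fb by (simp add: sum.distrib l1_norm_eq[of ?A])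
    finally show ?thesis .
  qed
  show "l1_norm (a \<otimes>\<^bsub>CR\<^esub> b) \<le> l1_norm a * l1_norm b"
  proof -
    let ?A = "gsupp a" and ?K = "(\<lambda>(g, h). g \<otimes> h) ` (gsupp a \<times> gsupp b)"
    note K = gsupp_prod[OF a b]
    have "l1_norm (a \<otimes>\<^bsub>CR\<^esub> b) = (\<Sum>k\<in>?K. nrm (C0 X) ((a \<otimes>\<^bsub>CR\<^esub> b) k))"
      by (rule l1_norm_eq[OF K(1) CR_mult_supp[OF a b]])
    also have "\<dots> \<le> (\<Sum>k\<in>?K. \<Sum>g\<in>?A. nrm (C0 X) (a g) * nrm (C0 X) (b (inv g \<otimes> k)))"
    proof (intro sum_mono C0_nrm_le)
      fix k x assume "k \<in> ?K"
      then have k: "k \<in> carrier G" using K(2) by blast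
      have "cmod ((a \<otimes>\<^bsub>CR\<^esub> b) k x) = cmod (\<Sum>g\<in>?A. a g x * C0_act G \<theta> g (b (inv g \<otimes> k)) x)"
        by (simp add: CR_mult[OF a b fa subset_refl k])
      also have "\<dots> \<le> (\<Sum>g\<in>?A. nrm (C0 X) (a g) * nrm (C0 X) (b (inv g \<otimes> k)))"
        using norm_le_C0_nrm[OF CR_C0[OF a]] norm_C0_act_le[OF CR_C0[OF b]] nrm_nonneg[OF a]
        by (intro sum_norm_le) (auto simp: norm_mult intro!: mult_mono)
      finally show "cmod ((a \<otimes>\<^bsub>CR\<^esub> b) k x) \<le> (\<Sum>g\<in>?A. nrm (C0 X) (a g) * nrm (C0 X) (b (inv g \<otimes> k)))" .
    qed (use nrm_nonneg a b in \<open>auto intro!: sum_nonneg\<close>)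
    also have "\<dots> = (\<Sum>g\<in>?A. nrm (C0 X) (a g) * (\<Sum>k\<in>?K. nrm (C0 X) (b (inv g \<otimes> k))))"
      by (subst sum.swap) (simp add: sum_distrib_left)
    \<comment> \<open>For fixed g the translation by \<open>inv g\<close> is injective, so each
      coefficient of b is counted at most once.\<close>
    also have "\<dots> \<le> (\<Sum>g\<in>?A. nrm (C0 X) (a g) * l1_norm b)"
    proof (intro sum_mono mult_left_mono sum_le_l1_norm[OF b K(1)] nrm_nonneg[OF a] inj_onI)
      fix g k k' assume *: "g \<in> ?A" "k \<in> ?K" "k' \<in> ?K" "inv g \<otimes> k = inv g \<otimes> k'"
      then have "inv g \<in> carrier G" "k \<in> carrier G" "k' \<in> carrier G" using fa(2) K(2) by blast+
      then show "k = k'" using *(4) by (simp add: Units_eq)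
    qed
    also have "\<dots> = l1_norm a * l1_norm b" by (simp add: l1_norm_def sum_distrib_right)
    finally show ?thesis .
  qed
qed

definition single :: "'g \<Rightarrow> ('x \<Rightarrow> complex) \<Rightarrow> 'g \<Rightarrow> 'x \<Rightarrow> complex" where
  "single g f = (\<lambda>h. if h = g then f else (\<lambda>_. 0))"

lemma ideal_zero: "g \<in> carrier G \<Longrightarrow> (\<lambda>_. 0) \<in> C0_ideal G X \<theta> g"
  using C0.zero_closed[of X] by (simp add: ideal_iff C0_zero)

lemma single_closed: "\<lbrakk>g \<in> carrier G; f \<in> C0_ideal G X \<theta> g\<rbrakk> \<Longrightarrow> single g f \<in> carrier CR"
  using finite_subset[of "gsupp (single g f)" "{g}"]
  by (auto simp: CR_carrier single_def ideal_zero)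

lemma single_one_closed: "f \<in> carrier (C0 X) \<Longrightarrow> single \<one> f \<in> carrier CR"
  by (intro single_closed) (auto simp: ideal_one)

lemma gsupp_single: "gsupp (single g f) \<subseteq> {g}"
  by (auto simp: single_def)

lemma single_one_mult:
  assumes f: "f \<in> carrier (C0 X)" and f': "f' \<in> carrier (C0 X)"
  shows "single \<one> f \<otimes>\<^bsub>CR\<^esub> single \<one> f' = single \<one> (f \<otimes>\<^bsub>C0 X\<^esub> f')"
proof (intro ext)
  fix k x
  note sc = single_one_closed[OF f] single_one_closed[OF f']
  show "(single \<one> f \<otimes>\<^bsub>CR\<^esub> single \<one> f') k x = single \<one> (f \<otimes>\<^bsub>C0 X\<^esub> f') k x"
  proof (cases "k \<in> carrier G")
    case True
    have "(single \<one> f \<otimes>\<^bsub>CR\<^esub> single \<one> f') k x = (\<Sum>g\<in>{\<one>}. single \<one> f g x * C0_act G \<theta> g (single \<one> f' (inv g \<otimes> k)) x)"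
      by (rule CR_mult[OF sc _ _ gsupp_single True]) auto
    also have "\<dots> = single \<one> (f \<otimes>\<^bsub>C0 X\<^esub> f') k x"
      using True f' by (auto simp: single_def C0_mult C0_act_zero C0_act_one)
    finally show ?thesis .
  next
    case False
    then have "k \<notin> gsupp (single \<one> f \<otimes>\<^bsub>CR\<^esub> single \<one> f')" using CR_supp[OF CR.m_closed[OF sc]] by blast
    then show ?thesis using False by (auto simp: single_def)
  qed
qed

text \<open>The square of a homogeneous element lies in degree 1, where the crossed product is a
  copy of C0(X) and \<open>cstar_seminorm_le_C0_nrm\<close> applies.\<close>

lemma single_adj_mult:
  assumes g: "g \<in> carrier G" and f: "f \<in> C0_ideal G X \<theta> g"
  shows "adj CR (single g f) \<otimes>\<^bsub>CR\<^esub> single g f = single \<one> (C0_act G \<theta> (inv g) (adj (C0 X) f \<otimes>\<^bsub>C0 X\<^esub> f))"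
proof (intro ext)
  fix k x
  have g': "inv g \<in> carrier G" using g by simp
  note sc = CR.adj_closed[OF single_closed[OF g f]] single_closed[OF g f]
  have inv_eq: "inv h = g \<longleftrightarrow> h = inv g" if "h \<in> carrier G" for h using that g by auto
  have adj: "adj CR (single g f) = single (inv g) (C0_act G \<theta> (inv g) (\<lambda>x. cnj (f x)))"
    using g by (auto simp: CR_adj single_def fun_eq_iff inv_eq C0_act_zero)
  have gk: "g \<otimes> k = g \<longleftrightarrow> k = \<one>" if "k \<in> carrier G" using g that by simp
  show "(adj CR (single g f) \<otimes>\<^bsub>CR\<^esub> single g f) k x = single \<one> (C0_act G \<theta> (inv g) (adj (C0 X) f \<otimes>\<^bsub>C0 X\<^esub> f)) k x"
  proof (cases "k \<in> carrier G")
    case True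
    have "(adj CR (single g f) \<otimes>\<^bsub>CR\<^esub> single g f) k x =
        (\<Sum>h\<in>{inv g}. adj CR (single g f) h x * C0_act G \<theta> h (single g f (inv h \<otimes> k)) x)"
      by (rule CR_mult[OF sc _ _ _ True]) (use g' gsupp_single[of "inv g"] in \<open>simp_all add: adj\<close>)
    also have "\<dots> = single \<one> (C0_act G \<theta> (inv g) (adj (C0 X) f \<otimes>\<^bsub>C0 X\<^esub> f)) k x"
      using g gk[OF True]
      by (simp add: adj) (auto simp: single_def C0_act_zero C0_mult C0_adj C0_act_def split: option.splits)
    finally show ?thesis .
  next
    case False
    then have "k \<notin> gsupp (adj CR (single g f) \<otimes>\<^bsub>CR\<^esub> single g f)" using CR_supp[OF CR.m_closed[OF sc]] by blast
    then show ?thesis using False by (auto simp: single_def)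
  qed
qed

text \<open>On the copy of C0(X) in degree 1 the seminorm is at most the sup norm. The C*-identity
  carries this bound to degree g, since the partial action does not increase norms.\<close>

lemma seminorm_single_le:
  assumes p: "cstar_seminorm CR p" and g: "g \<in> carrier G" and f: "f \<in> C0_ideal G X \<theta> g"
  shows "p (single g f) \<le> nrm (C0 X) f"
proof -
  interpret p: cstar_seminorm_alg CR p by unfold_locales (rule p)
  have hom: "star_hom_alg (C0 X) CR (single \<one>)"
  proof unfold_locales
    show "star_hom (C0 X) CR (single \<one>)"
      unfolding star_hom_def
    proof (intro conjI ballI allI)
      fix f assume f: "f \<in> carrier (C0 X)"
      show "single \<one> (c \<odot>\<^bsub>C0 X\<^esub> f) = c \<odot>\<^bsub>CR\<^esub> single \<one> f" for c
        by (auto simp: single_def CR_smult C0_smult)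
      have inv1: "inv h = \<one> \<longleftrightarrow> h = \<one>" if "h \<in> carrier G" for h using that by auto
      show "single \<one> (adj (C0 X) f) = adj CR (single \<one> f)"
        using C0_act_one[OF C0.adj_closed[OF f]]
        by (auto simp: single_def CR_adj C0_adj fun_eq_iff inv1 C0_act_zero)
      fix f' assume f': "f' \<in> carrier (C0 X)"
      show "single \<one> (f \<oplus>\<^bsub>C0 X\<^esub> f') = single \<one> f \<oplus>\<^bsub>CR\<^esub> single \<one> f'"
        by (auto simp: single_def CR_add C0_add)
      show "single \<one> (f \<otimes>\<^bsub>C0 X\<^esub> f') = single \<one> f \<otimes>\<^bsub>CR\<^esub> single \<one> f'"
        using single_one_mult[OF f f'] by simp
    qed (use single_one_closed in auto)
  qed
  have le: "p (single \<one> w) \<le> nrm (C0 X) w" if "w \<in> carrier (C0 X)" for w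
    using cstar_seminorm_le_C0_nrm[OF star_hom_alg.cstar_seminorm_pullback[OF hom p] that] .
  have g': "inv g \<in> carrier G" using g by simp
  have fC: "f \<in> carrier (C0 X)" using ideal_C0[OF g f] .
  let ?ff = "adj (C0 X) f \<otimes>\<^bsub>C0 X\<^esub> f"
  have ffC: "?ff \<in> carrier (C0 X)" using fC by (simp add: C0.m_closed C0.adj_closed)
  have "?ff \<in> C0_ideal G X \<theta> (inv (inv g))"
    using ffC f g by (simp add: ideal_iff) (simp add: C0_mult)
  then have act: "C0_act G \<theta> (inv g) ?ff \<in> carrier (C0 X)"
    using C0_act_ideal[OF g'] ideal_C0[OF g'] by blast
  have "(p (single g f))\<^sup>2 = p (single \<one> (C0_act G \<theta> (inv g) ?ff))"
    using p.cstar_identity[OF single_closed[OF g f]] single_adj_mult[OF g f] by simp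
  also have "\<dots> \<le> nrm (C0 X) (C0_act G \<theta> (inv g) ?ff)" by (rule le[OF act])
  also have "\<dots> \<le> nrm (C0 X) ?ff" by (rule C0_act_norm_le[OF ffC])
  also have "\<dots> = (nrm (C0 X) f)\<^sup>2" by (rule C0.cstar_identity[OF fC])
  finally show ?thesis using C0.nonneg[OF fC] by (rule power2_le_imp_le)
qed

text \<open>The triangle inequality over the finitely many degrees. It serves twice: it bounds the
  C*-seminorms, so that the envelope is meaningful, and it turns density in \<open>l1_norm\<close>
  into density in the envelope norm.\<close>

lemma cstar_seminorm_le_l1_norm:
  assumes p: "cstar_seminorm CR p" and a: "a \<in> carrier CR" shows "p a \<le> l1_norm a"
proof -
  interpret p: cstar_seminorm_alg CR p by unfold_locales (rule p)
  have *: "p a \<le> (\<Sum>g\<in>A. nrm (C0 X) (a g))" if "finite A" "A \<subseteq> carrier G" "a \<in> carrier CR" "gsupp a \<subseteq> A" for A a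
    using that
  proof (induction A arbitrary: a rule: finite_induct)
    case empty
    then have "a = \<zero>\<^bsub>CR\<^esub>" by (auto simp: CR_zero)
    then show ?case using p.p_zero by simp
  next
    case (insert g A)
    let ?b = "a(g := (\<lambda>_. 0))"
    have g: "g \<in> carrier G" using insert.prems by simp
    have supp: "gsupp ?b \<subseteq> A" using insert.prems(3) by auto
    then have b: "?b \<in> carrier CR"
      using insert.prems insert.hyps(1) ideal_zero finite_subset[OF supp] by (auto simp: CR_carrier)
    have ag: "a g \<in> C0_ideal G X \<theta> g" using CR_ideal[OF insert.prems(2) g] .
    have "a = ?b \<oplus>\<^bsub>CR\<^esub> single g (a g)" by (auto simp: CR_add single_def fun_eq_iff)
    then have "p a \<le> p ?b + p (single g (a g))"
      using p.triangle[OF b single_closed[OF g ag]] by simp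
    also have "p (single g (a g)) \<le> nrm (C0 X) (a g)" by (rule seminorm_single_le[OF p g ag])
    also have "p ?b \<le> (\<Sum>h\<in>A. nrm (C0 X) (?b h))" by (rule insert.IH[OF _ b supp]) (use insert.prems in blast)
    also have "\<dots> = (\<Sum>h\<in>A. nrm (C0 X) (a h))" using insert.hyps by (intro sum.cong) auto
    finally show ?case using insert.hyps by simp
  qed
  show ?thesis unfolding l1_norm_def using *[OF CR_finite[OF a] CR_supp[OF a] a subset_refl] .
qed

lemma bounded_star_alg_CR: "bounded_star_alg CR"
  by unfold_locales (use cstar_seminorm_le_l1_norm in blast)

end

sublocale partial_action \<subseteq> CR: bounded_star_alg CR
  by (rule bounded_star_alg_CR)


section \<open>Transport of structure\<close>

text \<open>No algebra law is assumed for A: its carrier and operations are those of B relabelled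
  along \<Gamma>, and the laws are deduced.\<close>

locale star_alg_transport = B: star_alg B for A :: "('a, 'm) star_algebra_scheme" and B :: "('b, 'n) star_algebra_scheme" +
  fixes \<Gamma> :: "'a \<Rightarrow> 'b" and \<Delta> :: "'b \<Rightarrow> 'a"
  assumes \<Gamma>: "x \<in> carrier A \<Longrightarrow> \<Gamma> x \<in> carrier B" and \<Delta>\<Gamma>: "x \<in> carrier A \<Longrightarrow> \<Delta> (\<Gamma> x) = x"
    and \<Delta>: "y \<in> carrier B \<Longrightarrow> \<Delta> y \<in> carrier A" and \<Gamma>\<Delta>: "y \<in> carrier B \<Longrightarrow> \<Gamma> (\<Delta> y) = y"
    and zero: "\<zero>\<^bsub>A\<^esub> = \<Delta> \<zero>\<^bsub>B\<^esub>"
    and add: "\<lbrakk>x \<in> carrier A; x' \<in> carrier A\<rbrakk> \<Longrightarrow> x \<oplus>\<^bsub>A\<^esub> x' = \<Delta> (\<Gamma> x \<oplus>\<^bsub>B\<^esub> \<Gamma> x')"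
    and mult: "\<lbrakk>x \<in> carrier A; x' \<in> carrier A\<rbrakk> \<Longrightarrow> x \<otimes>\<^bsub>A\<^esub> x' = \<Delta> (\<Gamma> x \<otimes>\<^bsub>B\<^esub> \<Gamma> x')"
    and smult: "x \<in> carrier A \<Longrightarrow> c \<odot>\<^bsub>A\<^esub> x = \<Delta> (c \<odot>\<^bsub>B\<^esub> \<Gamma> x)"
    and adj: "x \<in> carrier A \<Longrightarrow> adj A x = \<Delta> (adj B (\<Gamma> x))"
begin

lemmas tr = \<Gamma> \<Delta>\<Gamma> \<Delta> \<Gamma>\<Delta> zero add mult smult adj B.m_closed B.smult_closed B.adj_closed

lemma star_alg_A: "star_alg A"
proof -
  have "abelian_group A"
  proof (rule abelian_groupI)
    fix x assume x: "x \<in> carrier A"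
    show "\<exists>y\<in>carrier A. y \<oplus>\<^bsub>A\<^esub> x = \<zero>\<^bsub>A\<^esub>"
      using x by (intro bexI[of _ "\<Delta> (\<ominus>\<^bsub>B\<^esub> \<Gamma> x)"]) (simp_all add: tr B.l_neg)
  next
    fix x y assume "x \<in> carrier A" "y \<in> carrier A"
    then show "x \<oplus>\<^bsub>A\<^esub> y = y \<oplus>\<^bsub>A\<^esub> x" by (simp add: tr B.a_comm)
  qed (simp_all add: tr B.a_assoc)
  then show ?thesis
    by (intro star_alg.intro star_alg_axioms.intro)
      (simp_all add: tr B.l_distr B.r_distr B.smult_r_distr B.smult_l_distr B.smult_one B.adj_add B.adj_adj)
qed

lemma star_hom_\<Gamma>: "star_hom_alg A B \<Gamma>" and star_hom_\<Delta>: "star_hom_alg B A \<Delta>"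
proof -
  show "star_hom_alg A B \<Gamma>"
    by (intro star_hom_alg.intro star_alg_A B.star_alg_axioms star_hom_alg_axioms.intro)
      (simp add: star_hom_def tr)
  show "star_hom_alg B A \<Delta>"
    by (intro star_hom_alg.intro star_alg_A B.star_alg_axioms star_hom_alg_axioms.intro)
      (simp add: star_hom_def tr)
qed

text \<open>C*-seminorms pull back along \<Gamma> and along its inverse \<Delta>, so the two largest
  ones agree under the relabelling.\<close>

lemma envelope_isomorphic:
  assumes "bounded_star_alg B"
  shows "cstar_isomorphic (envelope A) (envelope B)" and "cstar_isomorphic (envelope B) (envelope A)"
proof -
  interpret BB: bounded_star_alg B by fact
  interpret \<Gamma>: star_hom_alg A B \<Gamma> by (rule star_hom_\<Gamma>)
  interpret \<Delta>: star_hom_alg B A \<Delta> by (rule star_hom_\<Delta>)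
  have le: "p x \<le> env_norm B (\<Gamma> x)" if p: "cstar_seminorm A p" and x: "x \<in> carrier A" for p x
    using BB.le_env_norm[OF \<Delta>.cstar_seminorm_pullback[OF p] \<Gamma>[OF x]] by (simp add: \<Delta>\<Gamma> x)
  interpret AA: bounded_star_alg A
    by (intro bounded_star_alg.intro star_alg_A bounded_star_alg_axioms.intro) (use le in blast)
  have eq: "env_norm A x = env_norm B (\<Gamma> x)" if x: "x \<in> carrier A" for x
  proof (rule antisym)
    show "env_norm A x \<le> env_norm B (\<Gamma> x)" using le x by (intro AA.env_norm_le)
    show "env_norm B (\<Gamma> x) \<le> env_norm A x"
      using AA.le_env_norm[OF \<Gamma>.cstar_seminorm_pullback x] by (intro BB.env_norm_le)
  qed
  have "completion A (env_norm A) (envelope B) (\<lambda>u X. range u \<subseteq> carrier A \<and> BB.env_conv (\<Gamma> \<circ> u) X)"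
  proof (intro completion_pullback[OF BB.env.completion_axioms star_hom_\<Gamma>])
    fix b and e :: real assume b: "b \<in> carrier B" and "e > 0"
    then have "env_norm B (b \<ominus>\<^bsub>B\<^esub> \<Gamma> (\<Delta> b)) < e"
      by (simp only: \<Gamma>\<Delta>[OF b] B.diff_self[OF b] BB.env.p_zero)
    then show "\<exists>x\<in>carrier A. env_norm B (b \<ominus>\<^bsub>B\<^esub> \<Gamma> x) < e" using \<Delta>[OF b] by blast
  qed (rule eq)
  from completion_isomorphic[OF AA.env.completion_axioms this] completion_isomorphic[OF this AA.env.completion_axioms]
  show "cstar_isomorphic (envelope A) (envelope B)" "cstar_isomorphic (envelope B) (envelope A)" .
qed

end

text \<open>Applying \<gamma> to each coefficient identifies the two crossed product *-algebras.
  That A is a completion supplies what the coefficient formulas need of A: closure under the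
  operations and an additive monoid for \<open>finsum\<close>.\<close>

theorem (in partial_action) transported_isomorphic:
  assumes "completion D p A conv" and \<gamma>: "cstar_iso A (C0 X) \<gamma>"
  shows "cstar_isomorphic (transported_crossed_product A \<gamma> G X \<theta>) (C0_crossed_product G X \<theta>)"
    and "cstar_isomorphic (C0_crossed_product G X \<theta>) (transported_crossed_product A \<gamma> G X \<theta>)"
proof -
  interpret A: completion D p A conv by fact
  interpret AM: abelian_monoid A by (rule A.abelian_monoid_completion)
  have bij: "bij_betw \<gamma> (carrier A) (carrier (C0 X))"
    and \<gamma>_add: "\<And>x y. \<lbrakk>x \<in> carrier A; y \<in> carrier A\<rbrakk> \<Longrightarrow> \<gamma> (x \<oplus>\<^bsub>A\<^esub> y) = \<gamma> x \<oplus>\<^bsub>C0 X\<^esub> \<gamma> y"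
    and \<gamma>_mult: "\<And>x y. \<lbrakk>x \<in> carrier A; y \<in> carrier A\<rbrakk> \<Longrightarrow> \<gamma> (x \<otimes>\<^bsub>A\<^esub> y) = \<gamma> x \<otimes>\<^bsub>C0 X\<^esub> \<gamma> y"
    and \<gamma>_smult: "\<And>c x. x \<in> carrier A \<Longrightarrow> \<gamma> (c \<odot>\<^bsub>A\<^esub> x) = c \<odot>\<^bsub>C0 X\<^esub> \<gamma> x"
    and \<gamma>_adj: "\<And>x. x \<in> carrier A \<Longrightarrow> \<gamma> (adj A x) = adj (C0 X) (\<gamma> x)"
    using \<gamma> unfolding cstar_iso_def by blast+
  define \<delta> where "\<delta> = inv_into (carrier A) \<gamma>"
  have \<gamma>c: "\<gamma> x \<in> carrier (C0 X)" if "x \<in> carrier A" for x using bij that by (auto simp: bij_betw_def)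
  have \<delta>c: "\<delta> f \<in> carrier A" if "f \<in> carrier (C0 X)" for f
    using bij that by (auto simp: \<delta>_def bij_betw_def inv_into_into)
  have \<delta>\<gamma>: "\<delta> (\<gamma> x) = x" if "x \<in> carrier A" for x
    using bij that by (simp add: \<delta>_def bij_betw_def)
  have \<gamma>\<delta>: "\<gamma> (\<delta> f) = f" if "f \<in> carrier (C0 X)" for f
    using bij that by (simp add: \<delta>_def bij_betw_def f_inv_into_f)
  have \<gamma>0: "\<gamma> \<zero>\<^bsub>A\<^esub> = (\<lambda>_. 0)"
  proof -
    have "\<gamma> \<zero>\<^bsub>A\<^esub> = \<gamma> \<zero>\<^bsub>A\<^esub> \<oplus>\<^bsub>C0 X\<^esub> \<gamma> \<zero>\<^bsub>A\<^esub>" using \<gamma>_add[of "\<zero>\<^bsub>A\<^esub>" "\<zero>\<^bsub>A\<^esub>"] by simp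
    then show ?thesis using C0.eq_zeroI[OF \<gamma>c] by (simp add: C0_zero)
  qed
  have \<delta>0: "\<delta> (\<lambda>_. 0) = \<zero>\<^bsub>A\<^esub>" using \<delta>\<gamma>[of "\<zero>\<^bsub>A\<^esub>"] by (simp add: \<gamma>0)
  have \<gamma>0_iff: "\<gamma> x = (\<lambda>_. 0) \<longleftrightarrow> x = \<zero>\<^bsub>A\<^esub>" if "x \<in> carrier A" for x
    using \<delta>\<gamma>[OF that] \<delta>0 \<gamma>0 by metis
  have \<delta>0_iff: "\<delta> f = \<zero>\<^bsub>A\<^esub> \<longleftrightarrow> f = (\<lambda>_. 0)" if "f \<in> carrier (C0 X)" for f
    using \<gamma>\<delta>[OF that] \<delta>0 \<gamma>0 by metis
  let ?T = "crossed_star_algebra A G (\<lambda>g. {a \<in> carrier A. \<gamma> a \<in> C0_ideal G X \<theta> g}) (\<lambda>g a. \<delta> (C0_act G \<theta> g (\<gamma> a)))"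
  have T_carrier: "a \<in> carrier ?T \<longleftrightarrow> (\<forall>g\<in>carrier G. a g \<in> carrier A \<and> \<gamma> (a g) \<in> C0_ideal G X \<theta> g) \<and>
      (\<forall>g. g \<notin> carrier G \<longrightarrow> a g = \<zero>\<^bsub>A\<^esub>) \<and> finite {g. a g \<noteq> \<zero>\<^bsub>A\<^esub>}" for a
    by (auto simp: crossed_star_algebra_def)
  have Tc: "a g \<in> carrier A" if "a \<in> carrier ?T" for a g
    using that AM.zero_closed unfolding T_carrier by (cases "g \<in> carrier G") auto
  define \<Gamma> where "\<Gamma> a = (\<lambda>g. \<gamma> (a g))" for a :: "'g \<Rightarrow> _"
  define \<Delta> where "\<Delta> b = (\<lambda>g. \<delta> (b g))" for b :: "'g \<Rightarrow> 'x \<Rightarrow> complex"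
  have \<Gamma>c: "\<Gamma> a \<in> carrier CR" if a: "a \<in> carrier ?T" for a
  proof -
    have "gsupp (\<Gamma> a) = {g. a g \<noteq> \<zero>\<^bsub>A\<^esub>}" using \<gamma>0_iff[OF Tc[OF a]] by (simp add: \<Gamma>_def)
    then show ?thesis using a unfolding T_carrier CR_carrier by (auto simp: \<Gamma>_def)
  qed
  have \<Delta>c: "\<Delta> b \<in> carrier ?T" if b: "b \<in> carrier CR" for b
  proof -
    have "{g. \<Delta> b g \<noteq> \<zero>\<^bsub>A\<^esub>} = gsupp b" using \<delta>0_iff[OF CR_C0[OF b]] by (simp add: \<Delta>_def)
    then show ?thesis
      using b CR_C0[OF b] unfolding T_carrier CR_carrier by (auto simp: \<Delta>_def \<delta>c \<gamma>\<delta>)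
  qed
  have \<delta>_add: "\<delta> (f \<oplus>\<^bsub>C0 X\<^esub> f') = \<delta> f \<oplus>\<^bsub>A\<^esub> \<delta> f'" if "f \<in> carrier (C0 X)" "f' \<in> carrier (C0 X)" for f f'
    using \<delta>\<gamma>[of "\<delta> f \<oplus>\<^bsub>A\<^esub> \<delta> f'"] that by (simp add: \<delta>c \<gamma>_add \<gamma>\<delta>)
  \<comment> \<open>The two multiplications are finite sums taken in A and in C0(X); this fact
    carries one into the other.\<close>
  have \<delta>_sum: "finsum A (\<lambda>i. \<delta> (t i)) I = \<delta> (finsum (C0 X) t I)"
    if "finite I" "\<And>i. i \<in> I \<Longrightarrow> t i \<in> carrier (C0 X)" for I :: "('g \<times> 'g) set" and t
    using that
  proof (induction I rule: finite_induct)
    case empty then show ?case by (simp add: \<delta>0 C0_zero)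
  next
    case (insert i I)
    then have "finsum (C0 X) t (insert i I) = t i \<oplus>\<^bsub>C0 X\<^esub> finsum (C0 X) t I"
      by (intro C0.finsum_insert) auto
    moreover have "finsum A (\<lambda>i. \<delta> (t i)) (insert i I) = \<delta> (t i) \<oplus>\<^bsub>A\<^esub> finsum A (\<lambda>i. \<delta> (t i)) I"
      using insert \<delta>c by (intro AM.finsum_insert) auto
    moreover have "finsum (C0 X) t I \<in> carrier (C0 X)"
      using insert by (intro C0.finsum_closed) auto
    ultimately show ?case using insert by (simp add: \<delta>_add)
  qed
  have "star_alg_transport ?T CR \<Gamma> \<Delta>"
  proof (intro star_alg_transport.intro star_alg_CR star_alg_transport_axioms.intro \<Gamma>c \<Delta>c)
    show "\<Delta> (\<Gamma> a) = a" if "a \<in> carrier ?T" for a using Tc[OF that] by (simp add: \<Gamma>_def \<Delta>_def \<delta>\<gamma>)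
    show "\<Gamma> (\<Delta> b) = b" if "b \<in> carrier CR" for b using CR_C0[OF that] by (simp add: \<Gamma>_def \<Delta>_def \<gamma>\<delta>)
    show "\<zero>\<^bsub>?T\<^esub> = \<Delta> \<zero>\<^bsub>CR\<^esub>" by (simp add: CR_zero \<Delta>_def \<delta>0) (simp add: crossed_star_algebra_def)
    fix a assume a: "a \<in> carrier ?T"
    show "c \<odot>\<^bsub>?T\<^esub> a = \<Delta> (c \<odot>\<^bsub>CR\<^esub> \<Gamma> a)" for c
    proof
      fix g
      have "\<delta> (\<gamma> (c \<odot>\<^bsub>A\<^esub> a g)) = c \<odot>\<^bsub>A\<^esub> a g" by (intro \<delta>\<gamma> A.completion_closed Tc[OF a])
      then show "(c \<odot>\<^bsub>?T\<^esub> a) g = \<Delta> (c \<odot>\<^bsub>CR\<^esub> \<Gamma> a) g"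
        using \<gamma>_smult[OF Tc[OF a]] by (simp add: \<Delta>_def \<Gamma>_def crossed_star_algebra_def)
    qed
    show "adj ?T a = \<Delta> (adj CR (\<Gamma> a))"
    proof
      fix g show "adj ?T a g = \<Delta> (adj CR (\<Gamma> a)) g"
        using \<gamma>_adj[OF Tc[OF a]] by (simp add: \<Delta>_def \<Gamma>_def crossed_star_algebra_def \<delta>0 C0_zero)
    qed
    fix b assume b: "b \<in> carrier ?T"
    show "a \<oplus>\<^bsub>?T\<^esub> b = \<Delta> (\<Gamma> a \<oplus>\<^bsub>CR\<^esub> \<Gamma> b)"
    proof
      fix g
      have "\<delta> (\<gamma> (a g \<oplus>\<^bsub>A\<^esub> b g)) = a g \<oplus>\<^bsub>A\<^esub> b g" by (intro \<delta>\<gamma> A.completion_closed Tc a b)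
      then show "(a \<oplus>\<^bsub>?T\<^esub> b) g = \<Delta> (\<Gamma> a \<oplus>\<^bsub>CR\<^esub> \<Gamma> b) g"
        using \<gamma>_add[OF Tc[OF a] Tc[OF b]] by (simp add: \<Delta>_def \<Gamma>_def crossed_star_algebra_def)
    qed
    show "a \<otimes>\<^bsub>?T\<^esub> b = \<Delta> (\<Gamma> a \<otimes>\<^bsub>CR\<^esub> \<Gamma> b)"
    proof
      fix k
      let ?I = "{(g, h). a g \<noteq> \<zero>\<^bsub>A\<^esub> \<and> b h \<noteq> \<zero>\<^bsub>A\<^esub> \<and> g \<otimes> h = k}"
      let ?t = "\<lambda>i. C0_act G \<theta> (fst i) (C0_act G \<theta> (inv (fst i)) (\<Gamma> a (fst i)) \<otimes>\<^bsub>C0 X\<^esub> \<Gamma> b (snd i))"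
      have fin: "finite ?I"
        by (rule finite_subset[of _ "{g. a g \<noteq> \<zero>\<^bsub>A\<^esub>} \<times> {g. b g \<noteq> \<zero>\<^bsub>A\<^esub>}"]) (use a b T_carrier in auto)
      have gG: "fst i \<in> carrier G" if "i \<in> ?I" for i using that a T_carrier by auto
      have u: "C0_act G \<theta> (inv (fst i)) (\<Gamma> a (fst i)) \<in> carrier (C0 X)" if i: "i \<in> ?I" for i
        using C0_act_ideal[of "inv (fst i)" "\<Gamma> a (fst i)"] CR_ideal[OF \<Gamma>c[OF a] gG[OF i]] gG[OF i] ideal_C0[of "inv (fst i)"]
        by simp
      have t: "?t i \<in> carrier (C0 X)" if i: "i \<in> ?I" for i
        using cterm_C0[OF gG[OF i] CR_ideal[OF \<Gamma>c[OF a] gG[OF i]] CR_C0[OF \<Gamma>c[OF b], of "snd i"]]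
        unfolding cterm_eq[OF gG[OF i] CR_ideal[OF \<Gamma>c[OF a] gG[OF i]], symmetric] .
      have summand: "\<delta> (C0_act G \<theta> (fst i) (\<gamma> (\<delta> (C0_act G \<theta> (inv (fst i)) (\<gamma> (a (fst i)))) \<otimes>\<^bsub>A\<^esub> b (snd i)))) = \<delta> (?t i)"
        if i: "i \<in> ?I" for i
        using u[OF i] \<gamma>_mult[OF \<delta>c[OF u[OF i]] Tc[OF b, of "snd i"]] by (simp add: \<Gamma>_def \<gamma>\<delta>)
      have "(a \<otimes>\<^bsub>?T\<^esub> b) k = finsum A (\<lambda>i. \<delta> (C0_act G \<theta> (fst i) (\<gamma> (\<delta> (C0_act G \<theta> (inv (fst i)) (\<gamma> (a (fst i)))) \<otimes>\<^bsub>A\<^esub> b (snd i))))) ?I"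
        by (simp add: crossed_star_algebra_def case_prod_unfold)
      also have "\<dots> = finsum A (\<lambda>i. \<delta> (?t i)) ?I"
        using summand t \<delta>c by (intro AM.finsum_cong') auto
      also have "\<dots> = \<delta> (finsum (C0 X) ?t ?I)" by (rule \<delta>_sum[OF fin t])
      also have "?I = {(g, h). \<Gamma> a g \<noteq> \<zero>\<^bsub>C0 X\<^esub> \<and> \<Gamma> b h \<noteq> \<zero>\<^bsub>C0 X\<^esub> \<and> g \<otimes> h = k}"
        using \<gamma>0_iff[OF Tc[OF a]] \<gamma>0_iff[OF Tc[OF b]] by (simp add: \<Gamma>_def C0_zero)
      also have "\<delta> (finsum (C0 X) ?t {(g, h). \<Gamma> a g \<noteq> \<zero>\<^bsub>C0 X\<^esub> \<and> \<Gamma> b h \<noteq> \<zero>\<^bsub>C0 X\<^esub> \<and> g \<otimes> h = k}) = \<Delta> (\<Gamma> a \<otimes>\<^bsub>CR\<^esub> \<Gamma> b) k"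
        by (simp add: crossed_star_algebra_def case_prod_unfold \<Delta>_def)
      finally show "(a \<otimes>\<^bsub>?T\<^esub> b) k = \<Delta> (\<Gamma> a \<otimes>\<^bsub>CR\<^esub> \<Gamma> b) k" .
    qed
  qed
  from star_alg_transport.envelope_isomorphic[OF this bounded_star_alg_CR]
  show "cstar_isomorphic (transported_crossed_product A \<gamma> G X \<theta>) (C0_crossed_product G X \<theta>)"
    "cstar_isomorphic (C0_crossed_product G X \<theta>) (transported_crossed_product A \<gamma> G X \<theta>)"
    by (simp_all add: transported_crossed_product_def C0_crossed_product_def crossed_product_def \<delta>_def)
qed

section \<open>The crossed product of an inverse semigroup\<close>

lemma cstar_isomorphic_trans:
  assumes "cstar_isomorphic A B" "cstar_isomorphic B C" shows "cstar_isomorphic A C"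
proof -
  obtain f g where f: "cstar_iso A B f" and g: "cstar_iso B C g"
    using assms by (auto simp: cstar_isomorphic_def)
  have fc: "f x \<in> carrier B" if "x \<in> carrier A" for x
    using f that by (auto simp: cstar_iso_def bij_betw_def)
  have "bij_betw (g \<circ> f) (carrier A) (carrier C)"
    using f g unfolding cstar_iso_def by (blast intro: bij_betw_trans)
  then have "cstar_iso A C (g \<circ> f)"
    using f g fc unfolding cstar_iso_def by simp
  then show ?thesis by (auto simp: cstar_isomorphic_def)
qed

sublocale idempotent_pure_grading \<subseteq> PA: partial_action G "spectrum S" \<theta>
  by (rule partial_action_\<theta>)

context idempotent_pure_grading
begin

text \<open>The coefficient at g of the image of s. The range idempotent appears because
  coefficients at g live on X_g, the domain of \<theta> at g^-1. The zero of S is given the value 0,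
  in accordance with the contraction.\<close>

definition germ_ind :: "'s \<Rightarrow> 'g \<Rightarrow> ('s \<Rightarrow> nat) \<Rightarrow> complex" where
  "germ_ind s g \<phi> = (if s \<in> nonzero S \<and> \<iota> s = g \<and> \<phi> \<in> DD S (s \<cdot> s\<^sup>\<star>) then 1 else 0)"

text \<open>\<open>\<Phi>\<close> is the linear extension of \<open>s \<mapsto> 1\<^bsub>D(ss*)\<^esub>\<delta>\<^bsub>\<iota>(s)\<^esub>\<close>.\<close>

definition \<Phi> :: "('s \<Rightarrow> complex) \<Rightarrow> 'g \<Rightarrow> ('s \<Rightarrow> nat) \<Rightarrow> complex" where
  "\<Phi> x g \<phi> = lin (\<lambda>s. germ_ind s g \<phi>) x"

lemma \<theta>_inv_ran:
  assumes "s \<in> nonzero S" "\<phi> \<in> DD S (s \<cdot> s\<^sup>\<star>)" shows "\<theta> (inv\<^bsub>G\<^esub> \<iota> s) \<phi> = Some (act S (s\<^sup>\<star>) \<phi>)"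
  using \<theta>_eq[OF nonzero_sinv[OF assms(1)], of \<phi>] assms nonzero_closed[OF assms(1)]
  by (simp add: sinv_sinv \<iota>_sinv)

lemma germ_ind_None: "\<theta> (inv\<^bsub>G\<^esub> g) \<phi> = None \<Longrightarrow> germ_ind s g \<phi> = 0"
  using \<theta>_inv_ran by (auto simp: germ_ind_def)

text \<open>A character lies in D of the range idempotent of s t iff it lies in that of s and
  \<open>act S (s\<^sup>\<star>)\<close> moves it into that of t; the degrees match when \<iota>(t)
  = \<iota>(s)^-1 k. The right-hand side has the shape of a summand in
  \<open>PA.CR_mult\<close>.\<close>

lemma germ_ind_mult:
  assumes s: "s \<in> carrier S" and t: "t \<in> carrier S" and k: "k \<in> carrier G"
  shows "germ_ind (s \<cdot> t) k \<phi> =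
    (if s \<in> nonzero S \<and> \<phi> \<in> DD S (s \<cdot> s\<^sup>\<star>) then germ_ind t (inv\<^bsub>G\<^esub> \<iota> s \<otimes>\<^bsub>G\<^esub> k) (act S (s\<^sup>\<star>) \<phi>) else 0)"
proof -
  have st: "s \<cdot> t \<in> carrier S" using s t closed by simp
  have D: "\<phi> \<in> DD S (s \<cdot> s\<^sup>\<star>) \<and> act S (s\<^sup>\<star>) \<phi> \<in> DD S (t \<cdot> t\<^sup>\<star>) \<longleftrightarrow> \<phi> \<in> DD S (s \<cdot> t \<cdot> (s \<cdot> t)\<^sup>\<star>)"
    using act_DD_iff[OF sinv(1)[OF t] sinv(1)[OF s], of \<phi>] s t st
    by (simp add: sinv_sinv sinv_mult[symmetric])
  show ?thesis
  proof (cases "\<phi> \<in> DD S (s \<cdot> t \<cdot> (s \<cdot> t)\<^sup>\<star>)")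
    case True
    then have nz: "s \<cdot> t \<in> nonzero S" using DD_ran_nonzero[OF st] by blast
    note st_nz = mult_nonzeroD[OF s t nz]
    have g: "\<iota> s \<in> carrier G" "\<iota> t \<in> carrier G" using \<iota>_closed st_nz by auto
    have "\<iota> s \<otimes>\<^bsub>G\<^esub> \<iota> t = k \<longleftrightarrow> \<iota> t = inv\<^bsub>G\<^esub> \<iota> s \<otimes>\<^bsub>G\<^esub> k"
      using g k by (metis G.inv_solve_left)
    then show ?thesis using True D nz st_nz \<iota>_mult'[OF s t nz] by (auto simp: germ_ind_def)
  next
    case False
    then show ?thesis using D by (auto simp: germ_ind_def)
  qed
qed

lemma \<Phi>_eq_sum: "\<lbrakk>finite A; supp x \<subseteq> A\<rbrakk> \<Longrightarrow> \<Phi> x g \<phi> = (\<Sum>s\<in>A. x s * germ_ind s g \<phi>)"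
  unfolding \<Phi>_def by (rule lin_eq_sum)

lemma gsupp_\<Phi>: "PA.gsupp (\<Phi> x) \<subseteq> \<iota> ` (supp x \<inter> nonzero S)"
proof
  fix g assume g: "g \<in> PA.gsupp (\<Phi> x)"
  show "g \<in> \<iota> ` (supp x \<inter> nonzero S)"
  proof (rule ccontr)
    assume "g \<notin> \<iota> ` (supp x \<inter> nonzero S)"
    then have "\<Phi> x g \<phi> = 0" for \<phi>
      unfolding \<Phi>_def lin_def by (intro sum.neutral) (auto simp: germ_ind_def)
    then show False using g by auto
  qed
qed

lemma \<Phi>_C0:
  assumes x: "x \<in> carrier CS" shows "\<Phi> x g \<in> carrier (C0 \<EE>)"
proof -
  have t: "(\<lambda>\<phi>. x s * germ_ind s g \<phi>) \<in> carrier (C0 \<EE>)" if s: "s \<in> supp x" for s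
  proof (cases "s \<in> nonzero S \<and> \<iota> s = g")
    case True
    let ?e = "s \<cdot> s\<^sup>\<star>"
    have e: "?e \<in> idem S" using True nonzero_closed ran_idem by blast
    have "gelf (point_mass ?e) \<in> carrier (C0 \<EE>)"
      using e by (intro gelf_C0 point_mass_closed idem_closed) (auto simp: point_mass_def)
    then have "x s \<odot>\<^bsub>C0 \<EE>\<^esub> gelf (point_mass ?e) \<in> carrier (C0 \<EE>)" by (rule C0.smult_closed)
    also have "x s \<odot>\<^bsub>C0 \<EE>\<^esub> gelf (point_mass ?e) = (\<lambda>\<phi>. x s * germ_ind s g \<phi>)"
      using True by (auto simp: C0_smult gelf_point_mass[OF e] germ_ind_def indicator_def)
    finally show ?thesis .
  next
    case False
    then have "(\<lambda>\<phi>. x s * germ_ind s g \<phi>) = \<zero>\<^bsub>C0 \<EE>\<^esub>" by (auto simp: germ_ind_def C0_zero)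
    then show ?thesis by simp
  qed
  have "(\<lambda>\<phi>. \<Sum>s\<in>supp x. x s * germ_ind s g \<phi>) \<in> carrier (C0 \<EE>)"
    using x t by (intro finsum_C0(2)) (auto simp: CS_carrier)
  then show ?thesis by (simp add: \<Phi>_def[abs_def] lin_def)
qed

lemma \<Phi>_closed:
  assumes x: "x \<in> carrier CS" shows "\<Phi> x \<in> carrier PA.CR"
  unfolding PA.CR_carrier
proof (intro conjI ballI)
  show "\<Phi> x g \<in> C0_ideal G \<EE> \<theta> g" if "g \<in> carrier G" for g
    unfolding PA.ideal_iff[OF that] using \<Phi>_C0[OF x] germ_ind_None by (simp add: \<Phi>_def lin_def)
  show "PA.gsupp (\<Phi> x) \<subseteq> carrier G" using gsupp_\<Phi> \<iota>_closed by blast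
  show "finite (PA.gsupp (\<Phi> x))"
    using finite_subset[OF gsupp_\<Phi>] x by (simp add: CS_carrier)
qed

lemma \<Phi>_outside: "x \<in> carrier CS \<Longrightarrow> g \<notin> carrier G \<Longrightarrow> \<Phi> x g \<phi> = 0"
  using PA.CR_supp[OF \<Phi>_closed] by (metis (mono_tags, lifting) mem_Collect_eq subsetD)

lemma \<Phi>_mult:
  assumes x: "x \<in> carrier CS" and y: "y \<in> carrier CS"
  shows "\<Phi> (x \<otimes>\<^bsub>CS\<^esub> y) = \<Phi> x \<otimes>\<^bsub>PA.CR\<^esub> \<Phi> y"
proof (intro ext)
  fix k \<phi>
  have fin: "finite (supp x)" "finite (supp y)" and c: "supp x \<subseteq> carrier S" "supp y \<subseteq> carrier S"
    using x y by (auto simp: CS_carrier)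
  show "\<Phi> (x \<otimes>\<^bsub>CS\<^esub> y) k \<phi> = (\<Phi> x \<otimes>\<^bsub>PA.CR\<^esub> \<Phi> y) k \<phi>"
  proof (cases "k \<in> carrier G")
    case False
    then have "k \<notin> PA.gsupp (\<Phi> x \<otimes>\<^bsub>PA.CR\<^esub> \<Phi> y)"
      using PA.CR_supp[OF PA.CR.m_closed[OF \<Phi>_closed[OF x] \<Phi>_closed[OF y]]] by blast
    then show ?thesis using \<Phi>_outside[OF CS.m_closed[OF x y] False] by simp
  next
    case k: True
    let ?A = "\<iota> ` (supp x \<inter> nonzero S)"
    let ?H = "\<lambda>g. C0_act G \<theta> g (\<Phi> y (inv\<^bsub>G\<^esub> g \<otimes>\<^bsub>G\<^esub> k)) \<phi>"
    have A: "finite ?A" "?A \<subseteq> carrier G" using fin \<iota>_closed by auto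
    have "(\<Phi> x \<otimes>\<^bsub>PA.CR\<^esub> \<Phi> y) k \<phi> = (\<Sum>g\<in>?A. \<Phi> x g \<phi> * ?H g)"
      by (rule PA.CR_mult[OF \<Phi>_closed[OF x] \<Phi>_closed[OF y] A gsupp_\<Phi> k])
    also have "\<dots> = (\<Sum>g\<in>?A. \<Sum>s\<in>supp x. x s * germ_ind s g \<phi> * ?H g)"
      by (simp add: \<Phi>_eq_sum[OF fin(1) subset_refl, of _ \<phi>] sum_distrib_right)
    also have "\<dots> = (\<Sum>s\<in>supp x. \<Sum>g\<in>?A. x s * germ_ind s g \<phi> * ?H g)" by (rule sum.swap)
    also have "\<dots> = (\<Sum>s\<in>supp x. \<Sum>t\<in>supp y. x s * y t * germ_ind (s \<cdot> t) k \<phi>)"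
    proof (rule sum.cong[OF HOL.refl])
      fix s assume s: "s \<in> supp x"
      show "(\<Sum>g\<in>?A. x s * germ_ind s g \<phi> * ?H g) = (\<Sum>t\<in>supp y. x s * y t * germ_ind (s \<cdot> t) k \<phi>)"
      proof (cases "s \<in> nonzero S \<and> \<phi> \<in> DD S (s \<cdot> s\<^sup>\<star>)")
        case True
        \<comment> \<open>Only the degree of s survives, since \<open>germ_ind s\<close> vanishes in
          all others.\<close>
        have "(\<Sum>g\<in>?A. x s * germ_ind s g \<phi> * ?H g) = (\<Sum>g\<in>{\<iota> s}. x s * germ_ind s g \<phi> * ?H g)"
          using A True s by (intro sum.mono_neutral_right) (auto simp: germ_ind_def)
        also have "\<dots> = x s * \<Phi> y (inv\<^bsub>G\<^esub> \<iota> s \<otimes>\<^bsub>G\<^esub> k) (act S (s\<^sup>\<star>) \<phi>)"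
          using True \<theta>_inv_ran[of s \<phi>] by (simp add: germ_ind_def PA.C0_act_apply)
        also have "\<dots> = (\<Sum>t\<in>supp y. x s * y t * germ_ind (s \<cdot> t) k \<phi>)"
          unfolding \<Phi>_eq_sum[OF fin(2) subset_refl] sum_distrib_left
        proof (intro sum.cong HOL.refl)
          fix t assume "t \<in> supp y"
          then have "germ_ind (s \<cdot> t) k \<phi> = germ_ind t (inv\<^bsub>G\<^esub> \<iota> s \<otimes>\<^bsub>G\<^esub> k) (act S (s\<^sup>\<star>) \<phi>)"
            using germ_ind_mult[of s t k \<phi>] True s c k by auto
          then show "x s * (y t * germ_ind t (inv\<^bsub>G\<^esub> \<iota> s \<otimes>\<^bsub>G\<^esub> k) (act S (s\<^sup>\<star>) \<phi>)) = x s * y t * germ_ind (s \<cdot> t) k \<phi>"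
            by simp
        qed
        finally show ?thesis .
      next
        case False
        then have "germ_ind s g \<phi> = 0" for g by (auto simp: germ_ind_def)
        moreover have "germ_ind (s \<cdot> t) k \<phi> = 0" if "t \<in> supp y" for t
        proof -
          have "s \<in> carrier S" "t \<in> carrier S" using s that c by blast+
          then show ?thesis using False by (auto simp: germ_ind_mult k)
        qed
        ultimately show ?thesis by simp
      qed
    qed
    also have "\<dots> = \<Phi> (x \<otimes>\<^bsub>CS\<^esub> y) k \<phi>" unfolding \<Phi>_def lin_mult[OF x y] ..
    finally show ?thesis by simp
  qed
qed

text \<open>If s has degree g^-1, then on its domain s acts as \<theta> at g^-1. So \<phi> lies in
  the domain of s exactly when its image \<psi> lies in the range of s, and the domain of s is the
  range of its inverse.\<close>

lemma germ_ind_sinv: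
  assumes s: "s \<in> carrier S" and g: "g \<in> carrier G" and \<psi>: "\<theta> (inv\<^bsub>G\<^esub> g) \<phi> = Some \<psi>"
  shows "germ_ind s (inv\<^bsub>G\<^esub> g) \<psi> = germ_ind (s\<^sup>\<star>) g \<phi>"
proof -
  have \<phi>: "\<theta> g \<psi> = Some \<phi>" using \<psi> \<theta>_inv[OF g] by simp
  have inv: "\<iota> s = inv\<^bsub>G\<^esub> g \<longleftrightarrow> \<iota> (s\<^sup>\<star>) = g" if "s \<in> nonzero S"
    using \<iota>_sinv[OF that] \<iota>_closed[OF that] g by auto
  have nz: "s \<in> nonzero S \<longleftrightarrow> s\<^sup>\<star> \<in> nonzero S" using s sinv by (auto simp: nonzero_def zero_sinv)
  have "\<psi> \<in> DD S (s \<cdot> s\<^sup>\<star>) \<longleftrightarrow> \<phi> \<in> DD S (s\<^sup>\<star> \<cdot> s)" if sn: "s \<in> nonzero S" "\<iota> s = inv\<^bsub>G\<^esub> g"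
  proof
    assume \<psi>D: "\<psi> \<in> DD S (s \<cdot> s\<^sup>\<star>)"
    have "\<theta> (inv\<^bsub>G\<^esub> \<iota> s) \<psi> = Some (act S (s\<^sup>\<star>) \<psi>)" by (rule \<theta>_inv_ran[OF sn(1) \<psi>D])
    then have "\<phi> = act S (s\<^sup>\<star>) \<psi>" using sn(2) g \<phi> by simp
    then show "\<phi> \<in> DD S (s\<^sup>\<star> \<cdot> s)" using act_char[OF sinv(1)[OF s], of \<psi>] \<psi>D s by (simp add: sinv_sinv)
  next
    assume \<phi>D: "\<phi> \<in> DD S (s\<^sup>\<star> \<cdot> s)"
    then have "\<psi> = act S s \<phi>" using \<theta>_eq[OF sn(1) \<phi>D] sn(2) \<psi> by simp
    then show "\<psi> \<in> DD S (s \<cdot> s\<^sup>\<star>)" using act_char[OF s \<phi>D] by simp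
  qed
  then show ?thesis using inv nz s by (auto simp: germ_ind_def sinv_sinv)
qed

lemma \<Phi>_adj:
  assumes x: "x \<in> carrier CS" shows "\<Phi> (adj CS x) = adj PA.CR (\<Phi> x)"
proof (intro ext)
  fix g \<phi>
  have fin: "finite (supp x)" and c: "supp x \<subseteq> carrier S" using x by (auto simp: CS_carrier)
  show "\<Phi> (adj CS x) g \<phi> = adj PA.CR (\<Phi> x) g \<phi>"
  proof (cases "g \<in> carrier G")
    case False
    then show ?thesis using \<Phi>_outside[OF CS.adj_closed[OF x] False] by (simp add: PA.CR_adj)
  next
    case g: True
    have lhs: "\<Phi> (adj CS x) g \<phi> = (\<Sum>s\<in>supp x. cnj (x s) * germ_ind (s\<^sup>\<star>) g \<phi>)"
      unfolding \<Phi>_def lin_adj[OF x] ..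
    show ?thesis
    proof (cases "\<theta> (inv\<^bsub>G\<^esub> g) \<phi>")
      case None
      then show ?thesis using g by (simp add: lhs germ_ind_None PA.CR_adj PA.C0_act_None)
    next
      case (Some \<psi>)
      have "adj PA.CR (\<Phi> x) g \<phi> = cnj (\<Phi> x (inv\<^bsub>G\<^esub> g) \<psi>)"
        using g Some by (simp add: PA.CR_adj PA.C0_act_apply)
      also have "\<dots> = (\<Sum>s\<in>supp x. cnj (x s) * cnj (germ_ind s (inv\<^bsub>G\<^esub> g) \<psi>))"
        by (simp add: \<Phi>_eq_sum[OF fin subset_refl])
      also have "\<dots> = (\<Sum>s\<in>supp x. cnj (x s) * germ_ind (s\<^sup>\<star>) g \<phi>)"
      proof (intro sum.cong HOL.refl)
        fix s assume "s \<in> supp x"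
        then have "germ_ind s (inv\<^bsub>G\<^esub> g) \<psi> = germ_ind (s\<^sup>\<star>) g \<phi>" using germ_ind_sinv[OF _ g Some] c by blast
        moreover have "cnj (germ_ind s (inv\<^bsub>G\<^esub> g) \<psi>) = germ_ind s (inv\<^bsub>G\<^esub> g) \<psi>" by (simp add: germ_ind_def)
        ultimately show "cnj (x s) * cnj (germ_ind s (inv\<^bsub>G\<^esub> g) \<psi>) = cnj (x s) * germ_ind (s\<^sup>\<star>) g \<phi>" by simp
      qed
      finally show ?thesis using lhs by simp
    qed
  qed
qed

lemma star_hom_\<Phi>: "star_hom_alg CS PA.CR \<Phi>"
proof unfold_locales
  show "star_hom CS PA.CR \<Phi>"
    unfolding star_hom_def
  proof (intro conjI ballI allI)
    show "\<Phi> \<in> carrier CS \<rightarrow> carrier PA.CR" using \<Phi>_closed by blast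
    fix x assume x: "x \<in> carrier CS"
    show "\<Phi> (c \<odot>\<^bsub>CS\<^esub> x) = c \<odot>\<^bsub>PA.CR\<^esub> \<Phi> x" for c
      by (auto simp: \<Phi>_def CS_smult PA.CR_smult lin_smult fun_eq_iff)
    show "\<Phi> (adj CS x) = adj PA.CR (\<Phi> x)" by (rule \<Phi>_adj[OF x])
    fix y assume y: "y \<in> carrier CS"
    show "\<Phi> (x \<otimes>\<^bsub>CS\<^esub> y) = \<Phi> x \<otimes>\<^bsub>PA.CR\<^esub> \<Phi> y" by (rule \<Phi>_mult[OF x y])
    show "\<Phi> (x \<oplus>\<^bsub>CS\<^esub> y) = \<Phi> x \<oplus>\<^bsub>PA.CR\<^esub> \<Phi> y"
      using x y by (auto simp: \<Phi>_def CS_add PA.CR_add CS_carrier lin_add fun_eq_iff)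
  qed
qed

end

sublocale idempotent_pure_grading \<subseteq> \<Phi>: star_hom_alg CS PA.CR \<Phi>
  by (rule star_hom_\<Phi>)

context idempotent_pure_grading
begin

section \<open>Comparison of seminorms along \<Phi>\<close>

lemma \<Phi>_zz: "\<Phi> zz = \<zero>\<^bsub>PA.CR\<^esub>"
  by (auto simp: \<Phi>_def lin_point_mass germ_ind_def PA.CR_zero nonzero_def fun_eq_iff)

text \<open>The coefficient at the zero of S belongs to no degree. The degree parts thus add up to x
  only modulo \<open>zz\<close>, which a seminorm vanishing at \<open>zz\<close> does not
  notice.\<close>

definition degree_part :: "'g \<Rightarrow> ('s \<Rightarrow> complex) \<Rightarrow> 's \<Rightarrow> complex" where
  "degree_part g x = (\<lambda>s. if s \<in> nonzero S \<and> \<iota> s = g then x s else 0)"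

lemma degree_part_closed: "x \<in> carrier CS \<Longrightarrow> degree_part g x \<in> carrier CS"
  unfolding CS_carrier degree_part_def
  by (auto elim: rev_finite_subset split: if_splits)

lemma \<Phi>_degree_part:
  assumes x: "x \<in> carrier CS" shows "\<Phi> (degree_part g x) = PA.single g (\<Phi> x g)"
proof (intro ext)
  fix h \<phi>
  have fin: "finite (supp x)" using x by (simp add: CS_carrier)
  have "supp (degree_part g x) \<subseteq> supp x" by (auto simp: degree_part_def)
  then have "\<Phi> (degree_part g x) h \<phi> = (\<Sum>s\<in>supp x. degree_part g x s * germ_ind s h \<phi>)" by (rule \<Phi>_eq_sum[OF fin])
  also have "\<dots> = (\<Sum>s\<in>supp x. if h = g then x s * germ_ind s g \<phi> else 0)"
    by (intro sum.cong) (auto simp: degree_part_def germ_ind_def)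
  also have "\<dots> = PA.single g (\<Phi> x g) h \<phi>"
    by (simp add: PA.single_def \<Phi>_eq_sum[OF fin subset_refl])
  finally show "\<Phi> (degree_part g x) h \<phi> = PA.single g (\<Phi> x g) h \<phi>" .
qed

text \<open>\<open>y = x\<^sub>g\<^sup>\<star>x\<^sub>g\<close> is supported on idempotents because \<open>s\<^sup>\<star>t\<close> has degree \<open>1\<close> when \<open>s\<close> and \<open>t\<close> have degree \<open>g\<close>.\<close>

lemma seminorm_degree_part_le:
  assumes p: "cstar_seminorm CS p" and z: "p zz = 0" and x: "x \<in> carrier CS" and g: "g \<in> carrier G"
  shows "p (degree_part g x) \<le> nrm (C0 \<EE>) (\<Phi> x g)"
proof -
  interpret p: cstar_seminorm_alg CS p by unfold_locales (rule p)
  note xg = degree_part_closed[OF x, of g]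
  let ?a = "adj CS (degree_part g x)"
  let ?y = "?a \<otimes>\<^bsub>CS\<^esub> degree_part g x"
  have y: "?y \<in> carrier CS" using xg by (simp add: CS.m_closed CS.adj_closed)
  have supp_y: "supp ?y \<subseteq> idem S"
  proof
    fix u assume "u \<in> supp ?y"
    then obtain s t where st: "s \<in> supp (degree_part g x)" "t \<in> supp (degree_part g x)" "u = s\<^sup>\<star> \<cdot> t"
      using supp_mult[OF CS.adj_closed[OF xg] xg] supp_adj[OF xg] by fastforce
    then have nz: "s \<in> nonzero S" "t \<in> nonzero S" and eq: "\<iota> s = g" "\<iota> t = g" by (auto simp: degree_part_def split: if_splits)
    note c = sinv(1)[OF nonzero_closed[OF nz(1)]] nonzero_closed[OF nz(2)]
    show "u \<in> idem S"
    proof (cases "u = szero S")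
      case True then show ?thesis using zero_idem by simp
    next
      case False
      then have u: "u \<in> nonzero S" using c closed by (simp add: st(3) nonzero_def)
      then have "\<iota> u = \<one>\<^bsub>G\<^esub>" using \<iota>_mult'[OF c] \<iota>_sinv[OF nz(1)] eq g by (simp add: st(3))
      then show ?thesis using \<iota>_one_iff[OF u] by simp
    qed
  qed
  have F: "\<Phi> x g \<in> C0_ideal G \<EE> \<theta> g" using PA.CR_ideal[OF \<Phi>_closed[OF x] g] .
  have FC: "\<Phi> x g \<in> carrier (C0 \<EE>)" by (rule \<Phi>_C0[OF x])
  let ?ff = "adj (C0 \<EE>) (\<Phi> x g) \<otimes>\<^bsub>C0 \<EE>\<^esub> \<Phi> x g"
  have ffC: "?ff \<in> carrier (C0 \<EE>)" using FC by (simp add: C0.m_closed C0.adj_closed)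
  \<comment> \<open>The coefficient in degree 1 is a translate of the squared modulus of the
    coefficient of \<Phi>(x) at g, so its sup norm is at most the square of the norm of that
    coefficient.\<close>
  have "\<Phi> ?y = PA.single \<one>\<^bsub>G\<^esub> (C0_act G \<theta> (inv\<^bsub>G\<^esub> g) ?ff)"
    using xg x by (simp add: \<Phi>_mult \<Phi>_adj CS.adj_closed \<Phi>_degree_part PA.single_adj_mult[OF g F])
  then have \<Phi>y: "\<Phi> ?y \<one>\<^bsub>G\<^esub> \<phi> = C0_act G \<theta> (inv\<^bsub>G\<^esub> g) ?ff \<phi>" for \<phi> by (simp add: PA.single_def)
  \<comment> \<open>On combinations of idempotents, \<Phi> in degree 1 is the Gelfand transform: a
    nonzero idempotent has degree 1 and is its own range idempotent.\<close>
  have gelf: "gelf ?y \<phi> = \<Phi> ?y \<one>\<^bsub>G\<^esub> \<phi>" for \<phi>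
  proof (cases "\<phi> \<in> characters S")
    case True
    have "lin (\<lambda>e. of_nat (\<phi> e)) ?y = lin (\<lambda>s. germ_ind s \<one>\<^bsub>G\<^esub> \<phi>) ?y"
    proof (rule lin_cong)
      fix e assume "?y e \<noteq> 0"
      then have e: "e \<in> idem S" using supp_y by auto
      have "e \<cdot> e\<^sup>\<star> = e" using e by (simp add: sinv_idem idem_idem)
      then show "of_nat (\<phi> e) = germ_ind e \<one>\<^bsub>G\<^esub> \<phi>"
        using char_01[OF True e] True e DD_nonzero[OF e] \<iota>_one_iff[of e] by (auto simp: germ_ind_def DD_def)
    qed
    then show ?thesis using True by (simp add: gelf_def \<Phi>_def)
  next
    case False
    then have "germ_ind s \<one>\<^bsub>G\<^esub> \<phi> = 0" for s using DD_char by (auto simp: germ_ind_def)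
    then show ?thesis using False by (simp add: gelf_def \<Phi>_def lin_def)
  qed
  have "cmod (gelf ?y \<phi>) \<le> (nrm (C0 \<EE>) (\<Phi> x g))\<^sup>2" for \<phi>
    using PA.norm_C0_act_le[OF ffC, of "inv\<^bsub>G\<^esub> g" \<phi>] C0.cstar_identity[OF FC] by (simp add: gelf \<Phi>y)
  then have "p ?y \<le> (nrm (C0 \<EE>) (\<Phi> x g))\<^sup>2" by (rule seminorm_le_gelf[OF p z y supp_y])
  then have "(p (degree_part g x))\<^sup>2 \<le> (nrm (C0 \<EE>) (\<Phi> x g))\<^sup>2" using p.cstar_identity[OF xg] by simp
  then show ?thesis using C0.nonneg[OF FC] by (rule power2_le_imp_le)
qed

text \<open>Peeling off one degree at a time bounds p by a sum over degrees. This is the domination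
  under which \<open>cstar_seminorm_extension\<close> carries \<open>contracted_norm\<close> over to
  the crossed product.\<close>

lemma seminorm_le_l1_norm_\<Phi>:
  assumes p: "cstar_seminorm CS p" and z: "p zz = 0" and x: "x \<in> carrier CS"
  shows "p x \<le> PA.l1_norm (\<Phi> x)"
proof -
  interpret p: cstar_seminorm_alg CS p by unfold_locales (rule p)
  have *: "p x \<le> (\<Sum>g\<in>A. p (degree_part g x))"
    if "finite A" "x \<in> carrier CS" "\<iota> ` (supp x \<inter> nonzero S) \<subseteq> A" for A x
    using that
  proof (induction A arbitrary: x rule: finite_induct)
    case empty
    \<comment> \<open>No nonzero element of S is left in the support, so x is a multiple of
      \<open>zz\<close>.\<close>
    have "x s = (x (szero S) \<odot>\<^bsub>CS\<^esub> zz) s" for s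
      using empty by (auto simp: CS_carrier CS_smult point_mass_def nonzero_def)
    then have "p x = p (x (szero S) \<odot>\<^bsub>CS\<^esub> zz)" by (metis ext)
    then show ?case using z by (simp add: p.homogeneous zz_closed)
  next
    case (insert g A)
    note xg = degree_part_closed[OF insert.prems(1), of g]
    let ?y = "x \<ominus>\<^bsub>CS\<^esub> degree_part g x"
    have y: "?y \<in> carrier CS" using insert.prems(1) xg by (rule CS.diff_closed)
    have yeq: "?y s = x s - degree_part g x s" for s using CS_diff[OF insert.prems(1) xg] by simp
    have "\<iota> ` (supp ?y \<inter> nonzero S) \<subseteq> A"
    proof safe
      fix s assume s: "?y s \<noteq> 0" "s \<in> nonzero S"
      then have "x s - degree_part g x s \<noteq> 0" using yeq[of s] by simp
      then have "\<iota> s \<noteq> g" "x s \<noteq> 0" using s(2) by (auto simp: degree_part_def split: if_splits)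
      then show "\<iota> s \<in> A" using insert.prems(2) s(2) by blast
    qed
    then have IH: "p ?y \<le> (\<Sum>h\<in>A. p (degree_part h ?y))" by (rule insert.IH[OF y])
    have "degree_part h ?y = degree_part h x" if "h \<in> A" for h
    proof -
      have "h \<noteq> g" using that insert.hyps(2) by auto
      then show ?thesis using yeq by (auto simp: degree_part_def[of h] fun_eq_iff) (simp add: degree_part_def)
    qed
    then have "p ?y \<le> (\<Sum>h\<in>A. p (degree_part h x))" using IH by simp
    moreover have "p x \<le> p ?y + p (degree_part g x)" by (rule p.p_le_diff[OF insert.prems(1) xg])
    ultimately show ?case using insert.hyps by simp
  qed
  let ?A = "\<iota> ` (supp x \<inter> nonzero S)"
  have A: "finite ?A" using x by (simp add: CS_carrier)
  have "p x \<le> (\<Sum>g\<in>?A. p (degree_part g x))" by (rule *[OF A x subset_refl])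
  also have "\<dots> \<le> (\<Sum>g\<in>?A. nrm (C0 \<EE>) (\<Phi> x g))"
    using \<iota>_closed by (intro sum_mono seminorm_degree_part_le[OF p z x]) blast
  also have "\<dots> = PA.l1_norm (\<Phi> x)" by (rule PA.l1_norm_eq[OF A gsupp_\<Phi>, symmetric])
  finally show ?thesis .
qed

text \<open>A coefficient at g is a C0 function on X_g, which is the union of D(f) over the range
  idempotents f of elements of degree g, and \<open>gelf_dense\<close> approximates it by
  combinations of such f. Lifting each f to an element of S of degree g turns this combination into
  a coefficient of some \<Phi>(x).\<close>

lemma \<Phi>_dense:
  assumes b: "b \<in> carrier PA.CR" and e: "e > 0"
  shows "\<exists>x\<in>carrier CS. PA.l1_norm (b \<ominus>\<^bsub>PA.CR\<^esub> \<Phi> x) < e"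
proof -
  let ?B = "PA.gsupp b"
  have B: "finite ?B" "?B \<subseteq> carrier G" using PA.CR_finite[OF b] PA.CR_supp[OF b] by auto
  \<comment> \<open>One more than the number of coefficients, because B may be empty and the final
    estimate has to be strict.\<close>
  define d where "d = e / (real (card ?B) + 1)"
  have d: "d > 0" using e by (simp add: d_def)
  \<comment> \<open>The zero is added so that J g absorbs products with idempotents, some of which
    vanish; as D(0) is empty, the union of the D(f) is unchanged.\<close>
  define J where "J g = insert (szero S) ((\<lambda>s. s \<cdot> s\<^sup>\<star>) ` {s \<in> nonzero S. \<iota> s = g})" for g
  have "\<exists>y. y \<in> carrier CS \<and> supp y \<subseteq> J g \<and> (\<forall>\<phi>. cmod (b g \<phi> - gelf y \<phi>) \<le> d)" if g: "g \<in> ?B" for g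
  proof -
    have gG: "g \<in> carrier G" using g B by auto
    have dom: "dom (\<theta> (inv\<^bsub>G\<^esub> g)) = (\<Union>e\<in>J g. DD S e)"
    proof (intro equalityI subsetI)
      fix \<phi> assume "\<phi> \<in> dom (\<theta> (inv\<^bsub>G\<^esub> g))"
      then obtain t where t: "t \<in> nonzero S" "\<iota> t = inv\<^bsub>G\<^esub> g" "\<phi> \<in> DD S (t\<^sup>\<star> \<cdot> t)" by (auto simp: dom_\<theta>)
      have "t\<^sup>\<star> \<in> nonzero S" "\<iota> (t\<^sup>\<star>) = g" "t\<^sup>\<star> \<cdot> t\<^sup>\<star>\<^sup>\<star> = t\<^sup>\<star> \<cdot> t"
        using t gG nonzero_sinv nonzero_closed by (simp_all add: \<iota>_sinv sinv_sinv)
      then have "t\<^sup>\<star> \<cdot> t \<in> J g" unfolding J_def by (metis (mono_tags, lifting) image_eqI insertI2 mem_Collect_eq)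
      then show "\<phi> \<in> (\<Union>e\<in>J g. DD S e)" using t(3) by blast
    next
      fix \<phi> assume "\<phi> \<in> (\<Union>e\<in>J g. DD S e)"
      then obtain s where "s \<in> nonzero S" "\<iota> s = g" "\<phi> \<in> DD S (s \<cdot> s\<^sup>\<star>)"
        using DD_zero by (auto simp: J_def)
      then show "\<phi> \<in> dom (\<theta> (inv\<^bsub>G\<^esub> g))" using \<theta>_inv_ran by blast
    qed
    have JE: "J g \<subseteq> idem S" using zero_idem ran_idem nonzero_closed by (auto simp: J_def)
    \<comment> \<open>If h is the range idempotent of s, then f h is that of f s, and multiplying s
      by an idempotent does not change its degree.\<close>
    have JJ: "f \<cdot> h \<in> J g" if f: "f \<in> idem S" and h: "h \<in> J g" for f h
    proof (cases "f \<cdot> h = szero S")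
      case True then show ?thesis by (simp add: J_def)
    next
      case False
      then have "h \<noteq> szero S" using idem_closed[OF f] by (auto simp: mult_zero)
      then obtain s where s: "s \<in> nonzero S" "\<iota> s = g" "h = s \<cdot> s\<^sup>\<star>" using h by (auto simp: J_def)
      note c = nonzero_closed[OF s(1)] sinv(1)[OF nonzero_closed[OF s(1)]] idem_closed[OF f]
      have "f \<cdot> s \<cdot> (f \<cdot> s)\<^sup>\<star> = f \<cdot> (s \<cdot> s\<^sup>\<star> \<cdot> f)"
        using c f by (simp add: sinv_mult sinv_idem assoc closed)
      also have "\<dots> = f \<cdot> h"
        using idem_comm[OF ran_idem[OF c(1)] f] idem_left_idem[OF f, of h] c closed by (simp add: s(3))
      finally have eq: "f \<cdot> h = f \<cdot> s \<cdot> (f \<cdot> s)\<^sup>\<star>" ..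
      have fs: "f \<cdot> s \<in> nonzero S"
        using False c closed eq by (auto simp: nonzero_def zero_mult sinv_zero zero_closed)
      then have "\<iota> (f \<cdot> s) = g" using \<iota>_idem_mult[OF c(1) f] s(2) by simp
      then show ?thesis using fs eq unfolding J_def by blast
    qed
    have "b g \<in> carrier (C0 (subtopology \<EE> (\<Union>e\<in>J g. DD S e)))"
      using PA.CR_ideal[OF b gG] by (simp add: C0_ideal_def dom)
    from gelf_dense[OF JE JJ this d] show ?thesis by metis
  qed
  then have "\<exists>y. \<forall>g\<in>?B. y g \<in> carrier CS \<and> supp (y g) \<subseteq> J g \<and> (\<forall>\<phi>. cmod (b g \<phi> - gelf (y g) \<phi>) \<le> d)"
    by (intro bchoice ballI)
  then obtain y where y: "\<And>g. g \<in> ?B \<Longrightarrow> y g \<in> carrier CS" "\<And>g. g \<in> ?B \<Longrightarrow> supp (y g) \<subseteq> J g"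
    "\<And>g \<phi>. g \<in> ?B \<Longrightarrow> cmod (b g \<phi> - gelf (y g) \<phi>) \<le> d"
    by blast
  \<comment> \<open>A section of the map from elements of degree g to their range idempotents.
    Placing the coefficients of \<open>y g\<close> on its image uses every nonzero idempotent
    exactly once.\<close>
  define \<sigma> where "\<sigma> g f = (SOME s. s \<in> nonzero S \<and> \<iota> s = g \<and> s \<cdot> s\<^sup>\<star> = f)" for g f
  have \<sigma>: "\<sigma> g f \<in> nonzero S \<and> \<iota> (\<sigma> g f) = g \<and> \<sigma> g f \<cdot> (\<sigma> g f)\<^sup>\<star> = f" if "f \<in> J g - {szero S}" for g f
    unfolding \<sigma>_def by (rule someI_ex) (use that in \<open>auto simp: J_def\<close>)
  \<comment> \<open>The condition on \<sigma> restricts x to the image of the section. The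
    coefficient of \<open>y g\<close> at the zero of S is discarded, which the transform does not
    see because D(0) is empty.\<close>
  define x where "x s = (if s \<in> nonzero S \<and> \<iota> s \<in> ?B \<and> \<sigma> (\<iota> s) (s \<cdot> s\<^sup>\<star>) = s then y (\<iota> s) (s \<cdot> s\<^sup>\<star>) else 0)" for s
  define T where "T g = \<sigma> g ` (supp (y g) - {szero S})" for g
  have ran_nz: "s \<cdot> s\<^sup>\<star> \<noteq> szero S" if "s \<in> nonzero S" for s
    using that by (auto simp: nonzero_def zero_ran)
  have suppx: "s \<in> T (\<iota> s) \<and> \<iota> s \<in> ?B \<and> s \<in> nonzero S" if "s \<in> supp x" for s
  proof -
    have s: "s \<in> nonzero S" "\<iota> s \<in> ?B" "\<sigma> (\<iota> s) (s \<cdot> s\<^sup>\<star>) = s" "y (\<iota> s) (s \<cdot> s\<^sup>\<star>) \<noteq> 0"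
      using that by (auto simp: x_def split: if_splits)
    have "s \<cdot> s\<^sup>\<star> \<in> supp (y (\<iota> s)) - {szero S}" using s(4) ran_nz[OF s(1)] by simp
    from imageI[OF this, of "\<sigma> (\<iota> s)"] show ?thesis using s by (simp add: T_def)
  qed
  have "finite (\<Union>g\<in>?B. T g)" using B y(1) by (auto simp: T_def CS_carrier)
  then have "finite (supp x)" by (rule finite_subset[rotated]) (use suppx in blast)
  then have xC: "x \<in> carrier CS" using suppx nonzero_closed by (auto simp: CS_carrier)
  have \<Phi>x: "\<Phi> x g \<phi> = gelf (y g) \<phi>" if g: "g \<in> ?B" for g \<phi>
  proof -
    have fin: "finite (supp (y g))" using y(1)[OF g] by (simp add: CS_carrier)
    have \<sigma>g: "\<sigma> g f \<in> nonzero S" "\<iota> (\<sigma> g f) = g" "\<sigma> g f \<cdot> (\<sigma> g f)\<^sup>\<star> = f" if "f \<in> supp (y g) - {szero S}" for f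
      using \<sigma>[of f g] that y(2)[OF g] by auto
    have inj: "inj_on (\<sigma> g) (supp (y g) - {szero S})" by (rule inj_onI) (metis \<sigma>g(3))
    have "\<Phi> x g \<phi> = (\<Sum>s\<in>supp x \<union> T g. x s * germ_ind s g \<phi>)"
      using \<open>finite (supp x)\<close> fin by (intro \<Phi>_eq_sum) (auto simp: T_def)
    also have "\<dots> = (\<Sum>s\<in>T g. x s * germ_ind s g \<phi>)"
      using \<open>finite (supp x)\<close> fin suppx by (intro sum.mono_neutral_right) (auto simp: T_def germ_ind_def)
    also have "\<dots> = (\<Sum>f\<in>supp (y g) - {szero S}. x (\<sigma> g f) * germ_ind (\<sigma> g f) g \<phi>)"
      unfolding T_def by (simp add: sum.reindex[OF inj])
    also have "\<dots> = (\<Sum>f\<in>supp (y g) - {szero S}. y g f * (if \<phi> \<in> DD S f then 1 else 0))"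
      using \<sigma>g g by (intro sum.cong HOL.refl) (auto simp: x_def germ_ind_def)
    also have "\<dots> = gelf (y g) \<phi>"
    proof (cases "\<phi> \<in> characters S")
      case True
      have "(\<Sum>f\<in>supp (y g) - {szero S}. y g f * (if \<phi> \<in> DD S f then 1 else 0)) =
          (\<Sum>f\<in>supp (y g). y g f * (if \<phi> \<in> DD S f then 1 else 0))"
        using fin DD_zero by (intro sum.mono_neutral_left) auto
      also have "\<dots> = (\<Sum>f\<in>supp (y g). y g f * of_nat (\<phi> f))"
      proof (intro sum.cong HOL.refl)
        fix f assume f: "f \<in> supp (y g)"
        then have "f \<in> idem S"
          using y(2)[OF g] zero_idem ran_idem nonzero_closed by (auto simp: J_def)
        then show "y g f * (if \<phi> \<in> DD S f then 1 else 0) = y g f * of_nat (\<phi> f)"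
          using char_01[OF True, of f] True by (auto simp: DD_def)
      qed
      finally show ?thesis using True by (simp add: gelf_def lin_def)
    next
      case False
      then have "\<phi> \<notin> DD S f" for f using DD_char by blast
      then show ?thesis using False by (simp add: gelf_def)
    qed
    finally show ?thesis .
  qed
  have \<Phi>x0: "\<Phi> x g = (\<lambda>_. 0)" if "g \<notin> ?B" for g
  proof -
    have "g \<notin> PA.gsupp (\<Phi> x)" using gsupp_\<Phi>[of x] suppx that by blast
    then show ?thesis by simp
  qed
  have diff: "(b \<ominus>\<^bsub>PA.CR\<^esub> \<Phi> x) g \<phi> = b g \<phi> - \<Phi> x g \<phi>" for g \<phi>
    using \<Phi>_closed[OF xC] by (simp add: a_minus_def PA.CR.minus_smult PA.CR_add PA.CR_smult)
  have "PA.gsupp (b \<ominus>\<^bsub>PA.CR\<^esub> \<Phi> x) \<subseteq> ?B"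
  proof (rule subsetI, rule ccontr)
    fix g assume g: "g \<in> PA.gsupp (b \<ominus>\<^bsub>PA.CR\<^esub> \<Phi> x)" "g \<notin> ?B"
    then have "(b \<ominus>\<^bsub>PA.CR\<^esub> \<Phi> x) g = (\<lambda>_. 0)" by (simp add: fun_eq_iff diff \<Phi>x0[OF g(2)])
    then show False using g(1) by simp
  qed
  then have "PA.l1_norm (b \<ominus>\<^bsub>PA.CR\<^esub> \<Phi> x) = (\<Sum>g\<in>?B. nrm (C0 \<EE>) ((b \<ominus>\<^bsub>PA.CR\<^esub> \<Phi> x) g))" by (rule PA.l1_norm_eq[OF B(1)])
  also have "\<dots> \<le> (\<Sum>g\<in>?B. d)"
    using y(3) d by (intro sum_mono C0_nrm_le) (auto simp: diff \<Phi>x)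
  also have "\<dots> = real (card ?B) * d" by simp
  also have "\<dots> < (real (card ?B) + 1) * d" using d by simp
  also have "\<dots> = e" by (simp add: d_def)
  finally show ?thesis using xC by blast
qed

text \<open>A C*-seminorm of the crossed product pulls back to one vanishing at \<open>zz\<close>,
  hence below \<open>contracted_norm\<close>. Conversely \<open>contracted_norm\<close> is itself
  such a pullback, because it extends along \<Phi>.\<close>

lemma env_norm_\<Phi>:
  assumes x: "x \<in> carrier CS" shows "env_norm PA.CR (\<Phi> x) = contracted_norm x"
proof (rule antisym)
  show "env_norm PA.CR (\<Phi> x) \<le> contracted_norm x"
  proof (rule PA.CR.env_norm_le)
    fix p assume p: "cstar_seminorm PA.CR p"
    interpret p: cstar_seminorm_alg PA.CR p by unfold_locales (rule p)
    show "p (\<Phi> x) \<le> contracted_norm x"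
      using le_contracted_norm[OF \<Phi>.cstar_seminorm_pullback[OF p] _ x] by (simp add: \<Phi>_zz p.p_zero)
  qed
  have "\<exists>q. cstar_seminorm PA.CR q \<and> (\<forall>x\<in>carrier CS. q (\<Phi> x) = contracted_norm x)"
  proof (rule cstar_seminorm_extension[OF PA.star_seminorm_l1_norm star_hom_\<Phi>])
    show "contracted_norm x \<le> PA.l1_norm (\<Phi> x)" if "x \<in> carrier CS" for x
      using seminorm_le_l1_norm_\<Phi>[OF cstar_seminorm_contracted contracted_norm_zz that] .
  qed (use \<Phi>_dense cstar_seminorm_contracted in blast)+
  then obtain q where q: "cstar_seminorm PA.CR q" "\<And>x. x \<in> carrier CS \<Longrightarrow> q (\<Phi> x) = contracted_norm x"
    by blast
  show "contracted_norm x \<le> env_norm PA.CR (\<Phi> x)"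
    using PA.CR.le_env_norm[OF q(1) \<Phi>_closed[OF x]] q(2)[OF x] by simp
qed

theorem contracted_crossed_product:
  "cstar_isomorphic (contracted_cstar S) (C0_crossed_product G \<EE> \<theta>)"
proof -
  have "completion CS contracted_norm (envelope PA.CR) (\<lambda>u X. range u \<subseteq> carrier CS \<and> PA.CR.env_conv (\<Phi> \<circ> u) X)"
  proof (rule completion_pullback[OF PA.CR.env.completion_axioms star_hom_\<Phi>])
    fix b and e :: real assume b: "b \<in> carrier PA.CR" and "e > 0"
    then obtain x where x: "x \<in> carrier CS" "PA.l1_norm (b \<ominus>\<^bsub>PA.CR\<^esub> \<Phi> x) < e" using \<Phi>_dense by blast
    have "env_norm PA.CR (b \<ominus>\<^bsub>PA.CR\<^esub> \<Phi> x) \<le> PA.l1_norm (b \<ominus>\<^bsub>PA.CR\<^esub> \<Phi> x)"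
      using PA.cstar_seminorm_le_l1_norm[OF PA.CR.cstar_seminorm_env_norm PA.CR.diff_closed[OF b \<Phi>_closed[OF x(1)]]] .
    then show "\<exists>x\<in>carrier CS. env_norm PA.CR (b \<ominus>\<^bsub>PA.CR\<^esub> \<Phi> x) < e" using x by (intro bexI[of _ x]) auto
  qed (simp add: env_norm_\<Phi>)
  then have "cstar_isomorphic (contracted_cstar S) (envelope PA.CR)"
    by (rule completion_isomorphic[OF completion_contracted])
  then show ?thesis by (simp add: C0_crossed_product_def crossed_product_def)
qed

end

theorem theorem5p1:
  fixes S :: "'s semigroup0"
  assumes "inverse_semigroup0 S"
    and "countable (carrier S)"
    and "strongly_0_E_unitary TYPE('h) S"
  shows "\<exists>\<theta> \<gamma>.
    partial_action (universal_group S) (spectrum S) \<theta> \<and>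
    topgroupoid_isomorphic (universal_groupoid S)
      (transformation_groupoid (universal_group S) (spectrum S) \<theta>) \<and>
    Hausdorff_space (arrows (universal_groupoid S)) \<and>
    cstar_iso (contracted_cstar (idem_semigroup S)) (C0 (spectrum S)) \<gamma> \<and>
    (\<forall>e\<in>idem S. \<gamma> (contracted_gen (idem_semigroup S) e) = indicator (DD S e)) \<and>
    cstar_isomorphic (contracted_cstar S)
      (transported_crossed_product (contracted_cstar (idem_semigroup S)) \<gamma>
        (universal_group S) (spectrum S) \<theta>) \<and>
    cstar_isomorphic
      (transported_crossed_product (contracted_cstar (idem_semigroup S)) \<gamma>
        (universal_group S) (spectrum S) \<theta>)
      (C0_crossed_product (universal_group S) (spectrum S) \<theta>)"
proof -
  interpret inverse_semigroup0 S by fact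
  obtain H :: "'h monoid" and \<phi> where H: "group H" "partial_hom S H \<phi>" "idempotent_pure S H \<phi>"
    using assms(3) by (auto simp: strongly_0_E_unitary_def)
  \<comment> \<open>The given group H serves only to show that the canonical map to the universal
    group is idempotent pure; from here on the universal group is the grading group.\<close>
  interpret U: idempotent_pure_grading S "universal_group S" ug_gen
    by (intro idempotent_pure_grading.intro idempotent_pure_grading_axioms.intro assms(1)
        group_universal_group partial_hom_ug_gen idempotent_pure_ug_gen[OF H])
  interpret E: inverse_semigroup0 "idem_semigroup S" by (rule inverse_semigroup0_idem)
  obtain \<gamma> where \<gamma>: "cstar_iso (contracted_cstar (idem_semigroup S)) (C0 (spectrum S)) \<gamma>"
    "\<And>e. e \<in> idem S \<Longrightarrow> \<gamma> (contracted_gen (idem_semigroup S) e) = indicator (DD S e)"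
    using gelfand_contracted by blast
  note transported = U.PA.transported_isomorphic[OF E.completion_contracted \<gamma>(1)]
  have "topgroupoid_isomorphic (universal_groupoid S)
      (transformation_groupoid (universal_group S) (spectrum S) U.\<theta>)"
    using U.topgroupoid_iso_graded_germ unfolding topgroupoid_isomorphic_def by blast
  moreover have "cstar_isomorphic (contracted_cstar S)
      (transported_crossed_product (contracted_cstar (idem_semigroup S)) \<gamma>
        (universal_group S) (spectrum S) U.\<theta>)"
    using cstar_isomorphic_trans[OF U.contracted_crossed_product transported(2)] .
  ultimately show ?thesis
    using U.partial_action_\<theta> U.Hausdorff_\<G> \<gamma> transported(1) by blast
qed

end
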